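(* Let $k$ be a number field of degree $d$ over $\mathbb{Q}$ (not necessarily Galois), with ring of integers $\mathcal{O}_k$ and a fixed $\mathbb{Z}$-basis $\Omega = (\omega_1,\dots,\omega_d)$ of $\mathcal{O}_k$. Let $n \ge 2$. For integer $B\ge1$ let $\mathcal{F}_n(B;\Omega)$ be the set of monic polynomials $f(x) = x^n + \sum_{j=0}^{n-1}\alpha_jx^j$ with $\alpha_j = \sum_{l=1}^d m_{j,l}\omega_l$, $m_{j,l}\in\mathbb{Z}$, $-B+1 \le m_{j,l} \le B$ (so $\#\mathcal{F}_n(B;\Omega) = (2B)^{nd}$). Let $\mathfrak{p}_1,\dots,\mathfrak{p}_r$ be distinct prime ideals of $\mathcal{O}_k$ with norms $q_i = N\mathfrak{p}_i = p_i^{f_i}$, and let $\mu_1,\dots,\mu_r$ be partitions of $n$. (1) Let $\mathcal{F}_n(B;\mathcal{S},\Omega)$ be the set of $f \in \mathcal{F}_n(B;\Omega)$ such that the ideals $(\mathrm{Disc}(f))$ and $\prod_{i=1}^r\mathfrak{p}_i$ of $\mathcal{O}_k$ are coprime. Then $$\lim_{B\to\infty}\frac{\#\mathcal{F}_n(B;\mathcal{S},\Omega)}{\#\mathcal{F}_n(B;\Omega)} = \prod_{i=1}^r\Big(1 - \frac{1}{q_i}\Big).$$ (2) Let $\mathcal{F}_n(B;\{\mathcal{S},\mathfrak{U}\},\Omega)$ be the set of $f \in \mathcal{F}_n(B;\mathcal{S},\Omega)$ such that (i) the splitting type of $f \bmod \mathfrak{p}_i$ is $\mu_i$ for $1 \le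 i \le r$, and (ii) the splitting field of $f$ over $k$ has Galois group $S_n$ over $k$. Then $$\lim_{B\to\infty}\frac{\#\mathcal{F}_n(B;\{\mathcal{S},\mathfrak{U}\},\Omega)}{\#\mathcal{F}_n(B;\mathcal{S},\Omega)} = \prod_{i=1}^r\nu_{n,q_i}^{\ast}(C_{\mu_i}).$$
   Context: $\mathrm{Disc}(f)$ is the polynomial discriminant. When $\mathfrak{p} \nmid (\mathrm{Disc}(f))$, the reduction of $f$ modulo $\mathfrak{p}$ is a product of distinct monic irreducible factors over the residue field $\mathcal{O}_k/\mathfrak{p} \cong \mathbb{F}_{N\mathfrak{p}}$, and its splitting type is the partition of $n$ given by their degrees. For $m\ge1$, $M_m(X) = \frac{1}{m}\sum_{d\mid m}\mu(d)X^{m/d}$ ($\mu(d)$ the Möbius function); $\binom{w}{k} = \frac{w(w-1)\cdots(w-k+1)}{k!}$; $c_i(\mu)$ is the number of parts of $\mu$ equal to $i$; $C_\mu$ is the conjugacy class of $S_n$ of cycle type $\mu$; and $\nu_{n,q}^{\ast}(C_\mu) = \frac{1}{q^{n-1}(q-1)}\prod_{i=1}^n\binom{M_i(q)}{c_i(\mu)}$. *)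

theory Defs
  imports
    Complex_Main
    "HOL-Computational_Algebra.Squarefree"
    "HOL-Algebra.Algebraic_Closure_Type"
    "HOL-Algebra.Ideal_Product"
    "HOL-Algebra.Generated_Fields"
    "HOL-Algebra.Sym_Groups"
    "HOL-Algebra.Bij"
    "Subresultants.Resultant_Prelim"
begin

text \<open>A number field is given as a type of characteristic zero that has finite dimension
  over the rationals.\<close>

definition rat_scale :: "rat \<Rightarrow> 'k \<Rightarrow> 'k :: field_char_0" where
  "rat_scale q x = of_rat q * x"

definition number_field :: "'k :: field_char_0 itself \<Rightarrow> bool" where
  "number_field _ \<longleftrightarrow>
     (\<exists>B. finite_dimensional_vector_space (rat_scale :: rat \<Rightarrow> 'k \<Rightarrow> 'k) B)"

definition number_field_degree :: "'k :: field_char_0 itself \<Rightarrow> nat" where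
  "number_field_degree _ = vector_space.dim (rat_scale :: rat \<Rightarrow> 'k \<Rightarrow> 'k) UNIV"

definition ring_of_integers :: "'k :: field_char_0 ring" where
  "ring_of_integers = ring_of_type_algebra \<lparr>carrier := {x. algebraic_int x}\<rparr>"

definition integral_basis :: "nat \<Rightarrow> (nat \<Rightarrow> 'k :: field_char_0) \<Rightarrow> bool" where
  "integral_basis d \<omega> \<longleftrightarrow>
     (\<forall>l\<in>{1..d}. \<omega> l \<in> carrier ring_of_integers) \<and>
     (\<forall>x\<in>carrier ring_of_integers.
        \<exists>!m :: nat \<Rightarrow> int. m \<in> {1..d} \<rightarrow>\<^sub>E UNIV \<and> x = (\<Sum>l=1..d. of_int (m l) * \<omega> l))"

definition residue_ring_at :: "'k :: field_char_0 set \<Rightarrow> 'k set ring" where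
  "residue_ring_at P = ring_of_integers Quot P"

definition ideal_norm :: "'k :: field_char_0 set \<Rightarrow> nat" where
  "ideal_norm P = card (carrier (residue_ring_at P))"

definition coprime_ideals :: "'k :: field_char_0 set \<Rightarrow> 'k set \<Rightarrow> bool" where
  "coprime_ideals I J \<longleftrightarrow> I <+>\<^bsub>ring_of_integers\<^esub> J = carrier ring_of_integers"

definition discriminant :: "'a :: field poly \<Rightarrow> 'a" where
  "discriminant f =
     (-1) ^ (Polynomial.degree f * (Polynomial.degree f - 1) div 2) *
     resultant f (pderiv f) / Polynomial.lead_coeff f"

text \<open>Polynomials over a ring \<^term>\<open>R\<close> with explicit carrier are lists of coefficients with the
  leading coefficient first. The reduction below is such a list for monic \<^term>\<open>f\<close> and
  proper \<^term>\<open>P\<close>: its head is then the unit of the residue ring.\<close>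

definition reduce_poly :: "'k :: field_char_0 set \<Rightarrow> 'k poly \<Rightarrow> 'k set list" where
  "reduce_poly P f = map (\<lambda>a. P +>\<^bsub>ring_of_integers\<^esub> a) (rev (coeffs f))"

definition has_splitting_type ::
    "'k :: field_char_0 set \<Rightarrow> 'k poly \<Rightarrow> nat multiset \<Rightarrow> bool" where
  "has_splitting_type P f \<mu> \<longleftrightarrow>
     (let R = residue_ring_at P in
      \<exists>A. finite A \<and> A \<subseteq> carrier (poly_ring R) \<and>
          (\<forall>g\<in>A. pirreducible\<^bsub>R\<^esub> (carrier R) g \<and> Polynomials.lead_coeff g = \<one>\<^bsub>R\<^esub>) \<and>
          reduce_poly P f = finprod (poly_ring R) (\<lambda>g. g) A \<and>
          \<mu> = image_mset Polynomials.degree (mset_set A))"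

definition is_partition :: "nat \<Rightarrow> nat multiset \<Rightarrow> bool" where
  "is_partition n \<mu> \<longleftrightarrow> 0 \<notin># \<mu> \<and> sum_mset \<mu> = n"

definition splitting_field :: "'k :: field poly \<Rightarrow> 'k alg_closure set" where
  "splitting_field f =
     generate_field ring_of_type_algebra (range to_ac \<union> {z. poly (map_poly to_ac f) z = 0})"

definition galois_group :: "'k :: field poly \<Rightarrow> ('k alg_closure \<Rightarrow> 'k alg_closure) monoid" where
  "galois_group f =
     (let L = splitting_field f; R = ring_of_type_algebra \<lparr>carrier := L\<rparr> in
      BijGroup L \<lparr>carrier := {\<sigma> \<in> Bij L. \<sigma> \<in> ring_iso R R \<and> (\<forall>x. \<sigma> (to_ac x) = to_ac x)}\<rparr>)"

definition moebius :: "nat \<Rightarrow> int" where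
  "moebius m = (if squarefree m then (-1) ^ card (prime_factors m) else 0)"

definition necklace :: "nat \<Rightarrow> real \<Rightarrow> real" where
  "necklace m x = 1 / real m * (\<Sum>d | d dvd m. of_int (moebius d) * x ^ (m div d))"

text \<open>A conjugacy class of the symmetric group is represented by its cycle type \<^term>\<open>\<mu>\<close>.\<close>

definition nu_star :: "nat \<Rightarrow> nat \<Rightarrow> nat multiset \<Rightarrow> real" where
  "nu_star n q \<mu> =
     1 / (real q ^ (n - 1) * (real q - 1)) *
     (\<Prod>i=1..n. necklace i (real q) gchoose count \<mu> i)"

definition poly_box :: "nat \<Rightarrow> nat \<Rightarrow> (nat \<Rightarrow> 'k :: field_char_0) \<Rightarrow> nat \<Rightarrow> 'k poly set" where
  "poly_box n d \<omega> B =
     {Polynomial.monom 1 n +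
        (\<Sum>j<n. Polynomial.monom (\<Sum>l=1..d. of_int (m j l) * \<omega> l) j) | m :: nat \<Rightarrow> nat \<Rightarrow> int.
      \<forall>j<n. \<forall>l\<in>{1..d}. - int B + 1 \<le> m j l \<and> m j l \<le> int B}"

definition poly_box_S ::
    "nat \<Rightarrow> nat \<Rightarrow> (nat \<Rightarrow> 'k :: field_char_0) \<Rightarrow> nat \<Rightarrow> (nat \<Rightarrow> 'k set) \<Rightarrow> nat \<Rightarrow> 'k poly set"
  where
  "poly_box_S n d \<omega> r P B =
     {f \<in> poly_box n d \<omega> B.
        coprime_ideals (PIdl\<^bsub>ring_of_integers\<^esub> (discriminant f))
                       (finprod (ideals_set ring_of_integers) P {1..r})}"

definition poly_box_SU ::
    "nat \<Rightarrow> nat \<Rightarrow> (nat \<Rightarrow> 'k :: field_char_0) \<Rightarrow> nat \<Rightarrow> (nat \<Rightarrow> 'k set) \<Rightarrow>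
     (nat \<Rightarrow> nat multiset) \<Rightarrow> nat \<Rightarrow> 'k poly set"
  where
  "poly_box_SU n d \<omega> r P \<mu> B =
     {f \<in> poly_box_S n d \<omega> r P B.
        (\<forall>i\<in>{1..r}. has_splitting_type (P i) f (\<mu> i)) \<and>
        galois_group f \<cong> sym_group n}"

lemma card_poly_box:
  fixes \<omega> :: "nat \<Rightarrow> 'k :: field_char_0"
  assumes "integral_basis d \<omega>"
  shows "card (poly_box n d \<omega> B) = (2 * B) ^ (n * d)"
proof -
  define I where "I = {- int B + 1..int B}"
  define S where "S = (\<lambda>m. \<Sum>l=1..d. of_int (m l) * \<omega> l :: 'k)"
  define F where "F = (\<lambda>m. Polynomial.monom 1 n + (\<Sum>j<n. Polynomial.monom (S (m j)) j))"
  define D where "D = PiE {..<n} (\<lambda>_. PiE {1..d} (\<lambda>_. I))"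
  have coeffF: "coeff (F m) j = S (m j)" if "j < n" for m j
    using that by (simp add: F_def coeff_sum sum.delta' if_distrib cong: if_cong)
  have injS: "u l = v l" if uv: "S u = S v" and l: "l \<in> {1..d}" for u v :: "nat \<Rightarrow> int" and l
  proof -
    have "0 \<in> carrier (ring_of_integers :: 'k ring)"
      by (simp add: ring_of_integers_def)
    then have "\<exists>!m. m \<in> {1..d} \<rightarrow>\<^sub>E (UNIV :: int set) \<and> 0 = S m"
      using assms unfolding integral_basis_def S_def by blast
    moreover have "(\<lambda>l\<in>{1..d}. u l - v l) \<in> {1..d} \<rightarrow>\<^sub>E UNIV"
        "(\<lambda>l\<in>{1..d}. 0) \<in> {1..d} \<rightarrow>\<^sub>E (UNIV :: int set)"
      by (simp_all add: PiE_iff)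
    moreover have "0 = S (\<lambda>l\<in>{1..d}. u l - v l)" "0 = S (\<lambda>l\<in>{1..d}. 0)"
      using uv by (simp_all add: S_def left_diff_distrib sum_subtractf)
    ultimately have "(\<lambda>l\<in>{1..d}. u l - v l) = (\<lambda>l\<in>{1..d}. 0)"
      by blast
    from fun_cong[OF this, of l] l show ?thesis by simp
  qed
  have "poly_box n d \<omega> B = F ` D"
  proof (intro equalityI subsetI)
    fix f assume "f \<in> poly_box n d \<omega> B"
    then obtain m where m: "f = F m" "\<forall>j<n. \<forall>l\<in>{1..d}. m j l \<in> I"
      by (auto simp: poly_box_def F_def S_def I_def)
    define m' where "m' = (\<lambda>j\<in>{..<n}. \<lambda>l\<in>{1..d}. m j l)"
    have "F m' = F m" by (simp add: F_def S_def m'_def)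
    moreover have "m' \<in> D" using m(2) by (simp add: D_def m'_def)
    ultimately show "f \<in> F ` D" using m(1) by (metis imageI)
  next
    fix f assume "f \<in> F ` D"
    then obtain m where m: "f = F m" "m \<in> D" by blast
    have "\<forall>j<n. \<forall>l\<in>{1..d}. - int B + 1 \<le> m j l \<and> m j l \<le> int B"
      using m(2) unfolding D_def I_def by (force simp: PiE_iff)
    then show "f \<in> poly_box n d \<omega> B"
      unfolding poly_box_def m(1) F_def S_def by blast
  qed
  moreover have "inj_on F D"
  proof (rule inj_onI)
    fix u v assume uv: "u \<in> D" "v \<in> D" "F u = F v"
    show "u = v"
    proof (rule PiE_ext[OF uv(1,2)[unfolded D_def]])
      fix j assume j: "j \<in> {..<n}"
      have uj: "u j \<in> {1..d} \<rightarrow>\<^sub>E I" and vj: "v j \<in> {1..d} \<rightarrow>\<^sub>E I"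
        using uv j by (auto simp: D_def PiE_iff)
      have "S (u j) = S (v j)" using coeffF uv(3) j by (metis lessThan_iff)
      then show "u j = v j" using injS by (intro PiE_ext[OF uj vj]) blast
    qed
  qed
  moreover have "card D = (2 * B) ^ (n * d)"
    using nat_int[of "2 * B"] by (simp add: D_def I_def card_PiE power_mult mult.commute[of n d] power_mult_distrib)
  ultimately show ?thesis by (simp add: card_image)
qed

end

(*
  The reductions of the polynomials in the box are equidistributed modulo any finite set of primes
  (Chinese remainder theorem), so every density is a product of local counts over finite fields.
  These come from unique factorization: squarefree monic polynomials of degree n number
  q^n - q^(n-1), and those of splitting type mu number the product of the binomials of the necklace
  polynomials.

  The condition on the Galois group costs no density. Each of the types (n), (n-1,1) and
  (2,1,...,1) has local density bounded away from 0 as q grows, so almost every f attains all three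
  at suitable auxiliary primes. A Frobenius element at each of these permutes the roots of f with
  that cycle type, and the three permutations generate the symmetric group.
*)

theory Submission
  imports
    Defs
    "Jordan_Normal_Form.Char_Poly"
    "Subresultants.Subresultant"
    "HOL-Algebra.Polynomial_Divisibility"
begin

text \<open>Frobenius elements are built without decomposition groups. A prime \<open>Q\<close> over
  \<open>P\<close> is taken in the ring of all algebraic integers of the algebraic closure, and an
  embedding with \<open>\<tau> a\<close> congruent to \<open>a ^ q\<close> modulo \<open>Q\<close>
  is extended from the base field one root of \<open>f\<close> at a time. The obstacle: an algebraic
  integer of M(\<alpha>) need not be an integral polynomial in \<alpha>. Its denominators divide the
  product of the root differences, up to sign the discriminant, which lies outside \<open>Q\<close>
  exactly when \<open>f\<close> has squarefree reduction. So squarefreeness acts twice: it lets the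
  Frobenius congruence extend, and it keeps the roots distinct modulo \<open>Q\<close>.

  Equidistribution is not read off from full residue systems, because the side 2B need not be
  divisible by the relevant integers. Fibres of the reduction map are compared by translations
  instead, at the cost of a boundary layer.

  The auxiliary primes are chosen independently of the prescribed ones: the polynomials without full
  Galois group have density 0 in the whole box and are then removed from the set cut out by the
  local conditions.\<close>

section \<open>Algebraic integers\<close>

text \<open>Determinant trick: \<open>v\<close> is an eigenvector of an integer matrix with
  eigenvalue \<open>x\<close>, so \<open>x\<close> is a root of its characteristic polynomial, which
  is monic over the integers.\<close>

lemma integer_eigenvalue_algebraic_int:
  fixes x :: "'a :: field_char_0" and A :: "nat \<Rightarrow> nat \<Rightarrow> int"
  assumes eq: "\<And>i. i < n \<Longrightarrow> x * v i = (\<Sum>j<n. of_int (A i j) * v j)"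
    and i: "i < n" "v i \<noteq> 0"
  shows "algebraic_int x"
proof -
  define M where "M = mat n n (\<lambda>(i, j). A i j)"
  have M: "M \<in> carrier_mat n n" by (simp add: M_def)
  let ?M = "map_mat of_int M :: 'a mat"
  have "vec n v \<noteq> 0\<^sub>v n" using i by (metis index_vec index_zero_vec(1))
  moreover have "?M *\<^sub>v vec n v = x \<cdot>\<^sub>v vec n v"
    using M eq by (intro eq_vecI) (auto simp: M_def scalar_prod_def atLeast0LessThan)
  ultimately have "eigenvector ?M (vec n v) x"
    using M by (simp add: eigenvector_def)
  then have "eigenvalue ?M x" by (auto simp: eigenvalue_def)
  then have "poly (char_poly ?M) x = 0"
    using M eigenvalue_root_char_poly[of ?M n x] by simp
  moreover have "char_poly ?M = map_poly of_int (char_poly M)"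
    using of_int_hom.char_poly_hom[OF M] by simp
  moreover have "Polynomial.lead_coeff (char_poly M) = 1"
    using degree_monic_char_poly[OF M] by simp
  ultimately show ?thesis by (auto simp: algebraic_int_altdef_ipoly)
qed

interpretation zmod: Modules.module "\<lambda>(k :: int) (x :: 'a :: comm_ring_1). of_int k * x"
  by unfold_locales (simp_all add: algebra_simps)

text \<open>Multiplication by \<open>x\<close> on the generators is given by an integer matrix, and
  the generators themselves form the eigenvector; \<open>s0\<close> makes it nonzero.\<close>

lemma algebraic_int_if_span_stable:
  fixes x :: "'a :: field_char_0"
  assumes "finite S" "s0 \<in> S" "s0 \<noteq> 0" and st: "\<And>s. s \<in> S \<Longrightarrow> x * s \<in> zmod.span S"
  shows "algebraic_int x"
proof -
  obtain h where h: "bij_betw h {..<card S} S"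
    using ex_bij_betw_nat_finite[OF assms(1)] by (auto simp: atLeast0LessThan)
  have "\<exists>u. x * s = (\<Sum>t\<in>S. of_int (u t) * t)" if "s \<in> S" for s
    using st[OF that] zmod.span_finite[OF assms(1)] by auto
  then obtain u where u: "\<And>s. s \<in> S \<Longrightarrow> x * s = (\<Sum>t\<in>S. of_int (u s t) * t)"
    by metis
  have "x * h i = (\<Sum>j<card S. of_int (u (h i) (h j)) * h j)" if "i < card S" for i
    using u[of "h i"] bij_betwE[OF h] that
    by (simp add: sum.reindex_bij_betw[OF h, symmetric])
  moreover obtain i where "i < card S" "h i = s0"
    using h assms(2) by (metis bij_betw_iff_bijections lessThan_iff)
  ultimately show ?thesis
    using integer_eigenvalue_algebraic_int[of "card S" x h "\<lambda>i j. u (h i) (h j)" i] assms(3) by auto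
qed

text \<open>The multiplier ring of the lattice spanned by \<open>S\<close>. For finite
  \<open>S\<close> containing 1 it consists of algebraic integers, so closure of the algebraic
  integers under sums and products reduces to finding one lattice stable under both
  operands.\<close>

definition span_stabilizer :: "'a :: field_char_0 set \<Rightarrow> 'a set" where
  "span_stabilizer S = {x. \<forall>s\<in>zmod.span S. x * s \<in> zmod.span S}"

lemma span_stabilizerI:
  assumes "\<And>s. s \<in> S \<Longrightarrow> x * s \<in> zmod.span S"
  shows "x \<in> span_stabilizer S"
  unfolding span_stabilizer_def
proof (intro CollectI ballI)
  fix s assume "s \<in> zmod.span S"
  then show "x * s \<in> zmod.span S"
  proof (induction rule: zmod.span_induct_alt)
    case base
    then show ?case by (simp add: zmod.span_zero)
  next
    case (step c y z)
    have "x * (of_int c * y + z) = of_int c * (x * y) + x * z" by (simp add: algebra_simps)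
    then show ?case using step assms zmod.span_add zmod.span_scale by metis
  qed
qed

lemma span_stabilizer_add:
  "x \<in> span_stabilizer S \<Longrightarrow> y \<in> span_stabilizer S \<Longrightarrow> x + y \<in> span_stabilizer S"
  by (auto simp: span_stabilizer_def distrib_right intro: zmod.span_add)

lemma span_stabilizer_mult:
  "x \<in> span_stabilizer S \<Longrightarrow> y \<in> span_stabilizer S \<Longrightarrow> x * y \<in> span_stabilizer S"
  by (auto simp: span_stabilizer_def mult.assoc)

lemma span_stabilizer_of_int: "of_int k \<in> span_stabilizer S"
  by (auto simp: span_stabilizer_def intro: zmod.span_scale)

lemma algebraic_int_span_stabilizer:
  assumes "finite S" "1 \<in> S" "x \<in> span_stabilizer S"
  shows "algebraic_int x"
  using assms by (intro algebraic_int_if_span_stable[of S 1])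
    (auto simp: span_stabilizer_def intro: zmod.span_base)

text \<open>The new lattice is generated by the products \<open>s * y ^ j\<close> with
  \<open>j\<close> below the degree; the monic equation brings \<open>y ^ n\<close> back into it.
  The coefficients are only asked to stabilize the old lattice, so the same lemma covers roots of
  monic polynomials whose coefficients are algebraic integers.\<close>

lemma span_stabilizer_adjoin:
  fixes y :: "'a :: field_char_0"
  assumes S: "finite S" "1 \<in> S" and p: "Polynomial.lead_coeff p = 1" "poly p y = 0"
    and cf: "\<And>i. coeff p i \<in> span_stabilizer S"
  obtains T where "finite T" "1 \<in> T" "y \<in> span_stabilizer T" "span_stabilizer S \<subseteq> span_stabilizer T"
proof -
  define n where "n = Polynomial.degree p"
  have n: "n > 0"
    using p by (intro Nat.gr0I) (auto simp: n_def elim!: degree_eq_zeroE)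
  define T where "T = (\<lambda>(s, j). s * y ^ j) ` (S \<times> {..<n})"
  have mem: "s * y ^ j \<in> zmod.span T" if "s \<in> zmod.span S" "j < n" for s j
    using that(1)
  proof (induction rule: zmod.span_induct_alt)
    case base
    then show ?case by (simp add: zmod.span_zero)
  next
    case (step c x z)
    have "x * y ^ j \<in> T" using step that by (force simp: T_def)
    moreover have "(of_int c * x + z) * y ^ j = of_int c * (x * y ^ j) + z * y ^ j"
      by (simp add: algebra_simps)
    ultimately show ?case using step by (metis zmod.span_add zmod.span_scale zmod.span_base)
  qed
  have "finite T" "1 \<in> T"
    using S n by (auto simp: T_def intro!: image_eqI[of _ _ "(1, 0)"])
  moreover have "y \<in> span_stabilizer T"
  proof (rule span_stabilizerI)
    fix t assume "t \<in> T"
    then obtain s j where t: "t = s * y ^ j" "s \<in> S" "j < n" by (auto simp: T_def)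
    show "y * t \<in> zmod.span T"
    proof (cases "Suc j < n")
      case True
      have "s * y ^ Suc j \<in> zmod.span T" using mem[OF zmod.span_base[OF t(2)] True] .
      then show ?thesis by (simp add: t mult_ac)
    next
      case False
      then have nj: "n = Suc j" using t by simp
      have "0 = (\<Sum>i\<le>n. coeff p i * y ^ i)" using p by (simp add: poly_altdef n_def)
      also have "\<dots> = (\<Sum>i<n. coeff p i * y ^ i) + y ^ n"
        using p by (simp add: n_def flip: lessThan_Suc_atMost)
      finally have "y ^ n = - (\<Sum>i<n. coeff p i * y ^ i)"
        by (metis add.commute add_eq_0_iff)
      then have "s * y ^ n = - (\<Sum>i<n. coeff p i * s * y ^ i)"
        by (simp add: sum_distrib_left mult_ac)
      moreover have "y * t = s * y ^ n" using nj by (simp add: t)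
      ultimately have "y * t = - (\<Sum>i<n. coeff p i * s * y ^ i)" by simp
      moreover have "coeff p i * s * y ^ i \<in> zmod.span T" if "i < n" for i
        using cf[of i] zmod.span_base[OF t(2)] that by (intro mem) (auto simp: span_stabilizer_def)
      ultimately show ?thesis
        by (auto intro!: zmod.span_neg zmod.span_sum)
    qed
  qed
  moreover have "span_stabilizer S \<subseteq> span_stabilizer T"
  proof
    fix x assume x: "x \<in> span_stabilizer S"
    show "x \<in> span_stabilizer T"
    proof (rule span_stabilizerI)
      fix t assume "t \<in> T"
      then obtain s j where t: "t = s * y ^ j" "s \<in> S" "j < n" by (auto simp: T_def)
      have "x * s \<in> zmod.span S" using x zmod.span_base[OF t(2)] by (auto simp: span_stabilizer_def)
      from mem[OF this t(3)] show "x * t \<in> zmod.span T" by (simp add: t mult_ac)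
    qed
  qed
  ultimately show ?thesis using that by blast
qed

lemma finite_algebraic_ints_stabilize:
  fixes Y :: "'a :: field_char_0 set"
  assumes "finite Y" "\<And>x. x \<in> Y \<Longrightarrow> algebraic_int x"
  obtains S where "finite S" "1 \<in> S" "Y \<subseteq> span_stabilizer S"
  using assms
proof (induction Y arbitrary: thesis rule: finite_induct)
  case empty
  then show ?case by (metis empty_subsetI finite.emptyI finite_insert insertI1)
next
  case (insert y Y)
  then obtain S where S: "finite S" "1 \<in> S" "Y \<subseteq> span_stabilizer S" by blast
  have "algebraic_int y" using insert by blast
  then obtain p where p: "Polynomial.lead_coeff p = 1" "\<And>i. coeff p i \<in> \<int>" "poly p y = 0"
    by (auto elim: algebraic_int.cases)
  have "coeff p i \<in> span_stabilizer S" for i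
    using p(2)[of i] by (auto elim!: Ints_cases intro: span_stabilizer_of_int)
  then obtain T where "finite T" "1 \<in> T" "y \<in> span_stabilizer T"
      "span_stabilizer S \<subseteq> span_stabilizer T"
    using span_stabilizer_adjoin[OF S(1,2) p(1,3)] by blast
  then show ?case using S insert.prems by auto
qed

lemma algebraic_int_plus:
  assumes "algebraic_int x" "algebraic_int y"
  shows "algebraic_int (x + y :: 'a :: field_char_0)"
proof -
  obtain S where "finite S" "1 \<in> S" "{x, y} \<subseteq> span_stabilizer S"
    by (rule finite_algebraic_ints_stabilize[of "{x, y}"]) (use assms in auto)
  then show ?thesis by (auto intro: algebraic_int_span_stabilizer span_stabilizer_add)
qed

lemma algebraic_int_times:
  assumes "algebraic_int x" "algebraic_int y"
  shows "algebraic_int (x * y :: 'a :: field_char_0)"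
proof -
  obtain S where "finite S" "1 \<in> S" "{x, y} \<subseteq> span_stabilizer S"
    by (rule finite_algebraic_ints_stabilize[of "{x, y}"]) (use assms in auto)
  then show ?thesis by (auto intro: algebraic_int_span_stabilizer span_stabilizer_mult)
qed

lemma algebraic_int_diff:
  "algebraic_int x \<Longrightarrow> algebraic_int y \<Longrightarrow> algebraic_int (x - y :: 'a :: field_char_0)"
  using algebraic_int_plus[of x "- y"] by simp

lemma algebraic_int_pow:
  "algebraic_int x \<Longrightarrow> algebraic_int (x ^ n :: 'a :: field_char_0)"
  by (induction n) (auto intro: algebraic_int_times)

lemma algebraic_int_sum:
  fixes f :: "'b \<Rightarrow> 'a :: field_char_0"
  shows "(\<And>x. x \<in> A \<Longrightarrow> algebraic_int (f x)) \<Longrightarrow> algebraic_int (sum f A)"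
  by (induction A rule: infinite_finite_induct) (auto intro: algebraic_int_plus)

lemma algebraic_int_prod:
  fixes f :: "'b \<Rightarrow> 'a :: field_char_0"
  shows "(\<And>x. x \<in> A \<Longrightarrow> algebraic_int (f x)) \<Longrightarrow> algebraic_int (prod f A)"
  by (induction A rule: infinite_finite_induct) (auto intro: algebraic_int_times)

lemma algebraic_int_of_int': "algebraic_int (of_int k :: 'a :: field_char_0)"
  by (intro int_imp_algebraic_int) auto

text \<open>Transitivity of integrality: some lattice is stable under all coefficients, and
  adjoining \<open>x\<close> to it produces one that is stable under \<open>x\<close> as
  well.\<close>

lemma algebraic_int_monic_root:
  fixes x :: "'a :: field_char_0"
  assumes "Polynomial.lead_coeff p = 1" "\<And>i. algebraic_int (coeff p i)" "poly p x = 0"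
  shows "algebraic_int x"
proof -
  obtain S where S: "finite S" "1 \<in> S" "set (coeffs p) \<subseteq> span_stabilizer S"
    by (rule finite_algebraic_ints_stabilize[of "set (coeffs p)"])
      (use assms(2) in \<open>auto simp: coeffs_def split: if_splits\<close>)
  have "coeff p i \<in> span_stabilizer S" for i
    using S(3) span_stabilizer_of_int[of 0 S] coeff_in_coeffs[of p i] coeff_eq_0[of p i]
    by (cases "p = 0"; cases "i \<le> Polynomial.degree p") auto
  then obtain T where "finite T" "1 \<in> T" "x \<in> span_stabilizer T"
    using span_stabilizer_adjoin[OF S(1,2) assms(1,3)] by metis
  then show ?thesis by (rule algebraic_int_span_stabilizer)
qed

lemma algebraic_int_poly:
  fixes x :: "'a :: field_char_0"
  assumes "\<And>i. algebraic_int (coeff p i)" "algebraic_int x"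
  shows "algebraic_int (poly p x)"
  using assms by (auto simp: poly_altdef intro!: algebraic_int_sum algebraic_int_times algebraic_int_pow)

lemma algebraic_int_coeff_mult:
  fixes p q :: "'a :: field_char_0 poly"
  assumes "\<And>i. algebraic_int (coeff p i)" "\<And>i. algebraic_int (coeff q i)"
  shows "algebraic_int (coeff (p * q) i)"
  using assms by (auto simp: coeff_mult intro!: algebraic_int_sum algebraic_int_times)

lemma algebraic_int_coeff_prod:
  fixes p :: "'b \<Rightarrow> 'a :: field_char_0 poly"
  assumes "\<And>x i. x \<in> A \<Longrightarrow> algebraic_int (coeff (p x) i)"
  shows "algebraic_int (coeff (prod p A) i)"
  using assms
proof (induction A arbitrary: i rule: infinite_finite_induct)
  case (insert x A)
  then show ?case by (simp add: algebraic_int_coeff_mult)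
qed auto

lemma algebraic_int_linear_coeff:
  "algebraic_int (a :: 'a :: field_char_0) \<Longrightarrow> algebraic_int (coeff [:- a, 1:] i)"
  by (auto simp: coeff_pCons split: nat.split)

lemma algebraic_int_to_ac_iff [simp]:
  "algebraic_int (to_ac x) \<longleftrightarrow> algebraic_int (x :: 'a :: field_char_0)"
proof -
  have "poly (map_poly of_int p) (to_ac x) = to_ac (poly (map_poly of_int p) x)" for p :: "int poly"
    by (simp add: poly_altdef degree_map_poly coeff_map_poly to_ac_sum)
  then show ?thesis by (simp add: algebraic_int_altdef_ipoly)
qed

section \<open>The discriminant as a product over the roots\<close>

text \<open>The case \<open>j = 0\<close> of the Brown-Traub recursion for subresultants. That
  recursion asks for a remainder of positive degree, so a constant \<open>h\<close> takes a separate
  formula.\<close>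

lemma resultant_euclid_step:
  fixes f g :: "'a :: field poly"
  assumes "f + b * g = h" "Polynomial.degree g \<le> Polynomial.degree f" "Polynomial.degree h < Polynomial.degree g"
  shows "resultant f g = (-1) ^ (Polynomial.degree f * Polynomial.degree g) *
           Polynomial.lead_coeff g ^ (Polynomial.degree f - Polynomial.degree h) * resultant g h"
proof (cases "Polynomial.degree h = 0")
  case False
  then have "subresultant 0 f g = smult ((-1) ^ (Polynomial.degree f * Polynomial.degree g) *
           Polynomial.lead_coeff g ^ (Polynomial.degree f - Polynomial.degree h)) (subresultant 0 g h)"
    using BT_lemma_1_12[OF assms(1,2), of 0] assms(3) by simp
  then show ?thesis by (simp add: subresultant_resultant)
next
  case True
  then obtain c where c: "h = [:c:]" by (metis degree_eq_zeroE)
  have "subresultant 0 f g = smult ((-1) ^ (Polynomial.degree f * Polynomial.degree g) *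
           Polynomial.lead_coeff g ^ Polynomial.degree f * c ^ (Polynomial.degree g - 1)) h"
    using BT_lemma_1_13[OF assms(1,2)] assms(3) c by simp
  moreover have "c ^ (Polynomial.degree g - 1) * c = c ^ Polynomial.degree g"
    using assms(3) by (metis power_minus_mult gr_zeroI not_less0)
  ultimately show ?thesis using c
    by (simp add: subresultant_resultant mult.assoc)
qed

lemma prod_mset_diff_swap:
  fixes A B :: "'a :: comm_ring_1 multiset"
  shows "(\<Prod>a\<in>#A. \<Prod>b\<in>#B. a - b) = (-1) ^ (size A * size B) * (\<Prod>b\<in>#B. \<Prod>a\<in>#A. b - a)"
proof -
  have *: "(\<Prod>b\<in>#B. a - b) = (-1) ^ size B * (\<Prod>b\<in>#B. b - a)" for a
    by (induction B) (auto simp: algebra_simps)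
  have "(\<Prod>a\<in>#A. \<Prod>b\<in>#B. a - b) = (-1) ^ (size A * size B) * (\<Prod>a\<in>#A. \<Prod>b\<in>#B. b - a)"
    unfolding * by (induction A) (auto simp: power_add mult_ac)
  also have "(\<Prod>a\<in>#A. \<Prod>b\<in>#B. b - a) = (\<Prod>b\<in>#B. \<Prod>a\<in>#A. b - a)"
    by (rule prod_mset.swap)
  finally show ?thesis .
qed

lemma poly_prod_mset_linear:
  "poly (\<Prod>a\<in>#A. [:- a, 1:]) x = (\<Prod>a\<in>#A. x - a :: 'a :: comm_ring_1)"
  by (induction A) (auto simp: algebra_simps)

lemma degree_prod_mset_linear:
  "Polynomial.degree (\<Prod>a\<in>#A. [:- a, 1:] :: 'a :: idom poly) = size A"
proof (induction A)
  case (add a A)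
  have "(\<Prod>a\<in>#A. [:- a, 1:] :: 'a poly) \<noteq> 0" by (auto simp: prod_mset_zero_iff)
  then show ?case using add by (simp add: degree_mult_eq del: mult_pCons_left)
qed simp

lemma prod_mset_mult_const:
  "(\<Prod>a\<in>#A. c * f a) = c ^ size A * (\<Prod>a\<in>#A. f a :: 'a :: comm_monoid_mult)"
  by (induction A) (auto simp: mult_ac)

text \<open>Induction along the Euclidean algorithm. \<open>f\<close> and its remainder
  \<open>h\<close> agree at the roots of \<open>g\<close>, so the product known by induction is one
  of values of \<open>f\<close>; exchanging the two products of root differences turns it into
  values of \<open>g\<close> at the roots of \<open>f\<close>.\<close>

lemma resultant_eq_prod_roots:
  fixes f g :: "'a :: alg_closed_field poly"
  assumes "Polynomial.degree g \<le> Polynomial.degree f" "c \<noteq> 0" "f = smult c (\<Prod>a\<in>#A. [:- a, 1:])"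
    "size A = Polynomial.degree f"
  shows "resultant f g = c ^ Polynomial.degree g * (\<Prod>a\<in>#A. poly g a)"
  using assms
proof (induction "Polynomial.degree g" arbitrary: f g c A rule: less_induct)
  case less
  show ?case
  proof (cases "Polynomial.degree g = 0")
    case True
    then obtain e where "g = [:e:]" by (metis degree_eq_zeroE)
    moreover have "(\<Prod>a\<in>#A. poly [:e:] a) = e ^ size A" by (induction A) auto
    ultimately show ?thesis using less.prems(4) by (metis True power_0 mult_1 resultant_const(2))
  next
    case False
    then have g0: "g \<noteq> 0" by auto
    define h where "h = f mod g"
    define e where "e = Polynomial.lead_coeff g"
    obtain B where B: "size B = Polynomial.degree g" "g = smult e (\<Prod>b\<in>#B. [:- b, 1:])"
      using alg_closed_imp_factorization[OF g0] e_def by blast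
    have pf: "poly f = (\<lambda>b. c * (\<Prod>a\<in>#A. b - a))"
      by (rule ext, subst less.prems(3)) (simp only: poly_smult poly_prod_mset_linear)
    have pg: "poly g = (\<lambda>a. e * (\<Prod>b\<in>#B. a - b))"
      by (rule ext, subst B(2)) (simp only: poly_smult poly_prod_mset_linear)
    have eq: "f + (- (f div g)) * g = h" by (simp add: h_def minus_div_mult_eq_mod)
    have dh: "Polynomial.degree h < Polynomial.degree g"
      unfolding h_def using False degree_mod_less[OF g0, of f] by auto
    have root: "poly f b = poly h b" if "b \<in># B" for b
    proof -
      have "poly g b = 0"
        using that by (auto simp: pg prod_mset_zero_iff)
      then show ?thesis using arg_cong[OF eq, of "\<lambda>p. poly p b"] by simp
    qed
    have "resultant f g = (-1) ^ (Polynomial.degree f * Polynomial.degree g) *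
             e ^ (Polynomial.degree f - Polynomial.degree h) * resultant g h"
      using resultant_euclid_step[OF eq less.prems(1) dh] by (simp add: e_def)
    also have "resultant g h = e ^ Polynomial.degree h * (\<Prod>b\<in>#B. poly h b)"
      by (rule less.hyps[OF dh _ _ B(2,1)]) (use dh g0 in \<open>simp_all add: e_def\<close>)
    also have "(\<Prod>b\<in>#B. poly h b) = (\<Prod>b\<in>#B. poly f b)"
      using root by (intro arg_cong[of _ _ prod_mset] image_mset_cong) simp
    also have "\<dots> = c ^ Polynomial.degree g * (\<Prod>b\<in>#B. \<Prod>a\<in>#A. b - a)"
      by (simp add: pf prod_mset_mult_const B(1))
    \<comment> \<open>The sign of the Euclidean step is exactly the sign of exchanging the two
      products of differences.\<close>
    also have "(-1) ^ (Polynomial.degree f * Polynomial.degree g) *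
             e ^ (Polynomial.degree f - Polynomial.degree h) * (e ^ Polynomial.degree h *
             (c ^ Polynomial.degree g * (\<Prod>b\<in>#B. \<Prod>a\<in>#A. b - a))) =
           c ^ Polynomial.degree g * (e ^ Polynomial.degree f *
            ((-1) ^ (size A * size B) * (\<Prod>b\<in>#B. \<Prod>a\<in>#A. b - a)))"
      using dh less.prems B(1) by (simp add: power_add[symmetric] mult.assoc mult.left_commute)
    also have "(-1) ^ (size A * size B) * (\<Prod>b\<in>#B. \<Prod>a\<in>#A. b - a) = (\<Prod>a\<in>#A. \<Prod>b\<in>#B. a - b)"
      by (rule prod_mset_diff_swap[symmetric])
    also have "e ^ Polynomial.degree f * \<dots> = (\<Prod>a\<in>#A. poly g a)"
      by (simp add: pg prod_mset_mult_const less.prems(4))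
    finally show ?thesis .
  qed
qed

interpretation to_ac_hom: field_hom to_ac
  by unfold_locales auto

text \<open>Resultants commute with the embedding \<open>to_ac\<close>, and over the closure the
  product formula applies. \<open>A\<close> is a multiset since repeated roots are allowed.\<close>

lemma to_ac_discriminant:
  fixes f :: "'k :: field poly"
  assumes "Polynomial.lead_coeff f = 1" "map_poly to_ac f = (\<Prod>a\<in>#A. [:- a, 1:])"
  shows "to_ac (discriminant f) = (-1) ^ (Polynomial.degree f * (Polynomial.degree f - 1) div 2) *
    (\<Prod>a\<in>#A. poly (pderiv (map_poly to_ac f)) a)"
proof -
  have sz: "size A = Polynomial.degree f"
    using degree_prod_mset_linear[of A] unfolding assms(2)[symmetric] by simp
  have "to_ac (resultant f (pderiv f)) = resultant (map_poly to_ac f) (pderiv (map_poly to_ac f))"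
    by (simp flip: to_ac_hom.resultant_hom to_ac_hom.map_poly_pderiv)
  also have "\<dots> = (\<Prod>a\<in>#A. poly (pderiv (map_poly to_ac f)) a)"
  proof -
    have 1: "Polynomial.degree (pderiv (map_poly to_ac f)) \<le> Polynomial.degree (map_poly to_ac f)"
      by (rule order.trans[OF degree_pderiv_le]) simp
    have 2: "map_poly to_ac f = smult 1 (\<Prod>a\<in>#A. [:- a, 1:])"
      unfolding smult_1_left by (rule assms(2))
    have 3: "size A = Polynomial.degree (map_poly to_ac f)"
      unfolding assms(2) degree_prod_mset_linear ..
    show ?thesis
      using resultant_eq_prod_roots[OF 1 one_neq_zero 2 3] by (simp only: power_one mult_1)
  qed
  finally show ?thesis using assms(1) by (simp add: discriminant_def)
qed

section \<open>Primes of the ring of all algebraic integers\<close>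

text \<open>Ideals of the ring of all algebraic integers of the field, kept as plain sets:
  arithmetic modulo \<open>I\<close> is written as \<open>x - y \<in> I\<close> with the field
  operations, without quotient rings.\<close>

locale integer_ideal =
  fixes I :: "'a :: field_char_0 set"
  assumes mem_int: "x \<in> I \<Longrightarrow> algebraic_int x"
    and zero_mem: "0 \<in> I"
    and add_mem: "x \<in> I \<Longrightarrow> y \<in> I \<Longrightarrow> x + y \<in> I"
    and mult_mem: "algebraic_int a \<Longrightarrow> x \<in> I \<Longrightarrow> a * x \<in> I"
begin

lemma mult_mem': "algebraic_int a \<Longrightarrow> x \<in> I \<Longrightarrow> x * a \<in> I"
  using mult_mem by (simp add: mult.commute)

lemma uminus_mem: "x \<in> I \<Longrightarrow> - x \<in> I"
  using mult_mem[of "-1" x] by simp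

lemma diff_mem: "x \<in> I \<Longrightarrow> y \<in> I \<Longrightarrow> x - y \<in> I"
  using add_mem[of x "- y"] uminus_mem by simp

lemma sum_mem: "(\<And>x. x \<in> B \<Longrightarrow> f x \<in> I) \<Longrightarrow> sum f B \<in> I"
  by (induction B rule: infinite_finite_induct) (auto intro: zero_mem add_mem)

lemma cong_sym: "x - y \<in> I \<Longrightarrow> y - x \<in> I"
  using uminus_mem[of "x - y"] by simp

lemma cong_trans: "x - y \<in> I \<Longrightarrow> y - z \<in> I \<Longrightarrow> x - z \<in> I"
  using add_mem[of "x - y" "y - z"] by simp

lemma cong_mult:
  assumes "x - y \<in> I" "z - w \<in> I" "algebraic_int x" "algebraic_int w"
  shows "x * z - y * w \<in> I"
proof -
  have "x * z - y * w = x * (z - w) + (x - y) * w" by (simp add: algebra_simps)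
  then show ?thesis using assms by (simp add: add_mem mult_mem mult_mem')
qed

lemma cong_int: "x - y \<in> I \<Longrightarrow> algebraic_int y \<Longrightarrow> algebraic_int x"
  using mem_int[of "x - y"] algebraic_int_plus[of "x - y" y] by simp

lemma cong_pow:
  assumes "x - y \<in> I" "algebraic_int x" "algebraic_int y"
  shows "x ^ n - y ^ n \<in> I"
  by (induction n) (use assms in \<open>auto intro: zero_mem cong_mult algebraic_int_pow\<close>)

lemma cong_sum: "(\<And>x. x \<in> B \<Longrightarrow> f x - g x \<in> I) \<Longrightarrow> sum f B - sum g B \<in> I"
  unfolding sum_subtractf[symmetric] by (rule sum_mem)

lemma cong_prod:
  assumes "\<And>x. x \<in> B \<Longrightarrow> f x - g x \<in> I \<and> algebraic_int (f x) \<and> algebraic_int (g x)"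
  shows "prod f B - prod g B \<in> I"
  using assms
  by (induction B rule: infinite_finite_induct)
    (auto intro!: zero_mem cong_mult algebraic_int_prod)

lemma poly_mem:
  assumes "\<And>i. coeff p i \<in> I" "algebraic_int x"
  shows "poly p x \<in> I"
  using assms by (auto simp: poly_altdef intro!: sum_mem mult_mem' algebraic_int_pow)

lemma cong_poly:
  assumes "\<And>i. coeff p i - coeff p' i \<in> I" "\<And>i. algebraic_int (coeff p' i)" "x - y \<in> I" "algebraic_int y"
  shows "poly p x - poly p' y \<in> I"
proof -
  have x: "algebraic_int x" using assms(3,4) cong_int by blast
  have 1: "poly p x - poly p' x \<in> I"
    unfolding poly_diff[symmetric] by (rule poly_mem) (use assms x in auto)
  have "poly p' x - poly p' y \<in> I"
    unfolding poly_altdef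
    by (intro cong_sum cong_mult cong_pow) (use assms x in \<open>auto intro: zero_mem algebraic_int_pow\<close>)
  with 1 show ?thesis by (rule cong_trans)
qed

end

locale integer_prime = integer_ideal Q for Q :: "'a :: field_char_0 set" +
  assumes one_not_mem: "1 \<notin> Q"
    and prime: "algebraic_int x \<Longrightarrow> algebraic_int y \<Longrightarrow> x * y \<in> Q \<Longrightarrow> x \<in> Q \<or> y \<in> Q"
begin

lemma prod_memE:
  assumes "finite B" "prod f B \<in> Q" "\<And>x. x \<in> B \<Longrightarrow> algebraic_int (f x)"
  obtains x where "x \<in> B" "f x \<in> Q"
  using assms
proof (induction B arbitrary: thesis rule: finite_induct)
  case (insert x B)
  then show ?case
    using prime[of "f x" "prod f B"] by (auto intro: algebraic_int_prod)
qed (use one_not_mem in auto)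

lemma prod_mset_memE:
  assumes "(\<Prod>x\<in>#B. f x) \<in> Q" "\<And>x. x \<in># B \<Longrightarrow> algebraic_int (f x)"
  obtains x where "x \<in># B" "f x \<in> Q"
  using assms
proof (induction B arbitrary: thesis)
  case (add x B)
  have "algebraic_int (\<Prod>x\<in>#B. f x)"
    using add.prems(3) by (induction B) (auto intro: algebraic_int_times)
  then show ?case using add prime[of "f x" "\<Prod>x\<in>#B. f x"] by auto
qed (use one_not_mem in auto)

lemma power_memD: "algebraic_int x \<Longrightarrow> x ^ n \<in> Q \<Longrightarrow> x \<in> Q"
  by (induction n) (auto simp: one_not_mem dest: prime intro: algebraic_int_pow)

lemma synthetic_div_int:
  fixes p :: "'a poly"
  assumes "\<And>i. algebraic_int (coeff p i)" "algebraic_int c"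
  shows "algebraic_int (coeff (synthetic_div p c) i)"
  using assms(1)
proof (induction p arbitrary: i)
  case (pCons a p)
  have j: "algebraic_int (coeff p j)" for j using pCons.prems[of "Suc j"] by simp
  have "algebraic_int (poly p c)" by (rule algebraic_int_poly[OF j assms(2)])
  moreover have "algebraic_int (coeff (synthetic_div p c) i)" for i by (rule pCons.IH[OF j])
  ultimately show ?case by (auto simp: synthetic_div_pCons coeff_pCons split: nat.split)
qed simp

text \<open>Synthetic division by one root \<open>c\<close> keeps the other roots, because
  \<open>s - c\<close> lies outside the prime \<open>Q\<close>. This is the bound on the number of
  roots over the residue domain, phrased without the quotient ring.\<close>

lemma coeff_mem_if_many_roots:
  assumes "finite S" "Polynomial.degree p < card S" "\<And>i. algebraic_int (coeff p i)"
    and "\<And>s. s \<in> S \<Longrightarrow> algebraic_int s \<and> poly p s \<in> Q"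
    and "\<And>s t. s \<in> S \<Longrightarrow> t \<in> S \<Longrightarrow> s - t \<in> Q \<Longrightarrow> s = t"
  shows "coeff p i \<in> Q"
  using assms
proof (induction S arbitrary: p i rule: finite_induct)
  case (insert c S)
  define p1 where "p1 = synthetic_div p c"
  have c: "algebraic_int c" "poly p c \<in> Q" using insert.prems by auto
  have p: "p = pCons (poly p c) p1 - smult c p1"
    using synthetic_div_correct[of p c] unfolding p1_def by (metis add_diff_cancel)
  have int: "algebraic_int (coeff p1 i)" for i
    unfolding p1_def using insert.prems c by (intro synthetic_div_int) auto
  have p1: "coeff p1 i \<in> Q" for i
  proof (cases "Polynomial.degree p = 0")
    case True
    then have "p1 = 0" by (simp add: p1_def synthetic_div_eq_0_iff)
    then show ?thesis by (simp add: zero_mem)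
  next
    case False
    show ?thesis
    proof (rule insert.IH)
      show "Polynomial.degree p1 < card S"
        using insert.prems(1) insert.hyps False by (simp add: p1_def degree_synthetic_div)
      fix s assume s: "s \<in> S"
      have "poly p s = poly p c + (s - c) * poly p1 s"
        by (subst p) (simp add: algebra_simps)
      then have "(s - c) * poly p1 s \<in> Q"
        using diff_mem[of "poly p s" "poly p c"] insert.prems(3)[of s] s c(2) by simp
      moreover have "s - c \<notin> Q" using insert s by blast
      ultimately show "algebraic_int s \<and> poly p1 s \<in> Q"
        using prime s c int insert.prems(3) by (meson algebraic_int_diff algebraic_int_poly insertCI)
    qed (use insert int in auto)
  qed
  show ?case
    by (subst p) (use p1 c in \<open>auto simp: coeff_pCons intro!: diff_mem mult_mem split: nat.split\<close>)
qed simp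

end

text \<open>\<open>Q\<close> is maximal, by Zorn, among the ideals that meet \<open>A\<close> inside
  \<open>P\<close>. Maximality gives primality, and integrality gives that all of \<open>P\<close>
  lies in \<open>Q\<close>. The lemma serves twice: for the ring of integers inside the algebraic
  closure, and for the rational integers inside the number field.\<close>

lemma lying_over:
  fixes A P :: "'a :: field_char_0 set"
  assumes A: "\<And>a. a \<in> A \<Longrightarrow> algebraic_int a" "1 \<in> A"
      "\<And>a b. a \<in> A \<Longrightarrow> b \<in> A \<Longrightarrow> a + b \<in> A" "\<And>a b. a \<in> A \<Longrightarrow> b \<in> A \<Longrightarrow> a * b \<in> A"
      "\<And>k. of_int k \<in> A"
    and P: "P \<subseteq> A" "0 \<in> P" "\<And>a b. a \<in> P \<Longrightarrow> b \<in> P \<Longrightarrow> a + b \<in> P"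
      "\<And>a b. a \<in> A \<Longrightarrow> b \<in> P \<Longrightarrow> a * b \<in> P" "1 \<notin> P"
      "\<And>a b. a \<in> A \<Longrightarrow> b \<in> A \<Longrightarrow> a * b \<in> P \<Longrightarrow> a \<in> P \<or> b \<in> P"
  obtains Q where "integer_prime Q" "Q \<inter> A = P"
proof -
  define F where "F = {I :: 'a set. integer_ideal I \<and> I \<inter> A \<subseteq> P}"
  have "{0} \<in> F" using P(2) by (auto simp: F_def integer_ideal_def)
  moreover have "\<Union>C \<in> F" if C: "C \<noteq> {}" "subset.chain F C" for C
  proof -
    have cF: "I \<in> C \<Longrightarrow> integer_ideal I" "I \<in> C \<Longrightarrow> I \<inter> A \<subseteq> P" for I
      using C(2) by (auto simp: subset.chain_def F_def)
    have "integer_ideal (\<Union>C)"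
    proof
      fix x y assume "x \<in> \<Union>C" "y \<in> \<Union>C"
      then obtain I J where IJ: "I \<in> C" "J \<in> C" "x \<in> I" "y \<in> J" by auto
      then have "I \<subseteq> J \<or> J \<subseteq> I" using C(2) by (auto simp: subset.chain_def)
      then show "x + y \<in> \<Union>C"
        using IJ cF(1) integer_ideal.add_mem by blast
    qed (use C(1) cF(1) in \<open>auto dest: integer_ideal.mem_int integer_ideal.zero_mem integer_ideal.mult_mem\<close>)
    then show ?thesis using cF by (auto simp: F_def)
  qed
  ultimately obtain Q where Q: "Q \<in> F" and max: "\<And>I. I \<in> F \<Longrightarrow> Q \<subseteq> I \<Longrightarrow> I = Q"
    using subset_Zorn_nonempty[of F] by (metis empty_iff)
  interpret integer_ideal Q using Q by (simp add: F_def)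
  have QA: "Q \<inter> A \<subseteq> P" using Q by (simp add: F_def)
  \<comment> \<open>Maximality of \<open>Q\<close>: for \<open>x\<close> outside \<open>Q\<close>,
    the ideal generated by \<open>Q\<close> and \<open>x\<close> must meet \<open>A\<close> outside
    \<open>P\<close>.\<close>
  have ext: "\<exists>y\<in>Q. \<exists>a. algebraic_int a \<and> y + a * x \<in> A \<and> y + a * x \<notin> P"
    if x: "algebraic_int x" "x \<notin> Q" for x
  proof -
    define I where "I = {y + a * x | y a. y \<in> Q \<and> algebraic_int a}"
    have "integer_ideal I"
    proof
      fix u assume "u \<in> I"
      then show "algebraic_int u"
        using x mem_int by (auto simp: I_def intro!: algebraic_int_plus algebraic_int_times)
    next
      show "0 \<in> I" using zero_mem by (force simp: I_def intro: exI[of _ 0])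
    next
      fix u v assume "u \<in> I" "v \<in> I"
      then obtain y a y' a' where "u = y + a * x" "v = y' + a' * x" "y \<in> Q" "y' \<in> Q"
          "algebraic_int a" "algebraic_int a'" by (auto simp: I_def)
      then have "u + v = (y + y') + (a + a') * x" "y + y' \<in> Q" "algebraic_int (a + a')"
        by (auto simp: algebra_simps add_mem algebraic_int_plus)
      then show "u + v \<in> I" unfolding I_def by blast
    next
      fix b u :: 'a assume b: "algebraic_int b" and "u \<in> I"
      then obtain y a where "u = y + a * x" "y \<in> Q" "algebraic_int a" by (auto simp: I_def)
      then have "b * u = b * y + (b * a) * x" "b * y \<in> Q" "algebraic_int (b * a)"
        using b by (auto simp: algebra_simps mult_mem algebraic_int_times)
      then show "b * u \<in> I" unfolding I_def by blast
    qed
    moreover have "Q \<subseteq> I" by (force simp: I_def intro: exI[of _ 0])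
    moreover have "x \<in> I" using zero_mem by (force simp: I_def intro: exI[of _ 0] exI[of _ 1])
    ultimately have "\<not> I \<inter> A \<subseteq> P" using max[of I] x(2) by (auto simp: F_def)
    then show ?thesis by (auto simp: I_def)
  qed
  have "integer_prime Q"
  proof
    show "1 \<notin> Q" using QA A(2) P(5) by blast
    fix a b assume ab: "algebraic_int a" "algebraic_int b" "a * b \<in> Q"
    show "a \<in> Q \<or> b \<in> Q"
    proof (rule ccontr)
      assume "\<not> (a \<in> Q \<or> b \<in> Q)"
      then obtain y r z s where h: "y \<in> Q" "algebraic_int r" "y + r * a \<in> A" "y + r * a \<notin> P"
          "z \<in> Q" "algebraic_int s" "z + s * b \<in> A" "z + s * b \<notin> P"
        using ext ab by metis
      have "(y + r * a) * (z + s * b) = (z + s * b) * y + (r * a) * z + (r * s) * (a * b)"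
        by (simp add: algebra_simps)
      also have "\<dots> \<in> Q"
        using h(1,5) ab(3) mult_mem[of "z + s * b" y] mult_mem[of "r * a" z] mult_mem[of "r * s" "a * b"]
          A(1)[OF h(7)] h(2,6) ab(1,2) by (auto intro: add_mem algebraic_int_times)
      finally show False using QA A(4) P(6) h by blast
    qed
  qed
  moreover have "P \<subseteq> Q"
  proof (rule ccontr)
    assume "\<not> P \<subseteq> Q"
    then obtain x where x: "x \<in> P" "x \<notin> Q" by blast
    then have "algebraic_int x" using A(1) P(1) by blast
    then obtain y b where yb: "y \<in> Q" "algebraic_int b" and u: "y + b * x \<in> A" "y + b * x \<notin> P"
      using ext x(2) by blast
    define u where "u = y + b * x"
    obtain c :: "int poly" where c: "poly (map_poly of_int c) b = 0" "Polynomial.lead_coeff c = 1"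
      using yb(2) by (auto simp: algebraic_int_altdef_ipoly)
    define m where "m = Polynomial.degree c"
    have A_pow: "a ^ i \<in> A" if "a \<in> A" for a i
      using that A(2,4) by (induction i) auto
    \<comment> \<open>Scaling the monic equation of \<open>b\<close> by \<open>x ^ m\<close> gives a
      monic equation for \<open>b * x\<close> whose lower coefficients carry a factor
      \<open>x\<close> in \<open>P\<close>. Modulo \<open>Q\<close> the element \<open>u\<close> of
      \<open>A\<close> replaces \<open>b * x\<close>, so \<open>u ^ m\<close> lands in
      \<open>P\<close>.\<close>
    have "0 = x ^ m * poly (map_poly of_int c) b" using c by simp
    also have "\<dots> = (\<Sum>i\<le>m. of_int (coeff c i) * x ^ (m - i) * (b * x) ^ i)"
      unfolding poly_altdef sum_distrib_left
    proof (intro sum.cong)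
      fix i assume "i \<in> {..m}"
      then have "x ^ m = x ^ (m - i) * x ^ i" by (simp flip: power_add)
      then show "x ^ m * (coeff (map_poly of_int c) i * b ^ i) =
          of_int (coeff c i) * x ^ (m - i) * (b * x) ^ i"
        by (simp add: power_mult_distrib coeff_map_poly mult_ac)
    qed (simp add: m_def degree_map_poly)
    finally have "(\<Sum>i\<le>m. of_int (coeff c i) * x ^ (m - i) * u ^ i) -
        (\<Sum>i\<le>m. of_int (coeff c i) * x ^ (m - i) * (b * x) ^ i) =
        (\<Sum>i\<le>m. of_int (coeff c i) * x ^ (m - i) * u ^ i)" by simp
    moreover have "(\<Sum>i\<le>m. of_int (coeff c i) * x ^ (m - i) * u ^ i) -
        (\<Sum>i\<le>m. of_int (coeff c i) * x ^ (m - i) * (b * x) ^ i) \<in> Q"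
      using yb \<open>algebraic_int x\<close> A(1)[OF u(1)]
      by (intro cong_sum cong_mult cong_pow)
        (auto simp: u_def zero_mem intro!: algebraic_int_times algebraic_int_pow algebraic_int_of_int')
    moreover have "(\<Sum>i\<le>m. of_int (coeff c i) * x ^ (m - i) * u ^ i) =
        (\<Sum>i<m. of_int (coeff c i) * x ^ (m - i) * u ^ i) + u ^ m"
      using c(2) by (simp add: m_def flip: lessThan_Suc_atMost)
    moreover have low: "(\<Sum>i<m. of_int (coeff c i) * x ^ (m - i) * u ^ i) \<in> P"
    proof -
      have "of_int (coeff c i) * x ^ (m - i) * u ^ i \<in> P" if "i < m" for i
      proof -
        define j where "j = m - i - 1"
        have "m - i = Suc j" using that by (simp add: j_def)
        then have "of_int (coeff c i) * x ^ (m - i) * u ^ i = (of_int (coeff c i) * x ^ j * u ^ i) * x"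
          by (simp add: mult_ac)
        moreover have "of_int (coeff c i) * x ^ j * u ^ i \<in> A"
          using A(4,5) A_pow x(1) P(1) u(1) by (simp add: u_def subset_iff)
        ultimately show ?thesis using P(4) x(1) by metis
      qed
      moreover have "(\<And>i. i < k \<Longrightarrow> g i \<in> P) \<Longrightarrow> sum g {..<k} \<in> P" for g :: "nat \<Rightarrow> 'a" and k
        by (induction k) (auto simp: P(2,3))
      ultimately show ?thesis by simp
    qed
    ultimately have *: "(\<Sum>i<m. of_int (coeff c i) * x ^ (m - i) * u ^ i) + u ^ m \<in> Q" by metis
    have "(\<Sum>i<m. of_int (coeff c i) * x ^ (m - i) * u ^ i) + u ^ m \<in> A"
      using low P(1) A(3) A_pow u(1) by (auto simp: u_def)
    then have "(\<Sum>i<m. of_int (coeff c i) * x ^ (m - i) * u ^ i) + u ^ m \<in> P"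
      using * QA by blast
    moreover have "(-1) * (\<Sum>i<m. of_int (coeff c i) * x ^ (m - i) * u ^ i) \<in> P"
      using P(4)[of "-1", OF _ low] A(5)[of "-1"] by simp
    ultimately have um: "u ^ m \<in> P" using P(3) by fastforce
    have "u ^ i \<in> P \<Longrightarrow> u \<in> P" for i
    proof (induction i)
      case (Suc i)
      then show ?case using P(6)[of u "u ^ i"] A_pow u(1) by (auto simp: u_def)
    qed (simp add: P(5))
    then show False using um u by (auto simp: u_def)
  qed
  ultimately show ?thesis using that QA P(1) by blast
qed

section \<open>Frobenius modulo a prime\<close>

lemma degree_less_if_coeff_zero:
  assumes "\<And>j. j \<ge> n \<Longrightarrow> coeff p j = 0" "n > 0"
  shows "Polynomial.degree p < n"
proof (rule ccontr)
  assume "\<not> Polynomial.degree p < n"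
  then have "p = 0" using assms(1)[of "Polynomial.degree p"] by (simp add: not_less)
  then show False using \<open>\<not> Polynomial.degree p < n\<close> assms(2) by simp
qed

text \<open>The set \<open>S\<close> represents the residue classes of the subring \<open>A\<close> modulo \<open>Q\<close>; so
  \<open>A / (Q \<inter> A)\<close> is a finite domain with \<open>q\<close> elements.\<close>

locale residue_prime = integer_prime Q for Q :: "'a :: {field_char_0, alg_closed_field} set" +
  fixes A S :: "'a set" and q :: nat
  assumes A_int: "a \<in> A \<Longrightarrow> algebraic_int a"
    and A_one: "1 \<in> A"
    and A_add: "a \<in> A \<Longrightarrow> b \<in> A \<Longrightarrow> a + b \<in> A"
    and A_mult: "a \<in> A \<Longrightarrow> b \<in> A \<Longrightarrow> a * b \<in> A"
    and A_of_int: "of_int k \<in> A"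
    and S_fin: "finite S" and S_sub: "S \<subseteq> A" and S_card: "card S = q"
    and S_inj: "s \<in> S \<Longrightarrow> t \<in> S \<Longrightarrow> s - t \<in> Q \<Longrightarrow> s = t"
    and S_cover: "a \<in> A \<Longrightarrow> \<exists>s\<in>S. a - s \<in> Q"
begin

lemma q_ge2: "q \<ge> 2"
proof -
  obtain s t where st: "s \<in> S" "0 - s \<in> Q" "t \<in> S" "1 - t \<in> Q"
    using S_cover[of 0] S_cover[of 1] A_of_int[of 0] A_one by auto
  have "s \<noteq> t"
  proof
    assume "s = t"
    then have "(1 - t) - (0 - s) = 1" by simp
    then show False using diff_mem[OF st(4,2)] one_not_mem by simp
  qed
  then have "card {s, t} = 2" by simp
  then show ?thesis using card_mono[OF S_fin, of "{s, t}"] st S_card by auto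
qed

lemma A_pow: "a \<in> A \<Longrightarrow> a ^ n \<in> A"
  by (induction n) (auto intro: A_one A_mult)

text \<open>Multiplication by \<open>a\<close> permutes the nonzero residue classes, represented by
  \<open>T\<close>; comparing the two products over \<open>T\<close> and cancelling gives Fermat's
  theorem.\<close>

lemma fermat_A:
  assumes a: "a \<in> A"
  shows "a ^ q - a \<in> Q"
proof (cases "a \<in> Q")
  case True
  then have "a ^ q \<in> Q" using q_ge2 a mult_mem'[OF algebraic_int_pow[OF A_int[OF a]], of a "q - 1"]
    by (cases q) auto
  then show ?thesis using True diff_mem by blast
next
  case False
  \<comment> \<open>\<open>z\<close> represents the zero class; \<open>S\<close> need not contain 0
    itself.\<close>
  obtain z where z: "z \<in> S" "0 - z \<in> Q" using S_cover[of 0] A_of_int[of 0] by auto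
  then have zQ: "z \<in> Q" using uminus_mem[of "0 - z"] by simp
  define T where "T = S - {z}"
  have "\<exists>t. t \<in> S \<and> a * s - t \<in> Q" if "s \<in> S" for s
    using S_cover[of "a * s"] a A_mult S_sub that by blast
  then obtain r where r: "\<And>s. s \<in> S \<Longrightarrow> r s \<in> S \<and> a * s - r s \<in> Q" by metis
  have Sint: "s \<in> S \<Longrightarrow> algebraic_int s" for s using S_sub A_int by blast
  have TQ: "s \<notin> Q" if "s \<in> T" for s
    using that S_inj[of s z] z zQ diff_mem[of s z] by (auto simp: T_def)
  have rT: "r ` T \<subseteq> T"
  proof
    fix t assume "t \<in> r ` T"
    then obtain s where s: "t = r s" "s \<in> T" by auto
    then have sS: "s \<in> S" by (simp add: T_def)
    have "r s \<noteq> z"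
    proof
      assume "r s = z"
      then have "a * s \<in> Q" using r[OF sS] zQ add_mem[of "a * s - z" z] by simp
      then show False using prime[OF A_int[OF a] Sint[OF sS]] False TQ[OF s(2)] by blast
    qed
    then show "t \<in> T" using r[OF sS] s by (simp add: T_def)
  qed
  have inj: "inj_on r T"
  proof (rule inj_onI)
    fix s t assume st: "s \<in> T" "t \<in> T" "r s = r t"
    then have S: "s \<in> S" "t \<in> S" by (auto simp: T_def)
    have "a * s - a * t \<in> Q"
      using r[OF S(1)] r[OF S(2)] st(3) diff_mem[of "a * s - r s" "a * t - r t"] by simp
    then have "a * (s - t) \<in> Q" by (simp add: algebra_simps)
    then have "s - t \<in> Q" using prime[of a "s - t"] False A_int[OF a] Sint S algebraic_int_diff by blast
    then show "s = t" using S_inj S by blast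
  qed
  have finT: "finite T" using S_fin by (simp add: T_def)
  have "r ` T = T" using endo_inj_surj[OF finT rT inj] .
  then have "prod r T = \<Prod>T" using prod.reindex[OF inj, of id] by simp
  moreover have "(\<Prod>s\<in>T. a * s) - prod r T \<in> Q"
  proof (rule cong_prod)
    fix s assume "s \<in> T"
    then have sS: "s \<in> S" by (simp add: T_def)
    show "a * s - r s \<in> Q \<and> algebraic_int (a * s) \<and> algebraic_int (r s)"
      using r[OF sS] Sint sS A_int[OF a] by (auto intro: algebraic_int_times)
  qed
  moreover have "(\<Prod>s\<in>T. a * s) = a ^ (q - 1) * \<Prod>T"
    using z S_fin S_card by (simp add: prod.distrib T_def)
  ultimately have "a ^ (q - 1) * \<Prod>T - \<Prod>T \<in> Q" by simp
  moreover have "a ^ (q - 1) * \<Prod>T - \<Prod>T = (a ^ (q - 1) - 1) * \<Prod>T" by (simp add: algebra_simps)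
  ultimately have *: "(a ^ (q - 1) - 1) * \<Prod>T \<in> Q" by simp
  have Tint: "algebraic_int (\<Prod>T)" using Sint by (intro algebraic_int_prod) (auto simp: T_def)
  have "\<Prod>T \<notin> Q"
    using prod_memE[OF finT, of "\<lambda>x. x"] TQ Sint by (metis DiffD1 T_def)
  then have "a ^ (q - 1) - 1 \<in> Q"
    using prime[OF _ Tint *] A_int[OF a] by (auto intro: algebraic_int_diff algebraic_int_pow)
  then have "(a ^ (q - 1) - 1) * a \<in> Q" using mult_mem' A_int[OF a] by blast
  moreover have "(a ^ (q - 1) - 1) * a = a ^ q - a" using q_ge2 by (cases q) (auto simp: algebra_simps)
  ultimately show ?thesis by simp
qed

text \<open>By Fermat, \<open>(1 + X)^q - X^q - 1\<close> vanishes modulo \<open>Q\<close> at the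
  \<open>q\<close> elements of \<open>S\<close>, while its degree is below \<open>q\<close>; so all
  its coefficients lie in \<open>Q\<close>. This makes the Frobenius map additive directly from the
  size \<open>q\<close> of the residue ring.\<close>

lemma binomial_mem:
  assumes "0 < i" "i < q"
  shows "of_nat (q choose i) \<in> Q"
proof -
  define p :: "'a poly" where "p = [:1, 1:] ^ q - Polynomial.monom 1 q - 1"
  have co: "coeff ([:1, 1:] ^ q :: 'a poly) j = of_nat (q choose j)" for j
  proof (cases "j \<le> q")
    case True
    show ?thesis by (subst coeff_linear_poly_power[OF True]) simp
  next
    case False
    have "Polynomial.degree ([:1, 1 :: 'a:] ^ q) = q" by (rule degree_linear_power)
    then show ?thesis using False by (subst coeff_eq_0) (auto simp: binomial_eq_0)
  qed
  have pco: "coeff p j = of_nat (q choose j) - (if j = q then 1 else 0) - (if j = 0 then 1 else 0)" for j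
    unfolding p_def coeff_diff co by auto
  have "coeff p j \<in> Q" for j
  proof (rule coeff_mem_if_many_roots[OF S_fin])
    have "coeff p j = 0" if "j \<ge> q" for j
      using that q_ge2 by (auto simp: pco binomial_eq_0)
    then show "Polynomial.degree p < card S"
      using q_ge2 S_card by (auto intro: degree_less_if_coeff_zero)
  next
    fix j show "algebraic_int (coeff p j)"
      by (auto simp: pco intro!: algebraic_int_diff int_imp_algebraic_int)
  next
    fix s assume s: "s \<in> S"
    then have sA: "s \<in> A" using S_sub by blast
    have "poly p s = ((1 + s) ^ q - (1 + s)) - (s ^ q - s)"
      by (simp add: p_def poly_monom)
    then have "poly p s \<in> Q"
      using diff_mem[OF fermat_A[OF A_add[OF A_one sA]] fermat_A[OF sA]] by (simp only:)
    then show "algebraic_int s \<and> poly p s \<in> Q" using A_int[OF sA] by simp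
  next
    fix s t assume "s \<in> S" "t \<in> S" "s - t \<in> Q" then show "s = t" by (rule S_inj)
  qed
  from this[of i] show ?thesis using assms by (simp add: pco)
qed

lemma frob_add:
  assumes "algebraic_int x" "algebraic_int y"
  shows "(x + y) ^ q - (x ^ q + y ^ q) \<in> Q"
proof -
  have "(x + y) ^ q = (\<Sum>k\<le>q. of_nat (q choose k) * x ^ k * y ^ (q - k))"
    by (rule binomial_ring)
  also have "{..q} = insert 0 (insert q {0<..<q})" using q_ge2 by auto
  also have "(\<Sum>k\<in>\<dots>. of_nat (q choose k) * x ^ k * y ^ (q - k)) =
      y ^ q + (x ^ q + (\<Sum>k\<in>{0<..<q}. of_nat (q choose k) * x ^ k * y ^ (q - k)))"
    using q_ge2 by simp
  finally have "(x + y) ^ q - (x ^ q + y ^ q) =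
      (\<Sum>k\<in>{0<..<q}. of_nat (q choose k) * x ^ k * y ^ (q - k))" by simp
  also have "\<dots> \<in> Q"
    using assms by (intro sum_mem mult_mem' binomial_mem algebraic_int_pow) auto
  finally show ?thesis .
qed

lemma frob_sum:
  assumes "finite B" "\<And>x. x \<in> B \<Longrightarrow> algebraic_int (f x)"
  shows "(\<Sum>x\<in>B. f x) ^ q - (\<Sum>x\<in>B. f x ^ q) \<in> Q"
  using assms
proof (induction B rule: finite_induct)
  case empty
  then show ?case using q_ge2 by (simp add: zero_mem power_0_left)
next
  case (insert x B)
  have "(f x + sum f B) ^ q - (f x ^ q + sum f B ^ q) \<in> Q"
    using insert by (intro frob_add algebraic_int_sum) auto
  moreover have "(f x ^ q + sum f B ^ q) - (f x ^ q + (\<Sum>x\<in>B. f x ^ q)) \<in> Q"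
    using insert by simp
  ultimately have "(f x + sum f B) ^ q - (f x ^ q + (\<Sum>x\<in>B. f x ^ q)) \<in> Q"
    by (rule cong_trans)
  then show ?case using insert by simp
qed

lemma frob_poly:
  assumes "\<And>i. algebraic_int (coeff p i)" "algebraic_int x"
  shows "poly p x ^ q - poly (map_poly (\<lambda>c. c ^ q) p) (x ^ q) \<in> Q"
proof -
  have "poly (map_poly (\<lambda>c. c ^ q) p) (x ^ q) = (\<Sum>i\<le>Polynomial.degree p. (coeff p i * x ^ i) ^ q)"
    using q_ge2 by (simp add: poly_altdef degree_map_poly coeff_map_poly power_mult_distrib
        power_mult[symmetric] mult.commute)
  moreover have "(\<Sum>i\<le>Polynomial.degree p. coeff p i * x ^ i) ^ q -
      (\<Sum>i\<le>Polynomial.degree p. (coeff p i * x ^ i) ^ q) \<in> Q"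
    using assms by (intro frob_sum algebraic_int_times algebraic_int_pow) auto
  ultimately show ?thesis by (simp add: poly_altdef)
qed

text \<open>\<open>X^q - X\<close> and the product of the \<open>X - s\<close> agree modulo
  \<open>Q\<close>: their difference has degree below \<open>q\<close> and \<open>q\<close>
  incongruent roots. An element fixed by Frobenius therefore puts the product of the
  \<open>x - s\<close> into \<open>Q\<close>, which is prime.\<close>

lemma frob_fixed:
  assumes x: "algebraic_int x" "x ^ q - x \<in> Q"
  shows "\<exists>s\<in>S. x - s \<in> Q"
proof -
  define p :: "'a poly" where "p = Polynomial.monom 1 q - [:0, 1:] - (\<Prod>s\<in>S. [:- s, 1:])"
  have Sint: "s \<in> S \<Longrightarrow> algebraic_int s" for s using S_sub A_int by blast
  have dS: "Polynomial.degree (\<Prod>s\<in>S. [:- s, 1:]) = q"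
    using S_card by (subst degree_prod_eq_sum_degree) auto
  have lS: "coeff (\<Prod>s\<in>S. [:- s, 1:]) q = 1"
    using lead_coeff_prod[of "\<lambda>s. [:- s, 1:]" S] unfolding dS by simp
  have "coeff p i \<in> Q" for i
  proof (rule coeff_mem_if_many_roots[OF S_fin])
    have 1: "coeff p j = 0" if "j \<ge> q" for j
    proof (cases "j = q")
      case True
      then show ?thesis using q_ge2 lS by (simp add: p_def coeff_pCons split: nat.split)
    next
      case False
      then have "coeff (\<Prod>s\<in>S. [:- s, 1:]) j = 0" using that dS by (intro coeff_eq_0) auto
      then show ?thesis using False that q_ge2 by (simp add: p_def coeff_pCons split: nat.split)
    qed
    have "Polynomial.degree p < q"
      using 1 q_ge2 by (auto intro: degree_less_if_coeff_zero)
    then show "Polynomial.degree p < card S" using S_card by simp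
  next
    fix j
    have "algebraic_int (coeff (\<Prod>s\<in>S. [:- s, 1:]) j)"
      by (intro algebraic_int_coeff_prod algebraic_int_linear_coeff Sint)
    moreover have "algebraic_int (coeff [:0, 1 :: 'a:] j)" by (simp add: coeff_pCons split: nat.split)
    ultimately show "algebraic_int (coeff p j)"
      unfolding p_def coeff_diff coeff_monom by (intro algebraic_int_diff) auto
  next
    fix s assume s: "s \<in> S"
    then have sA: "s \<in> A" using S_sub by blast
    have "poly (\<Prod>s\<in>S. [:- s, 1:]) s = 0" using s S_fin by (auto simp: poly_prod)
    then have "poly p s = s ^ q - s" by (simp add: p_def poly_monom)
    then show "algebraic_int s \<and> poly p s \<in> Q" using fermat_A[OF sA] A_int[OF sA] by simp
  next
    fix s t assume "s \<in> S" "t \<in> S" "s - t \<in> Q" then show "s = t" by (rule S_inj)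
  qed
  then have "poly p x \<in> Q" using x(1) by (rule poly_mem)
  moreover have "poly p x = x ^ q - x - (\<Prod>s\<in>S. x - s)"
    by (simp add: p_def poly_monom poly_prod)
  ultimately have *: "(\<Prod>s\<in>S. x - s) \<in> Q" using x(2) diff_mem[of "x ^ q - x" "poly p x"] by simp
  obtain s where "s \<in> S" "x - s \<in> Q"
    by (rule prod_memE[OF S_fin *]) (use x(1) Sint algebraic_int_diff in blast)+
  then show ?thesis by blast
qed

end

section \<open>Subfields and their embeddings\<close>

locale subfield_set =
  fixes M :: "'a :: field set"
  assumes zero: "0 \<in> M" and one: "1 \<in> M"
    and add: "x \<in> M \<Longrightarrow> y \<in> M \<Longrightarrow> x + y \<in> M"
    and mult: "x \<in> M \<Longrightarrow> y \<in> M \<Longrightarrow> x * y \<in> M"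
    and uminus: "x \<in> M \<Longrightarrow> - x \<in> M"
    and inv: "x \<in> M \<Longrightarrow> inverse x \<in> M"
begin

lemma diff: "x \<in> M \<Longrightarrow> y \<in> M \<Longrightarrow> x - y \<in> M"
  using add[of x "- y"] uminus by simp

lemma divide: "x \<in> M \<Longrightarrow> y \<in> M \<Longrightarrow> x / y \<in> M"
  by (simp add: divide_inverse mult inv)

lemma sum: "(\<And>i. i \<in> B \<Longrightarrow> f i \<in> M) \<Longrightarrow> sum f B \<in> M"
  by (induction B rule: infinite_finite_induct) (auto intro: zero add)

lemma pow: "x \<in> M \<Longrightarrow> x ^ n \<in> M"
  by (induction n) (auto intro: one mult)

lemma of_int_mem: "of_int k \<in> M"
proof -
  have "of_nat n \<in> M" for n by (induction n) (auto intro: zero one add)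
  then show ?thesis by (cases k) (auto intro: uminus diff one simp del: of_nat_Suc)
qed

definition coeffs_in :: "'a poly \<Rightarrow> bool" where
  "coeffs_in p \<longleftrightarrow> (\<forall>i. coeff p i \<in> M)"

lemma coeffs_inD: "coeffs_in p \<Longrightarrow> coeff p i \<in> M" by (simp add: coeffs_in_def)

lemma coeffs_in_add: "coeffs_in p \<Longrightarrow> coeffs_in r \<Longrightarrow> coeffs_in (p + r)" by (simp add: coeffs_in_def add)
lemma coeffs_in_diff: "coeffs_in p \<Longrightarrow> coeffs_in r \<Longrightarrow> coeffs_in (p - r)" by (simp add: coeffs_in_def diff)
lemma coeffs_in_smult: "c \<in> M \<Longrightarrow> coeffs_in p \<Longrightarrow> coeffs_in (smult c p)" by (simp add: coeffs_in_def mult)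
lemma coeffs_in_mult: "coeffs_in p \<Longrightarrow> coeffs_in r \<Longrightarrow> coeffs_in (p * r)"
  by (auto simp: coeffs_in_def coeff_mult intro!: sum mult)
lemma coeffs_in_monom: "c \<in> M \<Longrightarrow> coeffs_in (Polynomial.monom c n)" by (simp add: coeffs_in_def zero)
lemma coeffs_in_0: "coeffs_in 0" and coeffs_in_1: "coeffs_in 1" by (auto simp: coeffs_in_def zero one)
lemma coeffs_in_const: "c \<in> M \<Longrightarrow> coeffs_in [:c:]"
  by (auto simp: coeffs_in_def coeff_pCons zero split: nat.split)
lemma coeffs_in_X: "coeffs_in [:0, 1:]" 
  by (auto simp: coeffs_in_def coeff_pCons zero one split: nat.split)

lemma poly_mem: "coeffs_in p \<Longrightarrow> x \<in> M \<Longrightarrow> poly p x \<in> M"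
  by (auto simp: poly_altdef coeffs_in_def intro!: sum mult pow)

lemma coeffs_in_division:
  assumes "coeffs_in p" "coeffs_in g" "g \<noteq> 0"
  obtains a r where "coeffs_in a" "coeffs_in r" "p = a * g + r" "r = 0 \<or> Polynomial.degree r < Polynomial.degree g"
  using assms(1)
proof (induction "Polynomial.degree p" arbitrary: p thesis rule: less_induct)
  case less
  show ?case
  proof (cases "p = 0 \<or> Polynomial.degree p < Polynomial.degree g")
    case True
    then show ?thesis using less.prems(1)[of 0 p] less.prems(2) coeffs_in_0 by auto
  next
    case False
    define n where "n = Polynomial.degree p - Polynomial.degree g"
    define c where "c = Polynomial.lead_coeff p / Polynomial.lead_coeff g"
    define p' where "p' = p - Polynomial.monom c n * g"
    have c: "c \<in> M" using less.prems(2) assms(2) by (auto simp: c_def intro!: divide coeffs_inD)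
    have p'M: "coeffs_in p'"
      unfolding p'_def by (intro coeffs_in_diff coeffs_in_mult coeffs_in_monom less.prems(2) assms(2) c)
    have p0: "p \<noteq> 0" and le: "Polynomial.degree g \<le> Polynomial.degree p" using False by auto
    have c0: "c \<noteq> 0" using p0 assms(3) by (simp add: c_def)
    have dm: "Polynomial.degree (Polynomial.monom c n * g) = Polynomial.degree p"
      using c0 assms(3) le by (subst degree_mult_eq) (auto simp: degree_monom_eq n_def)
    have lm: "coeff (Polynomial.monom c n * g) (Polynomial.degree p) = coeff p (Polynomial.degree p)"
      using lead_coeff_mult[of "Polynomial.monom c n" g] c0 assms(3) unfolding dm
      by (simp add: c_def degree_monom_eq)
    have "p' = 0 \<or> Polynomial.degree p' < Polynomial.degree p"
    proof (cases "Polynomial.degree p = 0")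
      case True
      have "Polynomial.degree p' \<le> 0" unfolding p'_def using dm True by (intro degree_diff_le) auto
      moreover have "coeff p' 0 = 0" using lm True by (simp add: p'_def)
      ultimately show ?thesis by (metis le_0_eq leading_coeff_0_iff)
    next
      case False
      have "coeff p' (Polynomial.degree p) = 0" using lm by (simp add: p'_def)
      moreover have "Polynomial.degree p' \<le> Polynomial.degree p"
        unfolding p'_def using dm by (intro degree_diff_le) auto
      ultimately show ?thesis by (metis le_neq_implies_less leading_coeff_0_iff)
    qed
    then obtain a r where "coeffs_in a" "coeffs_in r" "p' = a * g + r"
        "r = 0 \<or> Polynomial.degree r < Polynomial.degree g"
    proof
      assume "p' = 0"
      then show ?thesis using that[of 0 0] coeffs_in_0 by simp
    qed (use less.hyps p'M that in blast)
    then show ?thesis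
      using less.prems(1)[of "a + Polynomial.monom c n" r] c
      by (auto simp: p'_def algebra_simps intro: coeffs_in_add coeffs_in_monom)
  qed
qed

lemma minimal_polynomial:
  assumes "coeffs_in F" "F \<noteq> 0" "poly F x = 0"
  obtains g where "coeffs_in g" "Polynomial.lead_coeff g = 1" "poly g x = 0"
    "\<And>p. coeffs_in p \<Longrightarrow> poly p x = 0 \<Longrightarrow> \<exists>a. coeffs_in a \<and> p = a * g"
proof -
  define D where "D = {p. coeffs_in p \<and> p \<noteq> 0 \<and> poly p x = 0}"
  have "F \<in> D" using assms by (simp add: D_def)
  then obtain h where h: "h \<in> D" "\<And>p. p \<in> D \<Longrightarrow> Polynomial.degree h \<le> Polynomial.degree p"
    using ex_has_least_nat[of "\<lambda>p. p \<in> D" F Polynomial.degree] by blast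
  define g where "g = smult (inverse (Polynomial.lead_coeff h)) h"
  have hD: "coeffs_in h" "h \<noteq> 0" "poly h x = 0" using h by (auto simp: D_def)
  have g: "coeffs_in g" "Polynomial.lead_coeff g = 1" "poly g x = 0" "g \<noteq> 0"
    using hD by (auto simp: g_def intro!: coeffs_in_smult inv coeffs_inD)
  have dg: "Polynomial.degree g = Polynomial.degree h" using hD by (simp add: g_def)
  have "\<exists>a. coeffs_in a \<and> p = a * g" if p: "coeffs_in p" "poly p x = 0" for p
  proof -
    obtain a r where ar: "coeffs_in a" "coeffs_in r" "p = a * g + r"
        "r = 0 \<or> Polynomial.degree r < Polynomial.degree g"
      using coeffs_in_division[OF p(1) g(1,4)] by metis
    have "poly r x = 0" using p(2) ar(3) g(3) by simp
    then have "r = 0" using ar(2,4) h(2)[of r] dg by (cases "r = 0") (auto simp: D_def)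
    then show ?thesis using ar by auto
  qed
  then show ?thesis using that g by blast
qed

text \<open>Inverses are the point. For \<open>y = p(x)\<close> nonzero, let \<open>d\<close>
  generate the ideal \<open>D\<close> of \<open>p\<close> and \<open>g\<close>. It divides
  \<open>p\<close>, so it does not vanish at \<open>x\<close>, and minimality of \<open>g\<close>
  forces \<open>d\<close> to be constant. Evaluating its Bezout representation at \<open>x\<close>
  inverts \<open>y\<close>.\<close>

lemma adjoin_subfield:
  assumes g: "coeffs_in g" "Polynomial.lead_coeff g = 1" "poly g x = 0"
    and gm: "\<And>p. coeffs_in p \<Longrightarrow> poly p x = 0 \<Longrightarrow> \<exists>a. coeffs_in a \<and> p = a * g"
  shows "subfield_set {poly p x | p. coeffs_in p}"
proof
  let ?N = "{poly p x | p. coeffs_in p}"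
  show "0 \<in> ?N" using coeffs_in_0 by (force intro: exI[of _ 0])
  show "1 \<in> ?N" using coeffs_in_1 by (force intro: exI[of _ 1])
  fix y assume "y \<in> ?N"
  then obtain p where p: "y = poly p x" "coeffs_in p" by auto
  have "- y = poly (0 - p) x" "coeffs_in (0 - p)" using p coeffs_in_diff coeffs_in_0 by (simp, blast)
  then show "- y \<in> ?N" by blast
  show "inverse y \<in> ?N"
  proof (cases "y = 0")
    case True
    then show ?thesis using coeffs_in_0 by (force intro: exI[of _ 0])
  next
    case False
    define D where "D = {a * p + b * g | a b. coeffs_in a \<and> coeffs_in b}"
    have Dmult: "u * d \<in> D" if du: "d \<in> D" "coeffs_in u" for d u
    proof -
      obtain a b where "d = a * p + b * g" "coeffs_in a" "coeffs_in b" using du by (auto simp: D_def)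
      then have "u * d = (u * a) * p + (u * b) * g" "coeffs_in (u * a)" "coeffs_in (u * b)"
        using du by (auto simp: algebra_simps intro: coeffs_in_mult)
      then show ?thesis unfolding D_def by blast
    qed
    have Ddiff: "d - e \<in> D" if de: "d \<in> D" "e \<in> D" for d e
    proof -
      obtain a b a' b' where "d = a * p + b * g" "coeffs_in a" "coeffs_in b" "e = a' * p + b' * g" "coeffs_in a'" "coeffs_in b'"
        using de by (auto simp: D_def)
      then have "d - e = (a - a') * p + (b - b') * g" "coeffs_in (a - a')" "coeffs_in (b - b')"
        by (auto simp: algebra_simps intro: coeffs_in_diff)
      then show ?thesis unfolding D_def by blast
    qed
    have Dover: "d \<in> D \<Longrightarrow> coeffs_in d" for d
      using p(2) g(1) by (auto simp: D_def intro!: coeffs_in_add coeffs_in_mult)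
    have pD: "p \<in> D" and gD: "g \<in> D"
      using coeffs_in_0 coeffs_in_1 by (force simp: D_def intro: exI[of _ 0] exI[of _ 1])+
    have g0: "g \<noteq> 0" using g(2) by auto
    then obtain d where d: "d \<in> D" "d \<noteq> 0"
        "\<And>e. e \<in> D \<Longrightarrow> e \<noteq> 0 \<Longrightarrow> Polynomial.degree d \<le> Polynomial.degree e"
      using ex_has_least_nat[of "\<lambda>d. d \<in> D \<and> d \<noteq> 0" g Polynomial.degree] gD by blast
    have div: "\<exists>a. coeffs_in a \<and> e = a * d" if e: "e \<in> D" for e
    proof -
      obtain a r where ar: "coeffs_in a" "coeffs_in r" "e = a * d + r"
          "r = 0 \<or> Polynomial.degree r < Polynomial.degree d"
        using coeffs_in_division[OF Dover[OF e] Dover[OF d(1)] d(2)] by metis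
      have "e - a * d \<in> D" using Ddiff Dmult e d(1) ar(1) by blast
      then have "r \<in> D" using ar(3) by simp
      then have "r = 0" using ar(4) d(3)[of r] by (cases "r = 0") auto
      then show ?thesis using ar by auto
    qed
    obtain u where u: "coeffs_in u" "p = u * d" using div[OF pD] by blast
    obtain v where v: "coeffs_in v" "g = v * d" using div[OF gD] by blast
    have dx: "poly d x \<noteq> 0" using False p(1) u(2) by auto
    then have "poly v x = 0" using g(3) v(2) by simp
    then obtain w where w: "v = w * g" using gm[OF v(1)] by blast
    \<comment> \<open>Both \<open>g = v * d\<close> and \<open>v = w * g\<close> hold, so
      \<open>d\<close> is a unit.\<close>
    have "w * d = 1" using v(2) g0 unfolding w by (metis mult.assoc mult.commute mult_cancel_left mult_1_right)
    then have "Polynomial.degree d = 0"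
      by (metis degree_mult_eq_0 one_neq_zero mult_zero_left Polynomial.degree_1 add_is_0 d(2) degree_mult_eq)
    then obtain c where c: "d = [:c:]" by (metis degree_eq_zeroE)
    obtain a b where ab: "d = a * p + b * g" "coeffs_in a" "coeffs_in b" using d(1) by (auto simp: D_def)
    have "c = poly a x * y" using arg_cong[OF ab(1), of "\<lambda>p. poly p x"] c g(3) p(1) by simp
    moreover have "c \<noteq> 0" using c d(2) by auto
    ultimately have "inverse y = poly (smult (inverse c) a) x" using False by (simp add: field_simps)
    moreover have "c \<in> M" using coeffs_inD[OF Dover[OF d(1)], of 0] c by simp
    ultimately show ?thesis using coeffs_in_smult[OF inv ab(2)] by blast
  qed
  fix z assume "z \<in> ?N"
  then obtain r where r: "z = poly r x" "coeffs_in r" by auto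
  have "y + z = poly (p + r) x" "coeffs_in (p + r)" using p r coeffs_in_add by (simp, blast)
  then show "y + z \<in> ?N" by blast
  have "y * z = poly (p * r) x" "coeffs_in (p * r)" using p r coeffs_in_mult by (simp, blast)
  then show "y * z \<in> ?N" by blast
qed

end

text \<open>\<open>\<sigma>\<close> is a total function constrained only on \<open>M\<close>, so
  that embeddings with growing domains share one type.\<close>

locale subfield_embedding = subfield_set M for M :: "'a :: field set" +
  fixes \<sigma> :: "'a \<Rightarrow> 'b :: field"
  assumes hom_one: "\<sigma> 1 = 1"
    and hom_add: "x \<in> M \<Longrightarrow> y \<in> M \<Longrightarrow> \<sigma> (x + y) = \<sigma> x + \<sigma> y"
    and hom_mult: "x \<in> M \<Longrightarrow> y \<in> M \<Longrightarrow> \<sigma> (x * y) = \<sigma> x * \<sigma> y"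
begin

lemma hom_zero: "\<sigma> 0 = 0"
  using hom_add[OF zero zero] by (metis add.right_neutral add_cancel_right_right)

lemma hom_uminus: "x \<in> M \<Longrightarrow> \<sigma> (- x) = - \<sigma> x"
  using hom_add[of x "- x"] uminus hom_zero by (simp add: eq_neg_iff_add_eq_0 add.commute)

lemma hom_diff: "x \<in> M \<Longrightarrow> y \<in> M \<Longrightarrow> \<sigma> (x - y) = \<sigma> x - \<sigma> y"
  using hom_add[of x "- y"] hom_uminus uminus by simp

lemma hom_sum: "(\<And>i. i \<in> B \<Longrightarrow> f i \<in> M) \<Longrightarrow> \<sigma> (sum f B) = (\<Sum>i\<in>B. \<sigma> (f i))"
  by (induction B rule: infinite_finite_induct) (auto simp: hom_zero hom_add sum)

lemma hom_pow: "x \<in> M \<Longrightarrow> \<sigma> (x ^ n) = \<sigma> x ^ n"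
  by (induction n) (auto simp: hom_one hom_mult pow)

lemma hom_inverse:
  assumes "x \<in> M"
  shows "\<sigma> (inverse x) = inverse (\<sigma> x)"
proof (cases "x = 0")
  case False
  then have "\<sigma> x * \<sigma> (inverse x) = 1"
    using hom_mult[OF assms inv[OF assms]] hom_one by simp
  then show ?thesis by (metis inverse_unique)
qed (simp add: hom_zero)

lemma hom_eq_0_iff: "x \<in> M \<Longrightarrow> \<sigma> x = 0 \<longleftrightarrow> x = 0"
proof
  assume "x \<in> M" "\<sigma> x = 0"
  then show "x = 0" using hom_mult[of x "inverse x"] inv hom_one by (metis mult_zero_left right_inverse zero_neq_one)
qed (simp add: hom_zero)

lemma hom_inj: "inj_on \<sigma> M"
  by (rule inj_onI) (metis hom_diff hom_eq_0_iff diff eq_iff_diff_eq_0)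

lemma hom_of_int: "\<sigma> (of_int k) = of_int k"
proof -
  have mem: "of_nat n \<in> M" for n using of_int_mem[of "int n"] by simp
  have nat: "\<sigma> (of_nat n) = of_nat n" for n
    by (induction n) (auto simp: hom_zero hom_add hom_one one mem)
  show ?thesis
  proof (cases k)
    case (neg n)
    then have "of_int k = - (of_nat (Suc n) :: 'a)" "of_int k = - (of_nat (Suc n) :: 'b)" by auto
    then show ?thesis using hom_uminus[OF mem, of "Suc n"] nat[of "Suc n"] by metis
  qed (simp add: nat)
qed

lemma coeff_map: "coeff (map_poly \<sigma> p) i = \<sigma> (coeff p i)"
  by (simp add: coeff_map_poly hom_zero)

lemma map_add: "coeffs_in p \<Longrightarrow> coeffs_in r \<Longrightarrow> map_poly \<sigma> (p + r) = map_poly \<sigma> p + map_poly \<sigma> r"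
  by (intro poly_eqI) (simp add: coeff_map hom_add coeffs_inD)

lemma map_diff: "coeffs_in p \<Longrightarrow> coeffs_in r \<Longrightarrow> map_poly \<sigma> (p - r) = map_poly \<sigma> p - map_poly \<sigma> r"
  by (intro poly_eqI) (simp add: coeff_map hom_diff coeffs_inD)

lemma map_mult: "coeffs_in p \<Longrightarrow> coeffs_in r \<Longrightarrow> map_poly \<sigma> (p * r) = map_poly \<sigma> p * map_poly \<sigma> r"
  by (intro poly_eqI) (simp add: coeff_map coeff_mult hom_sum hom_mult coeffs_inD mult)

lemma degree_map: "coeffs_in p \<Longrightarrow> Polynomial.degree (map_poly \<sigma> p) = Polynomial.degree p"
  by (metis degree_map_poly hom_eq_0_iff coeffs_inD leading_coeff_0_iff map_poly_0 Polynomial.degree_0)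

lemma hom_poly:
  assumes "coeffs_in p" "x \<in> M"
  shows "\<sigma> (poly p x) = poly (map_poly \<sigma> p) (\<sigma> x)"
  using assms by (simp add: poly_altdef degree_map coeff_map hom_sum hom_mult hom_pow coeffs_inD mult pow)

text \<open>Two polynomials with the same value at \<open>x\<close> differ by a multiple of
  \<open>g\<close>, and the image of \<open>g\<close> under \<sigma> vanishes at \<open>y\<close>;
  hence sending \<open>x\<close> to \<open>y\<close> is well defined.\<close>

lemma extend_simple:
  assumes g: "coeffs_in g" "Polynomial.lead_coeff g = 1" "poly g x = 0"
    and gm: "\<And>p. coeffs_in p \<Longrightarrow> poly p x = 0 \<Longrightarrow> \<exists>a. coeffs_in a \<and> p = a * g"
    and y: "poly (map_poly \<sigma> g) y = 0"
  obtains \<tau> where "subfield_embedding {poly p x | p. coeffs_in p} \<tau>"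
    "\<And>p. coeffs_in p \<Longrightarrow> \<tau> (poly p x) = poly (map_poly \<sigma> p) y"
proof -
  define \<tau> where "\<tau> z = poly (map_poly \<sigma> (SOME p. coeffs_in p \<and> poly p x = z)) y" for z
  have \<tau>: "\<tau> (poly p x) = poly (map_poly \<sigma> p) y" if p: "coeffs_in p" for p
  proof -
    define r where "r = (SOME r. coeffs_in r \<and> poly r x = poly p x)"
    have r: "coeffs_in r" "poly r x = poly p x"
      using someI[of "\<lambda>r. coeffs_in r \<and> poly r x = poly p x" p] p by (auto simp: r_def)
    then obtain a where a: "coeffs_in a" "r - p = a * g"
      using gm[OF coeffs_in_diff[OF r(1) p]] by auto
    have "map_poly \<sigma> r - map_poly \<sigma> p = map_poly \<sigma> a * map_poly \<sigma> g"
      using a r(1) p g(1) by (metis map_diff map_mult)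
    from arg_cong[OF this, of "\<lambda>p. poly p y"] show ?thesis
      using y by (simp add: \<tau>_def r_def)
  qed
  interpret N: subfield_set "{poly p x | p. coeffs_in p}" by (rule adjoin_subfield[OF g gm])
  have "subfield_embedding {poly p x | p. coeffs_in p} \<tau>"
  proof
    have "map_poly \<sigma> 1 = 1" by (intro poly_eqI) (simp add: coeff_map hom_one hom_zero)
    then show "\<tau> 1 = 1" using \<tau>[OF coeffs_in_1] by simp
    fix u v assume "u \<in> {poly p x | p. coeffs_in p}" "v \<in> {poly p x | p. coeffs_in p}"
    then obtain p r where pr: "u = poly p x" "coeffs_in p" "v = poly r x" "coeffs_in r" by auto
    show "\<tau> (u + v) = \<tau> u + \<tau> v"
      using \<tau>[OF coeffs_in_add[OF pr(2,4)]] \<tau>[OF pr(2)] \<tau>[OF pr(4)] pr by (simp add: map_add)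
    show "\<tau> (u * v) = \<tau> u * \<tau> v"
      using \<tau>[OF coeffs_in_mult[OF pr(2,4)]] \<tau>[OF pr(2)] \<tau>[OF pr(4)] pr by (simp add: map_mult)
  qed
  then show ?thesis using that \<tau> by blast
qed

end

lemma (in subfield_embedding) hom_algebraic_int:
  fixes z :: 'a
  assumes "z \<in> M" "algebraic_int z"
  shows "algebraic_int (\<sigma> z)"
proof -
  obtain p where p: "Polynomial.lead_coeff p = 1" "\<forall>i. coeff p i \<in> \<int>" "poly p z = 0"
    using assms(2) by (auto elim: algebraic_int.cases)
  have fix_int: "c \<in> M \<and> \<sigma> c \<in> \<int>" if "c \<in> \<int>" for c
    using that of_int_mem hom_of_int by (auto elim!: Ints_cases)
  have o: "coeffs_in p" using p fix_int by (auto simp: coeffs_in_def)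
  show ?thesis
  proof (rule algebraic_int.intros)
    show "Polynomial.lead_coeff (map_poly \<sigma> p) = 1"
      using p(1) by (simp add: degree_map[OF o] coeff_map hom_one)
    show "\<forall>i. coeff (map_poly \<sigma> p) i \<in> \<int>" using fix_int p by (simp add: coeff_map)
    show "poly (map_poly \<sigma> p) (\<sigma> z) = 0" using hom_poly[OF o assms(1)] p(3) hom_zero by simp
  qed
qed

section \<open>Monic factors of separable polynomials, and interpolation at their roots\<close>

lemma monic_eq_prod_roots:
  fixes g :: "'a :: field poly"
  assumes "Polynomial.lead_coeff g = 1" "finite Y" "\<And>z. z \<in> Y \<Longrightarrow> poly g z = 0"
    "card Y = Polynomial.degree g"
  shows "g = (\<Prod>z\<in>Y. [:- z, 1:])"
proof (rule ccontr)
  define r where "r = (\<Prod>z\<in>Y. [:- z, 1:])"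
  assume "g \<noteq> (\<Prod>z\<in>Y. [:- z, 1:])"
  then have ne: "g - r \<noteq> 0" by (simp add: r_def)
  have dr: "Polynomial.degree r = card Y"
    unfolding r_def by (subst degree_prod_eq_sum_degree) auto
  have lr: "coeff r (card Y) = 1"
    using lead_coeff_prod[of "\<lambda>s. [:- s, 1:]" Y] unfolding r_def[symmetric] dr by simp
  have "coeff (g - r) j = 0" if "j \<ge> card Y" for j
  proof (cases "j = card Y")
    case True
    then show ?thesis using lr assms(1,4) by simp
  next
    case False
    then show ?thesis using that dr assms(4) by (simp add: coeff_eq_0)
  qed
  then have "Polynomial.degree (g - r) < card Y"
    using ne by (metis le_degree leading_coeff_0_iff linorder_not_le)
  moreover have "Y \<subseteq> {x. poly (g - r) x = 0}"
    using assms(2,3) by (auto simp: r_def poly_prod)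
  then have "card Y \<le> card {x. poly (g - r) x = 0}"
    using poly_roots_finite[OF ne] by (intro card_mono) auto
  ultimately show False using card_poly_roots_bound[OF ne] by simp
qed

text \<open>Counting: \<open>g\<close> and \<open>h\<close> have at most as many roots as their
  degrees, and together they must account for all of \<open>Z\<close>, whose size is the sum of the
  degrees.\<close>

lemma monic_factor_of_separable:
  fixes F g h :: "'a :: field poly"
  assumes Z: "finite Z" and F: "F = (\<Prod>z\<in>Z. [:- z, 1:])" "F = h * g" and g: "Polynomial.lead_coeff g = 1"
  defines "Y \<equiv> {z\<in>Z. poly g z = 0}"
  shows "g = (\<Prod>z\<in>Y. [:- z, 1:])" "card Y = Polynomial.degree g"
proof -
  have F0: "F \<noteq> 0" using Z F(1) by simp
  then have gh: "g \<noteq> 0" "h \<noteq> 0" using F(2) by auto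
  have "card Z = Polynomial.degree F"
    unfolding F(1) by (subst degree_prod_eq_sum_degree) auto
  also have "\<dots> = Polynomial.degree h + Polynomial.degree g"
    using F(2) gh by (simp add: degree_mult_eq)
  finally have c: "card Z = Polynomial.degree h + Polynomial.degree g" .
  have root: "poly F z = 0" if "z \<in> Z" for z using that Z by (auto simp: F(1) poly_prod)
  have "Z = Y \<union> {z\<in>Z. poly h z = 0}" using root F(2) by (auto simp: Y_def)
  then have "card Z \<le> card Y + card {z\<in>Z. poly h z = 0}" by (metis card_Un_le)
  moreover have "card Y \<le> Polynomial.degree g"
    using card_mono[OF poly_roots_finite[OF gh(1)], of Y] card_poly_roots_bound[OF gh(1)]
    by (auto simp: Y_def intro: le_trans)
  moreover have "card {z\<in>Z. poly h z = 0} \<le> Polynomial.degree h"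
    using card_mono[OF poly_roots_finite[OF gh(2)], of "{z\<in>Z. poly h z = 0}"]
      card_poly_roots_bound[OF gh(2)] by (auto intro: le_trans)
  ultimately show *: "card Y = Polynomial.degree g" using c by simp
  show "g = (\<Prod>z\<in>Y. [:- z, 1:])"
    using Z by (intro monic_eq_prod_roots[OF g _ _ *]) (auto simp: Y_def)
qed

text \<open>Lagrange interpolation of \<open>R\<close> at the points of \<open>Y\<close>: the
  denominator at \<open>z\<close> is the product of \<open>z - w\<close> over the other
  \<open>w\<close> in \<open>Y\<close>, and it divides the full product of differences with the
  integral cofactor \<open>e z\<close>.\<close>

lemma lagrange_integral:
  fixes R :: "'a :: field_char_0 poly"
  assumes Z: "finite Z" "\<And>z. z \<in> Z \<Longrightarrow> algebraic_int z" and Y: "Y \<subseteq> Z"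
    and R: "Polynomial.degree R < card Y" "\<And>z. z \<in> Y \<Longrightarrow> algebraic_int (poly R z)"
  shows "algebraic_int (coeff (smult (\<Prod>z\<in>Z. \<Prod>w\<in>Z - {z}. z - w) R) i)"
proof -
  define D where "D = (\<Prod>z\<in>Z. \<Prod>w\<in>Z - {z}. z - w)"
  have finY: "finite Y" using Z Y finite_subset by blast
  define e where "e z = (\<Prod>w\<in>Z - Y. z - w) * (\<Prod>u\<in>Z - {z}. \<Prod>w\<in>Z - {u}. u - w)" for z
  have e: "D = e z * (\<Prod>w\<in>Y - {z}. z - w)" if "z \<in> Y" for z
  proof -
    have "D = (\<Prod>w\<in>Z - {z}. z - w) * (\<Prod>u\<in>Z - {z}. \<Prod>w\<in>Z - {u}. u - w)"
      unfolding D_def using that Y Z by (subst prod.remove[of Z z]) auto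
    moreover have Zz: "Z - {z} = (Y - {z}) \<union> (Z - Y)" using that Y by auto
    have "(\<Prod>w\<in>Z - {z}. z - w) = (\<Prod>w\<in>Y - {z}. z - w) * (\<Prod>w\<in>Z - Y. z - w)"
      unfolding Zz by (rule prod.union_disjoint) (use Z finY in auto)
    ultimately show ?thesis by (simp add: e_def mult_ac)
  qed
  have eint: "algebraic_int (e z)" if "z \<in> Y" for z
    unfolding e_def using Z(2) Y that
    by (intro algebraic_int_times algebraic_int_prod algebraic_int_diff) auto
  define l where "l z = (\<Prod>w\<in>Y - {z}. [:- w, 1:])" for z
  have "smult D R = (\<Sum>z\<in>Y. smult (poly R z * e z) (l z))"
  proof (rule poly_eqI_degree[of Y])
    show "Polynomial.degree (smult D R) < card Y"
      using R(1) by (meson degree_smult_le le_less_trans)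
    have "Polynomial.degree (smult (poly R z * e z) (l z)) < card Y" if "z \<in> Y" for z
    proof -
      have "Polynomial.degree (l z) = card (Y - {z})"
        unfolding l_def by (subst degree_prod_eq_sum_degree) auto
      also have "\<dots> < card Y" using that finY by (rule card_Diff1_less[rotated])
      finally show ?thesis by (meson degree_smult_le le_less_trans)
    qed
    then show "Polynomial.degree (\<Sum>z\<in>Y. smult (poly R z * e z) (l z)) < card Y"
      using R(1) by (intro degree_sum_less) auto
    fix x assume x: "x \<in> Y"
    have "poly (l z) x = 0" if "z \<noteq> x" for z
      using that x finY by (auto simp: l_def poly_prod)
    then have "poly (\<Sum>z\<in>Y. smult (poly R z * e z) (l z)) x =
        (\<Sum>z\<in>Y. if z = x then poly R x * e x * poly (l x) x else 0)"
      unfolding poly_sum poly_smult by (intro sum.cong) auto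
    also have "\<dots> = poly R x * (e x * (\<Prod>w\<in>Y - {x}. x - w))"
      using x finY by (simp add: l_def poly_prod)
    also have "\<dots> = poly R x * D" using e[OF x] by simp
    finally show "poly (smult D R) x = poly (\<Sum>z\<in>Y. smult (poly R z * e z) (l z)) x" by simp
  qed
  moreover have "algebraic_int (coeff (l z) j)" for z j
    unfolding l_def using Z(2) Y by (intro algebraic_int_coeff_prod algebraic_int_linear_coeff) auto
  ultimately show ?thesis
    using R(2) eint unfolding D_def[symmetric]
    by (auto simp: coeff_sum intro!: algebraic_int_sum algebraic_int_times)
qed

lemma (in subfield_set) coeffs_in_pcompose: "coeffs_in p \<Longrightarrow> coeffs_in r \<Longrightarrow> coeffs_in (pcompose p r)"
proof (induction p)
  case (pCons a p)
  have "coeffs_in p" using coeffs_inD[OF pCons.prems(1), of "Suc _"] by (simp add: coeffs_in_def)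
  moreover have "a \<in> M" using coeffs_inD[OF pCons.prems(1), of 0] by simp
  ultimately show ?case
    using pCons by (simp add: pcompose_pCons coeffs_in_add coeffs_in_mult coeffs_in_const)
qed (simp add: coeffs_in_0)

section \<open>Extending the Frobenius congruence to a splitting field\<close>

context residue_prime
begin

text \<open>Elements of \<open>M(\<alpha>)\<close> that are algebraic integers need not be integral polynomials in \<open>\<alpha>\<close>.
  Lagrange interpolation shows that their denominators divide the product \<open>D\<close> of the differences of
  the roots, which is invertible modulo \<open>Q\<close>.\<close>

lemma frobenius_extend:
  assumes emb: "subfield_embedding M \<sigma>"
    and frob: "\<And>a. a \<in> M \<Longrightarrow> algebraic_int a \<Longrightarrow> \<sigma> a - a ^ q \<in> Q"
    and Z: "finite Z" "\<And>z. z \<in> Z \<Longrightarrow> algebraic_int z"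
    and F: "F = (\<Prod>z\<in>Z. [:- z, 1:])" "\<And>i. coeff F i \<in> M"
    and D: "D = (\<Prod>z\<in>Z. \<Prod>w\<in>Z - {z}. z - w)" "D \<in> A" "D \<in> M" "\<sigma> D = D" "D \<notin> Q"
    and \<alpha>: "\<alpha> \<in> Z"
  obtains N \<tau> where "subfield_embedding N \<tau>" "M \<subseteq> N" "\<alpha> \<in> N" "\<And>x. x \<in> M \<Longrightarrow> \<tau> x = \<sigma> x"
    "\<And>a. a \<in> N \<Longrightarrow> algebraic_int a \<Longrightarrow> \<tau> a - a ^ q \<in> Q"
proof -
  interpret E: subfield_embedding M \<sigma> by (rule emb)
  have q0: "(0 :: 'a) ^ q = 0" using q_ge2 by simp
  have aint: "algebraic_int \<alpha>" using Z(2) \<alpha> by blast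
  have FM: "E.coeffs_in F" using F(2) by (simp add: E.coeffs_in_def)
  have F0: "F \<noteq> 0" "poly F \<alpha> = 0" using Z(1) \<alpha> by (auto simp: F(1) poly_prod)
  obtain g where g: "E.coeffs_in g" "Polynomial.lead_coeff g = 1" "poly g \<alpha> = 0"
    and gm: "\<And>p. E.coeffs_in p \<Longrightarrow> poly p \<alpha> = 0 \<Longrightarrow> \<exists>a. E.coeffs_in a \<and> p = a * g"
    using E.minimal_polynomial[OF FM F0] by metis
  obtain h where h: "F = h * g" using gm[OF FM F0(2)] by blast
  define Y where "Y = {z\<in>Z. poly g z = 0}"
  have gY: "g = (\<Prod>z\<in>Y. [:- z, 1:])" "card Y = Polynomial.degree g"
    using monic_factor_of_separable[OF Z(1) F(1) h g(2)] by (simp_all add: Y_def)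
  have gint: "algebraic_int (coeff g i)" for i
    unfolding gY(1) using Z(2) by (intro algebraic_int_coeff_prod algebraic_int_linear_coeff) (auto simp: Y_def)
  have sg: "Polynomial.lead_coeff (map_poly \<sigma> g) = 1"
    using g(2) by (simp add: E.degree_map[OF g(1)] E.coeff_map E.hom_one)
  have pow_poly: "poly p \<alpha> ^ q - poly (map_poly \<sigma> p) y \<in> Q"
    if p: "E.coeffs_in p" "\<And>i. algebraic_int (coeff p i)" and y: "\<alpha> ^ q - y \<in> Q" "algebraic_int y" for p y
  proof -
    have "poly (map_poly (\<lambda>c. c ^ q) p) (\<alpha> ^ q) - poly (map_poly \<sigma> p) y \<in> Q"
    proof (rule cong_poly)
      fix i
      show "coeff (map_poly (\<lambda>c. c ^ q) p) i - coeff (map_poly \<sigma> p) i \<in> Q"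
        using cong_sym[OF frob[OF E.coeffs_inD[OF p(1)] p(2)]]
        by (simp add: E.coeff_map coeff_map_poly q0)
      show "algebraic_int (coeff (map_poly \<sigma> p) i)"
        using E.hom_algebraic_int[OF E.coeffs_inD[OF p(1)] p(2)] by (simp add: E.coeff_map)
    qed (use y in auto)
    then show ?thesis using frob_poly[OF p(2) aint] cong_trans by blast
  qed
  \<comment> \<open>Frobenius applied to the equation \<open>g\<close> of \<alpha> makes
    \<open>\<alpha> ^ q\<close> a root of the conjugate polynomial modulo \<open>Q\<close>, hence
    congruent to one of its true roots \<open>b\<close>; that \<open>b\<close> becomes the image of
    \<alpha>.\<close>
  have *: "poly (map_poly \<sigma> g) (\<alpha> ^ q) \<in> Q"
    using pow_poly[OF g(1) gint, of "\<alpha> ^ q"] algebraic_int_pow[OF aint, of q] g(3) q0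
      uminus_mem[of "- poly (map_poly \<sigma> g) (\<alpha> ^ q)"] by (simp add: zero_mem)
  obtain B where B: "map_poly \<sigma> g = (\<Prod>b\<in>#B. [:- b, 1:])"
  proof -
    have "map_poly \<sigma> g \<noteq> 0" using sg by auto
    from alg_closed_imp_factorization[OF this] show ?thesis
      using that sg by (metis smult_1_left)
  qed
  have Broot: "poly (map_poly \<sigma> g) b = 0" if "b \<in># B" for b
    using that unfolding B poly_prod_mset_linear by (auto simp: prod_mset_zero_iff)
  have Bint: "algebraic_int b" if "b \<in># B" for b
  proof (rule algebraic_int_monic_root[OF sg _ Broot[OF that]])
    fix i show "algebraic_int (coeff (map_poly \<sigma> g) i)"
      unfolding E.coeff_map by (rule E.hom_algebraic_int[OF E.coeffs_inD[OF g(1)] gint])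
  qed
  obtain b where b: "b \<in># B" "\<alpha> ^ q - b \<in> Q"
  proof (rule prod_mset_memE)
    show "(\<Prod>b\<in>#B. \<alpha> ^ q - b) \<in> Q" using * unfolding B poly_prod_mset_linear .
  qed (use Bint aint in \<open>auto intro: algebraic_int_diff algebraic_int_pow\<close>)
  define N where "N = {poly p \<alpha> | p. E.coeffs_in p}"
  obtain \<tau> where \<tau>: "subfield_embedding N \<tau>"
    "\<And>p. E.coeffs_in p \<Longrightarrow> \<tau> (poly p \<alpha>) = poly (map_poly \<sigma> p) b"
    unfolding N_def by (rule E.extend_simple[OF g gm Broot[OF b(1)]]) blast+
  interpret T: subfield_embedding N \<tau> by (rule \<tau>(1))
  have ext: "x \<in> N \<and> \<tau> x = \<sigma> x" if x: "x \<in> M" for x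
  proof -
    have "x = poly [:x:] \<alpha>" "E.coeffs_in [:x:]" using E.coeffs_in_const[OF x] by auto
    moreover have "map_poly \<sigma> [:x:] = [:\<sigma> x:]" by (intro poly_eqI) (simp add: E.coeff_map coeff_pCons E.hom_zero split: nat.split)
    ultimately show ?thesis using \<tau>(2)[of "[:x:]"] unfolding N_def by force
  qed
  have aN: "\<alpha> \<in> N" using E.coeffs_in_X unfolding N_def by (force intro: exI[of _ "[:0, 1:]"])
  have "\<tau> y - y ^ q \<in> Q" if y: "y \<in> N" "algebraic_int y" for y
  proof -
    obtain R0 where R0: "y = poly R0 \<alpha>" "E.coeffs_in R0" using y(1) by (auto simp: N_def)
    have g0: "g \<noteq> 0" using g(2) by auto
    \<comment> \<open>Reducing modulo \<open>g\<close> brings the degree below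
      \<open>card Y\<close>, as interpolation requires.\<close>
    obtain a R where R: "E.coeffs_in R" "R0 = a * g + R" "R = 0 \<or> Polynomial.degree R < Polynomial.degree g"
      using E.coeffs_in_division[OF R0(2) g(1) g0] by metis
    have yR: "y = poly R \<alpha>" using R0 R(2) g(3) by simp
    have "Y \<noteq> {}" using \<alpha> g(3) by (auto simp: Y_def)
    then have "card Y > 0" using Z(1) by (simp add: card_gt_0_iff Y_def)
    then have dR: "Polynomial.degree R < card Y" using R(3) gY(2) by auto
    \<comment> \<open>The conjugates of \<open>y\<close> are integral: if \<open>H\<close> is a
      monic integer polynomial with root \<open>y\<close>, then \<open>H(R(X))\<close> vanishes at
      \<alpha>, so it is divisible by \<open>g\<close> and vanishes at each
      \<open>z\<close>.\<close>
    have conj_int: "algebraic_int (poly R z)" if z: "z \<in> Y" for z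
    proof -
      obtain H where H: "Polynomial.lead_coeff H = 1" "\<forall>i. coeff H i \<in> \<int>" "poly H y = 0"
        using y(2) by (auto elim: algebraic_int.cases)
      have "coeff H i \<in> M" for i
      proof -
        obtain k where "coeff H i = of_int k" using H(2) by (meson Ints_cases)
        then show ?thesis using E.of_int_mem by simp
      qed
      then have "E.coeffs_in (pcompose H R)"
        using R(1) by (intro E.coeffs_in_pcompose) (auto simp: E.coeffs_in_def)
      moreover have "poly (pcompose H R) \<alpha> = 0" using H(3) yR by (simp add: poly_pcompose)
      ultimately obtain a where "pcompose H R = a * g" using gm by blast
      then have "poly (pcompose H R) z = 0" using z by (simp add: Y_def)
      then have "poly H (poly R z) = 0" by (simp add: poly_pcompose)
      then show ?thesis using H by (intro algebraic_int.intros)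
    qed
    have DR: "algebraic_int (coeff (smult D R) i)" for i
      unfolding D(1) by (rule lagrange_integral[OF Z _ dR conj_int]) (auto simp: Y_def)
    have DRM: "E.coeffs_in (smult D R)" by (rule E.coeffs_in_smult[OF D(3) R(1)])
    have "poly (smult D R) \<alpha> ^ q - poly (map_poly \<sigma> (smult D R)) b \<in> Q"
      by (rule pow_poly[OF DRM DR b(2) Bint[OF b(1)]])
    then have "(D * y) ^ q - \<tau> (D * y) \<in> Q"
      using \<tau>(2)[OF DRM] yR by simp
    moreover have "\<tau> (D * y) = D * \<tau> y" using T.hom_mult[of D y] ext[OF D(3)] D(4) y(1) by simp
    ultimately have 1: "D ^ q * y ^ q - D * \<tau> y \<in> Q" by (simp add: power_mult_distrib)
    \<comment> \<open>The congruence is now known for \<open>D * y\<close>, whose polynomial has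
      integral coefficients. \<open>D\<close> is fixed by \<sigma>, satisfies Fermat modulo
      \<open>Q\<close> and lies outside \<open>Q\<close>, so it can be cancelled.\<close>
    have "D ^ q * y ^ q - D * y ^ q \<in> Q"
      using fermat_A[OF D(2)] y(2) A_int[OF D(2)]
      by (intro cong_mult) (auto simp: zero_mem intro: algebraic_int_pow)
    then have "D * \<tau> y - D * y ^ q \<in> Q" using cong_trans[OF cong_sym[OF 1]] by blast
    then have "D * (\<tau> y - y ^ q) \<in> Q" by (simp add: algebra_simps)
    then show ?thesis
      using prime[OF A_int[OF D(2)], of "\<tau> y - y ^ q"] D(5) T.hom_algebraic_int[OF y] y(2)
      by (auto intro: algebraic_int_diff algebraic_int_pow)
  qed
  then show ?thesis using that[OF \<tau>(1)] ext aN by blast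
qed

text \<open>The induction starts with the identity on \<open>K\<close>, which is the
  \<open>q\<close>-th power map modulo \<open>Q\<close> by Fermat. The congruence is carried for all
  algebraic integers of the intermediate field, not just for the adjoined roots, because adjoining
  the next root needs it for the coefficients of polynomials over that field.\<close>

theorem frobenius_lift:
  assumes K: "subfield_set K" and KA: "\<And>a. a \<in> K \<Longrightarrow> algebraic_int a \<Longrightarrow> a \<in> A"
    and Z: "finite Z" "\<And>z. z \<in> Z \<Longrightarrow> algebraic_int z"
    and F: "F = (\<Prod>z\<in>Z. [:- z, 1:])" "\<And>i. coeff F i \<in> K"
    and D: "D = (\<Prod>z\<in>Z. \<Prod>w\<in>Z - {z}. z - w)" "D \<in> K" "D \<notin> Q"
  obtains M \<tau> where "subfield_embedding M \<tau>" "K \<subseteq> M" "Z \<subseteq> M" "\<And>x. x \<in> K \<Longrightarrow> \<tau> x = x"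
    "\<And>z. z \<in> Z \<Longrightarrow> \<tau> z - z ^ q \<in> Q"
proof -
  have DA: "D \<in> A"
    using KA[OF D(2)] Z(2) unfolding D(1) by (auto intro!: algebraic_int_prod algebraic_int_diff)
  have "\<exists>M \<tau>. subfield_embedding M \<tau> \<and> K \<subseteq> M \<and> W \<subseteq> M \<and> (\<forall>x\<in>K. \<tau> x = x) \<and>
      (\<forall>a\<in>M. algebraic_int a \<longrightarrow> \<tau> a - a ^ q \<in> Q)" if "finite W" "W \<subseteq> Z" for W
    using that
  proof (induction W rule: finite_induct)
    case empty
    interpret subfield_set K by (rule K)
    have "subfield_embedding K (\<lambda>x. x)" by unfold_locales auto
    moreover have "a - a ^ q \<in> Q" if "a \<in> K" "algebraic_int a" for a
      using fermat_A[OF KA[OF that]] by (rule cong_sym)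
    ultimately show ?case by (intro exI[of _ K] exI[of _ "\<lambda>x. x"]) auto
  next
    case (insert \<alpha> W)
    then obtain M \<sigma> where M: "subfield_embedding M \<sigma>" "K \<subseteq> M" "W \<subseteq> M" "\<forall>x\<in>K. \<sigma> x = x"
      "\<And>a. a \<in> M \<Longrightarrow> algebraic_int a \<Longrightarrow> \<sigma> a - a ^ q \<in> Q" by blast
    have FM: "coeff F i \<in> M" for i using F(2) M(2) by blast
    have \<alpha>: "\<alpha> \<in> Z" and DM: "D \<in> M" "\<sigma> D = D" using insert.prems D(2) M(2,4) by auto
    obtain N \<tau> where "subfield_embedding N \<tau>" "M \<subseteq> N" "\<alpha> \<in> N" "\<And>x. x \<in> M \<Longrightarrow> \<tau> x = \<sigma> x"
      "\<And>a. a \<in> N \<Longrightarrow> algebraic_int a \<Longrightarrow> \<tau> a - a ^ q \<in> Q"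
      using frobenius_extend[OF M(1,5) Z F(1) FM D(1) DA DM D(3) \<alpha>] by metis
    then show ?case using M(2,3,4) by (intro exI[of _ N] exI[of _ \<tau>]) auto
  qed
  from this[OF Z(1) order.refl] obtain M \<tau> where M: "subfield_embedding M \<tau>" "K \<subseteq> M" "Z \<subseteq> M"
      "\<forall>x\<in>K. \<tau> x = x" "\<forall>a\<in>M. algebraic_int a \<longrightarrow> \<tau> a - a ^ q \<in> Q" by blast
  show ?thesis by (rule that[OF M(1,2,3)]) (use M Z(2) in auto)
qed

end

section \<open>Galois groups that contain enough permutations of the roots\<close>

text \<open>Conjugating the one transposition by a group element that carries \<open>(a, b)\<close>
  to \<open>(x, y)\<close> gives every transposition. Such an element exists because transitivity
  together with a transitive stabilizer of \<open>c\<close> is double transitivity.\<close>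

lemma all_permutations_if_2_transitive:
  fixes G :: "('a \<Rightarrow> 'a) set"
  assumes Z: "finite Z" and G: "\<And>p. p \<in> G \<Longrightarrow> p permutes Z"
    and comp: "\<And>p r. p \<in> G \<Longrightarrow> r \<in> G \<Longrightarrow> p \<circ> r \<in> G"
    and inv: "\<And>p. p \<in> G \<Longrightarrow> inv_into UNIV p \<in> G"
    and T: "\<And>x y. x \<in> Z \<Longrightarrow> y \<in> Z \<Longrightarrow> \<exists>p\<in>G. p x = y"
    and S: "c \<in> Z" "\<And>x y. x \<in> Z - {c} \<Longrightarrow> y \<in> Z - {c} \<Longrightarrow> \<exists>p\<in>G. p c = c \<and> p x = y"
    and X: "a \<in> Z" "b \<in> Z" "a \<noteq> b" "Transposition.transpose a b \<in> G"
    and p: "p permutes Z"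
  shows "p \<in> G"
  using p Z
proof (induction rule: permutes_induct)
  case id
  have "inv_into UNIV (Transposition.transpose a b) \<circ> Transposition.transpose a b \<in> G"
    using comp inv X(4) by blast
  then show ?case by (simp add: id_def)
next
  case (swap x y p)
  obtain g h where g: "g \<in> G" "g a = c" and h: "h \<in> G" "h x = c"
    using T[OF X(1) S(1)] T[OF swap(1) S(1)] by blast
  note perm = G[OF g(1)] G[OF h(1)]
  have "g b \<in> Z - {c}" "h y \<in> Z - {c}"
    using perm g(2) h(2) X swap(1-3)
    by (metis DiffI permutes_in_image permutes_inj injD singletonD)+
  then obtain s where s: "s \<in> G" "s c = c" "s (g b) = h y" using S(2) by blast
  \<comment> \<open>\<open>g\<close> moves \<open>a\<close> to \<open>c\<close>; \<open>s\<close>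
    fixes \<open>c\<close> and moves \<open>g b\<close> to \<open>h y\<close>; the inverse of
    \<open>h\<close> moves \<open>c\<close> to \<open>x\<close> and \<open>h y\<close> to
    \<open>y\<close>.\<close>
  define t where "t = inv_into UNIV h \<circ> s \<circ> g"
  have tG: "t \<in> G" unfolding t_def using comp inv g h s by blast
  have tp: "t permutes Z" using G[OF tG] .
  have "t a = x" "t b = y"
    using g h s perm(2) by (auto simp: t_def permutes_inverses)
      (metis perm(2) permutes_inverses(2))+
  then have "t \<circ> Transposition.transpose a b \<circ> inv_into UNIV t = Transposition.transpose x y"
    using tp X(3) by (auto simp: fun_eq_iff Transposition.transpose_def permutes_inverses
        permutes_inv_eq)
  moreover have "t \<circ> Transposition.transpose a b \<circ> inv_into UNIV t \<in> G"
    using comp inv tG X(4) by blast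
  ultimately show ?case using comp swap.IH by metis
qed

lemma generate_field_subfield:
  "subfield_set (generate_field (ring_of_type_algebra :: 'a :: field ring) H)"
proof -
  interpret R: field "ring_of_type_algebra :: 'a ring" by (rule field_from_type_algebra)
  have carr: "carrier (ring_of_type_algebra :: 'a ring) = UNIV"
    and ops: "\<one>\<^bsub>ring_of_type_algebra\<^esub> = (1 :: 'a)" "\<zero>\<^bsub>ring_of_type_algebra\<^esub> = (0 :: 'a)"
      "\<And>x y :: 'a. x \<oplus>\<^bsub>ring_of_type_algebra\<^esub> y = x + y"
      "\<And>x y :: 'a. x \<otimes>\<^bsub>ring_of_type_algebra\<^esub> y = x * y"
    by (auto simp: ring_of_type_algebra_def)
  have um: "\<ominus>\<^bsub>ring_of_type_algebra\<^esub> x = - x" for x :: 'a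
    using R.minus_equality[of "- x" x] by (simp add: carr ops)
  have iv: "inv\<^bsub>ring_of_type_algebra\<^esub> x = inverse x" if "x \<noteq> 0" for x :: 'a
    using R.inv_unique'[of x "inverse x"] that by (simp add: carr ops)
  let ?F = "generate_field (ring_of_type_algebra :: 'a ring) H"
  have one: "1 \<in> ?F" using generate_field.one[of "ring_of_type_algebra :: 'a ring" H] by (simp add: ops)
  have um': "- x \<in> ?F" if "x \<in> ?F" for x using generate_field.a_inv[OF that] by (simp add: um)
  have add': "x + y \<in> ?F" if "x \<in> ?F" "y \<in> ?F" for x y
    using generate_field.eng_add[OF that] by (simp add: ops)
  have zero: "0 \<in> ?F" using add'[OF one um'[OF one]] by simp
  show ?thesis
  proof
    fix x y assume "x \<in> ?F" "y \<in> ?F"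
    from generate_field.eng_mult[OF this] show "x * y \<in> ?F" by (simp add: ops)
  next
    fix x assume x: "x \<in> ?F"
    show "inverse x \<in> ?F"
    proof (cases "x = 0")
      case False
      then show ?thesis using generate_field.m_inv[OF x] by (simp add: iv ops)
    qed (simp add: zero)
  qed (use one zero um' add' in auto)
qed

lemma generate_field_minimal:
  fixes H :: "'a :: field set"
  assumes "subfield_set M" "H \<subseteq> M"
  shows "generate_field ring_of_type_algebra H \<subseteq> M"
proof
  interpret R: field "ring_of_type_algebra :: 'a ring" by (rule field_from_type_algebra)
  interpret M: subfield_set M by (rule assms(1))
  have carr: "carrier (ring_of_type_algebra :: 'a ring) = UNIV"
    and ops: "\<one>\<^bsub>ring_of_type_algebra\<^esub> = (1 :: 'a)" "\<zero>\<^bsub>ring_of_type_algebra\<^esub> = (0 :: 'a)"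
      "\<And>x y :: 'a. x \<oplus>\<^bsub>ring_of_type_algebra\<^esub> y = x + y"
      "\<And>x y :: 'a. x \<otimes>\<^bsub>ring_of_type_algebra\<^esub> y = x * y"
    by (auto simp: ring_of_type_algebra_def)
  have um: "\<ominus>\<^bsub>ring_of_type_algebra\<^esub> x = - x" for x :: 'a
    using R.minus_equality[of "- x" x] by (simp add: carr ops)
  have iv: "inv\<^bsub>ring_of_type_algebra\<^esub> x = inverse x" if "x \<noteq> 0" for x :: 'a
    using R.inv_unique'[of x "inverse x"] that by (simp add: carr ops)
  fix x assume "x \<in> generate_field ring_of_type_algebra H"
  then show "x \<in> M"
    by induction (use assms(2) in \<open>auto simp: ops um iv M.one M.uminus M.add M.mult M.inv\<close>)
qed

section \<open>The Galois group as a group of permutations of the roots\<close>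

locale galois_setup =
  fixes f :: "'k :: field poly"
  assumes f0: "f \<noteq> 0"
begin

definition Z where "Z = {z. poly (map_poly to_ac f) z = 0}"
definition L where "L = splitting_field f"
definition \<Gamma> where "\<Gamma> = carrier (galois_group f)"

lemma Z_fin: "finite Z"
  unfolding Z_def using f0 by (intro poly_roots_finite) simp

lemma L_alt: "L = generate_field ring_of_type_algebra (range to_ac \<union> Z)"
  by (simp add: L_def splitting_field_def Z_def)

sublocale L: subfield_set L
  unfolding L_alt by (rule generate_field_subfield)

lemma Z_L: "Z \<subseteq> L" and K_L: "to_ac x \<in> L"
  unfolding L_alt by (auto intro: generate_field.incl)

lemma L_minimal: "subfield_set M \<Longrightarrow> range to_ac \<subseteq> M \<Longrightarrow> Z \<subseteq> M \<Longrightarrow> L \<subseteq> M"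
  unfolding L_alt by (intro generate_field_minimal) auto

lemma mem_iff:
  "\<sigma> \<in> \<Gamma> \<longleftrightarrow> \<sigma> \<in> extensional L \<and> bij_betw \<sigma> L L \<and>
     (\<forall>x\<in>L. \<forall>y\<in>L. \<sigma> (x + y) = \<sigma> x + \<sigma> y \<and> \<sigma> (x * y) = \<sigma> x * \<sigma> y) \<and> (\<forall>x. \<sigma> (to_ac x) = to_ac x)"
proof -
  have "\<sigma> 1 = 1" if "\<forall>x. \<sigma> (to_ac x) = to_ac x" using that to_ac_1 by metis
  then show ?thesis
    by (auto simp: \<Gamma>_def galois_group_def Let_def L_def[symmetric] Bij_def ring_iso_def Ring.ring_hom_def
        ring_of_type_algebra_def dest: bij_betwE)
qed

lemma embedding: "\<sigma> \<in> \<Gamma> \<Longrightarrow> subfield_embedding L \<sigma>"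
  unfolding mem_iff by unfold_locales (auto, metis to_ac_1)

lemma hom_root:
  assumes "subfield_embedding M \<sigma>" "range to_ac \<subseteq> M" "\<And>x. \<sigma> (to_ac x) = to_ac x" "z \<in> Z" "z \<in> M"
  shows "\<sigma> z \<in> Z"
proof -
  interpret subfield_embedding M \<sigma> by fact
  have "coeffs_in (map_poly to_ac f)" using assms(2) by (auto simp: coeffs_in_def coeff_map_poly)
  from hom_poly[OF this assms(5)] have "\<sigma> 0 = poly (map_poly \<sigma> (map_poly to_ac f)) (\<sigma> z)"
    using assms(4) by (simp add: Z_def)
  moreover have "map_poly \<sigma> (map_poly to_ac f) = map_poly to_ac f"
    by (intro poly_eqI) (simp add: coeff_map coeff_map_poly assms(3))
  ultimately show ?thesis by (simp add: Z_def hom_zero)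
qed

lemma image_Z:
  assumes "\<sigma> \<in> \<Gamma>"
  shows "\<sigma> ` Z = Z" "inj_on \<sigma> Z"
proof -
  have e: "subfield_embedding L \<sigma>" and fix': "\<And>x. \<sigma> (to_ac x) = to_ac x"
    using embedding[OF assms] assms by (auto simp: mem_iff)
  show inj: "inj_on \<sigma> Z" using subfield_embedding.hom_inj[OF e] Z_L inj_on_subset by blast
  have "\<sigma> ` Z \<subseteq> Z" using hom_root[OF e _ fix'] K_L Z_L by blast
  then show "\<sigma> ` Z = Z" using endo_inj_surj[OF Z_fin _ inj] by blast
qed

text \<open>\<open>\<tau>\<close> permutes the finite set of roots. Hence the part of
  \<open>L\<close> that it sends into \<open>L\<close>, and the image of \<open>L\<close>, are
  subfields containing the base field and the roots; minimality of \<open>L\<close> makes the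
  restriction a bijection of \<open>L\<close>.\<close>

lemma restrict_mem:
  assumes "subfield_embedding M \<tau>" "range to_ac \<subseteq> M" "Z \<subseteq> M" "\<And>x. \<tau> (to_ac x) = to_ac x"
  shows "restrict \<tau> L \<in> \<Gamma>"
proof -
  interpret E: subfield_embedding M \<tau> by fact
  have LM: "L \<subseteq> M" using L_minimal E.subfield_set_axioms assms by blast
  have "\<tau> ` Z \<subseteq> Z" using hom_root[OF assms(1,2,4)] assms(3) by blast
  moreover have "inj_on \<tau> Z" using E.hom_inj assms(3) inj_on_subset by blast
  ultimately have Zim: "\<tau> ` Z = Z" using endo_inj_surj[OF Z_fin] by blast
  have "L \<subseteq> {x\<in>L. \<tau> x \<in> L}"
  proof (rule L_minimal)
    show "subfield_set {x\<in>L. \<tau> x \<in> L}"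
      by unfold_locales
        (use LM in \<open>auto simp: E.hom_zero E.hom_one E.hom_add E.hom_mult E.hom_uminus E.hom_inverse
           L.zero L.one L.add L.mult L.uminus L.inv subset_iff\<close>)
  qed (use K_L Z_L Zim assms(4) in auto)
  then have sub: "\<tau> ` L \<subseteq> L" by auto
  have "L \<subseteq> \<tau> ` L"
  proof (rule L_minimal)
    show "subfield_set (\<tau> ` L)"
    proof
      show "0 \<in> \<tau> ` L" using E.hom_zero L.zero by (metis imageI)
      show "1 \<in> \<tau> ` L" using E.hom_one L.one by (metis imageI)
      fix x assume "x \<in> \<tau> ` L"
      then obtain a where a: "x = \<tau> a" "a \<in> L" by auto
      have aM: "a \<in> M" using a LM by blast
      show "- x \<in> \<tau> ` L" "inverse x \<in> \<tau> ` L"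
        using a E.hom_uminus[OF aM] E.hom_inverse[OF aM] L.uminus L.inv by (metis imageI)+
      fix y assume "y \<in> \<tau> ` L"
      then obtain b where b: "y = \<tau> b" "b \<in> L" by auto
      have bM: "b \<in> M" using b LM by blast
      show "x + y \<in> \<tau> ` L" "x * y \<in> \<tau> ` L"
        using a b E.hom_add[OF aM bM] E.hom_mult[OF aM bM] L.add L.mult by (metis imageI)+
    qed
    show "range to_ac \<subseteq> \<tau> ` L" using K_L assms(4) by (metis imageI image_subsetI)
    show "Z \<subseteq> \<tau> ` L" using Zim Z_L by blast
  qed
  then have "bij_betw \<tau> L L"
    using sub E.hom_inj LM by (auto simp: bij_betw_def intro: inj_on_subset)
  then have "bij_betw (restrict \<tau> L) L L" by (simp add: bij_betw_restrict_eq)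
  then show ?thesis
    using LM by (auto simp: mem_iff L.add L.mult E.hom_add E.hom_mult subset_iff K_L assms(4))
qed

lemma comp_mem:
  assumes "\<sigma> \<in> \<Gamma>" "\<tau> \<in> \<Gamma>"
  shows "compose L \<sigma> \<tau> \<in> \<Gamma>"
proof -
  have b: "bij_betw \<sigma> L L" "bij_betw \<tau> L L" using assms by (auto simp: mem_iff)
  then have "bij_betw (compose L \<sigma> \<tau>) L L" using bij_betw_compose by blast
  moreover have "\<tau> x \<in> L" if "x \<in> L" for x using b(2) that bij_betwE by blast
  ultimately show ?thesis using assms by (simp add: mem_iff compose_def L.add L.mult K_L)
qed

lemma inv_mem:
  assumes "\<sigma> \<in> \<Gamma>"
  obtains \<tau> where "\<tau> \<in> \<Gamma>" "\<And>x. x \<in> L \<Longrightarrow> \<tau> (\<sigma> x) = x"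
proof -
  have b: "bij_betw \<sigma> L L" and h: "\<And>x y. x \<in> L \<Longrightarrow> y \<in> L \<Longrightarrow> \<sigma> (x + y) = \<sigma> x + \<sigma> y"
    "\<And>x y. x \<in> L \<Longrightarrow> y \<in> L \<Longrightarrow> \<sigma> (x * y) = \<sigma> x * \<sigma> y" "\<And>x. \<sigma> (to_ac x) = to_ac x"
    using assms by (auto simp: mem_iff)
  define t where "t = inv_into L \<sigma>"
  have bt: "bij_betw t L L" unfolding t_def by (rule bij_betw_inv_into[OF b])
  have t1: "t (\<sigma> x) = x" if "x \<in> L" for x
    unfolding t_def using bij_betw_inv_into_left[OF b that] .
  have t2: "\<sigma> (t x) = x" "t x \<in> L" if "x \<in> L" for x
    unfolding t_def using bij_betw_inv_into_right[OF b that] bij_betwE[OF bt] that by (auto simp: t_def)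
  have "restrict t L \<in> \<Gamma>"
    unfolding mem_iff
  proof (intro conjI ballI allI)
    show "bij_betw (restrict t L) L L" using bt by (simp add: bij_betw_restrict_eq)
    fix x y assume xy: "x \<in> L" "y \<in> L"
    have "t (x + y) = t x + t y" using t1[of "t x + t y"] t2 xy h(1) L.add by metis
    then show "restrict t L (x + y) = restrict t L x + restrict t L y" using xy L.add by simp
    have "t (x * y) = t x * t y" using t1[of "t x * t y"] t2 xy h(2) L.mult by metis
    then show "restrict t L (x * y) = restrict t L x * restrict t L y" using xy L.mult by simp
  next
    fix x show "restrict t L (to_ac x) = to_ac x" using K_L t1[of "to_ac x"] h(3) by simp
  qed simp
  moreover have "\<sigma> x \<in> L" if "x \<in> L" for x using b that bij_betwE by blast
  ultimately show ?thesis using that[of "restrict t L"] t1 by simp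
qed

text \<open>The elements where \<sigma> and \<tau> agree form a subfield containing the base field
  and the roots, hence all of \<open>L\<close>.\<close>

lemma inj_on_roots:
  assumes "\<sigma> \<in> \<Gamma>" "\<tau> \<in> \<Gamma>" "\<And>z. z \<in> Z \<Longrightarrow> \<sigma> z = \<tau> z"
  shows "\<sigma> = \<tau>"
proof -
  interpret s: subfield_embedding L \<sigma> by (rule embedding[OF assms(1)])
  interpret t: subfield_embedding L \<tau> by (rule embedding[OF assms(2)])
  have "L \<subseteq> {x\<in>L. \<sigma> x = \<tau> x}"
  proof (rule L_minimal)
    show "subfield_set {x\<in>L. \<sigma> x = \<tau> x}"
      by unfold_locales (auto simp: s.hom_zero s.hom_one s.hom_add s.hom_mult s.hom_uminus s.hom_inverse
          t.hom_zero t.hom_one t.hom_add t.hom_mult t.hom_uminus t.hom_inverse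
           L.zero L.one L.add L.mult L.uminus L.inv)
  qed (use assms Z_L K_L in \<open>auto simp: mem_iff\<close>)
  then show ?thesis using assms(1,2) by (intro extensionalityI[of _ L]) (auto simp: mem_iff)
qed

definition root_perms where
  "root_perms = {p. p permutes Z \<and> (\<exists>\<sigma>\<in>\<Gamma>. \<forall>z\<in>Z. p z = \<sigma> z)}"

lemma root_perms_ex:
  assumes "\<sigma> \<in> \<Gamma>"
  shows "(\<lambda>z. if z \<in> Z then \<sigma> z else z) \<in> root_perms"
proof -
  have "bij_betw \<sigma> Z Z" using image_Z[OF assms] by (simp add: bij_betw_def)
  then have "bij_betw (\<lambda>z. if z \<in> Z then \<sigma> z else z) Z Z" using bij_betw_cong by (smt (verit))
  then have "(\<lambda>z. if z \<in> Z then \<sigma> z else z) permutes Z" by (rule bij_imp_permutes) auto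
  then show ?thesis using assms by (auto simp: root_perms_def)
qed

lemma root_perms_comp:
  assumes "p \<in> root_perms" "r \<in> root_perms"
  shows "p \<circ> r \<in> root_perms"
proof -
  obtain \<sigma> \<tau> where s: "\<sigma> \<in> \<Gamma>" "\<forall>z\<in>Z. p z = \<sigma> z" "\<tau> \<in> \<Gamma>" "\<forall>z\<in>Z. r z = \<tau> z"
    and perm: "p permutes Z" "r permutes Z" using assms by (auto simp: root_perms_def)
  have "(p \<circ> r) z = compose L \<sigma> \<tau> z" if "z \<in> Z" for z
    using that s Z_L permutes_in_image[OF perm(2), of z] by (auto simp: compose_def)
  then show ?thesis
    using comp_mem[OF s(1,3)] permutes_compose[OF perm(2,1)] by (auto simp: root_perms_def)
qed

lemma root_perms_inv:
  assumes "p \<in> root_perms"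
  shows "inv_into UNIV p \<in> root_perms"
proof -
  obtain \<sigma> where s: "\<sigma> \<in> \<Gamma>" "\<forall>z\<in>Z. p z = \<sigma> z"
    and perm: "p permutes Z" using assms by (auto simp: root_perms_def)
  obtain \<tau> where t: "\<tau> \<in> \<Gamma>" "\<And>x. x \<in> L \<Longrightarrow> \<tau> (\<sigma> x) = x" using inv_mem[OF s(1)] by blast
  have "inv_into UNIV p z = \<tau> z" if "z \<in> Z" for z
  proof -
    have "inv_into UNIV p z \<in> Z" using permutes_in_image[OF permutes_inv[OF perm], of z] that by blast
    then have "\<tau> (p (inv_into UNIV p z)) = inv_into UNIV p z" using s(2) t(2) Z_L by auto
    then show ?thesis using permutes_inverses(1)[OF perm] by simp
  qed
  then show ?thesis using t(1) permutes_inv[OF perm] by (auto simp: root_perms_def)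
qed

lemma root_perms_pow:
  assumes "p \<in> root_perms"
  shows "p ^^ j \<in> root_perms"
proof (induction j)
  case 0
  have "inv_into UNIV p \<circ> p = id" using assms permutes_inv_o(2) by (auto simp: root_perms_def)
  then show ?case using root_perms_comp[OF root_perms_inv[OF assms] assms] by (simp add: id_def)
next
  case (Suc j)
  then show ?case using root_perms_comp[OF assms Suc.IH] by (simp add: comp_def)
qed

text \<open>\<open>\<tau>1\<close> gives transitivity, \<open>\<tau>2\<close> transitivity of the
  stabilizer of \<open>c\<close>, and \<open>\<tau>3\<close> a transposition, so every permutation
  of the roots comes from \<Gamma>. A numbering \<open>h\<close> of the roots carries the action to
  \<open>{1..n}\<close>; the action is faithful because the roots generate \<open>L\<close>.\<close>

theorem iso_sym_group:
  assumes n: "card Z = n"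
    and T: "\<tau>1 \<in> \<Gamma>" "\<And>x y. x \<in> Z \<Longrightarrow> y \<in> Z \<Longrightarrow> \<exists>j. (\<tau>1 ^^ j) x = y"
    and S: "\<tau>2 \<in> \<Gamma>" "c \<in> Z" "\<tau>2 c = c" "\<And>x y. x \<in> Z - {c} \<Longrightarrow> y \<in> Z - {c} \<Longrightarrow> \<exists>j. (\<tau>2 ^^ j) x = y"
    and X: "\<tau>3 \<in> \<Gamma>" "a \<in> Z" "b \<in> Z" "a \<noteq> b" "\<tau>3 a = b" "\<tau>3 b = a" "\<And>z. z \<in> Z - {a, b} \<Longrightarrow> \<tau>3 z = z"
  shows "galois_group f \<cong> sym_group n"
proof -
  define r where "r \<sigma> z = (if z \<in> Z then \<sigma> z else z)" for \<sigma> z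
  have rp: "r \<sigma> \<in> root_perms" if "\<sigma> \<in> \<Gamma>" for \<sigma>
    using root_perms_ex[OF that] by (simp add: r_def[abs_def])
  have rpow: "(r \<sigma> ^^ j) z = (\<sigma> ^^ j) z \<and> (\<sigma> ^^ j) z \<in> Z" if "\<sigma> \<in> \<Gamma>" "z \<in> Z" for \<sigma> j z
    using that(2) image_Z(1)[OF that(1)] by (induction j) (auto simp: r_def)
  have all: "p \<in> root_perms" if p: "p permutes Z" for p
  proof (rule all_permutations_if_2_transitive[OF Z_fin _ root_perms_comp root_perms_inv _ S(2) _ X(2-4) _ p])
    show "\<And>p. p \<in> root_perms \<Longrightarrow> p permutes Z" by (simp add: root_perms_def)
  next
    fix x y assume "x \<in> Z" "y \<in> Z"
    then obtain j where "(\<tau>1 ^^ j) x = y" using T by blast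
    then show "\<exists>p\<in>root_perms. p x = y"
      using root_perms_pow[OF rp[OF T(1)], of j] rpow[OF T(1) \<open>x \<in> Z\<close>, of j] by auto
  next
    fix x y assume xy: "x \<in> Z - {c}" "y \<in> Z - {c}"
    then obtain j where "(\<tau>2 ^^ j) x = y" using S by blast
    moreover have "(\<tau>2 ^^ j) c = c" using S(3) by (induction j) auto
    ultimately show "\<exists>p\<in>root_perms. p c = c \<and> p x = y"
      using root_perms_pow[OF rp[OF S(1)], of j] rpow[OF S(1), of x j] rpow[OF S(1), of c j] xy S(2) by auto
  next
    have "r \<tau>3 = Transposition.transpose a b"
      using X by (auto simp: fun_eq_iff r_def Transposition.transpose_def)
    then show "Transposition.transpose a b \<in> root_perms" using rp[OF X(1)] by simp
  qed
  obtain h where h: "bij_betw h Z {1..n}"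
    using finite_same_card_bij[OF Z_fin, of "{1..n}"] n by auto
  define h' where "h' = inv_into Z h"
  have h1: "h' (h z) = z" if "z \<in> Z" for z using bij_betw_inv_into_left[OF h that] by (simp add: h'_def)
  have h2: "h (h' i) = i" "h' i \<in> Z" if "i \<in> {1..n}" for i
    using bij_betw_inv_into_right[OF h that] bij_betwE[OF bij_betw_inv_into[OF h]] that by (auto simp: h'_def)
  have h3: "h z \<in> {1..n}" if "z \<in> Z" for z using h that bij_betwE by blast
  define \<Phi> where "\<Phi> \<sigma> i = (if i \<in> {1..n} then h (\<sigma> (h' i)) else i)" for \<sigma> :: "'k alg_closure \<Rightarrow> _" and i
  have sZ: "\<sigma> z \<in> Z" if "\<sigma> \<in> \<Gamma>" "z \<in> Z" for \<sigma> z using image_Z(1)[OF that(1)] that(2) by blast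
  have mult: "\<sigma> \<otimes>\<^bsub>galois_group f\<^esub> \<tau> = compose L \<sigma> \<tau>" if "\<sigma> \<in> \<Gamma>" "\<tau> \<in> \<Gamma>" for \<sigma> \<tau>
    using that by (simp add: galois_group_def Let_def BijGroup_def L_def[symmetric] mem_iff Bij_def)
  have "\<Phi> \<sigma> permutes {1..n}" if s: "\<sigma> \<in> \<Gamma>" for \<sigma>
  proof (rule bij_imp_permutes)
    have "inj_on (\<Phi> \<sigma>) {1..n}"
    proof (rule inj_onI)
      fix i j assume ij: "i \<in> {1..n}" "j \<in> {1..n}" "\<Phi> \<sigma> i = \<Phi> \<sigma> j"
      then have "\<sigma> (h' i) = \<sigma> (h' j)" using h1 sZ[OF s] h2(2) unfolding \<Phi>_def by metis
      then have "h' i = h' j" using image_Z(2)[OF s] h2(2) ij by (meson inj_onD)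
      then show "i = j" using h2(1) ij by metis
    qed
    moreover have "\<Phi> \<sigma> ` {1..n} \<subseteq> {1..n}" using h3 sZ[OF s] h2(2) by (auto simp: \<Phi>_def)
    ultimately show "bij_betw (\<Phi> \<sigma>) {1..n} {1..n}"
      using endo_inj_surj[of "{1..n}" "\<Phi> \<sigma>"] by (simp add: bij_betw_def)
  qed (simp only: \<Phi>_def if_False)
  then have carr: "\<Phi> \<sigma> \<in> carrier (sym_group n)" if "\<sigma> \<in> \<Gamma>" for \<sigma> using that by (simp add: sym_group_carrier)
  moreover have "\<Phi> (\<sigma> \<otimes>\<^bsub>galois_group f\<^esub> \<tau>) = \<Phi> \<sigma> \<circ> \<Phi> \<tau>" if st: "\<sigma> \<in> \<Gamma>" "\<tau> \<in> \<Gamma>" for \<sigma> \<tau>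
  proof
    fix i
    show "\<Phi> (\<sigma> \<otimes>\<^bsub>galois_group f\<^esub> \<tau>) i = (\<Phi> \<sigma> \<circ> \<Phi> \<tau>) i"
    proof (cases "i \<in> {1..n}")
      case True
      have "h' i \<in> L" using h2(2)[OF True] Z_L by blast
      then show ?thesis
        using True h1[OF sZ[OF st(2) h2(2)[OF True]]] h3[OF sZ[OF st(2) h2(2)[OF True]]]
        by (simp only: \<Phi>_def mult[OF st] compose_def comp_apply if_True restrict_apply')
    next
      case False
      then show ?thesis by (simp only: \<Phi>_def comp_apply if_False)
    qed
  qed
  ultimately have "\<Phi> \<in> hom (galois_group f) (sym_group n)"
    by (auto simp: hom_def \<Gamma>_def[symmetric] sym_group_mult)
  moreover have "bij_betw \<Phi> \<Gamma> (carrier (sym_group n))"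
  proof (rule bij_betw_imageI)
    show "inj_on \<Phi> \<Gamma>"
    proof (rule inj_onI)
      fix \<sigma> \<tau> assume st: "\<sigma> \<in> \<Gamma>" "\<tau> \<in> \<Gamma>" "\<Phi> \<sigma> = \<Phi> \<tau>"
      have "\<sigma> z = \<tau> z" if z: "z \<in> Z" for z
      proof -
        have "h (\<sigma> z) = h (\<tau> z)" using fun_cong[OF st(3), of "h z"] h1[OF z] h3[OF z] by (simp only: \<Phi>_def if_True)
        then show ?thesis using h1 sZ st z by metis
      qed
      then show "\<sigma> = \<tau>" using inj_on_roots st by blast
    qed
    show "\<Phi> ` \<Gamma> = carrier (sym_group n)"
    proof (intro equalityI subsetI)
      fix p assume "p \<in> carrier (sym_group n)"
      then have p: "p permutes {1..n}" by (simp add: sym_group_carrier)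
      define u where "u z = (if z \<in> Z then h' (p (h z)) else z)" for z
      have "u permutes Z"
      proof (rule bij_imp_permutes)
        have "inj_on u Z"
        proof (rule inj_onI)
          fix x y assume xy: "x \<in> Z" "y \<in> Z" "u x = u y"
          then have "p (h x) = p (h y)"
            using h2(1) h3 permutes_in_image[OF p] unfolding u_def by metis
          then show "x = y" using permutes_inj[OF p] h1 xy(1,2) by (metis injD)
        qed
        moreover have "u ` Z \<subseteq> Z" using h2(2) h3 permutes_in_image[OF p] by (auto simp: u_def)
        ultimately show "bij_betw u Z Z" using endo_inj_surj[OF Z_fin] by (simp add: bij_betw_def)
      qed (simp add: u_def)
      then obtain \<sigma> where s: "\<sigma> \<in> \<Gamma>" "\<forall>z\<in>Z. u z = \<sigma> z" using all by (auto simp: root_perms_def)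
      have "\<Phi> \<sigma> = p"
      proof
        fix i
        show "\<Phi> \<sigma> i = p i"
        proof (cases "i \<in> {1..n}")
          case True
          have "\<sigma> (h' i) = h' (p i)" using s(2) h2[OF True] by (auto simp: u_def)
          then show ?thesis using h2(1)[of "p i"] permutes_in_image[OF p] True by (simp only: \<Phi>_def if_True)
        next
          case False
          then show ?thesis using permutes_not_in[OF p False] by (simp only: \<Phi>_def if_False)
        qed
      qed
      then show "p \<in> \<Phi> ` \<Gamma>" using s(1) by blast
    qed (use carr in auto)
  qed
  ultimately show ?thesis by (auto simp: is_iso_def iso_def \<Gamma>_def)
qed

end

section \<open>Counting weighted multisets\<close>

lemma moebius_prime_mult:
  assumes p: "Factorial_Ring.prime p" "\<not> p dvd d" "d > 0"
  shows "moebius (p * d) = - moebius d"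
proof -
  have cop: "coprime p d" using p prime_imp_coprime by blast
  have "squarefree (p * d) \<longleftrightarrow> squarefree d"
    using squarefree_mult_coprime[OF cop] squarefree_prime[of p] p squarefree_multD(2) by blast
  moreover have "prime_factors (p * d) = insert p (prime_factors d)" "p \<notin> prime_factors d"
    using p by (auto simp: prime_factors_product prime_prime_factors in_prime_factors_iff)
  ultimately show ?thesis by (simp add: moebius_def)
qed

text \<open>Among the squarefree divisors, those without a fixed prime factor \<open>p\<close> pair
  off with their multiples by \<open>p\<close>, with opposite signs.\<close>

lemma sum_moebius_divisors:
  assumes "n > 0"
  shows "(\<Sum>d | d dvd n. moebius d) = (if n = 1 then 1 else 0)"
proof (cases "n = 1")
  case False
  then obtain p where p: "Factorial_Ring.prime p" "p dvd n" using prime_factor_nat by blast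
  have p0: "p > 0" using p(1) by (simp add: prime_gt_0_nat)
  define D0 where "D0 = {d. d dvd n \<and> \<not> p dvd d \<and> squarefree d}"
  have fin: "finite {d. d dvd n}" using assms by simp
  have finD: "finite D0" using fin by (rule finite_subset[rotated]) (auto simp: D0_def)
  have pd: "p * d dvd n" if "d \<in> D0" for d
    using that p by (auto simp: D0_def intro!: divides_mult prime_imp_coprime)
  have nz: "d > 0" if "d dvd n" for d using that assms by (auto intro!: Nat.gr0I)
  have "(\<Sum>d | d dvd n. moebius d) = (\<Sum>d\<in>D0 \<union> (*) p ` D0. moebius d)"
  proof (rule sum.mono_neutral_right[OF fin])
    show "D0 \<union> (*) p ` D0 \<subseteq> {d. d dvd n}" using pd by (auto simp: D0_def)
    show "\<forall>d\<in>{d. d dvd n} - (D0 \<union> (*) p ` D0). moebius d = 0"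
    proof
      fix d assume d: "d \<in> {d. d dvd n} - (D0 \<union> (*) p ` D0)"
      show "moebius d = 0"
      proof (rule ccontr)
        assume "moebius d \<noteq> 0"
        then have sf: "squarefree d" by (auto simp: moebius_def split: if_splits)
        then have "p dvd d" using d by (auto simp: D0_def)
        then obtain e where e: "d = p * e" by blast
        have "\<not> p dvd e"
        proof
          assume "p dvd e"
          then have "p ^ 2 dvd d" using e by (auto simp: power2_eq_square)
          then show False using sf p(1) by (auto simp: squarefree_def)
        qed
        moreover have "squarefree e" using sf e squarefree_multD(2) by blast
        moreover have "e dvd n" using d e by (auto dest: dvd_mult_right)
        ultimately show False using d e by (auto simp: D0_def)
      qed
    qed
  qed
  also have "\<dots> = (\<Sum>d\<in>D0. moebius d) + (\<Sum>d\<in>(*) p ` D0. moebius d)"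
    using finD by (intro sum.union_disjoint) (auto simp: D0_def)
  also have "(\<Sum>d\<in>(*) p ` D0. moebius d) = (\<Sum>d\<in>D0. moebius (p * d))"
    using p0 by (subst sum.reindex) (auto simp: inj_on_def)
  also have "\<dots> = (\<Sum>d\<in>D0. - moebius d)"
    using p nz by (intro sum.cong moebius_prime_mult) (auto simp: D0_def)
  finally show ?thesis using False by (simp add: sum_negf)
qed (simp add: moebius_def)

text \<open>Exchange of summation over the pairs with \<open>d * e\<close> dividing
  \<open>m\<close>; the inner Moebius sum leaves only \<open>e = m\<close>.\<close>

lemma moebius_inversion:
  fixes F G :: "nat \<Rightarrow> real"
  assumes G: "\<And>m. m > 0 \<Longrightarrow> G m = (\<Sum>d | d dvd m. F d)" and m: "m > 0"
  shows "F m = (\<Sum>d | d dvd m. of_int (moebius d) * G (m div d))"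
proof -
  have fin: "finite {d. d dvd k}" if "k > 0" for k :: nat using that by simp
  have pos: "m div d > 0" if "d dvd m" for d using that m by (auto intro!: Nat.gr0I elim: dvdE)
  have "(\<Sum>d | d dvd m. of_int (moebius d) * G (m div d)) =
      (\<Sum>d | d dvd m. \<Sum>e | e dvd m div d. of_int (moebius d) * F e)"
    using pos by (intro sum.cong) (auto simp: G sum_distrib_left)
  also have "\<dots> = (\<Sum>(d, e)\<in>(SIGMA d:{d. d dvd m}. {e. e dvd m div d}). of_int (moebius d) * F e)"
    using fin m pos by (subst sum.Sigma) auto
  also have "\<dots> = (\<Sum>(e, d)\<in>(SIGMA e:{e. e dvd m}. {d. d dvd m div e}). of_int (moebius d) * F e)"
  proof (rule sum.reindex_bij_witness[of _ "\<lambda>(e, d). (d, e)" "\<lambda>(d, e). (e, d)"])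
    have *: "e dvd m \<and> d dvd m div e" if "d dvd m" "e dvd m div d" for d e :: nat
    proof -
      from that(1) obtain a where a: "m = d * a" by blast
      then have "d > 0" using m by (cases d) auto
      then have "e dvd a" using that(2) a by simp
      then obtain b where "a = e * b" by blast
      then show ?thesis using a m by (cases "e = 0") (auto simp: mult.left_commute[of d e])
    qed
    show "\<And>a. a \<in> (SIGMA d:{d. d dvd m}. {e. e dvd m div d}) \<Longrightarrow>
        (case a of (d, e) \<Rightarrow> (e, d)) \<in> (SIGMA e:{e. e dvd m}. {d. d dvd m div e})"
      using * by auto
    show "\<And>a. a \<in> (SIGMA e:{e. e dvd m}. {d. d dvd m div e}) \<Longrightarrow>
        (case a of (e, d) \<Rightarrow> (d, e)) \<in> (SIGMA d:{d. d dvd m}. {e. e dvd m div d})"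
      using * by auto
  qed auto
  also have "\<dots> = (\<Sum>e | e dvd m. \<Sum>d | d dvd m div e. of_int (moebius d) * F e)"
    using fin m pos by (subst sum.Sigma) auto
  also have "\<dots> = (\<Sum>e | e dvd m. of_int (\<Sum>d | d dvd m div e. moebius d) * F e)"
    by (simp add: sum_distrib_right)
  also have "\<dots> = (\<Sum>e | e dvd m. if e = m then F e else 0)"
  proof (rule sum.cong)
    fix e assume e: "e \<in> {e. e dvd m}"
    then have "m div e = 1 \<longleftrightarrow> e = m" using m by (auto elim!: dvdE)
    then show "of_int (\<Sum>d | d dvd m div e. moebius d) * F e = (if e = m then F e else 0)"
      using sum_moebius_divisors[OF pos] e by auto
  qed simp
  also have "\<dots> = F m" using m by (subst sum.delta) auto
  finally show ?thesis by simp
qed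

lemma sum_mset_eq_sum_count:
  fixes f :: "'a \<Rightarrow> nat"
  assumes "finite B" "set_mset m \<subseteq> B"
  shows "(\<Sum>x\<in>#m. f x) = (\<Sum>x\<in>B. count m x * f x)"
  using assms(2)
proof (induction m)
  case (add y m)
  have "(\<Sum>x\<in>B. count (add_mset y m) x * f x) = (\<Sum>x\<in>B. (if x = y then f x else 0) + count m x * f x)"
    by (intro sum.cong) auto
  also have "\<dots> = f y + (\<Sum>x\<in>B. count m x * f x)"
    using add.prems assms(1) by (simp add: sum.distrib)
  finally show ?case using add by simp
qed simp

text \<open>An abstract form of unique factorization: \<open>I\<close> stands for the monic
  irreducibles, \<open>w\<close> for the degree, and multisets for monic polynomials. The counts
  below follow from the single fact that weight \<open>n\<close> is attained \<open>q ^ n\<close>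
  times.\<close>

locale weighted_multisets =
  fixes I :: "'a set" and w :: "'a \<Rightarrow> nat" and q :: nat
  assumes w_pos: "x \<in> I \<Longrightarrow> w x > 0"
    and q_pos: "q > 0"
    and fin_M: "finite {m. set_mset m \<subseteq> I \<and> (\<Sum>x\<in>#m. w x) = n}"
    and card_M: "card {m. set_mset m \<subseteq> I \<and> (\<Sum>x\<in>#m. w x) = n} = q ^ n"
begin

definition M where "M n = {m. set_mset m \<subseteq> I \<and> (\<Sum>x\<in>#m. w x) = n}"
definition J where "J d = {x \<in> I. w x = d}"

lemma M_fin: "finite (M n)" and M_card: "card (M n) = q ^ n"
  using fin_M card_M by (auto simp: M_def)

lemma J_fin: "finite (J d)"
proof (rule inj_on_finite[of "\<lambda>x. {#x#}" _ "M d"])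
  show "inj_on (\<lambda>x. {#x#}) (J d)" by (auto simp: inj_on_def)
  show "(\<lambda>x. {#x#}) ` J d \<subseteq> M d" by (auto simp: J_def M_def)
qed (rule M_fin)

lemma count_le_weight: "count m x * w x \<le> (\<Sum>y\<in>#m. w y)"
  by (induction m) auto

lemma card_M_count_ge:
  assumes "x \<in> I"
  shows "card {m \<in> M n. k \<le> count m x} = (if k * w x \<le> n then q ^ (n - k * w x) else 0)"
proof (cases "k * w x \<le> n")
  case True
  have "bij_betw (\<lambda>m. m + replicate_mset k x) (M (n - k * w x)) {m \<in> M n. k \<le> count m x}"
  proof (rule bij_betw_byWitness[where f' = "\<lambda>m. m - replicate_mset k x"])
    show "(\<lambda>m. m + replicate_mset k x) ` M (n - k * w x) \<subseteq> {m \<in> M n. k \<le> count m x}"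
      using True assms by (auto simp: M_def subset_iff split: if_splits)
    show "(\<lambda>m. m - replicate_mset k x) ` {m \<in> M n. k \<le> count m x} \<subseteq> M (n - k * w x)"
    proof safe
      fix m assume m: "m \<in> M n" "k \<le> count m x"
      then have "replicate_mset k x \<subseteq># m" by (simp add: count_le_replicate_mset_subset_eq)
      then obtain r where r: "m = r + replicate_mset k x" by (metis subset_mset.diff_add)
      then show "m - replicate_mset k x \<in> M (n - k * w x)" using m by (auto simp: M_def)
    qed
    show "\<forall>m\<in>{m \<in> M n. k \<le> count m x}. m - replicate_mset k x + replicate_mset k x = m"
      by (auto simp: count_le_replicate_mset_subset_eq subset_mset.diff_add)
  qed auto
  from bij_betw_same_card[OF this] show ?thesis using True M_card by simp
next
  case False
  have "{m \<in> M n. k \<le> count m x} = {}"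
  proof safe
    fix m assume m: "m \<in> M n" "k \<le> count m x"
    then have "k * w x \<le> n"
      using le_trans[OF mult_le_mono1[of k "count m x" "w x"] count_le_weight[of m x]] by (auto simp: M_def)
    then show "m \<in> {}" using False by simp
  qed
  then show ?thesis unfolding if_not_P[OF False] by (simp only: card.empty)
qed

text \<open>The polynomial von Mangoldt function summed over degree \<open>j\<close>; equivalently,
  a coefficient of the logarithmic derivative of the zeta function of the polynomial ring.\<close>

definition \<Lambda> where "\<Lambda> j = (\<Sum>d | d dvd j. d * card (J d))"

text \<open>Double counting of the total weight of all multisets of weight \<open>n\<close>: an
  element \<open>x\<close> contributes \<open>w x\<close> for each \<open>k\<close> from 1 to its
  multiplicity, and \<open>q ^ (n - k * w x)\<close> multisets contain it at least \<open>k\<close>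
  times. The contributions are collected by \<open>j = k * w x\<close>.\<close>

lemma weight_identity: "n * q ^ n = (\<Sum>j=1..n. q ^ (n - j) * \<Lambda> j)"
proof -
  define B where "B = {x \<in> I. w x \<le> n}"
  have B: "B = (\<Union>d\<in>{1..n}. J d)"
    using w_pos by (auto simp: B_def J_def Suc_le_eq)
  have finB: "finite B" unfolding B using J_fin by blast
  have "n * q ^ n = (\<Sum>m\<in>M n. \<Sum>x\<in>#m. w x)"
  proof -
    have "(\<Sum>m\<in>M n. \<Sum>x\<in>#m. w x) = (\<Sum>m\<in>M n. n)" by (intro sum.cong) (auto simp: M_def)
    then show ?thesis using M_card by simp
  qed
  also have "\<dots> = (\<Sum>m\<in>M n. \<Sum>x\<in>B. \<Sum>k=1..n. if k \<le> count m x then w x else 0)"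
  proof (rule sum.cong)
    fix m assume m: "m \<in> M n"
    have sub: "set_mset m \<subseteq> B"
    proof
      fix x assume x: "x \<in># m"
      then have "w x \<le> count m x * w x" by (simp flip: count_greater_zero_iff)
      from le_trans[OF this count_le_weight[of m x]] have "w x \<le> n" using m by (auto simp: M_def)
      then show "x \<in> B" using x m by (auto simp: B_def M_def)
    qed
    have "(\<Sum>x\<in>#m. w x) = (\<Sum>x\<in>B. count m x * w x)"
      by (rule sum_mset_eq_sum_count[OF finB sub])
    also have "\<dots> = (\<Sum>x\<in>B. \<Sum>k=1..n. if k \<le> count m x then w x else 0)"
    proof (rule sum.cong)
      fix x assume x: "x \<in> B"
      then have "w x > 0" using w_pos by (auto simp: B_def)
      then have "count m x \<le> count m x * w x" by simp
      also have "\<dots> \<le> n" using count_le_weight[of m x] m by (auto simp: M_def)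
      finally have "{k \<in> {1..n}. k \<le> count m x} = {1..count m x}" by auto
      then show "count m x * w x = (\<Sum>k=1..n. if k \<le> count m x then w x else 0)"
        by (simp add: sum.inter_filter[symmetric])
    qed simp
    finally show "(\<Sum>x\<in>#m. w x) = \<dots>" .
  qed simp
  also have "\<dots> = (\<Sum>x\<in>B. \<Sum>k=1..n. \<Sum>m\<in>M n. if k \<le> count m x then w x else 0)"
    by (subst sum.swap, rule sum.cong[OF refl], rule sum.swap)
  also have "\<dots> = (\<Sum>x\<in>B. \<Sum>k=1..n. w x * (if k * w x \<le> n then q ^ (n - k * w x) else 0))"
  proof (intro sum.cong refl)
    fix x k assume "x \<in> B"
    then have x: "x \<in> I" by (simp add: B_def)
    have "(\<Sum>m\<in>M n. if k \<le> count m x then w x else 0) = w x * card {m \<in> M n. k \<le> count m x}"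
      using M_fin by (simp add: sum.inter_filter[symmetric] mult.commute)
    then show "(\<Sum>m\<in>M n. if k \<le> count m x then w x else 0) =
        w x * (if k * w x \<le> n then q ^ (n - k * w x) else 0)"
      using card_M_count_ge[OF x] by simp
  qed
  also have "\<dots> = (\<Sum>d=1..n. \<Sum>x\<in>J d. \<Sum>k=1..n. d * (if k * d \<le> n then q ^ (n - k * d) else 0))"
  proof -
    have "(\<Sum>x\<in>B. g x) = (\<Sum>d=1..n. \<Sum>x\<in>J d. g x)" for g :: "'a \<Rightarrow> nat"
      unfolding B by (intro sum.UNION_disjoint) (simp_all add: J_fin, auto simp: J_def)
    moreover have "(\<Sum>x\<in>J d. \<Sum>k=1..n. w x * (if k * w x \<le> n then q ^ (n - k * w x) else 0)) =
        (\<Sum>x\<in>J d. \<Sum>k=1..n. d * (if k * d \<le> n then q ^ (n - k * d) else 0))" for d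
      by (intro sum.cong refl) (simp only: J_def mem_Collect_eq)
    ultimately show ?thesis by simp
  qed
  also have "\<dots> = (\<Sum>d=1..n. \<Sum>k=1..n. if k * d \<le> n then d * card (J d) * q ^ (n - k * d) else 0)"
    by (intro sum.cong refl) (auto simp: sum_distrib_left intro!: sum.cong)
  also have "\<dots> = (\<Sum>(d, k)\<in>{1..n} \<times> {1..n}. if k * d \<le> n then d * card (J d) * q ^ (n - k * d) else 0)"
    by (simp add: sum.cartesian_product)
  also have "\<dots> = (\<Sum>(d, k)\<in>{(d, k) \<in> {1..n} \<times> {1..n}. k * d \<le> n}. d * card (J d) * q ^ (n - k * d))"
    by (rule sum.mono_neutral_cong_right) (auto split: if_splits)
  also have "\<dots> = (\<Sum>(j, d)\<in>(SIGMA j:{1..n}. {d. d dvd j}). q ^ (n - j) * (d * card (J d)))"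
  proof (rule sum.reindex_bij_witness[of _ "\<lambda>(j, d). (d, j div d)" "\<lambda>(d, k). (k * d, d)"])
    fix a assume a: "a \<in> (SIGMA j:{1..n}. {d. d dvd j})"
    obtain j d where jd: "a = (j, d)" by (cases a)
    then obtain k where k: "j = d * k" "1 \<le> j" "j \<le> n" using a by auto
    then have dk: "d > 0" "k > 0" by (cases d; cases k; simp)+
    then have "d \<le> j" "k \<le> j" using k by auto
    then have "d \<le> n" "k \<le> n" using k(3) by linarith+
    then show "(case case a of (j, d) \<Rightarrow> (d, j div d) of (d, k) \<Rightarrow> (k * d, d)) = a"
      "(case a of (j, d) \<Rightarrow> (d, j div d)) \<in> {(d, k) \<in> {1..n} \<times> {1..n}. k * d \<le> n}"
      using jd k dk by (auto simp: mult.commute)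
  qed auto
  also have "\<dots> = (\<Sum>j=1..n. q ^ (n - j) * \<Lambda> j)"
    by (subst sum.Sigma[symmetric]) (auto simp: \<Lambda>_def sum_distrib_left)
  finally show ?thesis .
qed

text \<open>Subtracting \<open>q\<close> times the weight identity for \<open>n - 1\<close> from the
  one for \<open>n\<close> leaves \<open>n * q ^ n - (n - 1) * q ^ n\<close>.\<close>

lemma \<Lambda>_eq:
  assumes "n > 0"
  shows "\<Lambda> n = q ^ n"
proof -
  obtain k where k: "n = Suc k" using assms by (cases n) auto
  have "n * q ^ n = (\<Sum>j=1..k. q ^ (n - j) * \<Lambda> j) + \<Lambda> n"
    using weight_identity[of n] by (simp add: k)
  also have "(\<Sum>j=1..k. q ^ (n - j) * \<Lambda> j) = q * (\<Sum>j=1..k. q ^ (k - j) * \<Lambda> j)"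
    unfolding sum_distrib_left by (intro sum.cong) (auto simp: k Suc_diff_le)
  also have "\<dots> = k * q ^ n" using weight_identity[of k] by (simp add: k)
  finally show ?thesis by (simp add: k)
qed

lemma card_J:
  assumes "m > 0"
  shows "real (card (J m)) = necklace m (real q)"
proof -
  have "real m * real (card (J m)) = (\<Sum>d | d dvd m. of_int (moebius d) * real q ^ (m div d))"
    by (rule moebius_inversion[of "\<lambda>m. real q ^ m" "\<lambda>m. real m * real (card (J m))"])
      (use assms in \<open>simp_all flip: of_nat_power add: \<Lambda>_eq[symmetric] \<Lambda>_def\<close>)
  then show ?thesis using assms by (simp add: necklace_def field_simps)
qed

definition sets_of_weight where
  "sets_of_weight n = {A. finite A \<and> A \<subseteq> I \<and> (\<Sum>x\<in>A. w x) = n}"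

lemma sets_of_weight_fin: "finite (sets_of_weight n)"
proof (rule inj_on_finite[of mset_set _ "M n"])
  show "inj_on mset_set (sets_of_weight n)"
    by (rule inj_onI) (auto simp: sets_of_weight_def mset_set_eq_iff)
  show "mset_set ` sets_of_weight n \<subseteq> M n"
    by (auto simp: sets_of_weight_def M_def sum_unfold_sum_mset)
qed (rule M_fin)

text \<open>Every multiset is uniquely \<open>a + a + A\<close> with a set \<open>A\<close>, namely
  the elements of odd multiplicity; for polynomials, a square times a squarefree part.\<close>

lemma M_decomp: "card (M n) = (\<Sum>i | 2 * i \<le> n. card (M i) * card (sets_of_weight (n - 2 * i)))"
proof -
  have fin: "finite {i. 2 * i \<le> n}" by (rule finite_subset[of _ "{..n}"]) auto
  define h where "h = (\<lambda>(a, A). a + a + mset_set A :: 'a multiset)"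
  define T where "T = (SIGMA i:{i. 2 * i \<le> n}. M i \<times> sets_of_weight (n - 2 * i))"
  have "bij_betw (\<lambda>(i, p). h p) T (M n)"
  proof (rule bij_betw_imageI)
    have half: "a = Abs_multiset (\<lambda>x. count (h (a, A)) x div 2)" "A = {x. odd (count (h (a, A)) x)}"
      if "finite A" for a A
    proof -
      have "count (h (a, A)) x = 2 * count a x + (if x \<in> A then 1 else 0)" for x
        using that by (simp add: h_def count_mset_set')
      then show "a = Abs_multiset (\<lambda>x. count (h (a, A)) x div 2)" "A = {x. odd (count (h (a, A)) x)}"
        by (auto simp: count_inverse)
    qed
    show "inj_on (\<lambda>(i, p). h p) T"
    proof (rule inj_onI)
      fix x y assume xy: "x \<in> T" "y \<in> T" "(case x of (i, p) \<Rightarrow> h p) = (case y of (i, p) \<Rightarrow> h p)"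
      obtain i a A j b B where p: "x = (i, a, A)" "y = (j, b, B)" by (cases x, cases y) auto
      have "finite A" "finite B" using xy p by (auto simp: T_def sets_of_weight_def)
      then have "a = b" "A = B" using xy(3) p half(1)[of A a] half(1)[of B b] half(2)[of A a] half(2)[of B b] by auto
      moreover have "i = j" using xy p \<open>a = b\<close> by (auto simp: T_def M_def)
      ultimately show "x = y" using p by simp
    qed
    show "(\<lambda>(i, p). h p) ` T = M n"
    proof (intro equalityI subsetI)
      fix m assume "m \<in> (\<lambda>(i, p). h p) ` T"
      then obtain i a A where h: "m = h (a, A)" "2 * i \<le> n" "a \<in> M i" "A \<in> sets_of_weight (n - 2 * i)"
        by (auto simp: T_def)
      then have "(\<Sum>x\<in>#a. w x) = i" "(\<Sum>x\<in>#mset_set A. w x) = n - 2 * i"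
        by (simp_all add: M_def sets_of_weight_def sum_unfold_sum_mset)
      then have "(\<Sum>x\<in>#m. w x) = n" using h(1,2) by (simp add: h_def)
      then show "m \<in> M n" using h by (auto simp: h_def M_def sets_of_weight_def)
    next
      fix m assume m: "m \<in> M n"
      define A where "A = {x. odd (count m x)}"
      have A: "A \<subseteq> set_mset m" using odd_pos by (fastforce simp: A_def simp flip: count_greater_zero_iff)
      then have finA: "finite A" by (rule finite_subset) simp
      have "finite {x. 0 < count m x div 2}"
        by (rule finite_subset[of _ "set_mset m"]) (auto simp flip: count_greater_zero_iff)
      then have "count (Abs_multiset (\<lambda>x. count m x div 2)) = (\<lambda>x. count m x div 2)"
        by (intro Abs_multiset_inverse) simp
      then obtain a where a: "count a = (\<lambda>x. count m x div 2)" by blast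
      have "count m x = count (h (a, A)) x" for x
        using finA by (cases "x \<in> A") (auto simp: h_def a count_mset_set' A_def elim!: oddE evenE)
      then have mh: "m = h (a, A)" by (rule multiset_eqI)
      define i where "i = (\<Sum>x\<in>#a. w x)"
      have "n = i + i + (\<Sum>x\<in>A. w x)"
        using m mh by (auto simp: M_def h_def i_def sum_unfold_sum_mset)
      then have "n = 2 * i + (\<Sum>x\<in>A. w x)" by simp
      moreover have "set_mset a \<subseteq> I" "A \<subseteq> I" using m finA unfolding mh by (auto simp: M_def h_def)
      ultimately have "(i, a, A) \<in> T" using finA by (auto simp: T_def M_def sets_of_weight_def i_def)
      then show "m \<in> (\<lambda>(i, p). h p) ` T" using mh by force
    qed
  qed
  from bij_betw_same_card[OF this] have "card (M n) = card T" by simp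
  also have "\<dots> = (\<Sum>i | 2 * i \<le> n. card (M i \<times> sets_of_weight (n - 2 * i)))"
    unfolding T_def using fin M_fin sets_of_weight_fin by (intro card_SigmaI) auto
  finally show ?thesis by (simp add: card_cartesian_product)
qed

text \<open>In the decomposition for \<open>n\<close>, the terms with a nonempty square part sum to
  \<open>q\<close> times the decomposition for \<open>n - 2\<close>, that is, to
  \<open>q ^ (n - 1)\<close>. Here \<open>n \<ge> 2\<close> enters.\<close>

lemma card_sets_of_weight:
  assumes "n \<ge> 2"
  shows "card (sets_of_weight n) + q ^ (n - 1) = q ^ n"
proof -
  have fin: "finite {i. 2 * i \<le> m}" for m :: nat by (rule finite_subset[of _ "{..m}"]) auto
  have set: "{i. 2 * i \<le> n} = insert 0 (Suc ` {i. 2 * i \<le> n - 2})"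
  proof (intro equalityI subsetI)
    fix i assume "i \<in> {i. 2 * i \<le> n}"
    then show "i \<in> insert 0 (Suc ` {i. 2 * i \<le> n - 2})" by (cases i) auto
  qed (use assms in auto)
  have "q ^ n = card (M 0) * card (sets_of_weight n) +
      (\<Sum>i | 2 * i \<le> n - 2. card (M (Suc i)) * card (sets_of_weight (n - 2 * Suc i)))"
    using M_decomp[of n] M_card[of n] unfolding set
    by (subst (asm) sum.insert) (auto simp: fin sum.reindex)
  also have "(\<Sum>i | 2 * i \<le> n - 2. card (M (Suc i)) * card (sets_of_weight (n - 2 * Suc i))) =
      q * (\<Sum>i | 2 * i \<le> n - 2. card (M i) * card (sets_of_weight (n - 2 - 2 * i)))"
    unfolding sum_distrib_left by (intro sum.cong) (auto simp: M_card mult.assoc)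
  also have "\<dots> = q ^ (n - 1)"
    using M_decomp[of "n - 2"] M_card[of "n - 2"] assms
    by (metis (no_types, lifting) One_nat_def Suc_1 Suc_diff_le diff_Suc_Suc power_Suc)
  finally show ?thesis by (simp add: M_card)
qed

text \<open>A set of type \<mu> amounts to independent choices, for each weight \<open>i\<close>, of
  \<open>count \<mu> i\<close> elements among those of weight \<open>i\<close>. The generalized
  binomial appears because \<open>necklace\<close> is real-valued.\<close>

lemma card_sets_of_type:
  assumes "is_partition n \<mu>"
  shows "real (card {A. finite A \<and> A \<subseteq> I \<and> image_mset w (mset_set A) = \<mu>}) =
    (\<Prod>i=1..n. necklace i (real q) gchoose count \<mu> i)"
proof -
  define T where "T = {A. finite A \<and> A \<subseteq> I \<and> image_mset w (mset_set A) = \<mu>}"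
  define D where "D = PiE {1..n} (\<lambda>i. {B. B \<subseteq> J i \<and> card B = count \<mu> i})"
  have cnt: "count (image_mset w (mset_set A)) i = card (A \<inter> J i)" if "finite A" "A \<subseteq> I" for A i
  proof -
    have "count (image_mset w (mset_set A)) i = (\<Sum>x\<in>{x\<in>A. w x = i}. 1)"
      using that by (simp add: count_image_mset vimage_def Int_def conj_commute count_mset_set')
    also have "\<dots> = card {x\<in>A. w x = i}" by simp
    also have "{x\<in>A. w x = i} = A \<inter> J i" using that by (auto simp: J_def)
    finally show ?thesis .
  qed
  have le: "i \<in> {1..n}" if i: "i \<in># \<mu>" for i
  proof -
    have "i \<noteq> 0" using i assms by (auto simp: is_partition_def intro!: Nat.gr0I)
    moreover obtain \<mu>' where "\<mu> = add_mset i \<mu>'" using multi_member_split[OF i] by blast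
    then have "i \<le> n" using assms by (auto simp: is_partition_def)
    ultimately show ?thesis by simp
  qed
  have "bij_betw (\<lambda>A. \<lambda>i\<in>{1..n}. A \<inter> J i) T D"
  proof (rule bij_betw_byWitness[where f' = "\<lambda>g. \<Union>i\<in>{1..n}. g i"])
    show "\<forall>A\<in>T. (\<Union>i\<in>{1..n}. (\<lambda>i\<in>{1..n}. A \<inter> J i) i) = A"
    proof
      fix A assume A: "A \<in> T"
      have "x \<in> (\<Union>i\<in>{1..n}. A \<inter> J i)" if x: "x \<in> A" for x
      proof -
        have "w x \<in># \<mu>" using A x by (auto simp: T_def)
        then show ?thesis using le[of "w x"] x A by (auto simp: J_def T_def)
      qed
      then show "(\<Union>i\<in>{1..n}. (\<lambda>i\<in>{1..n}. A \<inter> J i) i) = A" by auto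
    qed
    show "\<forall>g\<in>D. (\<lambda>i\<in>{1..n}. (\<Union>i\<in>{1..n}. g i) \<inter> J i) = g"
    proof
      fix g assume g: "g \<in> D"
      have "(\<Union>k\<in>{1..n}. g k) \<inter> J i = g i" if "i \<in> {1..n}" for i
        using g that unfolding D_def PiE_iff J_def by blast
      then show "(\<lambda>i\<in>{1..n}. (\<Union>i\<in>{1..n}. g i) \<inter> J i) = g"
        using g by (intro extensionalityI[of _ "{1..n}"]) (auto simp: D_def PiE_iff)
    qed
    show "(\<lambda>A. \<lambda>i\<in>{1..n}. A \<inter> J i) ` T \<subseteq> D"
      using cnt by (auto simp: T_def D_def)
    show "(\<lambda>g. \<Union>i\<in>{1..n}. g i) ` D \<subseteq> T"
    proof safe
      fix g assume g: "g \<in> D"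
      define A where "A = (\<Union>i\<in>{1..n}. g i)"
      have gi: "g i \<subseteq> J i" "card (g i) = count \<mu> i" if "i \<in> {1..n}" for i
        using g that by (auto simp: D_def PiE_iff)
      have A: "finite A" "A \<subseteq> I"
        using gi(1) J_fin finite_subset by (auto simp: A_def J_def) blast+
      have "count (image_mset w (mset_set A)) i = count \<mu> i" for i
      proof (cases "i \<in> {1..n}")
        case True
        have "A \<inter> J i = g i" using gi(1) True unfolding A_def J_def by blast
        then show ?thesis using cnt[OF A] gi(2)[OF True] by simp
      next
        case False
        then have "count \<mu> i = 0" using le by (meson not_in_iff)
        moreover have "A \<inter> J i = {}" using gi(1) False unfolding A_def J_def by blast
        ultimately show ?thesis using cnt[OF A] by simp
      qed
      then show "(\<Union>i\<in>{1..n}. g i) \<in> T" using A unfolding A_def T_def by (auto intro: multiset_eqI)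
    qed
  qed
  from bij_betw_same_card[OF this] have "card T = card D" .
  also have "\<dots> = (\<Prod>i=1..n. card (J i) choose count \<mu> i)"
    using J_fin by (simp add: D_def card_PiE n_subsets)
  finally have "real (card T) = (\<Prod>i=1..n. real (card (J i)) gchoose count \<mu> i)"
    by (simp add: binomial_gbinomial)
  also have "\<dots> = (\<Prod>i=1..n. necklace i (real q) gchoose count \<mu> i)"
    by (intro prod.cong) (auto simp: card_J)
  finally show ?thesis by (simp add: T_def)
qed

end

section \<open>Unique factorization of monic polynomials over a finite field\<close>

text \<open>A constant of its own: \<open>Polynomials.degree\<close> abbreviates
  \<open>length p - 1\<close> and would not stay folded.\<close>

definition pdeg :: "'a list \<Rightarrow> nat" where
  "pdeg p = Polynomials.degree p"

lemma pdeg_singleton [simp]: "pdeg [k] = 0" by (simp add: pdeg_def)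

locale finite_field = field R for R (structure) +
  assumes fin_carrier: "finite (carrier R)"
begin

abbreviation "RX \<equiv> poly_ring R"

sublocale UP: principal_domain RX
  by (rule univ_poly_is_principal[OF carrier_is_subfield])

definition monic :: "'a list \<Rightarrow> bool" where
  "monic p \<longleftrightarrow> p \<in> carrier RX \<and> p \<noteq> [] \<and> hd p = \<one>"

lemma mult_nonzero:
  assumes "p \<in> carrier RX" "r \<in> carrier RX" "p \<noteq> []" "r \<noteq> []"
  shows "p \<otimes>\<^bsub>RX\<^esub> r \<noteq> []" "hd (p \<otimes>\<^bsub>RX\<^esub> r) = hd p \<otimes> hd r"
    "pdeg (p \<otimes>\<^bsub>RX\<^esub> r) = pdeg p + pdeg r"
  using assms UP.integral[OF _ assms(1,2)] poly_mult_lead_coeff[OF carrier_is_subring]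
    poly_mult_degree_eq[OF carrier_is_subring]
  by (auto simp: univ_poly_mult univ_poly_zero univ_poly_carrier pdeg_def)

lemma monic_mult: "monic p \<Longrightarrow> monic r \<Longrightarrow> monic (p \<otimes>\<^bsub>RX\<^esub> r)"
  using mult_nonzero[of p r] by (auto simp: monic_def)

lemma monic_degree_mult:
  "monic p \<Longrightarrow> monic r \<Longrightarrow> pdeg (p \<otimes>\<^bsub>RX\<^esub> r) = pdeg p + pdeg r"
  using mult_nonzero[of p r] by (auto simp: monic_def)

lemma monic_one: "monic \<one>\<^bsub>RX\<^esub>"
  using UP.one_closed by (simp add: monic_def univ_poly_one)

lemma hd_nonzero: "p \<in> carrier RX \<Longrightarrow> p \<noteq> [] \<Longrightarrow> hd p \<in> carrier R - {\<zero>}"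
  by (cases p) (auto simp: univ_poly_carrier[symmetric] polynomial_def)

lemma const_carrier: "k \<in> carrier R - {\<zero>} \<Longrightarrow> [k] \<in> carrier RX"
  by (auto simp: univ_poly_carrier[symmetric] polynomial_def)

lemma monic_const_mult:
  assumes "k \<in> carrier R - {\<zero>}" "monic p" "monic ([k] \<otimes>\<^bsub>RX\<^esub> p)"
  shows "[k] \<otimes>\<^bsub>RX\<^esub> p = p"
proof -
  have "k \<otimes> \<one> = \<one>" using assms mult_nonzero(2)[of "[k]" p] const_carrier by (auto simp: monic_def)
  then have "[k] = \<one>\<^bsub>RX\<^esub>" using assms(1) by (simp add: univ_poly_one)
  then show ?thesis using assms(2) by (simp add: monic_def)
qed

lemma monic_degree_0: "monic p \<Longrightarrow> pdeg p = 0 \<Longrightarrow> p = \<one>\<^bsub>RX\<^esub>"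
  by (cases p) (auto simp: monic_def univ_poly_one pdeg_def)

lemma card_monic: "finite {p. monic p \<and> pdeg p = n}"
    "card {p. monic p \<and> pdeg p = n} = card (carrier R) ^ n"
proof -
  have eq: "{p. monic p \<and> pdeg p = n} =
      (\<lambda>xs. \<one> # xs) ` {xs. set xs \<subseteq> carrier R \<and> length xs = n}"
  proof (intro equalityI subsetI)
    fix p assume "p \<in> {p. monic p \<and> pdeg p = n}"
    then show "p \<in> (\<lambda>xs. \<one> # xs) ` {xs. set xs \<subseteq> carrier R \<and> length xs = n}"
      by (cases p) (auto simp: monic_def univ_poly_carrier[symmetric] polynomial_def pdeg_def)
  qed (auto simp: monic_def univ_poly_carrier[symmetric] polynomial_def pdeg_def)
  show "finite {p. monic p \<and> pdeg p = n}"
    unfolding eq using finite_lists_length_eq[OF fin_carrier] by simp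
  show "card {p. monic p \<and> pdeg p = n} = card (carrier R) ^ n"
    unfolding eq by (subst card_image) (auto simp: inj_on_def card_lists_length_eq[OF fin_carrier])
qed

definition Irred :: "'a list set" where
  "Irred = {g. monic g \<and> pirreducible (carrier R) g}"

lemma IrredD: "g \<in> Irred \<Longrightarrow> monic g" "g \<in> Irred \<Longrightarrow> g \<in> carrier RX"
    "g \<in> Irred \<Longrightarrow> pirreducible (carrier R) g"
  by (auto simp: Irred_def monic_def)

lemma Irred_degree: "g \<in> Irred \<Longrightarrow> pdeg g > 0"
  using pirreducible_degree[OF carrier_is_subfield, of g] by (auto simp: Irred_def monic_def pdeg_def)

lemma Irred_pdivides_eq:
  assumes "g \<in> Irred" "h \<in> Irred" "g pdivides h"
  shows "g = h"
proof -
  note c = IrredD(2)[OF assms(1)] IrredD(2)[OF assms(2)]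
  have "g divides\<^bsub>RX\<^esub> h" using assms(3) by (simp add: pdivides_def)
  then have "g \<in> Units RX \<or> g \<sim>\<^bsub>RX\<^esub> h"
    using divides_pirreducible_condition[OF IrredD(3)[OF assms(2)] c(1)] by simp
  moreover have "g \<notin> Units RX"
    using pirreducibleE(2)[OF carrier_is_subring c(1) IrredD(3)[OF assms(1)]] .
  ultimately obtain k where "k \<in> carrier R - {\<zero>}" "g = [k] \<otimes>\<^bsub>RX\<^esub> h"
    using associated_polynomials_iff[OF carrier_is_subfield c] by blast
  then show ?thesis using monic_const_mult[of k h] IrredD(1) assms(1,2) by simp
qed

text \<open>\<open>finprod\<close> runs over sets, so multiplicities are put into exponents.\<close>

definition mprod :: "'a list multiset \<Rightarrow> 'a list" where
  "mprod m = finprod RX (\<lambda>g. g [^]\<^bsub>RX\<^esub> count m g) (set_mset m)"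

lemma mprod_empty: "mprod {#} = \<one>\<^bsub>RX\<^esub>" by (simp add: mprod_def)

lemma mprod_add:
  assumes "set_mset m \<subseteq> carrier RX" "g \<in> carrier RX"
  shows "mprod (add_mset g m) = g \<otimes>\<^bsub>RX\<^esub> mprod m"
proof -
  define A where "A = set_mset m - {g}"
  have A: "finite A" "g \<notin> A" "A \<subseteq> carrier RX" using assms by (auto simp: A_def)
  have eq: "finprod RX (\<lambda>h. h [^]\<^bsub>RX\<^esub> count (add_mset g m) h) A = finprod RX (\<lambda>h. h [^]\<^bsub>RX\<^esub> count m h) A"
    using A by (intro UP.finprod_cong') auto
  have fc: "finprod RX (\<lambda>h. h [^]\<^bsub>RX\<^esub> count m h) A \<in> carrier RX"
    using A by (intro UP.finprod_closed) auto
  have "mprod (add_mset g m) = finprod RX (\<lambda>h. h [^]\<^bsub>RX\<^esub> count (add_mset g m) h) (insert g A)"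
    by (simp add: mprod_def A_def)
  also have "\<dots> = g [^]\<^bsub>RX\<^esub> Suc (count m g) \<otimes>\<^bsub>RX\<^esub> finprod RX (\<lambda>h. h [^]\<^bsub>RX\<^esub> count m h) A"
  proof -
    have "finprod RX (\<lambda>h. h [^]\<^bsub>RX\<^esub> count (add_mset g m) h) (insert g A) =
        g [^]\<^bsub>RX\<^esub> count (add_mset g m) g \<otimes>\<^bsub>RX\<^esub> finprod RX (\<lambda>h. h [^]\<^bsub>RX\<^esub> count (add_mset g m) h) A"
      using A assms(2) by (intro UP.finprod_insert) auto
    then show ?thesis unfolding eq by simp
  qed
  also have "\<dots> = g \<otimes>\<^bsub>RX\<^esub> (g [^]\<^bsub>RX\<^esub> count m g \<otimes>\<^bsub>RX\<^esub> finprod RX (\<lambda>h. h [^]\<^bsub>RX\<^esub> count m h) A)"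
    using assms(2) fc by (simp add: UP.m_ac)
  also have "g [^]\<^bsub>RX\<^esub> count m g \<otimes>\<^bsub>RX\<^esub> finprod RX (\<lambda>h. h [^]\<^bsub>RX\<^esub> count m h) A = mprod m"
  proof (cases "g \<in># m")
    case True
    then have e: "set_mset m = insert g A" by (auto simp: A_def)
    show ?thesis
      unfolding mprod_def e by (rule UP.finprod_insert[symmetric]) (use A assms(2) in auto)
  next
    case False
    then have "set_mset m = A" "count m g = 0" by (auto simp: A_def not_in_iff)
    then show ?thesis using fc by (simp add: mprod_def)
  qed
  finally show ?thesis .
qed

lemma mprod_monic:
  "set_mset m \<subseteq> Irred \<Longrightarrow> monic (mprod m) \<and> pdeg (mprod m) = (\<Sum>g\<in>#m. pdeg g)"
proof (induction m)
  case (add g m)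
  have "set_mset m \<subseteq> carrier RX" using add.prems IrredD(2) by auto
  then show ?case
    using add mprod_add[of m g] IrredD[of g] monic_mult[of g "mprod m"] monic_degree_mult[of g "mprod m"] by auto
qed (simp add: mprod_empty monic_one, simp add: univ_poly_one pdeg_def)

lemma Irred_divides_mprod:
  assumes "g \<in> Irred" "set_mset m \<subseteq> Irred" "g pdivides (mprod m)"
  shows "g \<in># m"
  using assms(2,3)
proof (induction m)
  case empty
  have "g divides\<^bsub>RX\<^esub> \<one>\<^bsub>RX\<^esub>" using empty by (simp add: mprod_empty pdivides_def)
  then have "g \<in> Units RX" using UP.unit_divides UP.Unit_eq_dividesone IrredD(2)[OF assms(1)] by blast
  then show ?case
    using pirreducibleE(2)[OF carrier_is_subring IrredD(2,3)[OF assms(1)]] by blast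
next
  case (add h m)
  have h: "h \<in> Irred" "set_mset m \<subseteq> carrier RX" "set_mset m \<subseteq> Irred" using add.prems(1) IrredD(2) by auto
  have pr: "pprime (carrier R) g"
    using pprime_iff_pirreducible[OF carrier_is_subfield IrredD(2)[OF assms(1)]] IrredD(3)[OF assms(1)] by blast
  have "g pdivides (h \<otimes>\<^bsub>RX\<^esub> mprod m)" using add.prems(2) mprod_add[OF h(2) IrredD(2)[OF h(1)]] by simp
  moreover have "mprod m \<in> carrier RX" using mprod_monic[OF h(3)] by (simp add: monic_def)
  ultimately have "g pdivides h \<or> g pdivides (mprod m)"
    using pprimeE(3)[OF carrier_is_subfield IrredD(2)[OF assms(1)] pr IrredD(2)[OF h(1)]] by blast
  then show ?case using Irred_pdivides_eq[OF assms(1) h(1)] add.IH[OF h(3)] by auto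
qed

text \<open>One irreducible is cancelled at a time: it divides the other product, hence occurs among
  its factors, since irreducible polynomials over a field are prime.\<close>

lemma mprod_inj:
  "set_mset m \<subseteq> Irred \<Longrightarrow> set_mset m' \<subseteq> Irred \<Longrightarrow> mprod m = mprod m' \<Longrightarrow> m = m'"
proof (induction m arbitrary: m')
  case empty
  have "m' = {#}"
  proof (rule ccontr)
    assume "m' \<noteq> {#}"
    then obtain g r where r: "m' = add_mset g r" by (meson multiset_cases)
    have "pdeg (mprod m') = 0" using mprod_monic[of "{#}"] empty(3) by simp
    then have "pdeg g = 0" using mprod_monic[OF empty(2)] r by simp
    then show False using Irred_degree[of g] empty(2) r by simp
  qed
  then show ?case by simp
next
  case (add g m)
  have g: "g \<in> Irred" "set_mset m \<subseteq> Irred" "set_mset m \<subseteq> carrier RX" using add.prems(1) IrredD(2) by auto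
  have c: "mprod m \<in> carrier RX" using mprod_monic[OF g(2)] by (simp add: monic_def)
  have "mprod m' = g \<otimes>\<^bsub>RX\<^esub> mprod m" using add.prems(3) mprod_add[OF g(3) IrredD(2)[OF g(1)]] by simp
  then have "g pdivides (mprod m')" using c by (auto simp: pdivides_def)
  then have "g \<in># m'" using Irred_divides_mprod[OF g(1) add.prems(2)] by blast
  then obtain r where r: "m' = add_mset g r" by (meson multi_member_split)
  have rI: "set_mset r \<subseteq> Irred" "set_mset r \<subseteq> carrier RX" using add.prems(2) r IrredD(2) by auto
  have c': "mprod r \<in> carrier RX" using mprod_monic[OF rI(1)] by (simp add: monic_def)
  have "g \<otimes>\<^bsub>RX\<^esub> mprod m = g \<otimes>\<^bsub>RX\<^esub> mprod r"
    using \<open>mprod m' = g \<otimes>\<^bsub>RX\<^esub> mprod m\<close> mprod_add[OF rI(2) IrredD(2)[OF g(1)]] r by simp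
  moreover have "g \<noteq> \<zero>\<^bsub>RX\<^esub>" using IrredD(1)[OF g(1)] by (simp add: monic_def univ_poly_zero)
  ultimately have "mprod m = mprod r" using UP.m_lcancel[OF _ IrredD(2)[OF g(1)] c c'] by blast
  then show ?case using add.IH[OF g(2) rI(1)] r by simp
qed

lemma mprod_union:
  assumes "set_mset m \<subseteq> carrier RX" "set_mset m' \<subseteq> carrier RX"
  shows "mprod (m + m') = mprod m \<otimes>\<^bsub>RX\<^esub> mprod m' \<and> mprod m \<in> carrier RX \<and> mprod m' \<in> carrier RX"
proof -
  have cl: "mprod r \<in> carrier RX" if "set_mset r \<subseteq> carrier RX" for r
    using that unfolding mprod_def by (intro UP.finprod_closed) auto
  show ?thesis using assms
    by (induction m) (auto simp: mprod_empty mprod_add cl UP.m_assoc)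
qed

text \<open>Strong induction on the degree. The factors of a reducible \<open>p\<close> are made
  monic by the inverses \<open>k\<close>, \<open>l\<close> of their leading coefficients; the
  product of the results is \<open>[k \<otimes> l]\<close> times \<open>p\<close> and is monic, so
  it equals \<open>p\<close>.\<close>

lemma mprod_surj: "monic p \<Longrightarrow> \<exists>m. set_mset m \<subseteq> Irred \<and> mprod m = p"
proof (induction "pdeg p" arbitrary: p rule: less_induct)
  case less
  have p: "p \<in> carrier RX" "p \<noteq> []" "hd p = \<one>" using less.prems by (auto simp: monic_def)
  consider "pdeg p = 0" | "p \<in> Irred" | "pdeg p > 0" "p \<notin> Irred"
    by (cases "pdeg p = 0"; cases "p \<in> Irred") auto
  then show ?case
  proof cases
    case 1
    then have "p = mprod {#}" using monic_degree_0[OF less.prems] by (simp add: mprod_empty)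
    then show ?thesis by (metis empty_subsetI set_mset_empty)
  next
    case 2
    have "mprod {#p#} = p" using mprod_add[of "{#}" p] p(1) by (simp add: mprod_empty)
    then show ?thesis using 2 by (intro exI[of _ "{#p#}"]) auto
  next
    case 3
    have units: "u \<in> Units RX \<longleftrightarrow> u \<in> carrier RX \<and> u \<noteq> [] \<and> pdeg u = 0" for u
      unfolding pdeg_def by (rule univ_poly_units'[OF carrier_is_subfield])
    have "p \<notin> Units RX" using 3 units by simp
    moreover have "\<not> pirreducible (carrier R) p" using 3 less.prems by (simp add: Irred_def)
    ultimately obtain a b where ab: "a \<in> carrier RX" "b \<in> carrier RX" "p = a \<otimes>\<^bsub>RX\<^esub> b"
        "a \<notin> Units RX" "b \<notin> Units RX"
      using pirreducibleI[OF carrier_is_subring p(1,2)] by blast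
    have nz: "a \<noteq> []" "b \<noteq> []"
      using ab p(2) UP.l_null UP.r_null by (auto simp: univ_poly_zero)
    have deg: "pdeg a > 0" "pdeg b > 0" using ab nz units by auto
    define k where "k = inv (hd a)"
    define l where "l = inv (hd b)"
    have kl: "k \<in> carrier R - {\<zero>}" "l \<in> carrier R - {\<zero>}"
      using hd_nonzero[OF ab(1) nz(1)] hd_nonzero[OF ab(2) nz(2)] Units_inv_Units
      by (simp_all add: k_def l_def field_Units)
    have "monic ([k] \<otimes>\<^bsub>RX\<^esub> a)" "pdeg ([k] \<otimes>\<^bsub>RX\<^esub> a) = pdeg a"
      using mult_nonzero[OF const_carrier[OF kl(1)] ab(1) _ nz(1)] const_carrier[OF kl(1)] ab(1)
        hd_nonzero[OF ab(1) nz(1)] by (auto simp: monic_def k_def field_Units)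
    moreover have "monic ([l] \<otimes>\<^bsub>RX\<^esub> b)" "pdeg ([l] \<otimes>\<^bsub>RX\<^esub> b) = pdeg b"
      using mult_nonzero[OF const_carrier[OF kl(2)] ab(2) _ nz(2)] const_carrier[OF kl(2)] ab(2)
        hd_nonzero[OF ab(2) nz(2)] by (auto simp: monic_def l_def field_Units)
    moreover have "pdeg p = pdeg a + pdeg b"
      using mult_nonzero(3)[OF ab(1,2) nz] ab(3) by simp
    ultimately obtain m m' where m: "set_mset m \<subseteq> Irred" "mprod m = [k] \<otimes>\<^bsub>RX\<^esub> a"
        "set_mset m' \<subseteq> Irred" "mprod m' = [l] \<otimes>\<^bsub>RX\<^esub> b"
      using less.hyps[of "[k] \<otimes>\<^bsub>RX\<^esub> a"] less.hyps[of "[l] \<otimes>\<^bsub>RX\<^esub> b"] deg by auto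
    have sub: "set_mset m \<subseteq> carrier RX" "set_mset m' \<subseteq> carrier RX" using m IrredD(2) by auto
    have mm: "mprod (m + m') = ([k] \<otimes>\<^bsub>RX\<^esub> a) \<otimes>\<^bsub>RX\<^esub> ([l] \<otimes>\<^bsub>RX\<^esub> b)"
      using mprod_union[OF sub] m by simp
    also have "\<dots> = [k] \<otimes>\<^bsub>RX\<^esub> ([l] \<otimes>\<^bsub>RX\<^esub> p)"
      using const_carrier[OF kl(1)] const_carrier[OF kl(2)] ab(1,2)
      by (simp add: ab(3) UP.m_ac)
    also have "\<dots> = ([k] \<otimes>\<^bsub>RX\<^esub> [l]) \<otimes>\<^bsub>RX\<^esub> p"
      using const_carrier[OF kl(1)] const_carrier[OF kl(2)] p(1) by (simp add: UP.m_assoc)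
    also have "[k] \<otimes>\<^bsub>RX\<^esub> [l] = [k \<otimes> l]"
    proof -
      have "length ([k] \<otimes>\<^bsub>RX\<^esub> [l]) = 1" "hd ([k] \<otimes>\<^bsub>RX\<^esub> [l]) = k \<otimes> l"
        using mult_nonzero[OF const_carrier[OF kl(1)] const_carrier[OF kl(2)]]
        by (cases "[k] \<otimes>\<^bsub>RX\<^esub> [l]"; auto simp: pdeg_def)+
      then show ?thesis by (cases "[k] \<otimes>\<^bsub>RX\<^esub> [l]") auto
    qed
    finally have e: "mprod (m + m') = [k \<otimes> l] \<otimes>\<^bsub>RX\<^esub> p" .
    have "set_mset (m + m') \<subseteq> Irred" using m by auto
    moreover have "k \<otimes> l \<in> carrier R - {\<zero>}" using kl integral by auto
    ultimately have "mprod (m + m') = p"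
      using monic_const_mult[of "k \<otimes> l" p] mprod_monic[of "m + m'"] less.prems e by simp
    then show ?thesis using \<open>set_mset (m + m') \<subseteq> Irred\<close> by blast
  qed
qed

text \<open>\<open>mprod\<close> is a bijection from multisets of monic irreducibles to monic
  polynomials, and a monic polynomial of degree \<open>n\<close> has \<open>n\<close> free
  coefficients.\<close>

sublocale W: weighted_multisets Irred pdeg "card (carrier R)"
proof
  show "card (carrier R) > 0" using fin_carrier by (auto simp: card_gt_0_iff)
  fix n
  have bij: "bij_betw mprod {m. set_mset m \<subseteq> Irred \<and> (\<Sum>x\<in>#m. pdeg x) = n}
      {p. monic p \<and> pdeg p = n}"
  proof (rule bij_betw_imageI)
    show "inj_on mprod {m. set_mset m \<subseteq> Irred \<and> (\<Sum>x\<in>#m. pdeg x) = n}"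
      using mprod_inj by (auto simp: inj_on_def)
    show "mprod ` {m. set_mset m \<subseteq> Irred \<and> (\<Sum>x\<in>#m. pdeg x) = n} =
        {p. monic p \<and> pdeg p = n}"
    proof (intro equalityI subsetI)
      fix p assume "p \<in> {p. monic p \<and> pdeg p = n}"
      then obtain m where "set_mset m \<subseteq> Irred" "mprod m = p" "pdeg p = n"
        using mprod_surj by blast
      then show "p \<in> mprod ` {m. set_mset m \<subseteq> Irred \<and> (\<Sum>x\<in>#m. pdeg x) = n}"
        using mprod_monic[of m] by auto
    qed (use mprod_monic in auto)
  qed
  show "finite {m. set_mset m \<subseteq> Irred \<and> (\<Sum>x\<in>#m. pdeg x) = n}"
    using bij_betw_finite[OF bij] card_monic(1) by blast
  show "card {m. set_mset m \<subseteq> Irred \<and> (\<Sum>x\<in>#m. pdeg x) = n} = card (carrier R) ^ n"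
    using bij_betw_same_card[OF bij] card_monic(2) by simp
qed (use Irred_degree in auto)

lemma finprod_eq_mprod:
  assumes "finite A" "A \<subseteq> Irred"
  shows "finprod RX (\<lambda>g. g) A = mprod (mset_set A)"
  unfolding mprod_def using assms IrredD(2) by (intro UP.finprod_cong') (auto simp: count_mset_set')

lemma finprod_monic:
  assumes "finite A" "A \<subseteq> Irred"
  shows "monic (finprod RX (\<lambda>g. g) A)"
    "pdeg (finprod RX (\<lambda>g. g) A) = (\<Sum>g\<in>A. pdeg g)"
  using mprod_monic[of "mset_set A"] assms by (auto simp: finprod_eq_mprod sum_unfold_sum_mset)

lemma finprod_inj:
  assumes "finite A" "A \<subseteq> Irred" "finite B" "B \<subseteq> Irred" "finprod RX (\<lambda>g. g) A = finprod RX (\<lambda>g. g) B"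
  shows "A = B"
  using mprod_inj[of "mset_set A" "mset_set B"] assms by (auto simp: finprod_eq_mprod mset_set_eq_iff)

text \<open>Squarefreeness is encoded as being a product over a set of distinct irreducibles, the
  form in which splitting types are stated too.\<close>

definition sqfree_monic :: "nat \<Rightarrow> 'a list set" where
  "sqfree_monic n = {p. pdeg p = n \<and> (\<exists>A. finite A \<and> A \<subseteq> Irred \<and> p = finprod RX (\<lambda>g. g) A)}"

definition type_monic :: "nat multiset \<Rightarrow> 'a list set" where
  "type_monic \<mu> = {p. \<exists>A. finite A \<and> A \<subseteq> Irred \<and> p = finprod RX (\<lambda>g. g) A \<and>
      \<mu> = image_mset pdeg (mset_set A)}"

lemma sqfree_monicI: "monic p \<Longrightarrow> (\<And>g. g \<in> Irred \<Longrightarrow> \<not> (g \<otimes>\<^bsub>RX\<^esub> g) pdivides p) \<Longrightarrow>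
    p \<in> sqfree_monic (pdeg p)"
proof -
  assume p: "monic p" and g: "\<And>g. g \<in> Irred \<Longrightarrow> \<not> (g \<otimes>\<^bsub>RX\<^esub> g) pdivides p"
  obtain m where m: "set_mset m \<subseteq> Irred" "mprod m = p" using mprod_surj[OF p] by blast
  have "count m h \<le> 1" for h
  proof (rule ccontr)
    assume "\<not> count m h \<le> 1"
    then have "replicate_mset 2 h \<subseteq># m" by (simp flip: count_le_replicate_mset_subset_eq)
    then obtain r where r: "m = add_mset h (add_mset h r)"
      by (auto simp: numeral_2_eq_2 elim!: mset_subset_eq_exists_conv[THEN iffD1, elim_format])
    have h: "h \<in> Irred" "set_mset r \<subseteq> carrier RX" "set_mset (add_mset h r) \<subseteq> carrier RX"
      using m r IrredD(2) by auto
    have rc: "mprod r \<in> carrier RX" using mprod_union[of r "{#}"] h by simp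
    have "p = (h \<otimes>\<^bsub>RX\<^esub> h) \<otimes>\<^bsub>RX\<^esub> mprod r"
      using m(2) r mprod_add[OF h(3) IrredD(2)[OF h(1)]] mprod_add[OF h(2) IrredD(2)[OF h(1)]] rc
        IrredD(2)[OF h(1)] by (simp add: UP.m_assoc)
    then have "(h \<otimes>\<^bsub>RX\<^esub> h) pdivides p" using rc by (auto simp: pdivides_def)
    then show False using g h by blast
  qed
  then have "m = mset_set (set_mset m)"
    by (intro multiset_eqI) (auto simp: count_mset_set' le_Suc_eq not_in_iff[symmetric] dest: le_antisym)
  then have "p = finprod RX (\<lambda>g. g) (set_mset m)" using finprod_eq_mprod[of "set_mset m"] m by simp
  then show ?thesis using m(1) unfolding sqfree_monic_def by blast
qed

lemma card_sqfree_monic: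
  assumes "n \<ge> 2"
  shows "card (sqfree_monic n) + card (carrier R) ^ (n - 1) = card (carrier R) ^ n"
proof -
  have "sqfree_monic n = finprod RX (\<lambda>g. g) ` W.sets_of_weight n"
    using finprod_monic(2) by (auto simp: sqfree_monic_def W.sets_of_weight_def)
  moreover have "inj_on (finprod RX (\<lambda>g. g)) (W.sets_of_weight n)"
    using finprod_inj by (auto simp: inj_on_def W.sets_of_weight_def)
  ultimately show ?thesis using W.card_sets_of_weight[OF assms] by (simp add: card_image)
qed

lemma card_type_monic:
  assumes "is_partition n \<mu>"
  shows "real (card (type_monic \<mu>)) = (\<Prod>i=1..n. necklace i (real (card (carrier R))) gchoose count \<mu> i)"
proof -
  define T where "T = {A. finite A \<and> A \<subseteq> Irred \<and> image_mset pdeg (mset_set A) = \<mu>}"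
  have "type_monic \<mu> = finprod RX (\<lambda>g. g) ` T"
    by (auto simp: type_monic_def T_def)
  moreover have "inj_on (finprod RX (\<lambda>g. g)) T"
    using finprod_inj by (auto simp: inj_on_def T_def)
  ultimately show ?thesis using W.card_sets_of_type[OF assms] by (simp add: card_image T_def)
qed

lemma type_monic_sqfree:
  assumes "is_partition n \<mu>"
  shows "type_monic \<mu> \<subseteq> sqfree_monic n" "type_monic \<mu> \<subseteq> {p. monic p \<and> pdeg p = n}"
  using assms finprod_monic
  by (auto simp: type_monic_def sqfree_monic_def is_partition_def sum_unfold_sum_mset)

lemma sqfree_monic_monic: "sqfree_monic n \<subseteq> {p. monic p \<and> pdeg p = n}"
  using finprod_monic by (auto simp: sqfree_monic_def)

end

section \<open>Reduction modulo a prime of a number field\<close>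

lemma ring_of_integers_simps [simp]:
  "carrier (ring_of_integers :: 'k :: field_char_0 ring) = {x. algebraic_int x}"
  "x \<otimes>\<^bsub>ring_of_integers\<^esub> y = (x * y :: 'k)" "x \<oplus>\<^bsub>ring_of_integers\<^esub> y = x + y"
  "\<one>\<^bsub>ring_of_integers\<^esub> = (1 :: 'k)" "\<zero>\<^bsub>ring_of_integers\<^esub> = (0 :: 'k)"
  by (auto simp: ring_of_integers_def ring_of_type_algebra_def)

lemma ring_of_integers_domain: "domain (ring_of_integers :: 'k :: field_char_0 ring)"
proof -
  have "cring (ring_of_integers :: 'k ring)"
  proof (rule cringI)
    show "abelian_group (ring_of_integers :: 'k ring)"
    proof (rule abelian_groupI)
      fix x :: 'k assume "x \<in> carrier ring_of_integers"
      then show "\<exists>y\<in>carrier ring_of_integers. y \<oplus>\<^bsub>ring_of_integers\<^esub> x = \<zero>\<^bsub>ring_of_integers\<^esub>"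
        by (intro bexI[of _ "- x"]) auto
    qed (auto intro: algebraic_int_plus)
    show "Group.comm_monoid (ring_of_integers :: 'k ring)"
      by (rule comm_monoidI) (auto intro: algebraic_int_times)
  qed (auto simp: algebra_simps)
  then show ?thesis by (intro domain.intro domain_axioms.intro) auto
qed

lemma ring_of_integers_a_inv:
  "algebraic_int x \<Longrightarrow> \<ominus>\<^bsub>ring_of_integers\<^esub> x = - (x :: 'k :: field_char_0)"
proof -
  assume x: "algebraic_int x"
  interpret O: domain "ring_of_integers :: 'k ring" by (rule ring_of_integers_domain)
  show ?thesis using O.minus_equality[of "- x" x] x by simp
qed

lemma primeideal_ring_of_integersI:
  fixes P :: "'k :: field_char_0 set"
  assumes "P \<subseteq> {x. algebraic_int x}" "0 \<in> P" "\<And>x y. x \<in> P \<Longrightarrow> y \<in> P \<Longrightarrow> x + y \<in> P"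
    "\<And>a x. algebraic_int a \<Longrightarrow> x \<in> P \<Longrightarrow> a * x \<in> P" "1 \<notin> P"
    "\<And>x y. algebraic_int x \<Longrightarrow> algebraic_int y \<Longrightarrow> x * y \<in> P \<Longrightarrow> x \<in> P \<or> y \<in> P"
  shows "primeideal P ring_of_integers"
proof -
  interpret O: domain "ring_of_integers :: 'k ring" by (rule ring_of_integers_domain)
  have "subgroup P (add_monoid ring_of_integers)"
  proof (rule O.add.subgroupI)
    fix x assume "x \<in> P"
    then show "\<ominus>\<^bsub>ring_of_integers\<^esub> x \<in> P"
      using assms(1) assms(4)[of "-1" x] ring_of_integers_a_inv[of x] by auto
  qed (use assms in auto)
  then have "ideal P ring_of_integers"
  proof (rule idealI[OF O.ring_axioms])
    fix a x :: 'k assume "a \<in> P" "x \<in> carrier ring_of_integers"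
    then show "x \<otimes>\<^bsub>ring_of_integers\<^esub> a \<in> P" "a \<otimes>\<^bsub>ring_of_integers\<^esub> x \<in> P"
      using assms(4)[of x a] by (auto simp: mult.commute)
  qed
  then show ?thesis
    by (rule primeidealI) (use O.cring_axioms assms in auto)
qed

text \<open>Finiteness of the residue ring takes the place of \<open>P \<noteq> {0}\<close>: a
  finite domain is a field. For nonzero primes \<open>nf_primeI\<close> derives it from an integral
  basis.\<close>

locale nf_prime =
  fixes P :: "'k :: field_char_0 set"
  assumes prime_P: "primeideal P ring_of_integers"
    and fin_res: "finite (carrier (residue_ring_at P))"
begin

abbreviation "RP \<equiv> residue_ring_at P"

sublocale PI: primeideal P ring_of_integers by (rule prime_P)

lemma P_int: "x \<in> P \<Longrightarrow> algebraic_int x"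
  using PI.a_subset by auto

lemma P_zero: "0 \<in> P"
  using additive_subgroup.zero_closed[OF PI.additive_subgroup_axioms] by simp

lemma P_add: "x \<in> P \<Longrightarrow> y \<in> P \<Longrightarrow> x + y \<in> P"
  using additive_subgroup.a_closed[OF PI.additive_subgroup_axioms, of x y] by simp

lemma P_mult: "algebraic_int a \<Longrightarrow> x \<in> P \<Longrightarrow> a * x \<in> P"
  using PI.I_l_closed[of x a] by simp

lemma P_uminus: "x \<in> P \<Longrightarrow> - x \<in> P"
  using P_mult[of "-1" x] by simp

lemma P_diff: "x \<in> P \<Longrightarrow> y \<in> P \<Longrightarrow> x - y \<in> P"
  using P_add[of x "- y"] P_uminus by simp

lemma P_sum: "(\<And>x. x \<in> B \<Longrightarrow> f x \<in> P) \<Longrightarrow> sum f B \<in> P"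
  by (induction B rule: infinite_finite_induct) (auto intro: P_zero P_add)

lemma P_one: "1 \<notin> P"
proof
  assume "1 \<in> P"
  then have "P = carrier ring_of_integers" using P_mult[of _ 1] P_int by auto
  then show False using PI.I_notcarr by simp
qed

lemma P_prime: "algebraic_int x \<Longrightarrow> algebraic_int y \<Longrightarrow> x * y \<in> P \<Longrightarrow> x \<in> P \<or> y \<in> P"
  using PI.I_prime[of x y] by simp

definition cl :: "'k \<Rightarrow> 'k set" where "cl a = P +>\<^bsub>ring_of_integers\<^esub> a"

lemma cl_alt: "cl a = (\<lambda>p. p + a) ` P"
  unfolding cl_def a_r_coset_def' by auto

lemma cl_eq_iff: "cl a = cl b \<longleftrightarrow> a - b \<in> P"
proof
  assume "cl a = cl b"
  moreover have "a \<in> cl a" unfolding cl_alt using P_zero by force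
  ultimately obtain p where "p \<in> P" "a = p + b" unfolding cl_alt by auto
  then show "a - b \<in> P" by simp
next
  have "cl a \<subseteq> cl b" if "a - b \<in> P" for a b
  proof
    fix x assume "x \<in> cl a"
    then obtain p where "p \<in> P" "x = p + a" unfolding cl_alt by auto
    then have "x = (p + (a - b)) + b" "p + (a - b) \<in> P" using that P_add by auto
    then show "x \<in> cl b" unfolding cl_alt by blast
  qed
  moreover assume "a - b \<in> P"
  moreover then have "b - a \<in> P" using P_uminus[of "a - b"] by simp
  ultimately show "cl a = cl b" by blast
qed

lemma RP_carrier: "carrier RP = cl ` {x. algebraic_int x}"
  by (auto simp: residue_ring_at_def FactRing_def A_RCOSETS_def' cl_def)

lemma RP_mult: "algebraic_int a \<Longrightarrow> algebraic_int b \<Longrightarrow> cl a \<otimes>\<^bsub>RP\<^esub> cl b = cl (a * b)"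
  using PI.rcoset_mult_add[of a b] by (simp add: residue_ring_at_def FactRing_def cl_def)

lemma RP_add: "algebraic_int a \<Longrightarrow> algebraic_int b \<Longrightarrow> cl a \<oplus>\<^bsub>RP\<^esub> cl b = cl (a + b)"
  using PI.a_rcos_sum[of a b] by (simp add: residue_ring_at_def FactRing_def cl_def)

lemma RP_one: "\<one>\<^bsub>RP\<^esub> = cl 1"
  by (simp add: residue_ring_at_def FactRing_def cl_def)

lemma RP_zero: "\<zero>\<^bsub>RP\<^esub> = cl 0"
  by (simp add: residue_ring_at_def FactRing_def cl_alt)

lemma RP_field: "field RP"
proof -
  interpret D: domain RP unfolding residue_ring_at_def by (rule PI.quotient_is_domain)
  show ?thesis
  proof (rule D.cring_fieldI2)
    fix x assume x: "x \<in> carrier RP" "x \<noteq> \<zero>\<^bsub>RP\<^esub>"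
    have "inj_on (\<lambda>y. x \<otimes>\<^bsub>RP\<^esub> y) (carrier RP)"
      using x D.m_lcancel by (auto simp: inj_on_def)
    moreover have "(\<lambda>y. x \<otimes>\<^bsub>RP\<^esub> y) ` carrier RP \<subseteq> carrier RP" using x by auto
    ultimately have "(\<lambda>y. x \<otimes>\<^bsub>RP\<^esub> y) ` carrier RP = carrier RP"
      using endo_inj_surj[OF fin_res] by blast
    then show "\<exists>b\<in>carrier RP. x \<otimes>\<^bsub>RP\<^esub> b = \<one>\<^bsub>RP\<^esub>" using D.one_closed by (metis (no_types, lifting) imageE)
  qed (rule D.zero_not_one)
qed

sublocale F: finite_field RP
  by (intro finite_field.intro RP_field finite_field_axioms.intro fin_res)

definition rep :: "'k set \<Rightarrow> 'k" where
  "rep u = (SOME a. algebraic_int a \<and> cl a = u)"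

lemma rep: "u \<in> carrier RP \<Longrightarrow> algebraic_int (rep u) \<and> cl (rep u) = u"
  unfolding rep_def by (rule someI_ex) (auto simp: RP_carrier)

lemma cl_carrier: "algebraic_int a \<Longrightarrow> cl a \<in> carrier RP"
  by (auto simp: RP_carrier)

definition intpoly :: "'k poly \<Rightarrow> bool" where
  "intpoly p \<longleftrightarrow> (\<forall>i. algebraic_int (Polynomial.coeff p i))"

lemma intpolyD: "intpoly p \<Longrightarrow> algebraic_int (Polynomial.coeff p i)" by (simp add: intpoly_def)

lemma intpoly_mult: "intpoly p \<Longrightarrow> intpoly r \<Longrightarrow> intpoly (p * r)"
  unfolding intpoly_def by (auto intro: algebraic_int_coeff_mult)

lemma intpoly_add: "intpoly p \<Longrightarrow> intpoly r \<Longrightarrow> intpoly (p + r)"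
  unfolding intpoly_def by (auto intro: algebraic_int_plus)

lemma intpoly_uminus: "intpoly p \<Longrightarrow> intpoly (- p)"
  unfolding intpoly_def by auto

lemma intpoly_1: "intpoly 1"
  unfolding intpoly_def by auto

lemma intpoly_prod: "(\<And>x. x \<in> B \<Longrightarrow> intpoly (f x)) \<Longrightarrow> intpoly (prod f B)"
  by (induction B rule: infinite_finite_induct) (auto intro: intpoly_1 intpoly_mult)

lemma intpoly_pderiv: "intpoly p \<Longrightarrow> intpoly (pderiv p)"
  unfolding intpoly_def coeff_pderiv
  by (auto intro!: algebraic_int_times simp del: of_nat_Suc)

text \<open>\<open>normalize\<close> strips leading zeros, so reduction is defined also for nonmonic
  polynomials such as derivatives and cofactors. On monic ones it agrees with
  \<open>reduce_poly\<close>.\<close>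

definition red :: "'k poly \<Rightarrow> 'k set list" where
  "red p = F.normalize (map cl (rev (coeffs p)))"

lemma red_coeff: "F.coeff (red p) i = cl (Polynomial.coeff p i)"
proof -
  have "F.coeff (red p) i = F.coeff (map cl (rev (coeffs p))) i"
    unfolding red_def using F.normalize_coeff by metis
  also have "\<dots> = cl (Polynomial.coeff p i)"
  proof (cases "i < length (coeffs p)")
    case True
    then show ?thesis
      by (subst F.coeff_nth) (auto simp: rev_nth nth_coeffs_coeff)
  next
    case False
    then have "Polynomial.coeff p i = 0" by (cases "p = 0") (auto simp: length_coeffs_degree coeff_eq_0)
    then show ?thesis using False by (subst F.coeff_length) (auto simp: RP_zero)
  qed
  finally show ?thesis .
qed

lemma red_carrier: "intpoly p \<Longrightarrow> red p \<in> carrier F.RX"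
proof -
  assume p: "intpoly p"
  have "set (map cl (rev (coeffs p))) \<subseteq> carrier RP"
    using intpolyD[OF p] by (auto simp: coeffs_def RP_carrier split: if_splits)
  then show ?thesis
    unfolding red_def univ_poly_carrier[symmetric] by (rule F.normalize_gives_polynomial)
qed

lemma RX_eqI:
  assumes "u \<in> carrier F.RX" "v \<in> carrier F.RX" "\<And>i. F.coeff u i = F.coeff v i"
  shows "u = v"
  using F.coeff_iff_polynomial_cond[of "carrier RP" u v] assms by (auto simp: univ_poly_carrier fun_eq_iff)

lemma RX_set: "u \<in> carrier F.RX \<Longrightarrow> set u \<subseteq> carrier RP"
  by (auto simp: univ_poly_carrier[symmetric] polynomial_def)

lemma red_eq_iff:
  assumes "intpoly p" "intpoly r"
  shows "red p = red r \<longleftrightarrow> (\<forall>i. Polynomial.coeff p i - Polynomial.coeff r i \<in> P)"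
  using RX_eqI[OF red_carrier[OF assms(1)] red_carrier[OF assms(2)]] red_coeff cl_eq_iff by metis

lemma red_add: "intpoly p \<Longrightarrow> intpoly r \<Longrightarrow> red (p + r) = red p \<oplus>\<^bsub>F.RX\<^esub> red r"
proof (rule RX_eqI)
  assume pr: "intpoly p" "intpoly r"
  show "red (p + r) \<in> carrier F.RX" "red p \<oplus>\<^bsub>F.RX\<^esub> red r \<in> carrier F.RX"
    using pr red_carrier intpoly_add F.UP.add.m_closed by auto
  fix i
  show "F.coeff (red (p + r)) i = F.coeff (red p \<oplus>\<^bsub>F.RX\<^esub> red r) i"
    using F.poly_add_coeff[of "red p" "red r"] RX_set[OF red_carrier] pr
    by (simp add: univ_poly_add red_coeff RP_add intpolyD)
qed

lemma finsum_cl: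
  assumes "finite B" "\<And>x. x \<in> B \<Longrightarrow> algebraic_int (f x)"
  shows "finsum RP (\<lambda>x. cl (f x)) B = cl (sum f B)"
  using assms
proof (induction B rule: finite_induct)
  case empty
  then show ?case by (simp add: RP_zero)
next
  case (insert x B)
  then have "finsum RP (\<lambda>x. cl (f x)) (insert x B) = cl (f x) \<oplus>\<^bsub>RP\<^esub> finsum RP (\<lambda>x. cl (f x)) B"
    by (intro F.finsum_insert) (auto intro: cl_carrier)
  then show ?case using insert by (simp add: RP_add algebraic_int_sum)
qed

lemma red_mult: "intpoly p \<Longrightarrow> intpoly r \<Longrightarrow> red (p * r) = red p \<otimes>\<^bsub>F.RX\<^esub> red r"
proof (rule RX_eqI)
  assume pr: "intpoly p" "intpoly r"
  show "red (p * r) \<in> carrier F.RX" "red p \<otimes>\<^bsub>F.RX\<^esub> red r \<in> carrier F.RX"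
    using pr red_carrier intpoly_mult by auto
  fix i
  have "F.coeff (red p \<otimes>\<^bsub>F.RX\<^esub> red r) i =
      finsum RP (\<lambda>k. cl (Polynomial.coeff p k) \<otimes>\<^bsub>RP\<^esub> cl (Polynomial.coeff r (i - k))) {..i}"
    using F.poly_mult_coeff[of "red p" "red r"] RX_set[OF red_carrier] pr
    by (simp add: univ_poly_mult red_coeff)
  also have "\<dots> = finsum RP (\<lambda>k. cl (Polynomial.coeff p k * Polynomial.coeff r (i - k))) {..i}"
    using pr by (simp add: RP_mult intpolyD)
  also have "\<dots> = cl (Polynomial.coeff (p * r) i)"
    unfolding coeff_mult using pr by (intro finsum_cl) (auto intro: algebraic_int_times intpolyD)
  finally show "F.coeff (red (p * r)) i = F.coeff (red p \<otimes>\<^bsub>F.RX\<^esub> red r) i" by (simp add: red_coeff)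
qed

lemma red_0: "red 0 = \<zero>\<^bsub>F.RX\<^esub>"
  by (simp add: red_def univ_poly_zero)

lemma reduce_poly_eq_red:
  assumes "Polynomial.lead_coeff p = 1"
  shows "reduce_poly P p = red p" "intpoly p \<Longrightarrow> F.monic (red p)"
    "pdeg (red p) = Polynomial.degree p"
proof -
  have p0: "p \<noteq> 0" using assms by auto
  then have hd: "hd (map cl (rev (coeffs p))) = cl 1"
    using assms by (simp add: hd_map hd_rev last_coeffs_eq_coeff_degree)
  moreover have "cl 1 \<noteq> cl 0" using cl_eq_iff[of 1 0] P_one by simp
  ultimately have n: "F.normalize (map cl (rev (coeffs p))) = map cl (rev (coeffs p))"
    using p0 by (cases "map cl (rev (coeffs p))") (auto simp: RP_zero)
  then show "reduce_poly P p = red p" by (simp add: reduce_poly_def red_def cl_def)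
  show "pdeg (red p) = Polynomial.degree p"
    unfolding red_def n using p0 by (simp add: pdeg_def degree_eq_length_coeffs)
  show "F.monic (red p)" if "intpoly p"
    using red_carrier[OF that] hd p0 unfolding F.monic_def red_def n RP_one by auto
qed

lemma red_monic: "intpoly p \<Longrightarrow> Polynomial.lead_coeff p = 1 \<Longrightarrow> F.monic (red p)"
  using reduce_poly_eq_red(2) by blast

lemma lift_monic:
  assumes "F.monic g"
  obtains p where "intpoly p" "red p = g" "Polynomial.lead_coeff p = 1" "Polynomial.degree p = pdeg g"
proof -
  define n where "n = pdeg g"
  have g: "g \<in> carrier F.RX" "g \<noteq> []" "hd g = \<one>\<^bsub>RP\<^esub>" using assms by (auto simp: F.monic_def)
  have gc: "F.coeff g i \<in> carrier RP" for i using F.coeff_in_carrier[OF RX_set[OF g(1)]] .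
  define s where "s = (\<Sum>i<n. Polynomial.monom (rep (F.coeff g i)) i)"
  define p where "p = Polynomial.monom 1 n + s"
  have s: "Polynomial.coeff s i = (if i < n then rep (F.coeff g i) else 0)" for i
    by (auto simp: s_def coeff_sum)
  have pc: "Polynomial.coeff p i = (if i < n then rep (F.coeff g i) else if i = n then 1 else 0)" for i
    by (auto simp: p_def s)
  have dp: "Polynomial.degree p = n"
    by (rule antisym) (auto intro!: degree_le le_degree simp: pc)
  have pint: "intpoly p" unfolding intpoly_def pc using rep[OF gc] by auto
  have "red p = g"
  proof (rule RX_eqI[OF red_carrier[OF pint] g(1)])
    fix i
    have len: "length g = Suc n" using g(2) by (cases g) (auto simp: n_def pdeg_def)
    consider "i < n" | "i = n" | "i > n" by linarith
    then show "F.coeff (red p) i = F.coeff g i"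
    proof cases
      case 1
      then show ?thesis using rep[OF gc] by (simp add: red_coeff pc)
    next
      case 2
      have "F.coeff g n = \<one>\<^bsub>RP\<^esub>" using F.lead_coeff_simp[OF g(2)] g(3) by (simp add: n_def pdeg_def)
      then show ?thesis using 2 by (simp add: red_coeff pc RP_one)
    next
      case 3
      then show ?thesis using F.coeff_length[of g i] len by (simp add: red_coeff pc RP_zero)
    qed
  qed
  then show ?thesis using that pint dp by (simp add: pc n_def)
qed

lemma lift:
  assumes "g \<in> carrier F.RX"
  obtains p where "intpoly p" "red p = g"
proof -
  have gc: "F.coeff g i \<in> carrier RP" for i using F.coeff_in_carrier[OF RX_set[OF assms]] .
  define p where "p = (\<Sum>i<length g. Polynomial.monom (rep (F.coeff g i)) i)"
  have pc: "Polynomial.coeff p i = (if i < length g then rep (F.coeff g i) else 0)" for i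
    by (auto simp: p_def coeff_sum)
  have pint: "intpoly p" unfolding intpoly_def pc using rep[OF gc] by auto
  have "red p = g"
  proof (rule RX_eqI[OF red_carrier[OF pint] assms])
    fix i show "F.coeff (red p) i = F.coeff g i"
      using rep[OF gc, of i] F.coeff_length[of g i] by (auto simp: red_coeff pc RP_zero)
  qed
  then show ?thesis using that pint by blast
qed

text \<open>Derivatives are formed in characteristic 0; this compatibility lets them decide
  multiplicities modulo \<open>P\<close>.\<close>

lemma red_pderiv:
  assumes "intpoly p" "intpoly r" "red p = red r"
  shows "red (pderiv p) = red (pderiv r)"
proof -
  have "Polynomial.coeff (pderiv p) i - Polynomial.coeff (pderiv r) i \<in> P" for i
  proof -
    have "of_nat (Suc i) * (Polynomial.coeff p (Suc i) - Polynomial.coeff r (Suc i)) \<in> P"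
      using assms red_eq_iff by (intro P_mult int_imp_algebraic_int) auto
    then show ?thesis by (simp add: coeff_pderiv algebra_simps)
  qed
  then show ?thesis using red_eq_iff assms intpoly_pderiv by blast
qed

end

section \<open>The Frobenius orbits on the roots\<close>

locale nf_prime_over = nf_prime P for P :: "'k :: field_char_0 set" +
  fixes Q :: "'k alg_closure set"
  assumes prime_Q: "integer_prime Q"
    and over: "Q \<inter> to_ac ` {x. algebraic_int x} = to_ac ` P"

lemma (in nf_prime) ex_prime_over: "\<exists>Q. nf_prime_over P Q"
proof -
  obtain Q where Q: "integer_prime Q" "Q \<inter> to_ac ` {x. algebraic_int x} = to_ac ` P"
  proof (rule lying_over[of "to_ac ` {x :: 'k. algebraic_int x}" "to_ac ` P"])
    show "of_int k \<in> to_ac ` {x :: 'k. algebraic_int x}" for k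
      using algebraic_int_of_int'[of k] by (intro image_eqI[of _ _ "of_int k"]) auto
    show "(1 :: 'k alg_closure) \<in> to_ac ` {x :: 'k. algebraic_int x}"
      by (intro image_eqI[of _ _ 1]) auto
    show "(0 :: 'k alg_closure) \<in> to_ac ` P" using P_zero by (intro image_eqI[of _ _ 0]) auto
    show "(1 :: 'k alg_closure) \<notin> to_ac ` P" using P_one by auto
    fix a b
    show "a + b \<in> to_ac ` {x :: 'k. algebraic_int x}" "a * b \<in> to_ac ` {x :: 'k. algebraic_int x}"
      if ab: "a \<in> to_ac ` {x. algebraic_int x}" "b \<in> to_ac ` {x. algebraic_int x}"
    proof -
      obtain u v where "a = to_ac u" "b = to_ac v" "algebraic_int u" "algebraic_int v" using ab by auto
      then show "a + b \<in> to_ac ` {x. algebraic_int x}" "a * b \<in> to_ac ` {x. algebraic_int x}"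
        using algebraic_int_plus[of u v] algebraic_int_times[of u v]
        by (auto simp flip: to_ac_add to_ac_mult)
    qed
    show "a + b \<in> to_ac ` P" if ab: "a \<in> to_ac ` P" "b \<in> to_ac ` P"
      using ab P_add by (auto simp flip: to_ac_add)
    show "a * b \<in> to_ac ` P" if ab: "a \<in> to_ac ` {x. algebraic_int x}" "b \<in> to_ac ` P"
      using ab P_mult by (auto simp flip: to_ac_mult)
    show "a \<in> to_ac ` P \<or> b \<in> to_ac ` P"
      if ab: "a \<in> to_ac ` {x. algebraic_int x}" "b \<in> to_ac ` {x. algebraic_int x}" "a * b \<in> to_ac ` P"
      using ab P_prime by (force simp flip: to_ac_mult)
  qed (use P_int in auto)
  then show ?thesis
    using nf_prime_axioms by (auto simp: nf_prime_over_def nf_prime_over_axioms_def)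
qed

context nf_prime_over
begin

lemma Q_iff: "algebraic_int a \<Longrightarrow> to_ac a \<in> Q \<longleftrightarrow> a \<in> P"
proof -
  assume "algebraic_int a"
  then have "to_ac a \<in> Q \<longleftrightarrow> to_ac a \<in> Q \<inter> to_ac ` {x. algebraic_int x}" by blast
  also have "\<dots> \<longleftrightarrow> a \<in> P" unfolding over by auto
  finally show ?thesis .
qed

lemma PQ: "a \<in> P \<Longrightarrow> to_ac a \<in> Q" using over by blast

abbreviation "q \<equiv> card (carrier RP)"

text \<open>Since \<open>Q\<close> lies over \<open>P\<close>, the classes of the ring of integers
  modulo \<open>Q\<close> are its classes modulo \<open>P\<close>; so the Frobenius exponent is the
  norm of \<open>P\<close>.\<close>

sublocale residue_prime Q "to_ac ` {x. algebraic_int x}" "(\<lambda>u. to_ac (rep u)) ` carrier RP" q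
proof (intro residue_prime.intro prime_Q residue_prime_axioms.intro)
  have inj: "u = v" if "u \<in> carrier RP" "v \<in> carrier RP" "to_ac (rep u) - to_ac (rep v) \<in> Q" for u v
  proof -
    have "rep u - rep v \<in> P"
      using that rep[OF that(1)] rep[OF that(2)] Q_iff[OF algebraic_int_diff, of "rep u" "rep v"] by simp
    then show ?thesis using cl_eq_iff rep that by metis
  qed
  have "inj_on (\<lambda>u. to_ac (rep u)) (carrier RP)"
    using inj integer_ideal.zero_mem[OF integer_prime.axioms(1)[OF prime_Q]] by (auto simp: inj_on_def)
  then show "card ((\<lambda>u. to_ac (rep u)) ` carrier RP) = q" by (rule card_image)
  show "finite ((\<lambda>u. to_ac (rep u)) ` carrier RP)" using fin_res by simp
  show "(\<lambda>u. to_ac (rep u)) ` carrier RP \<subseteq> to_ac ` {x. algebraic_int x}" using rep by auto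
  show "\<And>s t. s \<in> (\<lambda>u. to_ac (rep u)) ` carrier RP \<Longrightarrow> t \<in> (\<lambda>u. to_ac (rep u)) ` carrier RP \<Longrightarrow>
      s - t \<in> Q \<Longrightarrow> s = t" using inj by blast
  show "\<exists>s\<in>(\<lambda>u. to_ac (rep u)) ` carrier RP. a - s \<in> Q" if a: "a \<in> to_ac ` {x. algebraic_int x}" for a
  proof -
    obtain u where u: "a = to_ac u" "algebraic_int u" using a by auto
    then have "u - rep (cl u) \<in> P" using rep[OF cl_carrier[OF u(2)]] cl_eq_iff by metis
    then have "to_ac u - to_ac (rep (cl u)) \<in> Q" using PQ[of "u - rep (cl u)"] by simp
    then show ?thesis using u cl_carrier by blast
  qed
  show "(1 :: 'k alg_closure) \<in> to_ac ` {x :: 'k. algebraic_int x}"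
    by (intro image_eqI[of _ _ 1]) auto
  show "of_int k \<in> to_ac ` {x :: 'k. algebraic_int x}" for k
    using algebraic_int_of_int'[of k] by (intro image_eqI[of _ _ "of_int k"]) auto
  fix a b assume ab: "a \<in> to_ac ` {x :: 'k. algebraic_int x}" "b \<in> to_ac ` {x :: 'k. algebraic_int x}"
  then obtain u v where "a = to_ac u" "b = to_ac v" "algebraic_int u" "algebraic_int v" by auto
  then show "a + b \<in> to_ac ` {x. algebraic_int x}" "a * b \<in> to_ac ` {x. algebraic_int x}"
    using algebraic_int_plus[of u v] algebraic_int_times[of u v]
    by (auto simp flip: to_ac_add to_ac_mult)
qed auto

definition ev :: "'k poly \<Rightarrow> 'k alg_closure \<Rightarrow> 'k alg_closure" where
  "ev p x = poly (map_poly to_ac p) x"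

lemma ev_mult: "ev (p * r) x = ev p x * ev r x"
proof -
  have "map_poly to_ac (p * r) = map_poly to_ac p * map_poly to_ac r"
    by (intro poly_eqI) (simp add: coeff_map_poly coeff_mult to_ac_sum)
  then show ?thesis by (simp add: ev_def)
qed

lemma ev_add: "ev (p + r) x = ev p x + ev r x"
proof -
  have "map_poly to_ac (p + r) = map_poly to_ac p + map_poly to_ac r"
    by (intro poly_eqI) (simp add: coeff_map_poly)
  then show ?thesis by (simp add: ev_def)
qed

lemma ev_1: "ev 1 x = 1"
  by (simp add: ev_def)

lemma ev_uminus: "ev (- p) x = - ev p x"
  using ev_add[of "- p" p x] by (simp add: ev_def eq_neg_iff_add_eq_0)

lemma ev_prod: "ev (prod f B) x = (\<Prod>b\<in>B. ev (f b) x)"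
  by (induction B rule: infinite_finite_induct) (auto simp: ev_mult ev_1)

lemma coeff_map_ac: "Polynomial.coeff (map_poly to_ac p) i = to_ac (Polynomial.coeff p i)"
  by (simp add: coeff_map_poly)

lemma ev_int: "intpoly p \<Longrightarrow> algebraic_int x \<Longrightarrow> algebraic_int (ev p x)"
  unfolding ev_def by (intro algebraic_int_poly) (auto simp: coeff_map_ac intpolyD)

lemma ev_cong:
  assumes "intpoly p" "intpoly r" "red p = red r" "x - y \<in> Q" "algebraic_int y"
  shows "ev p x - ev r y \<in> Q"
  unfolding ev_def
proof (rule cong_poly)
  fix i
  have "Polynomial.coeff p i - Polynomial.coeff r i \<in> P" using assms red_eq_iff by blast
  from PQ[OF this] show "Polynomial.coeff (map_poly to_ac p) i - Polynomial.coeff (map_poly to_ac r) i \<in> Q"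
    by (simp add: coeff_map_ac)
  show "algebraic_int (Polynomial.coeff (map_poly to_ac r) i)"
    using intpolyD[OF assms(2)] by (simp add: coeff_map_ac)
qed (use assms in auto)

lemma ev_memI:
  assumes "intpoly p" "intpoly r" "red p = red r" "x - y \<in> Q" "algebraic_int y" "ev r y \<in> Q"
  shows "ev p x \<in> Q"
  using add_mem[OF ev_cong[OF assms(1-5)] assms(6)] by simp

lemma ev_same: "intpoly p \<Longrightarrow> intpoly r \<Longrightarrow> red p = red r \<Longrightarrow> algebraic_int x \<Longrightarrow> ev r x \<in> Q \<Longrightarrow> ev p x \<in> Q"
  using ev_memI[of p r x x] zero_mem by simp

text \<open>\<open>g\<close> is the minimal polynomial of \<open>x\<close> modulo \<open>Q\<close>:
  the reductions of the integral polynomials that vanish at \<open>x\<close> modulo \<open>Q\<close>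
  form a proper ideal, which contains the maximal ideal generated by \<open>g\<close> and hence
  equals it.\<close>

lemma irred_divides:
  assumes g: "g \<in> F.Irred" and p: "intpoly p" "red p = g" and x: "algebraic_int x" "ev p x \<in> Q"
    and h: "intpoly h" "ev h x \<in> Q"
  shows "g pdivides\<^bsub>RP\<^esub> (red h)"
proof -
  interpret MI: maximalideal "PIdl\<^bsub>F.RX\<^esub> g" F.RX
    using F.UP.irreducible_imp_maximalideal[OF F.IrredD(2)[OF g] F.IrredD(3)[OF g]] .
  define I where "I = {u. \<exists>p. intpoly p \<and> red p = u \<and> ev p x \<in> Q}"
  have Ic: "I \<subseteq> carrier F.RX" using red_carrier by (auto simp: I_def)
  have Iu: "red (- p) = \<ominus>\<^bsub>F.RX\<^esub> red p" if p: "intpoly p" for p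
  proof -
    have "red (- p) \<oplus>\<^bsub>F.RX\<^esub> red p = \<zero>\<^bsub>F.RX\<^esub>"
      using red_add[OF intpoly_uminus[OF p] p] by (simp add: red_0)
    then show ?thesis
      using F.UP.minus_equality red_carrier p intpoly_uminus by metis
  qed
  have idl: "ideal I F.RX"
  proof (rule idealI[OF F.UP.ring_axioms])
    show "subgroup I (add_monoid F.RX)"
    proof (rule F.UP.add.subgroupI[OF Ic])
      show "I \<noteq> {}" using p x by (auto simp: I_def)
      fix a assume "a \<in> I"
      then obtain r where r: "intpoly r" "red r = a" "ev r x \<in> Q" by (auto simp: I_def)
      then show "\<ominus>\<^bsub>F.RX\<^esub> a \<in> I"
        using Iu[OF r(1)] intpoly_uminus uminus_mem unfolding I_def by (auto intro!: exI[of _ "- r"] simp: ev_uminus)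
      fix b assume "b \<in> I"
      then obtain s where s: "intpoly s" "red s = b" "ev s x \<in> Q" by (auto simp: I_def)
      show "a \<oplus>\<^bsub>F.RX\<^esub> b \<in> I"
        using r s red_add[OF r(1) s(1)] intpoly_add add_mem unfolding I_def by (auto intro!: exI[of _ "r + s"] simp: ev_add)
    qed
    fix a y assume "a \<in> I" and y: "y \<in> carrier F.RX"
    then obtain r where r: "intpoly r" "red r = a" "ev r x \<in> Q" by (auto simp: I_def)
    obtain s where s: "intpoly s" "red s = y" using lift[OF y] by blast
    have "ev (s * r) x \<in> Q" using mult_mem ev_int[OF s(1) x(1)] r by (simp add: ev_mult)
    then show "y \<otimes>\<^bsub>F.RX\<^esub> a \<in> I"
      using red_mult[OF s(1) r(1)] intpoly_mult[OF s(1) r(1)] s r unfolding I_def by (auto intro!: exI[of _ "s * r"])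
    then show "a \<otimes>\<^bsub>F.RX\<^esub> y \<in> I" using F.UP.m_comm[of a y] subsetD[OF Ic \<open>a \<in> I\<close>] y by simp
  qed
  have gI: "g \<in> I" using p x by (auto simp: I_def)
  have oneI: "\<one>\<^bsub>F.RX\<^esub> \<notin> I"
  proof
    assume "\<one>\<^bsub>F.RX\<^esub> \<in> I"
    then obtain r where r: "intpoly r" "red r = \<one>\<^bsub>F.RX\<^esub>" "ev r x \<in> Q" by (auto simp: I_def)
    have "red 1 = \<one>\<^bsub>F.RX\<^esub>"
      using F.monic_degree_0[OF red_monic[OF intpoly_1]] reduce_poly_eq_red(3)[of 1] by simp
    then have "ev 1 x \<in> Q" using ev_same[OF intpoly_1 r(1) _ x(1) r(3)] r(2) by simp
    then show False using one_not_mem by (simp add: ev_1)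
  qed
  have "PIdl\<^bsub>F.RX\<^esub> g \<subseteq> I" by (rule F.UP.cgenideal_minimal[OF idl gI])
  then have "I = PIdl\<^bsub>F.RX\<^esub> g \<or> I = carrier F.RX" by (rule MI.I_maximal[OF idl _ Ic])
  moreover have "I \<noteq> carrier F.RX" using oneI F.UP.one_closed by metis
  ultimately have Ieq: "I = PIdl\<^bsub>F.RX\<^esub> g" by metis
  have "red h \<in> I" using h by (auto simp: I_def)
  then have "red h \<in> PIdl\<^bsub>F.RX\<^esub> g" unfolding Ieq .
  then obtain v where "v \<in> carrier F.RX" "red h = v \<otimes>\<^bsub>F.RX\<^esub> g"
    unfolding cgenideal_def by blast
  then have "red h = g \<otimes>\<^bsub>F.RX\<^esub> v" using F.UP.m_comm[of v g] F.IrredD(2)[OF g] by simp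
  then show ?thesis using \<open>v \<in> carrier F.RX\<close> unfolding pdivides_def by (rule dividesI[rotated])
qed

text \<open>Modulo \<open>Q\<close> the power \<open>(a - b)^q\<close> is \<open>a^q - b^q\<close>,
  and \<open>Q\<close> is prime.\<close>

lemma frob_inj:
  assumes "algebraic_int a" "algebraic_int b" "a ^ q - b ^ q \<in> Q"
  shows "a - b \<in> Q"
proof -
  have "((a - b) + b) ^ q - ((a - b) ^ q + b ^ q) \<in> Q"
    using assms by (intro frob_add algebraic_int_diff) auto
  then have "(a ^ q - b ^ q) - (a - b) ^ q \<in> Q" by (simp add: algebra_simps)
  then have "(a - b) ^ q \<in> Q"
    using diff_mem[OF assms(3), of "(a ^ q - b ^ q) - (a - b) ^ q"] by simp
  then show ?thesis using power_memD algebraic_int_diff assms by blast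
qed

lemma frob_inj_pow:
  assumes "algebraic_int a" "algebraic_int b" "a ^ (q ^ i) - b ^ (q ^ i) \<in> Q"
  shows "a - b \<in> Q"
  using assms(3)
proof (induction i)
  case (Suc i)
  have "(a ^ (q ^ i)) ^ q - (b ^ (q ^ i)) ^ q \<in> Q"
    using Suc.prems by (simp add: power_mult[symmetric] mult.commute)
  then show ?case using frob_inj Suc.IH algebraic_int_pow assms by blast
qed simp

text \<open>The coefficients of \<open>p\<close> come from the ring of integers, on which Frobenius
  is the identity modulo \<open>Q\<close>.\<close>

lemma ev_frob:
  assumes "intpoly p" "algebraic_int x"
  shows "ev p x ^ q - ev p (x ^ q) \<in> Q"
proof -
  have 1: "ev p x ^ q - poly (map_poly (\<lambda>c. c ^ q) (map_poly to_ac p)) (x ^ q) \<in> Q"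
    unfolding ev_def using assms by (intro frob_poly) (auto simp: coeff_map_ac intpolyD)
  have q0: "(0 :: 'k alg_closure) ^ q = 0" using q_ge2 by simp
  have "poly (map_poly (\<lambda>c. c ^ q) (map_poly to_ac p)) (x ^ q) - ev p (x ^ q) \<in> Q"
    unfolding ev_def
  proof (rule cong_poly)
    fix i
    show "Polynomial.coeff (map_poly (\<lambda>c. c ^ q) (map_poly to_ac p)) i - Polynomial.coeff (map_poly to_ac p) i \<in> Q"
      using fermat_A[of "to_ac (Polynomial.coeff p i)"] intpolyD[OF assms(1)]
      by (simp add: coeff_map_poly q0)
  qed (use assms in \<open>auto simp: coeff_map_ac intpolyD zero_mem intro: algebraic_int_pow\<close>)
  with 1 show ?thesis by (rule cong_trans)
qed

lemma ev_frob_mem: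
  assumes "intpoly p" "algebraic_int x" "ev p x \<in> Q"
  shows "ev p (x ^ (q ^ j)) \<in> Q"
proof (induction j)
  case (Suc j)
  let ?y = "x ^ (q ^ j)"
  have y: "algebraic_int ?y" using assms(2) by (rule algebraic_int_pow)
  have "ev p ?y * ev p ?y ^ (q - 1) \<in> Q"
    by (rule mult_mem'[OF algebraic_int_pow[OF ev_int[OF assms(1) y]] Suc])
  then have "ev p ?y ^ q \<in> Q" using q_ge2 by (simp flip: power_Suc)
  then have "ev p (?y ^ q) \<in> Q" 
    using diff_mem[of "ev p ?y ^ q", OF _ ev_frob[OF assms(1) y]] by simp
  then show ?case by (simp add: power_mult[symmetric] mult.commute)
qed (use assms in simp)

text \<open>Over the closure the value at \<open>x\<close> is a product of differences
  \<open>x - b\<close> over the true roots \<open>b\<close>, and primality of \<open>Q\<close> picks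
  one of them.\<close>

lemma ev_root:
  assumes "intpoly p" "Polynomial.lead_coeff p = 1" "algebraic_int x" "ev p x \<in> Q"
  obtains b where "ev p b = 0" "algebraic_int b" "x - b \<in> Q"
proof -
  have lc: "Polynomial.lead_coeff (map_poly to_ac p) = 1" using assms(2) by (simp add: coeff_map_ac)
  then have "map_poly to_ac p \<noteq> 0" by auto
  then obtain B where B: "map_poly to_ac p = (\<Prod>b\<in>#B. [:- b, 1:])"
    using alg_closed_imp_factorization[of "map_poly to_ac p"] lc by (metis smult_1_left)
  have root: "ev p b = 0" if "b \<in># B" for b
    using that unfolding ev_def B poly_prod_mset_linear by (auto simp: prod_mset_zero_iff)
  have int: "algebraic_int b" if "b \<in># B" for b
    by (rule algebraic_int_monic_root[OF lc]) (use root[OF that] intpolyD[OF assms(1)] in \<open>auto simp: coeff_map_ac ev_def\<close>)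
  obtain b where "b \<in># B" "x - b \<in> Q"
  proof (rule prod_mset_memE)
    show "(\<Prod>b\<in>#B. x - b) \<in> Q" using assms(4) unfolding ev_def B poly_prod_mset_linear .
  qed (use int assms(3) algebraic_int_diff in auto)
  then show ?thesis using that root int by blast
qed

text \<open>The product over a Frobenius orbit modulo \<open>Q\<close> has coefficients fixed by Frobenius, so it comes
  from a polynomial over the residue field, and the irreducible polynomial divides it.\<close>

lemma orbit_polynomial:
  assumes p: "intpoly p" "Polynomial.lead_coeff p = 1" and x: "algebraic_int x" "ev p x \<in> Q"
  obtains t h where "t > 0" "intpoly h" "\<And>z. algebraic_int z \<Longrightarrow> ev h z - (\<Prod>j<t. z - x ^ (q ^ j)) \<in> Q"
    "ev (pderiv h) x \<notin> Q"
proof -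
  define Fr where "Fr j = x ^ (q ^ j)" for j
  have Xint: "algebraic_int (Fr j)" for j unfolding Fr_def using x(1) by (rule algebraic_int_pow)
  have X0: "Fr 0 = x" and XS: "Fr (Suc j) = Fr j ^ q" for j
    by (simp_all add: Fr_def power_mult[symmetric] mult.commute)
  have Xadd: "Fr (i + j) = Fr j ^ (q ^ i)" for i j
    by (simp add: Fr_def power_add power_mult[symmetric] mult.commute)
  have shift_back: "Fr (j - i) - x \<in> Q" if "i < j" "Fr j - Fr i \<in> Q" for i j
  proof -
    have "Fr j = Fr (j - i) ^ (q ^ i)" using Xadd[of i "j - i"] that(1) by simp
    moreover have "Fr i = x ^ (q ^ i)" by (simp add: Fr_def)
    ultimately show ?thesis using frob_inj_pow[OF Xint x(1), of "j - i" i] that(2) by simp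
  qed
  \<comment> \<open>Every \<open>Fr j\<close> is congruent to a true root of \<open>p\<close>. There
    are finitely many, so two powers agree modulo \<open>Q\<close>, and injectivity of Frobenius
    carries the coincidence back to \<open>x\<close>.\<close>
  have "\<exists>t>0. Fr t - x \<in> Q"
  proof -
    have "\<exists>b. ev p b = 0 \<and> Fr j - b \<in> Q" for j
      using ev_root[OF p Xint, of j] ev_frob_mem[OF p(1) x, of j] unfolding Fr_def by metis
    then obtain b where b: "\<And>j. ev p (b j) = 0" "\<And>j. Fr j - b j \<in> Q" by metis
    have "finite {z. ev p z = 0}" unfolding ev_def using p(2) by (intro poly_roots_finite) auto
    then have "finite (range b)" using b(1) finite_subset[of "range b" "{z. ev p z = 0}"] by auto
    then have "\<not> inj b" using finite_imageD[of b UNIV] by auto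
    then obtain i j where "i < j" "b i = b j" unfolding inj_def by (metis linorder_neqE_nat)
    then have "b j - Fr i \<in> Q" using cong_sym[OF b(2)[of i]] by simp
    then have "Fr j - Fr i \<in> Q" by (rule cong_trans[OF b(2)])
    then show ?thesis using shift_back[OF \<open>i < j\<close>] \<open>i < j\<close> by (intro exI[of _ "j - i"]) auto
  qed
  then have ex: "\<exists>t. t > 0 \<and> Fr t - x \<in> Q" by blast
  define t where "t = (LEAST t. t > 0 \<and> Fr t - x \<in> Q)"
  have t: "t > 0" "Fr t - x \<in> Q" using LeastI_ex[OF ex] by (auto simp: t_def)
  have tmin: "Fr j - x \<notin> Q" if "0 < j" "j < t" for j
    using not_less_Least[of j "\<lambda>t. t > 0 \<and> Fr t - x \<in> Q"] that by (auto simp: t_def)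
  have incgr: "Fr j - Fr i \<notin> Q" if "i < j" "j - i < t" for i j
    using shift_back[OF that(1)] tmin[of "j - i"] that by auto
  have incgr2: "Fr j - Fr i \<notin> Q" if ij: "i \<in> {1..t}" "j \<in> {1..t}" "i \<noteq> j" for i j
  proof (cases "i < j")
    case True
    moreover have "j - i < t" using ij True by auto
    ultimately show ?thesis by (rule incgr)
  next
    case False
    then have "j < i" "i - j < t" using ij by auto
    then have "Fr i - Fr j \<notin> Q" by (rule incgr)
    then show ?thesis using cong_sym by blast
  qed
  define H where "H = (\<Prod>j<t. [:- Fr j, 1:])"
  have dH: "Polynomial.degree H = t"
    unfolding H_def by (subst degree_prod_eq_sum_degree) auto
  have lH: "Polynomial.coeff H t = 1"
    using lead_coeff_prod[of "\<lambda>j. [:- Fr j, 1:]" "{..<t}"] unfolding H_def[symmetric] dH by simp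
  have Hint: "algebraic_int (Polynomial.coeff H i)" for i
    unfolding H_def using Xint by (intro algebraic_int_coeff_prod algebraic_int_linear_coeff)
  have pH: "poly H z = (\<Prod>j<t. z - Fr j)" for z by (simp add: H_def poly_prod)
  have Hroot: "poly H (Fr j) = 0" if "j < t" for j using that by (auto simp: pH)
  have q0: "(0 :: 'k alg_closure) ^ q = 0" using q_ge2 by simp
  \<comment> \<open>Both terms are monic of degree \<open>t\<close>, so \<open>D\<close> has degree
    below \<open>t\<close>. Once it vanishes modulo \<open>Q\<close> at \<open>t\<close> incongruent
    points, the coefficients of \<open>H\<close> are fixed by Frobenius.\<close>
  define D where "D = map_poly (\<lambda>c. c ^ q) H - H"
  have Dc: "Polynomial.coeff D i = Polynomial.coeff H i ^ q - Polynomial.coeff H i" for i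
    by (simp add: D_def coeff_map_poly q0)
  have inj: "inj_on Fr {1..t}"
  proof (rule inj_onI)
    fix i j assume ij: "i \<in> {1..t}" "j \<in> {1..t}" "Fr i = Fr j"
    show "i = j"
    proof (rule ccontr)
      assume "i \<noteq> j"
      then show False using incgr2[of i j] ij zero_mem by simp
    qed
  qed
  have Dm: "Polynomial.coeff D i \<in> Q" for i
  proof (rule coeff_mem_if_many_roots[of "Fr ` {1..t}"])
    have "Polynomial.coeff D j = 0" if "j \<ge> t" for j
      using that lH dH by (cases "j = t") (auto simp: Dc coeff_eq_0 q0)
    then show "Polynomial.degree D < card (Fr ` {1..t})"
      using t(1) card_image[OF inj] by (auto intro: degree_less_if_coeff_zero)
    show "\<And>i. algebraic_int (Polynomial.coeff D i)"
      unfolding Dc using Hint by (intro algebraic_int_diff algebraic_int_pow)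
  next
    fix s assume "s \<in> Fr ` {1..t}"
    then obtain i where i: "s = Fr i" "i \<in> {1..t}" by blast
    \<comment> \<open>The points are indexed from 1: raising \<open>H(Fr k) = 0\<close> to the power
      \<open>q\<close> gives a zero of the Frobenius twist of \<open>H\<close> at
      \<open>Fr (Suc k)\<close>. At the end of the orbit \<open>Fr t\<close> is only congruent to
      \<open>Fr 0\<close>.\<close>
    define k where "k = i - 1"
    have k: "s = Fr (Suc k)" "k < t" using i by (auto simp: k_def)
    have "poly H (Fr k) ^ q - poly (map_poly (\<lambda>c. c ^ q) H) (Fr k ^ q) \<in> Q"
      using Hint Xint by (intro frob_poly)
    then have 1: "poly (map_poly (\<lambda>c. c ^ q) H) (Fr (Suc k)) \<in> Q"
      using Hroot[OF k(2)] q0 uminus_mem[of "- poly (map_poly (\<lambda>c. c ^ q) H) (Fr (Suc k))"] by (simp add: XS)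
    have 2: "poly H (Fr (Suc k)) \<in> Q"
    proof (cases "Suc k < t")
      case True
      then show ?thesis using Hroot zero_mem by simp
    next
      case False
      then have "Suc k = t" using k by simp
      then have "poly H (Fr (Suc k)) - poly H (Fr 0) \<in> Q"
        using t(2) Hint x(1) by (intro cong_poly) (auto simp: X0 zero_mem)
      then show ?thesis using Hroot[OF t(1)] by simp
    qed
    show "algebraic_int s \<and> poly D s \<in> Q"
      using 1 2 k Xint diff_mem by (auto simp: D_def)
  next
    fix s u assume "s \<in> Fr ` {1..t}" "u \<in> Fr ` {1..t}" and su: "s - u \<in> Q"
    then obtain i j where ij: "s = Fr i" "u = Fr j" "i \<in> {1..t}" "j \<in> {1..t}" by blast
    show "s = u"
    proof (rule ccontr)
      assume "s \<noteq> u"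
      then have "i \<noteq> j" using ij by auto
      then show False using incgr2[of j i] ij su by simp
    qed
  qed simp
  have "\<exists>a. algebraic_int a \<and> to_ac a - Polynomial.coeff H i \<in> Q" for i
  proof -
    obtain s where "s \<in> (\<lambda>u. to_ac (rep u)) ` carrier RP" "Polynomial.coeff H i - s \<in> Q"
      using frob_fixed[OF Hint[of i]] Dm[of i] unfolding Dc by blast
    then show ?thesis using rep cong_sym by blast
  qed
  then obtain a where a: "\<And>i. algebraic_int (a i)" "\<And>i. to_ac (a i) - Polynomial.coeff H i \<in> Q" by metis
  define h where "h = (\<Sum>i\<le>t. Polynomial.monom (a i) i)"
  have hc: "Polynomial.coeff h i = (if i \<le> t then a i else 0)" for i
    by (auto simp: h_def coeff_sum)
  have hint: "intpoly h" unfolding intpoly_def hc using a(1) by auto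
  have hH: "Polynomial.coeff (map_poly to_ac h) i - Polynomial.coeff H i \<in> Q" for i
    using a(2) dH by (auto simp: coeff_map_ac hc coeff_eq_0 zero_mem)
  have 1: "ev h z - (\<Prod>j<t. z - x ^ (q ^ j)) \<in> Q" if "algebraic_int z" for z
    using cong_poly[OF hH Hint _ that, of z] zero_mem pH by (simp add: ev_def Fr_def)
  have 2: "ev (pderiv h) x - poly (pderiv H) x \<in> Q"
    unfolding ev_def
  proof (rule cong_poly)
    fix i
    have "of_nat (Suc i) * (Polynomial.coeff (map_poly to_ac h) (Suc i) - Polynomial.coeff H (Suc i)) \<in> Q"
      by (rule mult_mem[OF _ hH]) (auto intro!: int_imp_algebraic_int simp del: of_nat_Suc)
    then show "Polynomial.coeff (map_poly to_ac (pderiv h)) i - Polynomial.coeff (pderiv H) i \<in> Q"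
      by (simp add: to_ac_hom.map_poly_pderiv coeff_pderiv right_diff_distrib del: of_nat_Suc)
    show "algebraic_int (Polynomial.coeff (pderiv H) i)"
      unfolding coeff_pderiv using Hint by (auto intro!: algebraic_int_times simp del: of_nat_Suc)
  qed (use x zero_mem in auto)
  have "poly (pderiv H) x = (\<Prod>j\<in>{..<t} - {0}. x - Fr j)"
  proof -
    have "H = [:- x, 1:] * (\<Prod>j\<in>{..<t} - {0}. [:- Fr j, 1:])"
      unfolding H_def using t(1) by (subst prod.remove[of _ 0]) (auto simp: X0)
    then show ?thesis by (simp add: pderiv_mult pderiv_pCons poly_prod del: mult_pCons_left)
  qed
  moreover have "(\<Prod>j\<in>{..<t} - {0}. x - Fr j) \<notin> Q"
  proof
    assume *: "(\<Prod>j\<in>{..<t} - {0}. x - Fr j) \<in> Q"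
    obtain j where "j \<in> {..<t} - {0}" "x - Fr j \<in> Q"
      by (rule prod_memE[OF _ *]) (use x(1) Xint algebraic_int_diff in auto)
    then show False using tmin[of j] cong_sym by auto
  qed
  ultimately have "ev (pderiv h) x \<notin> Q"
    using diff_mem[of "ev (pderiv h) x", OF _ 2] by auto
  then show ?thesis using that[OF t(1) hint 1] by blast
qed

text \<open>\<open>g\<close> divides the reduction of the orbit polynomial \<open>h\<close>. So a
  double root of \<open>p\<close> at \<open>x\<close> modulo \<open>Q\<close> would be one of
  \<open>h\<close>, whose derivative is nonzero there; and every root of \<open>p\<close> is a root
  of \<open>h\<close>, that is, congruent to a Frobenius power of \<open>x\<close>.\<close>

lemma orbit:
  assumes g: "g \<in> F.Irred" and p: "intpoly p" "red p = g" "Polynomial.lead_coeff p = 1"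
    and x: "algebraic_int x" "ev p x \<in> Q"
  shows "ev (pderiv p) x \<notin> Q"
    and "algebraic_int y \<Longrightarrow> ev p y \<in> Q \<Longrightarrow> \<exists>j. y - x ^ (q ^ j) \<in> Q"
proof -
  obtain t h where h: "t > 0" "intpoly h"
      "\<And>z. algebraic_int z \<Longrightarrow> ev h z - (\<Prod>j<t. z - x ^ (q ^ j)) \<in> Q" "ev (pderiv h) x \<notin> Q"
    using orbit_polynomial[OF p(1,3) x] by metis
  have "(\<Prod>j<t. x - x ^ (q ^ j)) = 0" using h(1) by (intro prod_zero bexI[of _ 0]) auto
  then have "ev h x \<in> Q" using h(3)[OF x(1)] by (simp only: diff_zero)
  then have "g pdivides\<^bsub>RP\<^esub> (red h)" using irred_divides[OF g p(1,2) x h(2)] by blast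
  then obtain v where v: "v \<in> carrier F.RX" "red h = g \<otimes>\<^bsub>F.RX\<^esub> v" by (auto simp: pdivides_def)
  obtain u where u: "intpoly u" "red u = v" using lift[OF v(1)] by blast
  have pu: "intpoly (p * u)" by (rule intpoly_mult[OF p(1) u(1)])
  have hr: "red h = red (p * u)" using red_mult[OF p(1) u(1)] v p u by simp
  show "ev (pderiv p) x \<notin> Q"
  proof
    assume d: "ev (pderiv p) x \<in> Q"
    have "pderiv (p * u) = p * pderiv u + u * pderiv p" by (rule pderiv_mult)
    then have "ev (pderiv (p * u)) x = ev p x * ev (pderiv u) x + ev u x * ev (pderiv p) x"
      by (simp add: ev_add ev_mult)
    also have "\<dots> \<in> Q"
      using x d u ev_int intpoly_pderiv by (intro add_mem mult_mem mult_mem') auto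
    finally have "ev (pderiv h) x \<in> Q"
      using ev_same[OF intpoly_pderiv[OF h(2)] intpoly_pderiv[OF pu] red_pderiv[OF h(2) pu hr] x(1)] by blast
    then show False using h(4) by blast
  qed
  show "\<exists>j. y - x ^ (q ^ j) \<in> Q" if y: "algebraic_int y" "ev p y \<in> Q"
  proof -
    have "ev (p * u) y \<in> Q" using y mult_mem' ev_int[OF u(1)] by (simp add: ev_mult)
    then have "ev h y \<in> Q" using ev_same[OF h(2) pu hr y(1)] by blast
    then have *: "(\<Prod>j<t. y - x ^ (q ^ j)) \<in> Q" 
      using diff_mem[of "ev h y", OF _ h(3)[OF y(1)]] by simp
    obtain j where "y - x ^ (q ^ j) \<in> Q"
      by (rule prod_memE[OF _ *]) (use x y in \<open>auto intro: algebraic_int_diff algebraic_int_pow\<close>)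
    then show ?thesis by blast
  qed
qed

end

section \<open>Squarefree reduction, the discriminant, and Frobenius elements\<close>

context nf_prime_over
begin

lemma red_prod:
  assumes "finite B" "\<And>b. b \<in> B \<Longrightarrow> intpoly (f b)"
  shows "red (prod f B) = finprod F.RX (\<lambda>b. red (f b)) B"
  using assms
proof (induction B rule: finite_induct)
  case empty
  have "red 1 = \<one>\<^bsub>F.RX\<^esub>"
    using F.monic_degree_0[OF red_monic[OF intpoly_1]] reduce_poly_eq_red(3)[of 1] by simp
  then show ?case by simp
next
  case (insert b B)
  have "finprod F.RX (\<lambda>b. red (f b)) (insert b B) = red (f b) \<otimes>\<^bsub>F.RX\<^esub> finprod F.RX (\<lambda>b. red (f b)) B"
    using insert red_carrier by (intro F.UP.finprod_insert) auto
  then show ?case using insert red_mult[of "f b" "prod f B"] intpoly_prod[of B f] by simp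
qed

lemma irred_root_unique:
  assumes "g \<in> F.Irred" "h \<in> F.Irred" "intpoly p" "red p = g" "intpoly r" "red r = h"
    "algebraic_int x" "ev p x \<in> Q" "ev r x \<in> Q"
  shows "g = h"
  using irred_divides[OF assms(1,3,4,7,8,5,9)] F.Irred_pdivides_eq[OF assms(1,2)] assms(6) by simp

lemma split_over_closure:
  assumes "intpoly f" "Polynomial.lead_coeff f = 1"
  obtains B where "map_poly to_ac f = (\<Prod>b\<in>#B. [:- b, 1:])" "\<And>b. b \<in># B \<longleftrightarrow> ev f b = 0"
    "\<And>b. b \<in># B \<Longrightarrow> algebraic_int b"
    "to_ac (discriminant f) = (-1) ^ (Polynomial.degree f * (Polynomial.degree f - 1) div 2) *
       (\<Prod>b\<in>#B. ev (pderiv f) b)"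
proof -
  have lc: "Polynomial.lead_coeff (map_poly to_ac f) = 1" using assms(2) by (simp add: coeff_map_ac)
  then have "map_poly to_ac f \<noteq> 0" by auto
  then obtain B where B: "map_poly to_ac f = (\<Prod>b\<in>#B. [:- b, 1:])"
    using alg_closed_imp_factorization[of "map_poly to_ac f"] lc by (metis smult_1_left)
  have root: "b \<in># B \<longleftrightarrow> ev f b = 0" for b
    unfolding ev_def B poly_prod_mset_linear by (auto simp: prod_mset_zero_iff)
  have int: "algebraic_int b" if "b \<in># B" for b
    by (rule algebraic_int_monic_root[OF lc]) (use root[of b] that intpolyD[OF assms(1)] in \<open>auto simp: coeff_map_ac ev_def\<close>)
  have "to_ac (discriminant f) = (-1) ^ (Polynomial.degree f * (Polynomial.degree f - 1) div 2) *
       (\<Prod>b\<in>#B. ev (pderiv f) b)"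
    unfolding to_ac_discriminant[OF assms(2) B] ev_def to_ac_hom.map_poly_pderiv ..
  then show ?thesis using that[OF B root int] by blast
qed

lemma ev_pderiv_product:
  assumes "map_poly to_ac f = (\<Prod>z\<in>Z. [:- z, 1:])" "finite Z" "z \<in> Z"
  shows "ev (pderiv f) z = (\<Prod>w\<in>Z - {z}. z - w)"
proof -
  have "map_poly to_ac f = [:- z, 1:] * (\<Prod>w\<in>Z - {z}. [:- w, 1:])"
    unfolding assms(1) using assms(2,3) by (subst prod.remove[of _ z]) auto
  then show ?thesis
    unfolding ev_def to_ac_hom.map_poly_pderiv
    by (simp add: pderiv_mult pderiv_pCons poly_prod del: mult_pCons_left)
qed

lemma discriminant_int: 
  assumes "intpoly f" "Polynomial.lead_coeff f = 1"
  shows "algebraic_int (discriminant f)"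
proof -
  obtain B where B: "\<And>b. b \<in># B \<Longrightarrow> algebraic_int b"
    "to_ac (discriminant f) = (-1) ^ (Polynomial.degree f * (Polynomial.degree f - 1) div 2) *
       (\<Prod>b\<in>#B. ev (pderiv f) b)"
    using split_over_closure[OF assms] by metis
  have "algebraic_int (\<Prod>b\<in>#B. ev (pderiv f) b)"
    using B(1) ev_int[OF intpoly_pderiv[OF assms(1)]]
    by (induction B) (auto intro: algebraic_int_times)
  then have "algebraic_int (to_ac (discriminant f))"
    unfolding B(2) by (intro algebraic_int_times algebraic_int_pow) auto
  then show ?thesis by simp
qed

text \<open>Up to sign the discriminant is the product of the derivative over the roots, and
  \<open>Q\<close> is prime. A root modulo \<open>Q\<close> is replaced by a congruent true root, so
  the criterion may be tested at any algebraic integer.\<close>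

lemma discriminant_mem_iff:
  assumes "intpoly f" "Polynomial.lead_coeff f = 1"
  shows "discriminant f \<in> P \<longleftrightarrow> (\<exists>z. algebraic_int z \<and> ev f z \<in> Q \<and> ev (pderiv f) z \<in> Q)"
proof -
  obtain B where B: "map_poly to_ac f = (\<Prod>b\<in>#B. [:- b, 1:])" "\<And>b. b \<in># B \<longleftrightarrow> ev f b = 0"
    "\<And>b. b \<in># B \<Longrightarrow> algebraic_int b"
    "to_ac (discriminant f) = (-1) ^ (Polynomial.degree f * (Polynomial.degree f - 1) div 2) *
       (\<Prod>b\<in>#B. ev (pderiv f) b)"
    using split_over_closure[OF assms] by metis
  let ?s = "(-1) ^ (Polynomial.degree f * (Polynomial.degree f - 1) div 2) :: 'k alg_closure"
  have s: "?s * ?s = 1" "algebraic_int ?s" by (auto simp flip: power_mult_distrib intro: algebraic_int_pow)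
  have fint: "algebraic_int (ev (pderiv f) b)" if "b \<in># B" for b
    using B(3)[OF that] ev_int[OF intpoly_pderiv[OF assms(1)]] by blast
  have "discriminant f \<in> P \<longleftrightarrow> ?s * (\<Prod>b\<in>#B. ev (pderiv f) b) \<in> Q"
    using Q_iff[OF discriminant_int[OF assms]] B(4) by simp
  also have "\<dots> \<longleftrightarrow> (\<Prod>b\<in>#B. ev (pderiv f) b) \<in> Q"
  proof
    assume "?s * (\<Prod>b\<in>#B. ev (pderiv f) b) \<in> Q"
    from mult_mem[OF s(2) this] show "(\<Prod>b\<in>#B. ev (pderiv f) b) \<in> Q"
      unfolding mult.assoc[symmetric] s(1) mult_1 .
  qed (rule mult_mem[OF s(2)])
  also have "\<dots> \<longleftrightarrow> (\<exists>b. b \<in># B \<and> ev (pderiv f) b \<in> Q)"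
  proof
    assume "(\<Prod>b\<in>#B. ev (pderiv f) b) \<in> Q"
    then obtain b where "b \<in># B" "ev (pderiv f) b \<in> Q" by (rule prod_mset_memE) (use fint in auto)
    then show "\<exists>b. b \<in># B \<and> ev (pderiv f) b \<in> Q" by blast
  next
    assume "\<exists>b. b \<in># B \<and> ev (pderiv f) b \<in> Q"
    then obtain b r where r: "B = add_mset b r" "ev (pderiv f) b \<in> Q" by (metis multi_member_split)
    have "algebraic_int (\<Prod>b\<in>#r. ev (pderiv f) b)"
      using fint r(1) by (induction r arbitrary: B) (auto intro: algebraic_int_times)
    then show "(\<Prod>b\<in>#B. ev (pderiv f) b) \<in> Q" using r mult_mem' by simp
  qed
  also have "\<dots> \<longleftrightarrow> (\<exists>z. algebraic_int z \<and> ev f z \<in> Q \<and> ev (pderiv f) z \<in> Q)"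
  proof
    assume "\<exists>b. b \<in># B \<and> ev (pderiv f) b \<in> Q"
    then show "\<exists>z. algebraic_int z \<and> ev f z \<in> Q \<and> ev (pderiv f) z \<in> Q" using B(2,3) zero_mem by metis
  next
    assume "\<exists>z. algebraic_int z \<and> ev f z \<in> Q \<and> ev (pderiv f) z \<in> Q"
    then obtain z where z: "algebraic_int z" "ev f z \<in> Q" "ev (pderiv f) z \<in> Q" by blast
    obtain b where b: "ev f b = 0" "algebraic_int b" "z - b \<in> Q" using ev_root[OF assms z(1,2)] by blast
    have "ev (pderiv f) b \<in> Q"
      using ev_memI[OF intpoly_pderiv[OF assms(1)] intpoly_pderiv[OF assms(1)] refl cong_sym[OF b(3)] z(1,3)] .
    then show "\<exists>b. b \<in># B \<and> ev (pderiv f) b \<in> Q" using b(1) B(2) by blast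
  qed
  finally show ?thesis .
qed

lemma lift_factors:
  assumes "finite A" "A \<subseteq> F.Irred" "red f = finprod F.RX (\<lambda>g. g) A"
  obtains pl where "\<And>g. g \<in> A \<Longrightarrow> intpoly (pl g)" "\<And>g. g \<in> A \<Longrightarrow> red (pl g) = g"
    "\<And>g. g \<in> A \<Longrightarrow> Polynomial.lead_coeff (pl g) = 1" "\<And>g. g \<in> A \<Longrightarrow> Polynomial.degree (pl g) = pdeg g"
    "red f = red (prod pl A)"
proof -
  have "\<exists>p. intpoly p \<and> red p = g \<and> Polynomial.lead_coeff p = 1 \<and> Polynomial.degree p = pdeg g" if "g \<in> A" for g
    using lift_monic[OF F.IrredD(1), of g] that assms(2) by (metis subsetD)
  then obtain pl where pl: "\<And>g. g \<in> A \<Longrightarrow> intpoly (pl g)" "\<And>g. g \<in> A \<Longrightarrow> red (pl g) = g"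
    "\<And>g. g \<in> A \<Longrightarrow> Polynomial.lead_coeff (pl g) = 1" "\<And>g. g \<in> A \<Longrightarrow> Polynomial.degree (pl g) = pdeg g"
    by metis
  have "red (prod pl A) = finprod F.RX (\<lambda>g. red (pl g)) A"
    by (rule red_prod[OF assms(1)]) (use pl(1) in auto)
  also have "\<dots> = finprod F.RX (\<lambda>g. g) A"
    using assms(2) F.IrredD(2) pl(2) by (intro F.UP.finprod_cong') auto
  finally have "red (prod pl A) = finprod F.RX (\<lambda>g. g) A" .
  then show ?thesis using that[OF pl] assms(3) by simp
qed

text \<open>\<open>z\<close> is a root modulo \<open>Q\<close> of one lifted factor
  \<open>pl g\<close>, with cofactor \<open>r\<close>. If the derivative vanished, the product rule
  would put \<open>r(z)\<close> times the derivative of \<open>pl g\<close> at \<open>z\<close> into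
  \<open>Q\<close>. The latter factor is excluded by separability, so a second irreducible factor
  vanishes at \<open>z\<close>, which is impossible.\<close>

lemma sqfree_simple:
  assumes f: "intpoly f" and A: "finite A" "A \<subseteq> F.Irred" "red f = finprod F.RX (\<lambda>g. g) A"
    and z: "algebraic_int z" "ev f z \<in> Q"
  shows "ev (pderiv f) z \<notin> Q"
proof
  assume d: "ev (pderiv f) z \<in> Q"
  obtain pl where pl: "\<And>g. g \<in> A \<Longrightarrow> intpoly (pl g)" "\<And>g. g \<in> A \<Longrightarrow> red (pl g) = g"
    "\<And>g. g \<in> A \<Longrightarrow> Polynomial.lead_coeff (pl g) = 1" "red f = red (prod pl A)"
    using lift_factors[OF A] by metis
  have pi: "intpoly (prod pl A)" using pl(1) by (rule intpoly_prod)
  have "ev (prod pl A) z \<in> Q" by (rule ev_same[OF pi f pl(4)[symmetric] z])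
  then have *: "(\<Prod>g\<in>A. ev (pl g) z) \<in> Q" by (simp add: ev_prod)
  obtain g where g: "g \<in> A" "ev (pl g) z \<in> Q"
    by (rule prod_memE[OF A(1) *]) (use pl(1) z ev_int in auto)
  define r where "r = prod pl (A - {g})"
  have ri: "intpoly r" unfolding r_def using pl(1) by (intro intpoly_prod) auto
  have pr: "prod pl A = pl g * r" unfolding r_def using A(1) g(1) by (rule prod.remove)
  have "ev (pderiv (prod pl A)) z \<in> Q"
    by (rule ev_same[OF intpoly_pderiv[OF pi] intpoly_pderiv[OF f] red_pderiv[OF pi f pl(4)[symmetric]] z(1) d])
  then have "ev (pl g) z * ev (pderiv r) z + ev r z * ev (pderiv (pl g)) z \<in> Q"
    unfolding pr pderiv_mult by (simp add: ev_add ev_mult)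
  moreover have "ev (pl g) z * ev (pderiv r) z \<in> Q"
    using g(2) ev_int[OF intpoly_pderiv[OF ri] z(1)] mult_mem' by blast
  ultimately have "ev r z * ev (pderiv (pl g)) z \<in> Q"
    using diff_mem[of "ev (pl g) z * ev (pderiv r) z + ev r z * ev (pderiv (pl g)) z" "ev (pl g) z * ev (pderiv r) z"] by simp
  moreover have "ev (pderiv (pl g)) z \<notin> Q"
    using orbit(1)[OF _ pl(1)[OF g(1)] pl(2)[OF g(1)] pl(3)[OF g(1)] z(1) g(2)] A(2) g(1) by blast
  ultimately have "ev r z \<in> Q"
    using prime ev_int[OF ri z(1)] ev_int[OF intpoly_pderiv[OF pl(1)[OF g(1)]] z(1)] by blast
  then have **: "(\<Prod>h\<in>A - {g}. ev (pl h) z) \<in> Q" by (simp add: r_def ev_prod)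
  obtain h where h: "h \<in> A - {g}" "ev (pl h) z \<in> Q"
    by (rule prod_memE[OF _ **]) (use A(1) pl(1) z ev_int in auto)
  then have "g = h"
    using irred_root_unique[of g h "pl g" "pl h" z] A(2) g pl(1,2) z(1) by blast
  then show False using h(1) by blast
qed

text \<open>If the square of \<open>g\<close> divides the reduction, a true root of a lift of
  \<open>g\<close> is a double root of \<open>f\<close> modulo \<open>Q\<close>. Conversely, a
  squarefree reduction has only simple roots modulo \<open>Q\<close>.\<close>

lemma discriminant_sqfree_iff:
  assumes f: "intpoly f" "Polynomial.lead_coeff f = 1"
  shows "discriminant f \<notin> P \<longleftrightarrow> red f \<in> F.sqfree_monic (Polynomial.degree f)"
proof
  assume "red f \<in> F.sqfree_monic (Polynomial.degree f)"
  then obtain A where A: "finite A" "A \<subseteq> F.Irred" "red f = finprod F.RX (\<lambda>g. g) A"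
    by (auto simp: F.sqfree_monic_def)
  show "discriminant f \<notin> P"
    unfolding discriminant_mem_iff[OF f] using sqfree_simple[OF f(1) A] by blast
next
  assume d: "discriminant f \<notin> P"
  have "\<not> (g \<otimes>\<^bsub>F.RX\<^esub> g) pdivides\<^bsub>RP\<^esub> red f" if g: "g \<in> F.Irred" for g
  proof
    assume "(g \<otimes>\<^bsub>F.RX\<^esub> g) pdivides\<^bsub>RP\<^esub> red f"
    then obtain v where v: "v \<in> carrier F.RX" "red f = (g \<otimes>\<^bsub>F.RX\<^esub> g) \<otimes>\<^bsub>F.RX\<^esub> v"
      unfolding pdivides_def factor_def by blast
    obtain u where u: "intpoly u" "red u = v" using lift[OF v(1)] by blast
    obtain p where p: "intpoly p" "red p = g" "Polynomial.lead_coeff p = 1" "Polynomial.degree p = pdeg g"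
      using lift_monic[OF F.IrredD(1)[OF g]] by blast
    have i: "intpoly (p * p)" "intpoly (p * p * u)" using p(1) u(1) intpoly_mult by auto
    have r: "red f = red (p * p * u)"
      using v(2) red_mult[OF i(1) u(1)] red_mult[OF p(1) p(1)] p(2) u(2) by simp
    have "Polynomial.degree (map_poly to_ac p) > 0" using p(4) F.Irred_degree[OF g] by simp
    then obtain z where z: "ev p z = 0" unfolding ev_def using alg_closed_imp_poly_has_root by blast
    have "algebraic_int z"
    proof (rule algebraic_int_monic_root)
      show "Polynomial.lead_coeff (map_poly to_ac p) = 1" using p(3) by (simp add: coeff_map_ac)
      show "algebraic_int (Polynomial.coeff (map_poly to_ac p) i)" for i
        using intpolyD[OF p(1)] by (simp add: coeff_map_ac)
    qed (use z in \<open>simp add: ev_def\<close>)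
    moreover have "ev (p * p * u) z \<in> Q" using z zero_mem by (simp add: ev_mult)
    moreover have "ev (pderiv (p * p * u)) z \<in> Q"
      using z zero_mem by (simp add: pderiv_mult ev_add ev_mult)
    ultimately have "ev f z \<in> Q" "ev (pderiv f) z \<in> Q" "algebraic_int z"
      using ev_same[OF f(1) i(2) r] ev_same[OF intpoly_pderiv[OF f(1)] intpoly_pderiv[OF i(2)] red_pderiv[OF f(1) i(2) r]]
      by auto
    then show False using d discriminant_mem_iff[OF f] by blast
  qed
  then have "red f \<in> F.sqfree_monic (pdeg (red f))"
    by (intro F.sqfree_monicI red_monic f)
  then show "red f \<in> F.sqfree_monic (Polynomial.degree f)" using reduce_poly_eq_red(3)[OF f(2)] by simp
qed

text \<open>\<open>W g\<close> collects the roots of \<open>f\<close> that reduce to roots of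
  \<open>g\<close>. The lifted Frobenius acts as the \<open>q\<close>-th power modulo
  \<open>Q\<close>, so it preserves \<open>W g\<close> and is transitive on it modulo
  \<open>Q\<close>; since the roots are pairwise incongruent, this holds for the roots themselves,
  and the sets \<open>W g\<close> are its cycles.\<close>

theorem frobenius_element:
  assumes f: "intpoly f" "Polynomial.lead_coeff f = 1"
    and A: "finite A" "A \<subseteq> F.Irred" "red f = finprod F.RX (\<lambda>g. g) A"
  defines "Z \<equiv> {z. poly (map_poly to_ac f) z = 0}"
  obtains \<sigma> W where "\<sigma> \<in> carrier (galois_group f)" "Z = (\<Union>g\<in>A. W g)"
    "\<And>g. g \<in> A \<Longrightarrow> card (W g) = pdeg g" "card Z = Polynomial.degree f"
    "\<And>g z. g \<in> A \<Longrightarrow> z \<in> W g \<Longrightarrow> \<sigma> z \<in> W g"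
    "\<And>g x y. g \<in> A \<Longrightarrow> x \<in> W g \<Longrightarrow> y \<in> W g \<Longrightarrow> \<exists>j. (\<sigma> ^^ j) x = y"
    "\<And>g h. g \<in> A \<Longrightarrow> h \<in> A \<Longrightarrow> g \<noteq> h \<Longrightarrow> W g \<inter> W h = {}"
proof -
  have f0: "f \<noteq> 0" using f(2) by auto
  interpret G: galois_setup f by unfold_locales (rule f0)
  have Zev: "z \<in> Z \<longleftrightarrow> ev f z = 0" for z by (simp add: Z_def ev_def)
  have GZ: "G.Z = Z" by (simp add: G.Z_def Z_def)
  have finZ: "finite Z" using G.Z_fin GZ by simp
  obtain B where B: "map_poly to_ac f = (\<Prod>b\<in>#B. [:- b, 1:])" "\<And>b. b \<in># B \<longleftrightarrow> ev f b = 0"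
    "\<And>b. b \<in># B \<Longrightarrow> algebraic_int b"
    "to_ac (discriminant f) = (-1) ^ (Polynomial.degree f * (Polynomial.degree f - 1) div 2) *
       (\<Prod>b\<in>#B. ev (pderiv f) b)"
    using split_over_closure[OF f] by metis
  have Zint: "algebraic_int z" if "z \<in> Z" for z using that Zev B(2,3) by blast
  have simple: "ev (pderiv f) z \<notin> Q" if "z \<in> Z" for z
    using sqfree_simple[OF f(1) A Zint[OF that]] that Zev zero_mem by simp
  have "count B b \<le> 1" for b
  proof (rule ccontr)
    assume "\<not> count B b \<le> 1"
    then have "{#b, b#} \<subseteq># B" by (auto simp: subseteq_mset_def)
    then obtain r where r: "B = {#b, b#} + r" by (metis subset_mset.le_iff_add)
    define s where "s = (\<Prod>b\<in>#r. [:- b, 1:])"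
    have "map_poly to_ac f = [:- b, 1:] * ([:- b, 1:] * s)" unfolding B(1) r s_def by simp
    then have "ev (pderiv f) b = 0"
      unfolding ev_def to_ac_hom.map_poly_pderiv by (simp add: pderiv_mult pderiv_pCons del: mult_pCons_left)
    moreover have "b \<in> Z" using B(2)[of b] r Zev[of b] by simp
    ultimately show False using simple zero_mem by fastforce
  qed
  then have "B = mset_set Z"
    by (intro multiset_eqI) (use B(2) Zev finZ in \<open>auto simp: count_mset_set' le_Suc_eq not_in_iff[symmetric] dest: le_antisym\<close>)
  then have FZ: "map_poly to_ac f = (\<Prod>z\<in>Z. [:- z, 1:])"
    and disc: "to_ac (discriminant f) = (-1) ^ (Polynomial.degree f * (Polynomial.degree f - 1) div 2) *
       (\<Prod>z\<in>Z. ev (pderiv f) z)"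
    using B(1,4) by (simp_all add: prod_unfold_prod_mset)
  have cZ: "card Z = Polynomial.degree f"
  proof -
    have "Polynomial.degree (map_poly to_ac f) = card Z"
      unfolding FZ by (subst degree_prod_eq_sum_degree) auto
    then show ?thesis by simp
  qed
  have dev: "ev (pderiv f) z = (\<Prod>w\<in>Z - {z}. z - w)" if "z \<in> Z" for z
    by (rule ev_pderiv_product[OF FZ finZ that])
  \<comment> \<open>The factor \<open>z - w\<close> occurs in the derivative at \<open>z\<close>,
    which lies outside \<open>Q\<close>.\<close>
  have incgr: "z = w" if zw: "z \<in> Z" "w \<in> Z" "z - w \<in> Q" for z w
  proof (rule ccontr)
    assume "z \<noteq> w"
    then have "(\<Prod>u\<in>Z - {z}. z - u) = (z - w) * (\<Prod>u\<in>Z - {z} - {w}. z - u)"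
      using finZ zw by (intro prod.remove) auto
    also have "\<dots> \<in> Q"
      using zw Zint by (intro mult_mem' algebraic_int_prod algebraic_int_diff) auto
    finally show False using dev simple zw(1) by simp
  qed
  define D where "D = (\<Prod>z\<in>Z. \<Prod>w\<in>Z - {z}. z - w)"
  have Ddev: "D = (\<Prod>z\<in>Z. ev (pderiv f) z)" unfolding D_def using dev by simp
  have DQ: "D \<notin> Q"
  proof
    assume "D \<in> Q"
    then have *: "(\<Prod>z\<in>Z. ev (pderiv f) z) \<in> Q" by (simp add: Ddev)
    obtain z where "z \<in> Z" "ev (pderiv f) z \<in> Q"
      by (rule prod_memE[OF finZ *]) (use Zint ev_int[OF intpoly_pderiv[OF f(1)]] in auto)
    then show False using simple by blast
  qed
  \<comment> \<open>The sign squares to 1; thus \<open>D\<close> is the discriminant up to sign and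
    lies in the base field, as the lift requires.\<close>
  have "D = to_ac ((-1) ^ (Polynomial.degree f * (Polynomial.degree f - 1) div 2) * discriminant f)"
    using disc unfolding Ddev by (simp add: mult.assoc[symmetric] power_mult_distrib[symmetric])
  then have DK: "D \<in> range to_ac" by blast
  have K: "subfield_set (range (to_ac :: 'k \<Rightarrow> _))"
    by unfold_locales (auto simp flip: to_ac_add to_ac_mult to_ac_minus to_ac_inverse intro: image_eqI[of _ _ 0] image_eqI[of _ _ 1])
  have KA: "\<And>a :: 'k alg_closure. a \<in> range to_ac \<Longrightarrow> algebraic_int a \<Longrightarrow> a \<in> to_ac ` {x. algebraic_int x}"
    by auto
  have FK: "\<And>i. Polynomial.coeff (map_poly to_ac f) i \<in> range to_ac" by (simp add: coeff_map_ac)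
  have "\<exists>M \<tau>. subfield_embedding M \<tau> \<and> range to_ac \<subseteq> M \<and> Z \<subseteq> M \<and>
      (\<forall>x\<in>range to_ac. \<tau> x = x) \<and> (\<forall>z\<in>Z. \<tau> z - z ^ q \<in> Q)"
  proof (rule frobenius_lift[OF K KA finZ Zint FZ FK D_def DK DQ])
    fix M and \<tau> :: "'k alg_closure \<Rightarrow> 'k alg_closure"
    assume M: "subfield_embedding M \<tau>" "range to_ac \<subseteq> M" "Z \<subseteq> M"
      and t: "\<And>x. x \<in> range to_ac \<Longrightarrow> \<tau> x = x" "\<And>z. z \<in> Z \<Longrightarrow> \<tau> z - z ^ q \<in> Q"
    show "\<exists>M \<tau>. subfield_embedding M \<tau> \<and> range to_ac \<subseteq> M \<and> Z \<subseteq> M \<and>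
      (\<forall>x\<in>range to_ac. \<tau> x = x) \<and> (\<forall>z\<in>Z. \<tau> z - z ^ q \<in> Q)"
      by (intro exI[of _ M] exI[of _ \<tau>] conjI ballI M t)
  qed
  then obtain M \<tau> where M: "subfield_embedding M \<tau>" "range to_ac \<subseteq> M" "Z \<subseteq> M"
      "\<And>x. x \<in> range to_ac \<Longrightarrow> \<tau> x = x" "\<And>z. z \<in> Z \<Longrightarrow> \<tau> z - z ^ q \<in> Q"
    by blast
  define \<sigma> where "\<sigma> = restrict \<tau> G.L"
  have sG: "\<sigma> \<in> G.\<Gamma>" unfolding \<sigma>_def using M by (intro G.restrict_mem) (auto simp: GZ)
  have sq: "\<sigma> z - z ^ q \<in> Q" if "z \<in> Z" for z
    using M(5)[OF that] that G.Z_L GZ by (auto simp: \<sigma>_def)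
  have sZ: "\<sigma> z \<in> Z" if "z \<in> Z" for z using G.image_Z(1)[OF sG] that GZ by blast
  have spow: "(\<sigma> ^^ j) z \<in> Z \<and> (\<sigma> ^^ j) z - z ^ (q ^ j) \<in> Q" if z: "z \<in> Z" for z j
  proof (induction j)
    case (Suc j)
    let ?y = "(\<sigma> ^^ j) z"
    have "?y ^ q - (z ^ (q ^ j)) ^ q \<in> Q"
      using Suc Zint z by (intro cong_pow) (auto intro: algebraic_int_pow)
    then have "\<sigma> ?y - (z ^ (q ^ j)) ^ q \<in> Q" using cong_trans[OF sq[of ?y]] Suc by blast
    then show ?case using Suc sZ by (simp add: power_mult[symmetric] mult.commute)
  qed (use z zero_mem in auto)
  obtain pl where pl: "\<And>g. g \<in> A \<Longrightarrow> intpoly (pl g)" "\<And>g. g \<in> A \<Longrightarrow> red (pl g) = g"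
    "\<And>g. g \<in> A \<Longrightarrow> Polynomial.lead_coeff (pl g) = 1" "\<And>g. g \<in> A \<Longrightarrow> Polynomial.degree (pl g) = pdeg g"
    "red f = red (prod pl A)"
    using lift_factors[OF A] by metis
  define W where "W g = {z \<in> Z. ev (pl g) z \<in> Q}" for g
  have WZ: "Z = (\<Union>g\<in>A. W g)"
  proof (intro equalityI subsetI)
    fix z assume z: "z \<in> Z"
    have pi: "intpoly (prod pl A)" using pl(1) by (rule intpoly_prod)
    have "ev (prod pl A) z \<in> Q"
      using ev_same[OF pi f(1) pl(5)[symmetric] Zint[OF z]] z Zev zero_mem by simp
    then have *: "(\<Prod>g\<in>A. ev (pl g) z) \<in> Q" by (simp add: ev_prod)
    obtain g where g: "g \<in> A" "ev (pl g) z \<in> Q"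
      by (rule prod_memE[OF A(1) *]) (use pl(1) Zint[OF z] ev_int in auto)
    then show "z \<in> (\<Union>g\<in>A. W g)" using z by (auto simp: W_def)
  qed (auto simp: W_def)
  have Wdisj: "W g \<inter> W h = {}" if gh: "g \<in> A" "h \<in> A" "g \<noteq> h" for g h
  proof (rule ccontr)
    assume "W g \<inter> W h \<noteq> {}"
    then obtain z where z: "z \<in> Z" "ev (pl g) z \<in> Q" "ev (pl h) z \<in> Q" by (auto simp: W_def)
    have "g \<in> F.Irred" "h \<in> F.Irred" using gh A(2) by auto
    from irred_root_unique[OF this pl(1)[OF gh(1)] pl(2)[OF gh(1)] pl(1)[OF gh(2)] pl(2)[OF gh(2)] Zint[OF z(1)] z(2,3)]
    show False using gh(3) by blast
  qed
  \<comment> \<open>With more incongruent roots than its degree, a lift of \<open>g\<close> would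
    have its leading coefficient 1 in \<open>Q\<close>. The degrees sum to \<open>card Z\<close>, so
    these bounds turn out to be equalities.\<close>
  have Wle: "card (W g) \<le> pdeg g" if g: "g \<in> A" for g
  proof (rule ccontr)
    assume "\<not> card (W g) \<le> pdeg g"
    then have "Polynomial.coeff (map_poly to_ac (pl g)) (pdeg g) \<in> Q"
      using finZ Zint incgr pl(4)[OF g] intpolyD[OF pl(1)[OF g]]
      by (intro coeff_mem_if_many_roots[of "W g"]) (auto simp: W_def coeff_map_ac ev_def)
    then show False using pl(3,4)[OF g] one_not_mem by (simp add: coeff_map_ac)
  qed
  have "(\<Sum>g\<in>A. card (W g)) = (\<Sum>g\<in>A. pdeg g)"
  proof -
    have "card Z = (\<Sum>g\<in>A. card (W g))"
      unfolding WZ by (rule card_UN_disjoint) (use A(1) finZ Wdisj in \<open>auto simp: W_def\<close>)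
    moreover have "pdeg (red f) = (\<Sum>g\<in>A. pdeg g)" using F.finprod_monic(2)[OF A(1,2)] A(3) by simp
    ultimately show ?thesis using cZ reduce_poly_eq_red(3)[OF f(2)] by simp
  qed
  then have Wc: "card (W g) = pdeg g" if "g \<in> A" for g
    using sum_mono_inv[of "\<lambda>g. card (W g)" A pdeg g] Wle that A(1) by blast
  have Ws: "\<sigma> z \<in> W g" if g: "g \<in> A" "z \<in> W g" for g z
  proof -
    have z: "z \<in> Z" "ev (pl g) z \<in> Q" using g by (auto simp: W_def)
    have "ev (pl g) (z ^ q) \<in> Q" using ev_frob_mem[OF pl(1)[OF g(1)] Zint[OF z(1)] z(2), of 1] by simp
    then have "ev (pl g) (\<sigma> z) \<in> Q"
      using ev_memI[OF pl(1)[OF g(1)] pl(1)[OF g(1)] refl sq[OF z(1)]] algebraic_int_pow[OF Zint[OF z(1)]] by blast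
    then show ?thesis using sZ[OF z(1)] by (simp add: W_def)
  qed
  have Wt: "\<exists>j. (\<sigma> ^^ j) x = y" if g: "g \<in> A" "x \<in> W g" "y \<in> W g" for g x y
  proof -
    have xy: "x \<in> Z" "ev (pl g) x \<in> Q" "y \<in> Z" "ev (pl g) y \<in> Q" using g by (auto simp: W_def)
    have "g \<in> F.Irred" using g(1) A(2) by blast
    then obtain j where "y - x ^ (q ^ j) \<in> Q"
      using orbit(2)[OF _ pl(1)[OF g(1)] pl(2)[OF g(1)] pl(3)[OF g(1)] Zint[OF xy(1)] xy(2) Zint[OF xy(3)] xy(4)] by blast
    then have "(\<sigma> ^^ j) x - y \<in> Q" using spow[OF xy(1), of j] cong_trans cong_sym by blast
    then show ?thesis using incgr[of "(\<sigma> ^^ j) x" y] spow[OF xy(1)] xy(3) by blast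
  qed
  show ?thesis
    by (rule that[of \<sigma> W]) (use sG WZ Wc cZ Ws Wt Wdisj in \<open>auto simp: G.\<Gamma>_def\<close>)
qed

end

section \<open>Equidistribution in boxes\<close>

text \<open>An injection \<open>s\<close> carries the fibre over \<open>t\<close> in a slightly
  smaller box into the fibre over \<open>t'\<close>. So any two fibres differ in size by at most the
  boundary layer \<open>e B\<close>, negligible against \<open>card (Y B)\<close>, and all fibres
  get the same density.\<close>

lemma equidistribution:
  fixes Y :: "nat \<Rightarrow> 'a set" and \<phi> :: "'a \<Rightarrow> 'b"
  assumes card_Y: "\<And>B. card (Y B) = (2 * B) ^ k" and fin_Y: "\<And>B. finite (Y B)"
    and mono: "\<And>B C. B \<le> C \<Longrightarrow> Y B \<subseteq> Y C"
    and T: "finite T" "\<And>B x. x \<in> Y B \<Longrightarrow> \<phi> x \<in> T"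
    and shift: "\<And>t t'. t \<in> T \<Longrightarrow> t' \<in> T \<Longrightarrow> \<exists>s V. inj s \<and>
      (\<forall>B x. V \<le> B \<longrightarrow> x \<in> Y (B - V) \<longrightarrow> \<phi> x = t \<longrightarrow> s x \<in> Y B \<and> \<phi> (s x) = t')"
    and U: "U \<subseteq> T"
  shows "(\<lambda>B. real (card {x \<in> Y B. \<phi> x \<in> U}) / real (card (Y B))) \<longlonglongrightarrow> real (card U) / real (card T)"
proof -
  define a where "a B t = card {x \<in> Y B. \<phi> x = t}" for B t
  obtain s V where sV: "\<And>t t'. t \<in> T \<Longrightarrow> t' \<in> T \<Longrightarrow> inj (s t t')"
    "\<And>t t' B x. t \<in> T \<Longrightarrow> t' \<in> T \<Longrightarrow> V t t' \<le> B \<Longrightarrow> x \<in> Y (B - V t t') \<Longrightarrow> \<phi> x = t \<Longrightarrow>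
      s t t' x \<in> Y B \<and> \<phi> (s t t' x) = t'"
    using shift by metis
  \<comment> \<open>The sum of all shifts bounds each of them, so one margin serves all pairs of
    classes.\<close>
  define W where "W = (\<Sum>t\<in>T. \<Sum>t'\<in>T. V t t')"
  have VW: "V t t' \<le> W" if "t \<in> T" "t' \<in> T" for t t'
  proof -
    have "V t t' \<le> (\<Sum>t'\<in>T. V t t')" using T(1) that by (intro member_le_sum) auto
    also have "\<dots> \<le> W" unfolding W_def using T(1) that by (intro member_le_sum[of t T "\<lambda>t. \<Sum>t'\<in>T. V t t'"]) auto
    finally show ?thesis .
  qed
  define e where "e B = card (Y B) - card (Y (B - W))" for B
  have close: "a B t \<le> a B t' + e B" if t: "t \<in> T" "t' \<in> T" and B: "B \<ge> W" for B t t'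
  proof -
    have "a B t \<le> card ({x \<in> Y (B - W). \<phi> x = t} \<union> (Y B - Y (B - W)))"
      unfolding a_def using fin_Y by (intro card_mono) auto
    also have "\<dots> \<le> card {x \<in> Y (B - W). \<phi> x = t} + card (Y B - Y (B - W))" by (rule card_Un_le)
    also have "card (Y B - Y (B - W)) = e B"
      unfolding e_def using fin_Y mono by (intro card_Diff_subset) auto
    also have "card {x \<in> Y (B - W). \<phi> x = t} \<le> a B t'"
      unfolding a_def
    proof (rule card_inj_on_le[of "s t t'"])
      show "inj_on (s t t') {x \<in> Y (B - W). \<phi> x = t}" using sV(1)[OF t] by (rule inj_on_subset) simp
      show "s t t' ` {x \<in> Y (B - W). \<phi> x = t} \<subseteq> {x \<in> Y B. \<phi> x = t'}"
      proof (rule image_subsetI)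
        fix x assume "x \<in> {x \<in> Y (B - W). \<phi> x = t}"
        then have x: "x \<in> Y (B - W)" "\<phi> x = t" by auto
        have "x \<in> Y (B - V t t')" using x(1) mono[OF diff_le_mono2[OF VW[OF t]]] by blast
        moreover have "V t t' \<le> B" using VW[OF t] B by simp
        ultimately show "s t t' x \<in> {x \<in> Y B. \<phi> x = t'}" using sV(2)[OF t _ _ x(2)] by blast
      qed
    qed (use fin_Y in auto)
    finally show ?thesis by simp
  qed
  have total: "(\<Sum>t\<in>T. a B t) = card (Y B)" for B
  proof -
    have "card (Y B) = card (\<Union>t\<in>T. {x \<in> Y B. \<phi> x = t})"
      using T(2) by (intro arg_cong[of _ _ card]) auto
    also have "\<dots> = (\<Sum>t\<in>T. a B t)"
      unfolding a_def using T(1) fin_Y by (intro card_UN_disjoint) auto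
    finally show ?thesis by simp
  qed
  have lim: "(\<lambda>B. real (a B t) / real (card (Y B))) \<longlonglongrightarrow> 1 / real (card T)" if t: "t \<in> T" for t
  proof -
    have T0: "real (card T) > 0" using T(1) t by (auto simp: card_gt_0_iff)
    have bound: "\<bar>real (a B t) / real (card (Y B)) - 1 / real (card T)\<bar> \<le> 1 - (1 - real W / real B) ^ k"
      if B: "B \<ge> W" "B > 0" for B
    proof -
      have Y0: "real (card (Y B)) > 0" using B by (simp add: card_Y)
      have ee: "real (e B) = real (card (Y B)) * (1 - (1 - real W / real B) ^ k)"
      proof -
        have "real (e B) = real (card (Y B)) - real (card (Y (B - W)))"
          unfolding e_def using card_mono[OF fin_Y mono, of "B - W" B] by simp
        also have "real (card (Y (B - W))) = real (card (Y B)) * (1 - real W / real B) ^ k"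
        proof -
          have "real (2 * (B - W)) = real (2 * B) * (1 - real W / real B)"
            using B by (simp add: of_nat_diff right_diff_distrib)
          then show ?thesis unfolding card_Y of_nat_power by (simp only: power_mult_distrib)
        qed
        finally show ?thesis by (simp add: algebra_simps)
      qed
      \<comment> \<open>Summing the comparison over all \<open>t'\<close> turns the fibre sizes into
        the size of the box.\<close>
      have "real (card T) * real (a B t) \<le> (\<Sum>t'\<in>T. real (a B t') + real (e B))"
      proof -
        have "(\<Sum>t'\<in>T. real (a B t)) \<le> (\<Sum>t'\<in>T. real (a B t') + real (e B))"
          using close[OF t _ B(1)] by (intro sum_mono) (simp flip: of_nat_add)
        then show ?thesis by simp
      qed
      also have "\<dots> = real (card (Y B)) + real (card T) * real (e B)"
        by (simp add: sum.distrib flip: total of_nat_sum)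
      finally have 1: "real (card T) * real (a B t) \<le> real (card (Y B)) + real (card T) * real (e B)" .
      have "real (card (Y B)) = (\<Sum>t'\<in>T. real (a B t'))" by (simp flip: total)
      also have "\<dots> \<le> (\<Sum>t'\<in>T. real (a B t) + real (e B))"
        using close[OF _ t B(1)] by (intro sum_mono) (simp flip: of_nat_add)
      also have "\<dots> = real (card T) * real (a B t) + real (card T) * real (e B)" by (simp add: algebra_simps)
      finally have 2: "real (card (Y B)) \<le> real (card T) * real (a B t) + real (card T) * real (e B)" .
      have "real (a B t) / real (card (Y B)) - 1 / real (card T) =
          (real (card T) * real (a B t) - real (card (Y B))) / (real (card T) * real (card (Y B)))"
        using T0 Y0 by (simp add: field_simps)
      also have "\<bar>\<dots>\<bar> = \<bar>real (card T) * real (a B t) - real (card (Y B))\<bar> / (real (card T) * real (card (Y B)))"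
        using T0 Y0 by (simp add: abs_mult)
      also have "\<dots> \<le> (real (card T) * real (e B)) / (real (card T) * real (card (Y B)))"
        using 1 2 T0 Y0 by (intro divide_right_mono) auto
      also have "\<dots> = 1 - (1 - real W / real B) ^ k" using T0 Y0 by (simp add: ee)
      finally show ?thesis .
    qed
    have "(\<lambda>B. 1 - (1 - real W / real B) ^ k) \<longlonglongrightarrow> 1 - (1 - 0) ^ k"
      by (intro tendsto_intros lim_const_over_n)
    then have z: "(\<lambda>B. 1 - (1 - real W / real B) ^ k) \<longlonglongrightarrow> 0" by simp
    have "(\<lambda>B. \<bar>real (a B t) / real (card (Y B)) - 1 / real (card T)\<bar>) \<longlonglongrightarrow> 0"
    proof (rule tendsto_sandwich[OF _ _ tendsto_const z])
      show "\<forall>\<^sub>F B in sequentially. \<bar>real (a B t) / real (card (Y B)) - 1 / real (card T)\<bar>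
          \<le> 1 - (1 - real W / real B) ^ k"
        using eventually_ge_at_top[of "max 1 W"] by eventually_elim (use bound in auto)
    qed auto
    then have "(\<lambda>B. real (a B t) / real (card (Y B)) - 1 / real (card T)) \<longlonglongrightarrow> 0"
      by (rule tendsto_rabs_zero_cancel)
    then show ?thesis by (simp add: LIM_zero_iff)
  qed
  have "(\<lambda>B. \<Sum>t\<in>U. real (a B t) / real (card (Y B))) \<longlonglongrightarrow> (\<Sum>t\<in>U. 1 / real (card T))"
    using lim U by (intro tendsto_sum) auto
  moreover have "(\<Sum>t\<in>U. real (a B t) / real (card (Y B))) = real (card {x \<in> Y B. \<phi> x \<in> U}) / real (card (Y B))" for B
  proof -
    have "card {x \<in> Y B. \<phi> x \<in> U} = card (\<Union>t\<in>U. {x \<in> Y B. \<phi> x = t})"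
      by (intro arg_cong[of _ _ card]) auto
    also have "\<dots> = (\<Sum>t\<in>U. a B t)"
      unfolding a_def using finite_subset[OF U T(1)] fin_Y by (intro card_UN_disjoint) auto
    finally show ?thesis by (simp add: sum_divide_distrib)
  qed
  ultimately show ?thesis by simp
qed

section \<open>Independence of the reductions modulo distinct primes\<close>

context nf_prime
begin

lemma ex_inverse:
  assumes "algebraic_int a" "a \<notin> P"
  obtains b where "algebraic_int b" "a * b - 1 \<in> P"
proof -
  have "cl a \<in> carrier RP" "cl a \<noteq> \<zero>\<^bsub>RP\<^esub>"
    using assms cl_eq_iff[of a 0] by (auto simp: cl_carrier RP_zero)
  then have "cl a \<in> Units RP" by (simp add: F.field_Units)
  then obtain u where u: "u \<in> carrier RP" "cl a \<otimes>\<^bsub>RP\<^esub> u = \<one>\<^bsub>RP\<^esub>"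
    using F.Units_r_inv_ex by blast
  then obtain b where b: "u = cl b" "algebraic_int b" by (auto simp: RP_carrier)
  then have "cl (a * b) = cl 1" using u RP_mult[OF assms(1), of b] RP_one by simp
  then show ?thesis using that b cl_eq_iff by blast
qed

text \<open>An element of \<open>P'\<close> outside \<open>P\<close> is invertible modulo
  \<open>P\<close>, which would put 1 into \<open>P'\<close>.\<close>

lemma maximal:
  assumes "nf_prime P'" "P \<subseteq> P'"
  shows "P = P'"
proof (rule ccontr)
  interpret N: nf_prime P' by fact
  assume "P \<noteq> P'"
  then obtain a where a: "a \<in> P'" "a \<notin> P" using assms(2) by blast
  obtain b where b: "algebraic_int b" "a * b - 1 \<in> P" using ex_inverse[OF N.P_int[OF a(1)] a(2)] by blast
  have "a * b \<in> P'" using N.P_mult[OF b(1) a(1)] by (simp add: mult.commute)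
  then have "a * b - (a * b - 1) \<in> P'" using b(2) assms(2) N.P_diff by blast
  then show False using N.P_one by simp
qed

end

text \<open>The element \<open>e P\<close> is 1 modulo \<open>P\<close> and lies in all other
  members of \<open>J\<close>: a product of elements that separate \<open>P\<close> from the others,
  normalized by an inverse modulo \<open>P\<close>.\<close>

lemma crt:
  assumes J: "finite J" "\<And>P. P \<in> J \<Longrightarrow> nf_prime P" and a: "\<And>P. P \<in> J \<Longrightarrow> algebraic_int (a P)"
  obtains c :: "'k :: field_char_0" where "algebraic_int c" "\<And>P. P \<in> J \<Longrightarrow> c - a P \<in> P"
proof -
  have "\<exists>e. algebraic_int e \<and> e - 1 \<in> P \<and> (\<forall>P'\<in>J - {P}. e \<in> P')" if P: "P \<in> J" for P
  proof -
    interpret N: nf_prime P using J P by blast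
    have "\<exists>x. x \<in> P' \<and> x \<notin> P" if "P' \<in> J - {P}" for P'
      using nf_prime.maximal[of P' P] J(2) P that by blast
    then obtain x where x: "\<And>P'. P' \<in> J - {P} \<Longrightarrow> x P' \<in> P' \<and> x P' \<notin> P" by metis
    have xint: "algebraic_int (x P')" if "P' \<in> J - {P}" for P'
      using nf_prime.P_int[OF J(2)] x[OF that] that by blast
    define y where "y = (\<Prod>P'\<in>J - {P}. x P')"
    have yint: "algebraic_int y" unfolding y_def using xint by (rule algebraic_int_prod)
    have "(\<Prod>P'\<in>K. x P') \<notin> P" if "finite K" "K \<subseteq> J - {P}" for K
      using that
    proof (induction K rule: finite_induct)
      case (insert P' K)
      then show ?case
        using N.P_prime[of "x P'" "\<Prod>P'\<in>K. x P'"] x xint algebraic_int_prod[of K x] by auto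
    qed (simp add: N.P_one)
    then have "y \<notin> P" unfolding y_def using J(1) by blast
    then obtain b where b: "algebraic_int b" "y * b - 1 \<in> P" using N.ex_inverse[OF yint] by blast
    have "y * b \<in> P'" if P': "P' \<in> J - {P}" for P'
    proof -
      interpret M: nf_prime P' using J P' by blast
      have "y = x P' * (\<Prod>R\<in>J - {P} - {P'}. x R)" unfolding y_def using J(1) P' by (intro prod.remove) auto
      moreover have "algebraic_int (\<Prod>R\<in>J - {P} - {P'}. x R)" using xint by (intro algebraic_int_prod) auto
      ultimately have "y \<in> P'" using M.P_mult[of "\<Prod>R\<in>J - {P} - {P'}. x R" "x P'"] x[OF P'] by (simp add: mult.commute)
      then show ?thesis using M.P_mult[OF b(1), of y] by (simp add: mult.commute)
    qed
    then show ?thesis using b yint algebraic_int_times by (intro exI[of _ "y * b"]) auto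
  qed
  then obtain e where e: "\<And>P. P \<in> J \<Longrightarrow> algebraic_int (e P)" "\<And>P. P \<in> J \<Longrightarrow> e P - 1 \<in> P"
      "\<And>P P'. P \<in> J \<Longrightarrow> P' \<in> J - {P} \<Longrightarrow> e P \<in> P'" by metis
  define c where "c = (\<Sum>P\<in>J. a P * e P)"
  have "algebraic_int c" unfolding c_def using a e(1) by (intro algebraic_int_sum algebraic_int_times) auto
  moreover have "c - a P \<in> P" if P: "P \<in> J" for P
  proof -
    interpret N: nf_prime P using J P by blast
    have "c = a P * e P + (\<Sum>P'\<in>J - {P}. a P' * e P')" unfolding c_def using J(1) P by (rule sum.remove)
    then have "c - a P = a P * (e P - 1) + (\<Sum>P'\<in>J - {P}. a P' * e P')" by (simp add: algebra_simps)
    moreover have "(\<Sum>P'\<in>J - {P}. a P' * e P') \<in> P"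
      using e(3) P a by (intro N.P_sum N.P_mult) auto
    ultimately show ?thesis using N.P_add N.P_mult[OF a[OF P] e(2)[OF P]] by simp
  qed
  ultimately show ?thesis using that by blast
qed

definition residue_polys :: "nat \<Rightarrow> 'k :: field_char_0 set \<Rightarrow> 'k set list set" where
  "residue_polys n P = {p. finite_field.monic (residue_ring_at P) p \<and> pdeg p = n}"

lemma poly_box_form:
  assumes \<omega>: "integral_basis d \<omega>" and f: "f \<in> poly_box n d \<omega> B"
  shows "Polynomial.lead_coeff f = 1" "Polynomial.degree f = n" "algebraic_int (Polynomial.coeff f i)"
proof -
  obtain m :: "nat \<Rightarrow> nat \<Rightarrow> int" where m: "f = Polynomial.monom 1 n +
      (\<Sum>j<n. Polynomial.monom (\<Sum>l=1..d. of_int (m j l) * \<omega> l) j)"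
    using f by (auto simp: poly_box_def)
  have c: "Polynomial.coeff f i = (if i < n then (\<Sum>l=1..d. of_int (m i l) * \<omega> l) else if i = n then 1 else 0)" for i
    by (auto simp: m coeff_sum)
  show d: "Polynomial.degree f = n" by (rule antisym) (auto intro!: degree_le le_degree simp: c)
  show "Polynomial.lead_coeff f = 1" by (simp add: d c)
  have "algebraic_int (\<omega> l)" if "l \<in> {1..d}" for l using \<omega> that by (auto simp: integral_basis_def)
  then show "algebraic_int (Polynomial.coeff f i)"
    unfolding c by (auto intro!: algebraic_int_sum algebraic_int_times)
qed

lemma poly_box_mono: "B \<le> C \<Longrightarrow> poly_box n d \<omega> B \<subseteq> poly_box n d \<omega> C"
  unfolding poly_box_def by fastforce

lemma finite_poly_box:
  assumes "integral_basis d \<omega>" shows "finite (poly_box n d \<omega> B)"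
proof (cases "(2 * B) ^ (n * d) = 0")
  case False
  then show ?thesis using card_poly_box[OF assms, of n B] by (metis card.infinite)
next
  case True
  then have "B = 0" "n > 0" "d > 0" by (auto split: if_splits intro!: Nat.gr0I)
  then have "poly_box n d \<omega> B = {}" by (force simp: poly_box_def)
  then show ?thesis by simp
qed

text \<open>The fixed summand has fixed coordinates with respect to \<omega>, and \<open>V\<close>
  bounds all of them.\<close>

lemma poly_box_shift:
  assumes \<omega>: "integral_basis d \<omega>" and c: "\<And>j. algebraic_int (c j)"
  obtains V where "\<And>B f. V \<le> B \<Longrightarrow> f \<in> poly_box n d \<omega> (B - V) \<Longrightarrow>
    f + (\<Sum>j<n. Polynomial.monom (c j) j) \<in> poly_box n d \<omega> B"
proof -
  have "\<exists>v :: nat \<Rightarrow> int. c j = (\<Sum>l=1..d. of_int (v l) * \<omega> l)" for j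
    using \<omega> c[of j] unfolding integral_basis_def by auto
  then obtain v :: "nat \<Rightarrow> nat \<Rightarrow> int" where v: "\<And>j. c j = (\<Sum>l=1..d. of_int (v j l) * \<omega> l)" by metis
  define V where "V = nat (\<Sum>j<n. \<Sum>l=1..d. \<bar>v j l\<bar>)"
  have vV: "\<bar>v j l\<bar> \<le> int V" if "j < n" "l \<in> {1..d}" for j l
  proof -
    have "\<bar>v j l\<bar> \<le> (\<Sum>l=1..d. \<bar>v j l\<bar>)" using that by (intro member_le_sum) auto
    also have "\<dots> \<le> (\<Sum>j<n. \<Sum>l=1..d. \<bar>v j l\<bar>)"
      using that by (intro member_le_sum[of j _ "\<lambda>j. \<Sum>l=1..d. \<bar>v j l\<bar>"]) (auto intro: sum_nonneg)
    finally have "\<bar>v j l\<bar> \<le> (\<Sum>j<n. \<Sum>l=1..d. \<bar>v j l\<bar>)" .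
    moreover have "0 \<le> (\<Sum>j<n. \<Sum>l=1..d. \<bar>v j l\<bar>)" by (intro sum_nonneg) auto
    ultimately show ?thesis by (simp add: V_def)
  qed
  show ?thesis
  proof (rule that[of V])
    fix B f assume B: "V \<le> B" and "f \<in> poly_box n d \<omega> (B - V)"
    then obtain m where m: "f = Polynomial.monom 1 n +
        (\<Sum>j<n. Polynomial.monom (\<Sum>l=1..d. of_int (m j l) * \<omega> l) j)"
      "\<And>j l. j < n \<Longrightarrow> l \<in> {1..d} \<Longrightarrow> - int (B - V) + 1 \<le> m j l \<and> m j l \<le> int (B - V)"
      by (auto simp: poly_box_def)
    have "f + (\<Sum>j<n. Polynomial.monom (c j) j) = Polynomial.monom 1 n +
        (\<Sum>j<n. Polynomial.monom (\<Sum>l=1..d. of_int (m j l + v j l) * \<omega> l) j)"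
      by (simp add: m(1) v sum.distrib add_monom[symmetric] distrib_right add.assoc)
    moreover have "- int B + 1 \<le> m j l + v j l \<and> m j l + v j l \<le> int B" if "j < n" "l \<in> {1..d}" for j l
      using m(2)[OF that] vV[OF that] B by (auto simp: of_nat_diff abs_le_iff)
    ultimately show "f + (\<Sum>j<n. Polynomial.monom (c j) j) \<in> poly_box n d \<omega> B"
      unfolding poly_box_def by (intro CollectI exI[of _ "\<lambda>j l. m j l + v j l"]) auto
  qed
qed

text \<open>To pass from class \<open>t\<close> to class \<open>t'\<close>, a fixed polynomial of
  degree below \<open>n\<close> is added, whose coefficients are congruent, by the Chinese remainder
  theorem, to the differences of monic lifts at all primes of \<open>J\<close> at once. This
  translation is injective and moves the box by a bounded amount, as \<open>equidistribution\<close>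
  asks.\<close>

theorem density_of_reductions:
  fixes \<omega> :: "nat \<Rightarrow> 'k :: field_char_0"
  assumes \<omega>: "integral_basis d \<omega>" and J: "finite J" "\<And>P. P \<in> J \<Longrightarrow> nf_prime P"
    and U: "\<And>P. P \<in> J \<Longrightarrow> U P \<subseteq> residue_polys n P"
  shows "(\<lambda>B. real (card {f \<in> poly_box n d \<omega> B. \<forall>P\<in>J. nf_prime.red P f \<in> U P}) / real (card (poly_box n d \<omega> B)))
    \<longlonglongrightarrow> (\<Prod>P\<in>J. real (card (U P)) / real (ideal_norm P) ^ n)"
proof -
  define T where "T = PiE J (residue_polys n)"
  define \<phi> where "\<phi> f = (\<lambda>P\<in>J. nf_prime.red P f)" for f :: "'k poly"
  have fin: "finite (residue_polys n P)" and crd: "card (residue_polys n P) = ideal_norm P ^ n" if "P \<in> J" for P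
  proof -
    interpret N: nf_prime P using J that by blast
    show "finite (residue_polys n P)" "card (residue_polys n P) = ideal_norm P ^ n"
      using N.F.card_monic[of n] by (auto simp: residue_polys_def ideal_norm_def)
  qed
  have finT: "finite T" unfolding T_def using J(1) fin by (intro finite_PiE) auto
  have cT: "card T = (\<Prod>P\<in>J. ideal_norm P ^ n)"
    unfolding T_def using J(1) crd by (simp add: card_PiE)
  have redT: "\<phi> f \<in> T" if f: "f \<in> poly_box n d \<omega> B" for f B
  proof -
    have "nf_prime.red P f \<in> residue_polys n P" if "P \<in> J" for P
    proof -
      interpret N: nf_prime P using J that by blast
      have "N.intpoly f" using poly_box_form(3)[OF \<omega> f] by (simp add: N.intpoly_def)
      then show ?thesis
        using N.red_monic N.reduce_poly_eq_red(3) poly_box_form[OF \<omega> f] by (simp add: residue_polys_def)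
    qed
    then show ?thesis by (auto simp: T_def \<phi>_def)
  qed
  have shift: "\<exists>s V. inj s \<and> (\<forall>B f. V \<le> B \<longrightarrow> f \<in> poly_box n d \<omega> (B - V) \<longrightarrow> \<phi> f = t \<longrightarrow>
      s f \<in> poly_box n d \<omega> B \<and> \<phi> (s f) = t')" if t: "t \<in> T" "t' \<in> T" for t t'
  proof -
    have ex: "\<exists>p. (\<forall>i. algebraic_int (Polynomial.coeff p i)) \<and> nf_prime.red P p = u P \<and>
        Polynomial.lead_coeff p = 1 \<and> Polynomial.degree p = n" if "P \<in> J" "u \<in> T" for P u
    proof -
      interpret N: nf_prime P using J that by blast
      have "u P \<in> residue_polys n P" using that by (auto simp: T_def)
      then have "N.F.monic (u P)" "pdeg (u P) = n" by (auto simp: residue_polys_def)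
      then show ?thesis using N.lift_monic[of "u P"] unfolding N.intpoly_def by metis
    qed
    have "\<exists>p. \<forall>P\<in>J. (\<forall>i. algebraic_int (Polynomial.coeff (p P) i)) \<and> nf_prime.red P (p P) = u P \<and>
        Polynomial.lead_coeff (p P) = 1 \<and> Polynomial.degree (p P) = n" if "u \<in> T" for u
      by (rule bchoice) (use ex that in blast)
    from this[OF t(1)] this[OF t(2)] obtain p p' where
      pp: "\<forall>P\<in>J. (\<forall>i. algebraic_int (Polynomial.coeff (p P) i)) \<and> nf_prime.red P (p P) = t P \<and>
        Polynomial.lead_coeff (p P) = 1 \<and> Polynomial.degree (p P) = n"
      and pp': "\<forall>P\<in>J. (\<forall>i. algebraic_int (Polynomial.coeff (p' P) i)) \<and> nf_prime.red P (p' P) = t' P \<and>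
        Polynomial.lead_coeff (p' P) = 1 \<and> Polynomial.degree (p' P) = n" by blast
    have p: "\<And>P i. P \<in> J \<Longrightarrow> algebraic_int (Polynomial.coeff (p P) i)" "\<And>P. P \<in> J \<Longrightarrow> nf_prime.red P (p P) = t P"
      using pp by blast+
    have p': "\<And>P i. P \<in> J \<Longrightarrow> algebraic_int (Polynomial.coeff (p' P) i)" "\<And>P. P \<in> J \<Longrightarrow> nf_prime.red P (p' P) = t' P"
        "\<And>P. P \<in> J \<Longrightarrow> Polynomial.lead_coeff (p' P) = 1 \<and> Polynomial.degree (p' P) = n"
      using pp' by blast+
    have "\<exists>c. algebraic_int c \<and> (\<forall>P\<in>J. c - (Polynomial.coeff (p' P) j - Polynomial.coeff (p P) j) \<in> P)" for j
    proof -
      obtain c where "algebraic_int c" "\<And>P. P \<in> J \<Longrightarrow> c - (Polynomial.coeff (p' P) j - Polynomial.coeff (p P) j) \<in> P"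
        by (rule crt[OF J, of "\<lambda>P. Polynomial.coeff (p' P) j - Polynomial.coeff (p P) j"])
          (use p(1) p'(1) in \<open>auto intro: algebraic_int_diff\<close>)
      then show ?thesis by blast
    qed
    then obtain c where c: "\<And>j. algebraic_int (c j)"
      "\<And>j P. P \<in> J \<Longrightarrow> c j - (Polynomial.coeff (p' P) j - Polynomial.coeff (p P) j) \<in> P" by metis
    obtain V where V: "\<And>B f. V \<le> B \<Longrightarrow> f \<in> poly_box n d \<omega> (B - V) \<Longrightarrow>
        f + (\<Sum>j<n. Polynomial.monom (c j) j) \<in> poly_box n d \<omega> B"
    proof (rule poly_box_shift[OF \<omega>, of c n, OF c(1)])
      fix V assume V: "\<And>B f. V \<le> B \<Longrightarrow> f \<in> poly_box n d \<omega> (B - V) \<Longrightarrow>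
        f + (\<Sum>j<n. Polynomial.monom (c j) j) \<in> poly_box n d \<omega> B"
      show thesis by (rule that[of V]) (rule V)
    qed
    define s where "s = (\<lambda>f. f + (\<Sum>j<n. Polynomial.monom (c j) j))"
    have "\<phi> (s f) = t'" if B: "V \<le> B" and f: "f \<in> poly_box n d \<omega> (B - V)" "\<phi> f = t" for B f
    proof
      fix P
      show "\<phi> (s f) P = t' P"
      proof (cases "P \<in> J")
        case True
        interpret N: nf_prime P using J True by blast
        have sf: "s f \<in> poly_box n d \<omega> B" using V[OF B f(1)] by (simp add: s_def)
        have fi: "N.intpoly f" "N.intpoly (s f)" "N.intpoly (p P)" "N.intpoly (p' P)"
          using poly_box_form(3)[OF \<omega> f(1)] poly_box_form(3)[OF \<omega> sf] p(1)[OF True] p'(1)[OF True]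
          by (auto simp: N.intpoly_def)
        have "N.red f = N.red (p P)" using fun_cong[OF f(2), of P] True p(2) by (simp add: \<phi>_def)
        then have fp: "Polynomial.coeff f i - Polynomial.coeff (p P) i \<in> P" for i
          using N.red_eq_iff[OF fi(1,3)] by blast
        have "Polynomial.coeff (s f) i - Polynomial.coeff (p' P) i \<in> P" for i
        proof -
          have ci: "Polynomial.coeff (s f) i = Polynomial.coeff f i + (if i < n then c i else 0)"
            by (auto simp: s_def coeff_sum)
          consider "i < n" | "i = n" | "i > n" by linarith
          then show ?thesis
          proof cases
            case 1
            then show ?thesis using N.P_add[OF fp[of i] c(2)[OF True, of i]] by (simp add: ci algebra_simps)
          next
            case 2
            then show ?thesis
              using poly_box_form(1,2)[OF \<omega> sf] p'(3)[OF True] N.P_zero by auto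
          next
            case 3
            then show ?thesis
              using poly_box_form(2)[OF \<omega> sf] p'(3)[OF True] N.P_zero by (simp add: coeff_eq_0)
          qed
        qed
        then have "N.red (s f) = N.red (p' P)" using N.red_eq_iff[OF fi(2,4)] by blast
        then show ?thesis using p'(2)[OF True] True by (simp add: \<phi>_def)
      next
        case False
        then show ?thesis using t(2) by (auto simp: \<phi>_def T_def PiE_iff extensional_def)
      qed
    qed
    moreover have "inj s" by (simp add: s_def inj_def)
    ultimately show ?thesis using V by (intro exI[of _ s] exI[of _ V]) (auto simp: s_def)
  qed
  have UT: "PiE J U \<subseteq> T" unfolding T_def using U by (rule PiE_mono)
  have "(\<lambda>B. real (card {f \<in> poly_box n d \<omega> B. \<phi> f \<in> PiE J U}) / real (card (poly_box n d \<omega> B)))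
      \<longlonglongrightarrow> real (card (PiE J U)) / real (card T)"
    by (rule equidistribution[OF card_poly_box[OF \<omega>] finite_poly_box[OF \<omega>] poly_box_mono finT redT shift UT])
  moreover have "\<phi> f \<in> PiE J U \<longleftrightarrow> (\<forall>P\<in>J. nf_prime.red P f \<in> U P)" for f
    by (auto simp: \<phi>_def PiE_iff)
  moreover have "real (card (PiE J U)) / real (card T) = (\<Prod>P\<in>J. real (card (U P)) / real (ideal_norm P) ^ n)"
    using J(1) by (simp add: card_PiE cT prod_dividef)
  ultimately show ?thesis by simp
qed

section \<open>Full symmetric Galois groups from splitting types\<close>

lemma (in nf_prime) has_splitting_type_iff:
  assumes "Polynomial.lead_coeff f = 1"
  shows "has_splitting_type P f \<mu> \<longleftrightarrow> red f \<in> F.type_monic \<mu>"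
proof -
  have deg: "pdeg = (\<lambda>p :: 'k set list. length p - 1)" by (simp add: fun_eq_iff pdeg_def)
  have "A \<subseteq> carrier F.RX \<and> (\<forall>g\<in>A. pirreducible\<^bsub>RP\<^esub> (carrier RP) g \<and> hd g = \<one>\<^bsub>RP\<^esub>) \<longleftrightarrow> A \<subseteq> F.Irred" for A
    using F.pirreducibleE(1)[OF F.carrier_is_subring] by (auto simp: F.Irred_def F.monic_def)
  then have "(finite A \<and> A \<subseteq> carrier F.RX \<and> (\<forall>g\<in>A. pirreducible\<^bsub>RP\<^esub> (carrier RP) g \<and> hd g = \<one>\<^bsub>RP\<^esub>) \<and> Q) \<longleftrightarrow>
      (finite A \<and> A \<subseteq> F.Irred \<and> Q)" for A Q by blast
  then show ?thesis
    unfolding has_splitting_type_def Let_def reduce_poly_eq_red(1)[OF assms] F.type_monic_def deg mem_Collect_eq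
    by (simp only:)
qed

text \<open>Records the action of a Frobenius element on the roots without mentioning
  \<open>P\<close> or \<open>Q\<close>, so that the data from several primes can be
  combined.\<close>

definition frobenius_data :: "'k :: field_char_0 poly \<Rightarrow> nat multiset \<Rightarrow>
    ('k alg_closure \<Rightarrow> 'k alg_closure) \<Rightarrow> 'k set list set \<Rightarrow> ('k set list \<Rightarrow> 'k alg_closure set) \<Rightarrow> bool" where
  "frobenius_data f \<mu> \<sigma> A W \<longleftrightarrow> \<sigma> \<in> carrier (galois_group f) \<and> finite A \<and>
    \<mu> = image_mset pdeg (mset_set A) \<and> {z. poly (map_poly to_ac f) z = 0} = (\<Union>g\<in>A. W g) \<and>
    (\<forall>g\<in>A. card (W g) = pdeg g) \<and>
    card {z. poly (map_poly to_ac f) z = 0} = Polynomial.degree f \<and> (\<forall>g\<in>A. \<forall>z\<in>W g. \<sigma> z \<in> W g) \<and>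
    (\<forall>g\<in>A. \<forall>x\<in>W g. \<forall>y\<in>W g. \<exists>j. (\<sigma> ^^ j) x = y)"

lemma frobenius_dataD:
  assumes "frobenius_data f \<mu> \<sigma> A W"
  shows "\<sigma> \<in> carrier (galois_group f)" "finite A" "\<mu> = image_mset pdeg (mset_set A)"
    "{z. poly (map_poly to_ac f) z = 0} = (\<Union>g\<in>A. W g)" "\<And>g. g \<in> A \<Longrightarrow> card (W g) = pdeg g"
    "card {z. poly (map_poly to_ac f) z = 0} = Polynomial.degree f"
    "\<And>g z. g \<in> A \<Longrightarrow> z \<in> W g \<Longrightarrow> \<sigma> z \<in> W g"
    "\<And>g x y. g \<in> A \<Longrightarrow> x \<in> W g \<Longrightarrow> y \<in> W g \<Longrightarrow> \<exists>j. (\<sigma> ^^ j) x = y"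
  using assms unfolding frobenius_data_def by (blast, blast, blast, blast, blast, blast, blast, blast)

lemma frobenius_of_type:
  fixes f :: "'k :: field_char_0 poly"
  assumes P: "nf_prime P" and f: "\<And>i. algebraic_int (Polynomial.coeff f i)" "Polynomial.lead_coeff f = 1"
    and t: "has_splitting_type P f \<mu>"
  shows "\<exists>\<sigma> A W. frobenius_data f \<mu> \<sigma> A W"
proof -
  obtain Q where "nf_prime_over P Q" using nf_prime.ex_prime_over[OF P] by blast
  then interpret nf_prime_over P Q .
  have fi: "intpoly f" using f(1) by (simp add: intpoly_def)
  obtain A where A: "finite A" "A \<subseteq> F.Irred" "red f = finprod F.RX (\<lambda>g. g) A" "\<mu> = image_mset pdeg (mset_set A)"
    using t unfolding has_splitting_type_iff[OF f(2)] F.type_monic_def by blast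
  show ?thesis
  proof (rule frobenius_element[OF fi f(2) A(1-3)])
    fix \<sigma> W
    assume W: "\<sigma> \<in> carrier (galois_group f)" "{z. poly (map_poly to_ac f) z = 0} = (\<Union>g\<in>A. W g)"
      "\<And>g. g \<in> A \<Longrightarrow> card (W g) = pdeg g" "card {z. poly (map_poly to_ac f) z = 0} = Polynomial.degree f"
      "\<And>g z. g \<in> A \<Longrightarrow> z \<in> W g \<Longrightarrow> \<sigma> z \<in> W g"
      "\<And>g x y. g \<in> A \<Longrightarrow> x \<in> W g \<Longrightarrow> y \<in> W g \<Longrightarrow> \<exists>j. (\<sigma> ^^ j) x = y"
    have "frobenius_data f \<mu> \<sigma> A W"
      unfolding frobenius_data_def by (intro conjI ballI W A)
    then show ?thesis by blast
  qed
qed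

text \<open>A single orbit gives transitivity; an orbit of size \<open>n - 1\<close> beside a fixed
  root gives transitivity of the stabilizer of that root; one orbit of size 2 beside fixed roots
  gives a transposition.\<close>

lemma galois_group_sym_if_types:
  fixes f :: "'k :: field_char_0 poly"
  assumes f: "\<And>i. algebraic_int (Polynomial.coeff f i)" "Polynomial.lead_coeff f = 1" "Polynomial.degree f = n"
    and t1: "nf_prime P1" "has_splitting_type P1 f {#n#}"
    and t2: "nf_prime P2" "has_splitting_type P2 f {#n - 1, 1#}"
    and t3: "nf_prime P3" "has_splitting_type P3 f (add_mset 2 (replicate_mset (n - 2) 1))"
  shows "galois_group f \<cong> sym_group n"
proof -
  define Z where "Z = {z. poly (map_poly to_ac f) z = 0}"
  have f0: "f \<noteq> 0" using f(2) by auto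
  interpret G: galois_setup f by unfold_locales (rule f0)
  have GZ: "G.Z = Z" by (simp add: G.Z_def Z_def)
  obtain \<sigma>1 A1 W1 where D1: "frobenius_data f {#n#} \<sigma>1 A1 W1"
    using frobenius_of_type[OF t1(1) f(1,2) t1(2)] by blast
  obtain \<sigma>2 A2 W2 where D2: "frobenius_data f {#n - 1, 1#} \<sigma>2 A2 W2"
    using frobenius_of_type[OF t2(1) f(1,2) t2(2)] by blast
  obtain \<sigma>3 A3 W3 where D3: "frobenius_data f (add_mset 2 (replicate_mset (n - 2) 1)) \<sigma>3 A3 W3"
    using frobenius_of_type[OF t3(1) f(1,2) t3(2)] by blast
  note 1 = frobenius_dataD[OF D1, folded Z_def G.\<Gamma>_def, unfolded f(3)]
  note 2 = frobenius_dataD[OF D2, folded Z_def G.\<Gamma>_def]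
  note 3 = frobenius_dataD[OF D3, folded Z_def G.\<Gamma>_def]
  have "card A1 = 1" using arg_cong[OF 1(3), of size] by simp
  then obtain g1 where g1: "A1 = {g1}" by (rule card_1_singletonE)
  have T: "\<exists>j. (\<sigma>1 ^^ j) x = y" if "x \<in> Z" "y \<in> Z" for x y
    using 1(8)[of g1 x y] that 1(4) g1 by simp
  have "card A2 = 2" using arg_cong[OF 2(3), of size] by simp
  then obtain u v where uv: "A2 = {u, v}" "u \<noteq> v" by (meson card_2_iff)
  then have "{#n - 1, 1#} = {#pdeg u, pdeg v#}" using 2(3) by simp
  \<comment> \<open>The parts are unordered, and for \<open>n = 2\<close> both are 1, so either
    factor may have to serve as the linear one.\<close>
  then have "pdeg v = 1 \<or> pdeg u = 1" by (auto simp: add_eq_conv_ex)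
  then obtain g h where gh: "A2 = {g, h}" "pdeg h = 1" using uv by auto
  then have "card (W2 h) = 1" using 2(5)[of h] by simp
  then obtain c where c: "W2 h = {c}" by (rule card_1_singletonE)
  have S: "c \<in> Z" "\<sigma>2 c = c" using 2(4) 2(7)[of h c] gh c by auto
  have S2: "\<exists>j. (\<sigma>2 ^^ j) x = y" if "x \<in> Z - {c}" "y \<in> Z - {c}" for x y
    using 2(8)[of g x y] that 2(4) gh c by auto
  have "2 \<in># image_mset pdeg (mset_set A3)" unfolding 3(3)[symmetric] by simp
  then obtain k where k: "k \<in> A3" "pdeg k = 2" using 3(2) by auto
  have "mset_set A3 = add_mset k (mset_set (A3 - {k}))" using 3(2) k(1) by (rule mset_set.remove)
  then have rest: "replicate_mset (n - 2) 1 = image_mset pdeg (mset_set (A3 - {k}))" using 3(3) k(2) by simp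
  have one: "pdeg h = 1" if "h \<in> A3 - {k}" for h
  proof -
    have "pdeg h \<in># replicate_mset (n - 2) 1" unfolding rest using that 3(2) by simp
    then show ?thesis by (auto split: if_splits)
  qed
  have "card (W3 k) = 2" using 3(5)[OF k(1)] k(2) by simp
  then obtain a b where ab: "W3 k = {a, b}" "a \<noteq> b" unfolding card_2_iff by blast
  have fixed: "(\<sigma>3 ^^ j) z = z" if "\<sigma>3 z = z" for z j using that by (induction j) auto
  \<comment> \<open>If \<open>a\<close> were fixed, no power of \<open>\<sigma>3\<close> could move
    it to \<open>b\<close>.\<close>
  have sa: "\<sigma>3 a = b"
  proof (rule ccontr)
    assume "\<sigma>3 a \<noteq> b"
    moreover have "\<sigma>3 a \<in> W3 k" by (rule 3(7)[OF k(1)]) (simp add: ab)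
    ultimately have "\<sigma>3 a = a" by (simp add: ab(1))
    moreover obtain j where "(\<sigma>3 ^^ j) a = b" using 3(8)[OF k(1), of a b] by (auto simp: ab(1))
    ultimately show False using fixed[of a j] ab(2) by simp
  qed
  have sb: "\<sigma>3 b = a"
  proof (rule ccontr)
    assume "\<sigma>3 b \<noteq> a"
    moreover have "\<sigma>3 b \<in> W3 k" by (rule 3(7)[OF k(1)]) (simp add: ab)
    ultimately have "\<sigma>3 b = b" by (simp add: ab(1))
    moreover obtain j where "(\<sigma>3 ^^ j) b = a" using 3(8)[OF k(1), of b a] by (auto simp: ab(1))
    ultimately show False using fixed[of b j] ab(2) by simp
  qed
  have sz: "\<sigma>3 z = z" if z: "z \<in> Z - {a, b}" for z
  proof -
    obtain h where h: "h \<in> A3 - {k}" "z \<in> W3 h" using z 3(4) ab by auto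
    then have "card (W3 h) = 1" using 3(5)[of h] one[OF h(1)] by simp
    then obtain e where "W3 h = {e}" by (rule card_1_singletonE)
    then show ?thesis using 3(7)[of h z] h by auto
  qed
  have abZ: "a \<in> Z" "b \<in> Z" using 3(4) k(1) ab by auto
  show ?thesis
    by (rule G.iso_sym_group[unfolded GZ, OF 1(6) 1(1) T 2(1) S S2 3(1) abZ ab(2) sa sb sz])
qed

section \<open>Primes of the number field\<close>

text \<open>A nonzero prime contains a positive integer \<open>N\<close>; hence the coordinates of
  an algebraic integer with respect to \<omega> matter only modulo \<open>N\<close>, and finitely
  many classes remain.\<close>

lemma nf_primeI:
  fixes P :: "'k :: field_char_0 set" and \<omega> :: "nat \<Rightarrow> 'k"
  assumes \<omega>: "integral_basis d \<omega>" and P: "primeideal P ring_of_integers" "P \<noteq> {0}"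
  shows "nf_prime P"
proof (rule nf_prime.intro)
  interpret PI: primeideal P ring_of_integers by (rule P(1))
  have Psub: "algebraic_int x" if "x \<in> P" for x using PI.a_subset that by auto
  have Pmult: "a * x \<in> P" if "algebraic_int a" "x \<in> P" for a x using PI.I_l_closed[of x a] that by simp
  have Padd: "x + y \<in> P" if "x \<in> P" "y \<in> P" for x y
    using additive_subgroup.a_closed[OF PI.additive_subgroup_axioms that] by simp
  have P0: "0 \<in> P" using additive_subgroup.zero_closed[OF PI.additive_subgroup_axioms] by simp
  obtain x where x: "x \<in> P" "x \<noteq> 0" using P(2) P0 by blast
  obtain p0 :: "int poly" where p0': "poly (map_poly of_int p0) x = 0 \<and> Polynomial.lead_coeff p0 = 1"
    using Psub[OF x(1)] unfolding algebraic_int_altdef_ipoly by (rule exE)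
  then have p0: "p0 \<noteq> 0" "poly (map_poly of_int p0) x = 0" by auto
  \<comment> \<open>Least degree forces a nonzero constant coefficient \<open>c\<close>, and the
    equation makes \<open>c\<close> a multiple of \<open>x\<close>.\<close>
  obtain p :: "int poly" where p: "p \<noteq> 0" "poly (map_poly of_int p) x = 0"
    and min: "\<And>r :: int poly. r \<noteq> 0 \<and> poly (map_poly of_int r) x = 0 \<Longrightarrow> Polynomial.degree p \<le> Polynomial.degree r"
    using ex_has_least_nat[of "\<lambda>p :: int poly. p \<noteq> 0 \<and> poly (map_poly of_int p) x = 0" p0 Polynomial.degree] p0 by blast
  obtain c r where pc: "p = pCons c r" by (cases p)
  have ev: "of_int c + x * poly (map_poly of_int r) x = 0"
  proof -
    have "map_poly of_int p = pCons (of_int c) (map_poly of_int r :: 'k poly)"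
      unfolding pc by (intro poly_eqI) (auto simp: coeff_map_poly coeff_pCons split: nat.splits)
    then show ?thesis using p(2) by simp
  qed
  have c0: "c \<noteq> 0"
  proof
    assume "c = 0"
    then have "r \<noteq> 0" "poly (map_poly of_int r) x = 0" using p(1) ev x(2) by (auto simp: pc)
    then have "Polynomial.degree p \<le> Polynomial.degree r" using min by blast
    then show False using \<open>r \<noteq> 0\<close> by (simp add: pc)
  qed
  have "algebraic_int (poly (map_poly of_int r) x)"
    by (rule algebraic_int_poly[OF _ Psub[OF x(1)]]) (simp add: coeff_map_poly algebraic_int_of_int')
  then have "- poly (map_poly of_int r) x * x \<in> P" using x(1) by (intro Pmult) auto
  moreover have "of_int c = - poly (map_poly of_int r) x * x" using ev by (simp add: mult.commute eq_neg_iff_add_eq_0)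
  ultimately have cP: "of_int c \<in> P" by simp
  define N where "N = \<bar>c\<bar>"
  have N: "N > 0" "of_int N \<in> P"
    using c0 cP Pmult[of "-1" "of_int c"] by (auto simp: N_def abs_if)
  have \<omega>i: "algebraic_int (\<omega> l)" if "l \<in> {1..d}" for l using \<omega> that by (auto simp: integral_basis_def)
  define S where "S m = (\<Sum>l=1..d. of_int (m l) * \<omega> l)" for m :: "nat \<Rightarrow> int"
  have Sint: "algebraic_int (S m)" for m
    unfolding S_def using \<omega>i by (intro algebraic_int_sum algebraic_int_times algebraic_int_of_int') auto
  define cl where "cl a = P +>\<^bsub>ring_of_integers\<^esub> a" for a
  have cl_sub: "cl a \<subseteq> cl b" if "a - b \<in> P" for a b
  proof
    fix y assume "y \<in> cl a"
    then obtain p where "p \<in> P" "y = p + a" by (auto simp: cl_def a_r_coset_def')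
    then have "y = (p + (a - b)) + b" "p + (a - b) \<in> P" using that Padd by auto
    then show "y \<in> cl b" by (auto simp: cl_def a_r_coset_def' intro!: bexI[of _ "p + (a - b)"])
  qed
  have cl_eq: "cl a = cl b" if ab: "a - b \<in> P" for a b
  proof -
    have "b - a \<in> P" using Pmult[of "-1" "a - b"] ab by simp
    then show ?thesis using cl_sub ab by blast
  qed
  have "carrier (residue_ring_at P) \<subseteq> (\<lambda>m. cl (S m)) ` PiE {1..d} (\<lambda>_. {0..<N})"
  proof
    fix u assume "u \<in> carrier (residue_ring_at P)"
    then obtain a where a: "u = cl a" "algebraic_int a"
      by (auto simp: residue_ring_at_def FactRing_def A_RCOSETS_def' cl_def)
    obtain m where m: "a = S m" using \<omega> a(2) unfolding integral_basis_def S_def by auto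
    define m' where "m' = (\<lambda>l\<in>{1..d}. m l mod N)"
    have "a - S m' = (\<Sum>l=1..d. of_int (m l - m l mod N) * \<omega> l)"
      by (simp add: m S_def m'_def sum_subtractf left_diff_distrib)
    also have "\<dots> = (\<Sum>l=1..d. of_int (m l div N) * \<omega> l) * of_int N"
      by (simp add: sum_distrib_left minus_mod_eq_mult_div mult_ac)
    also have "\<dots> \<in> P" using Pmult[OF Sint[of "\<lambda>l. m l div N"] N(2)] by (simp add: S_def)
    finally have "u = cl (S m')" using cl_eq a(1) by blast
    moreover have "m' \<in> PiE {1..d} (\<lambda>_. {0..<N})" using N(1) by (simp add: m'_def)
    ultimately show "u \<in> (\<lambda>m. cl (S m)) ` PiE {1..d} (\<lambda>_. {0..<N})" by blast
  qed
  then show "finite (carrier (residue_ring_at P))"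
    by (rule finite_surj[rotated]) (intro finite_PiE, auto)
  show "primeideal P ring_of_integers" by (rule P(1))
qed

text \<open>Lying over for the multiples of \<open>p\<close> among the rational integers. The
  ambient field is the given one, not its closure, so the prime obtained is already an ideal of
  \<open>ring_of_integers\<close>.\<close>

lemma ex_prime_ideal_over:
  assumes p: "Factorial_Ring.prime (p :: nat)"
  shows "\<exists>P :: 'k :: field_char_0 set. primeideal P ring_of_integers \<and> of_nat p \<in> P"
proof -
  define A where "A = range (of_int :: int \<Rightarrow> 'k)"
  define P0 where "P0 = (\<lambda>k. of_int (int p * k) :: 'k) ` UNIV"
  have P0_iff: "of_int k \<in> P0 \<longleftrightarrow> int p dvd k" for k
    unfolding P0_def dvd_def by (auto simp del: of_int_mult simp: of_int_eq_iff)
  have P0A: "x \<in> P0 \<Longrightarrow> \<exists>k. x = of_int k" for x unfolding P0_def by blast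
  have pp: "Factorial_Ring.prime (int p)" using p by simp
  obtain Q where Q: "integer_prime Q" "Q \<inter> A = P0"
  proof (rule lying_over[of A P0])
    fix a b
    show "a + b \<in> A" "a * b \<in> A" if "a \<in> A" "b \<in> A"
      using that by (auto simp: A_def simp flip: of_int_add of_int_mult)
    show "a + b \<in> P0" if ab: "a \<in> P0" "b \<in> P0"
    proof -
      obtain k l where "a = of_int k" "b = of_int l" using P0A[OF ab(1)] P0A[OF ab(2)] by blast
      then show ?thesis using ab P0_iff[of k] P0_iff[of l] P0_iff[of "k + l"] by simp
    qed
    show "a * b \<in> P0" if ab: "a \<in> A" "b \<in> P0"
    proof -
      obtain k l where "a = of_int k" "b = of_int l" using ab(1) P0A[OF ab(2)] by (auto simp: A_def)
      then show ?thesis using ab P0_iff[of l] P0_iff[of "k * l"] by simp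
    qed
    show "a \<in> P0 \<or> b \<in> P0" if ab: "a \<in> A" "b \<in> A" "a * b \<in> P0"
    proof -
      obtain k l where "a = of_int k" "b = of_int l" using ab(1,2) by (auto simp: A_def)
      then show ?thesis
        using ab(3) P0_iff[of k] P0_iff[of l] P0_iff[of "k * l"] prime_dvd_mult_iff[OF pp] by simp
    qed
  next
    show "1 \<notin> P0" using P0_iff[of 1] pp not_prime_unit by (metis of_int_1 dvd_refl)
    show "0 \<in> P0" using P0_iff[of 0] by simp
    show "1 \<in> A" unfolding A_def by (rule range_eqI[of _ _ 1]) simp
    show "P0 \<subseteq> A" using P0A by (auto simp: A_def)
  qed (auto simp: A_def algebraic_int_of_int')
  interpret integer_prime Q by (rule Q(1))
  have "primeideal Q ring_of_integers"
    by (rule primeideal_ring_of_integersI) (use mem_int zero_mem add_mem mult_mem one_not_mem prime in auto)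
  moreover have "of_nat p \<in> Q" using P0_iff[of "int p"] Q(2) by auto
  ultimately show ?thesis by blast
qed

context nf_prime
begin

lemma of_int_coprime:
  assumes "of_int a \<in> P" "of_int b \<in> P" "coprime a b"
  shows False
proof -
  obtain u v where "u * a + v * b = 1" using bezout_int[of a b] assms(3) by (metis coprime_iff_gcd_eq_1)
  then have "of_int u * of_int a + of_int v * of_int b = (1 :: 'k)"
    by (metis of_int_1 of_int_add of_int_mult)
  then show False
    using P_add[OF P_mult[OF algebraic_int_of_int' assms(1)] P_mult[OF algebraic_int_of_int' assms(2)]] P_one by metis
qed

text \<open>The residues of the integers from 0 to \<open>p - 1\<close> are distinct, since
  \<open>P\<close> cannot contain \<open>p\<close> together with an integer coprime to it.\<close>

lemma norm_ge:
  assumes "Factorial_Ring.prime (p :: nat)" "of_nat p \<in> P"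
  shows "ideal_norm P \<ge> p"
proof -
  have inj: "inj_on (\<lambda>i :: nat. cl (of_nat i)) {..<p}"
  proof (rule inj_onI)
    fix i j assume ij: "i \<in> {..<p}" "j \<in> {..<p}" "cl (of_nat i) = cl (of_nat j)"
    then have m: "of_int (int i - int j) \<in> P" using cl_eq_iff by simp
    show "i = j"
    proof (rule ccontr)
      assume "i \<noteq> j"
      then have "\<not> int p dvd (int i - int j)" using ij zdvd_not_zless[of "\<bar>int i - int j\<bar>" "int p"] by auto
      then have "coprime (int p) (int i - int j)" using assms(1) prime_imp_coprime[of "int p"] by simp
      then show False using of_int_coprime[of "int p" "int i - int j"] m assms(2) by simp
    qed
  qed
  have "(\<lambda>i :: nat. cl (of_nat i)) ` {..<p} \<subseteq> carrier RP"
    using cl_carrier by (auto intro!: int_imp_algebraic_int)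
  then have "card ((\<lambda>i :: nat. cl (of_nat i)) ` {..<p}) \<le> card (carrier RP)" using fin_res card_mono by blast
  then show ?thesis using card_image[OF inj] by (simp add: ideal_norm_def)
qed

lemma norm_ge2: "ideal_norm P \<ge> 2"
proof -
  have "cl 0 \<noteq> cl 1" using cl_eq_iff[of 1 0] P_one by auto
  then have "card {cl 0, cl 1} = 2" by simp
  moreover have "{cl 0, cl 1} \<subseteq> carrier RP" using cl_carrier by auto
  ultimately show ?thesis using card_mono[OF fin_res, of "{cl 0, cl 1}"] by (simp add: ideal_norm_def)
qed

lemma discriminant_sqfree:
  assumes "intpoly f" "Polynomial.lead_coeff f = 1"
  shows "discriminant f \<notin> P \<longleftrightarrow> red f \<in> F.sqfree_monic (Polynomial.degree f)" "algebraic_int (discriminant f)"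
proof -
  obtain Q where "nf_prime_over P Q" using ex_prime_over by blast
  then interpret nf_prime_over P Q .
  show "discriminant f \<notin> P \<longleftrightarrow> red f \<in> F.sqfree_monic (Polynomial.degree f)" "algebraic_int (discriminant f)"
    using discriminant_sqfree_iff[OF assms] discriminant_int[OF assms] by auto
qed

end

text \<open>Coprimality is written as a relation \<open>a * x + u = 1\<close>, and the induction
  also carries that the product is an ideal. If \<open>1 - b * x\<close> lies in \<open>P i\<close>
  and \<open>a * x + u = 1\<close> with \<open>u\<close> in the old product, then
  \<open>(a + b * u) * x + (1 - b * x) * u = 1\<close> is the relation for the new one.\<close>

lemma finprod_ideals_coprime:
  fixes J :: "'i set" and P :: "'i \<Rightarrow> 'k :: field_char_0 set"
  assumes "finite J" "\<And>i. i \<in> J \<Longrightarrow> nf_prime (P i)" and x: "algebraic_int x"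
  shows "ideal (finprod (ideals_set ring_of_integers) P J) ring_of_integers \<and>
    ((\<exists>a u. algebraic_int a \<and> u \<in> finprod (ideals_set ring_of_integers) P J \<and> a * x + u = 1) \<longleftrightarrow> (\<forall>i\<in>J. x \<notin> P i))"
  using assms(1,2)
proof (induction J rule: finite_induct)
  interpret O: domain "ring_of_integers :: 'k ring" by (rule ring_of_integers_domain)
  interpret IS: Group.comm_monoid "ideals_set (ring_of_integers :: 'k ring)" by (rule O.ideals_set_is_comm_monoid)
  case empty
  have "finprod (ideals_set ring_of_integers) P {} = carrier ring_of_integers"
    unfolding IS.finprod_empty by (simp add: ideals_set_def)
  moreover have "\<exists>a u. algebraic_int a \<and> u \<in> carrier ring_of_integers \<and> a * x + u = 1"
    by (intro exI[of _ 0] exI[of _ 1]) auto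
  ultimately show ?case using O.oneideal by simp
next
  interpret O: domain "ring_of_integers :: 'k ring" by (rule ring_of_integers_domain)
  interpret IS: Group.comm_monoid "ideals_set (ring_of_integers :: 'k ring)" by (rule O.ideals_set_is_comm_monoid)
  case (insert i J)
  define I where "I = finprod (ideals_set ring_of_integers) P J"
  interpret N: nf_prime "P i" using insert.prems by blast
  have I: "ideal I ring_of_integers"
    and IH: "(\<exists>a u. algebraic_int a \<and> u \<in> I \<and> a * x + u = 1) \<longleftrightarrow> (\<forall>i\<in>J. x \<notin> P i)"
    using insert by (auto simp: I_def)
  interpret I: ideal I ring_of_integers by (rule I)
  have carr: "P j \<in> carrier (ideals_set ring_of_integers)" if "j \<in> insert i J" for j
  proof -
    interpret M: nf_prime "P j" using insert.prems that by blast
    show ?thesis using M.PI.ideal_axioms by (simp add: ideals_set_def)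
  qed
  have "finprod (ideals_set ring_of_integers) P (insert i J) = P i \<otimes>\<^bsub>ideals_set ring_of_integers\<^esub> I"
    unfolding I_def using insert carr by (intro IS.finprod_insert) auto
  then have eq: "finprod (ideals_set ring_of_integers) P (insert i J) = P i \<cdot>\<^bsub>ring_of_integers\<^esub> I"
    by (simp add: ideals_set_def)
  have idl: "ideal (P i \<cdot>\<^bsub>ring_of_integers\<^esub> I) ring_of_integers"
    by (rule O.ideal_prod_is_ideal[OF N.PI.ideal_axioms I])
  have sub: "P i \<cdot>\<^bsub>ring_of_integers\<^esub> I \<subseteq> P i \<inter> I" by (rule O.ideal_prod_inter[OF N.PI.ideal_axioms I])
  have "(\<exists>a u. algebraic_int a \<and> u \<in> P i \<cdot>\<^bsub>ring_of_integers\<^esub> I \<and> a * x + u = 1) \<longleftrightarrow> (\<forall>i\<in>insert i J. x \<notin> P i)"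
  proof
    assume "\<exists>a u. algebraic_int a \<and> u \<in> P i \<cdot>\<^bsub>ring_of_integers\<^esub> I \<and> a * x + u = 1"
    then obtain a u where au: "algebraic_int a" "u \<in> P i" "u \<in> I" "a * x + u = 1" using sub by blast
    have "x \<notin> P i"
      using N.P_add[OF N.P_mult[OF au(1)] au(2), of x] au(4) N.P_one by auto
    then show "\<forall>i\<in>insert i J. x \<notin> P i" using au IH by blast
  next
    assume xs: "\<forall>i\<in>insert i J. x \<notin> P i"
    then obtain a u where au: "algebraic_int a" "u \<in> I" "a * x + u = 1" using IH by blast
    obtain b where b: "algebraic_int b" "x * b - 1 \<in> P i" using N.ex_inverse[OF x] xs by blast
    have "1 - b * x \<in> P i" using N.P_uminus[OF b(2)] by (simp add: mult.commute)
    then have "(1 - b * x) * u \<in> P i \<cdot>\<^bsub>ring_of_integers\<^esub> I"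
      using ideal_prod.prod[of "1 - b * x" "P i" u I ring_of_integers] au(2) by simp
    moreover have "(a + b * u) * x + (1 - b * x) * u = 1" using au(3) by (simp add: algebra_simps)
    moreover have "algebraic_int (a + b * u)"
      using au(1,2) b(1) I.a_subset by (auto intro!: algebraic_int_plus algebraic_int_times)
    ultimately show "\<exists>a u. algebraic_int a \<and> u \<in> P i \<cdot>\<^bsub>ring_of_integers\<^esub> I \<and> a * x + u = 1" by blast
  qed
  then show ?case unfolding eq using idl by blast
qed

lemma coprime_discriminant_iff:
  fixes P :: "'i \<Rightarrow> 'k :: field_char_0 set"
  assumes "finite J" "\<And>i. i \<in> J \<Longrightarrow> nf_prime (P i)" and x: "algebraic_int x"
  shows "coprime_ideals (PIdl\<^bsub>ring_of_integers\<^esub> x) (finprod (ideals_set ring_of_integers) P J) \<longleftrightarrow> (\<forall>i\<in>J. x \<notin> P i)"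
proof -
  define I where "I = finprod (ideals_set ring_of_integers) P J"
  have I: "ideal I ring_of_integers"
    and IH: "(\<exists>a u. algebraic_int a \<and> u \<in> I \<and> a * x + u = 1) \<longleftrightarrow> (\<forall>i\<in>J. x \<notin> P i)"
    using finprod_ideals_coprime[OF assms] by (auto simp: I_def)
  interpret I: ideal I ring_of_integers by (rule I)
  have sum: "PIdl\<^bsub>ring_of_integers\<^esub> x <+>\<^bsub>ring_of_integers\<^esub> I = {a * x + u | a u. algebraic_int a \<and> u \<in> I}"
    by (auto simp: set_add_def' cgenideal_def)
  have "PIdl\<^bsub>ring_of_integers\<^esub> x <+>\<^bsub>ring_of_integers\<^esub> I = carrier ring_of_integers \<longleftrightarrow>
      (\<exists>a u. algebraic_int a \<and> u \<in> I \<and> a * x + u = 1)"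
  proof
    assume "PIdl\<^bsub>ring_of_integers\<^esub> x <+>\<^bsub>ring_of_integers\<^esub> I = carrier ring_of_integers"
    then have "1 \<in> {a * x + u | a u. algebraic_int a \<and> u \<in> I}" unfolding sum by simp
    then show "\<exists>a u. algebraic_int a \<and> u \<in> I \<and> a * x + u = 1" by auto
  next
    assume "\<exists>a u. algebraic_int a \<and> u \<in> I \<and> a * x + u = 1"
    then obtain a u where au: "algebraic_int a" "u \<in> I" "a * x + u = 1" by blast
    show "PIdl\<^bsub>ring_of_integers\<^esub> x <+>\<^bsub>ring_of_integers\<^esub> I = carrier ring_of_integers"
      unfolding sum
    proof (intro equalityI subsetI)
      fix y assume "y \<in> {a * x + u | a u. algebraic_int a \<and> u \<in> I}"
      then show "y \<in> carrier ring_of_integers"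
        using x I.a_subset by (auto intro!: algebraic_int_plus algebraic_int_times)
    next
      fix y assume y: "y \<in> carrier (ring_of_integers :: 'k ring)"
      have "y = y * (a * x + u)" using au(3) by simp
      then have "y = (y * a) * x + y * u" by (simp add: algebra_simps)
      moreover have "algebraic_int (y * a)" "y * u \<in> I"
        using y au I.I_l_closed[of u y] by (auto intro: algebraic_int_times)
      ultimately show "y \<in> {a * x + u | a u. algebraic_int a \<and> u \<in> I}" by blast
    qed
  qed
  then show ?thesis using IH by (simp add: coprime_ideals_def I_def)
qed

section \<open>Densities of splitting types\<close>

text \<open>The share of splitting type \<mu> among monic polynomials of degree \<open>n\<close>
  over a field with \<open>x\<close> elements. The argument is real so that limits at infinity make
  sense.\<close>

definition type_density :: "nat \<Rightarrow> nat multiset \<Rightarrow> real \<Rightarrow> real" where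
  "type_density n \<mu> x = (\<Prod>i=1..n. necklace i x gchoose count \<mu> i) / x ^ n"

text \<open>The divisor \<open>d = 1\<close> gives the leading term; every other divisor contributes
  an exponent below \<open>m\<close>.\<close>

lemma necklace_asymp:
  assumes m: "m > 0"
  shows "((\<lambda>x. necklace m x / x ^ m) \<longlongrightarrow> 1 / real m) at_top"
proof -
  have t: "((\<lambda>x::real. of_int (moebius d) * x ^ (m div d) / x ^ m) \<longlongrightarrow> (if d = 1 then 1 else 0)) at_top"
    if d: "d dvd m" for d
  proof (cases "d = 1")
    case True
    have "eventually (\<lambda>x::real. of_int (moebius d) * x ^ (m div d) / x ^ m = 1) at_top"
      using eventually_gt_at_top[of 0] by eventually_elim (simp add: True moebius_def)
    then show ?thesis using True by (simp add: tendsto_eventually)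
  next
    case False
    have "d > 1" using d m False by (cases d) auto
    then have lt: "m div d < m" using m by simp
    have "((\<lambda>x::real. of_int (moebius d) * inverse (x ^ (m - m div d))) \<longlongrightarrow> of_int (moebius d) * 0) at_top"
      by (intro tendsto_mult tendsto_const tendsto_inverse_0_at_top filterlim_pow_at_top filterlim_ident) (use lt in auto)
    moreover have "eventually (\<lambda>x::real. of_int (moebius d) * inverse (x ^ (m - m div d)) =
        of_int (moebius d) * x ^ (m div d) / x ^ m) at_top"
      using eventually_gt_at_top[of 0]
    proof eventually_elim
      case (elim x)
      have "x ^ m = x ^ (m - m div d) * x ^ (m div d)" using lt by (simp flip: power_add)
      then show ?case using elim by (simp add: field_simps)
    qed
    ultimately have "((\<lambda>x::real. of_int (moebius d) * x ^ (m div d) / x ^ m) \<longlongrightarrow> of_int (moebius d) * 0) at_top"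
      by (rule Lim_transform_eventually)
    then show ?thesis using False by simp
  qed
  have "((\<lambda>x. 1 / real m * (\<Sum>d | d dvd m. of_int (moebius d) * x ^ (m div d) / x ^ m)) \<longlongrightarrow>
      1 / real m * (\<Sum>d | d dvd m. if d = 1 then 1 else 0)) at_top"
    by (intro tendsto_mult tendsto_const tendsto_sum t) auto
  moreover have "(\<Sum>d | d dvd m. if d = 1 then 1 else 0 :: real) = 1"
    using m by (subst sum.delta) auto
  moreover have "1 / real m * (\<Sum>d | d dvd m. of_int (moebius d) * x ^ (m div d) / x ^ m) = necklace m x / x ^ m" for x
    by (simp add: necklace_def sum_divide_distrib[symmetric])
  ultimately show ?thesis by simp
qed

lemma gbinomial_asymp:
  fixes w :: "real \<Rightarrow> real"
  assumes w: "((\<lambda>x. w x / x ^ m) \<longlongrightarrow> L) at_top" and m: "m > 0"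
  shows "((\<lambda>x. (w x gchoose k) / x ^ (m * k)) \<longlongrightarrow> L ^ k / fact k) at_top"
proof -
  have i: "((\<lambda>x::real. real i / x ^ m) \<longlongrightarrow> 0) at_top" for i
    by (intro tendsto_divide_0[OF tendsto_const] filterlim_at_top_imp_at_infinity filterlim_pow_at_top filterlim_ident)
      (use m in auto)
  have "((\<lambda>x. (\<Prod>i=0..<k. w x / x ^ m - real i / x ^ m) / fact k) \<longlongrightarrow> (\<Prod>i=0..<k. L - 0) / fact k) at_top"
    by (intro tendsto_divide tendsto_prod tendsto_diff tendsto_const w i) auto
  moreover have "(\<Prod>i=0..<k. w x / x ^ m - real i / x ^ m) / fact k = (w x gchoose k) / x ^ (m * k)" for x
    by (simp add: gbinomial_prod_rev power_mult prod_dividef diff_divide_distrib[symmetric])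
  ultimately show ?thesis by simp
qed

text \<open>\<open>L\<close> is the product of \<open>1 / (i ^ c * fact c)\<close> with
  \<open>c = count \<mu> i\<close>, the proportion of permutations of cycle type \<mu>. Its
  positivity yields a lower bound uniform in all large norms.\<close>

lemma type_density_limit:
  assumes \<mu>: "is_partition n \<mu>"
  shows "\<exists>L>0. (type_density n \<mu> \<longlongrightarrow> L) at_top"
proof -
  define L where "L = (\<Prod>i=1..n. (1 / real i) ^ count \<mu> i / fact (count \<mu> i))"
  have "((\<lambda>x. \<Prod>i=1..n. (necklace i x gchoose count \<mu> i) / x ^ (i * count \<mu> i)) \<longlongrightarrow> L) at_top"
    unfolding L_def by (intro tendsto_prod gbinomial_asymp necklace_asymp) auto
  moreover have "(\<Prod>i=1..n. (necklace i x gchoose count \<mu> i) / x ^ (i * count \<mu> i)) = type_density n \<mu> x" for x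
  proof -
    have "i \<in> {1..n}" if i: "i \<in># \<mu>" for i
    proof -
      have "i \<noteq> 0" using i \<mu> by (metis is_partition_def)
      moreover have "\<mu> = add_mset i (\<mu> - {#i#})" using i by simp
      then have "i \<le> sum_mset \<mu>" by (metis sum_mset.add_mset le_add1)
      ultimately show ?thesis using \<mu> by (simp add: is_partition_def)
    qed
    then have "sum_mset \<mu> = (\<Sum>i=1..n. count \<mu> i * i)"
      using sum_mset_eq_sum_count[of "{1..n}" \<mu> "\<lambda>i. i"] by (simp add: subset_iff)
    then have "(\<Sum>i=1..n. i * count \<mu> i) = n" using \<mu> by (simp add: is_partition_def mult.commute)
    then have "(\<Prod>i=1..n. x ^ (i * count \<mu> i)) = x ^ n" by (simp flip: power_sum)
    then show ?thesis by (simp add: type_density_def prod_dividef)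
  qed
  moreover have "L > 0" unfolding L_def by (intro prod_pos) auto
  ultimately show ?thesis by auto
qed

lemma type_density_lower_bound:
  assumes "is_partition n \<mu>"
  shows "\<exists>c>0. \<exists>q0. \<forall>q\<ge>q0. c \<le> type_density n \<mu> q"
proof -
  obtain L where L: "L > 0" "(type_density n \<mu> \<longlongrightarrow> L) at_top" using type_density_limit[OF assms] by blast
  have "eventually (\<lambda>x. L / 2 < type_density n \<mu> x) at_top" using L(1) by (intro order_tendstoD(1)[OF L(2)]) simp
  then obtain q0 where "\<forall>q\<ge>q0. L / 2 < type_density n \<mu> q" by (auto simp: eventually_at_top_linorder)
  then show ?thesis using L(1) by (intro exI[of _ "L / 2"] conjI exI[of _ q0]) (auto intro: less_imp_le)
qed

section \<open>Local densities at one prime\<close>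

context nf_prime
begin

lemma card_residue_polys: "finite (residue_polys n P)" "card (residue_polys n P) = ideal_norm P ^ n"
  using F.card_monic[of n] by (auto simp: residue_polys_def ideal_norm_def)

lemma type_monic_density:
  assumes "is_partition n \<mu>"
  shows "real (card (F.type_monic \<mu>)) / real (ideal_norm P) ^ n = type_density n \<mu> (real (ideal_norm P))"
    "F.type_monic \<mu> \<subseteq> residue_polys n P"
  using F.card_type_monic[OF assms] F.type_monic_sqfree(2)[OF assms]
  by (auto simp: type_density_def ideal_norm_def residue_polys_def)

lemma sqfree_monic_density:
  assumes "n \<ge> 2"
  shows "real (card (F.sqfree_monic n)) / real (ideal_norm P) ^ n = 1 - 1 / real (ideal_norm P)"
    "F.sqfree_monic n \<subseteq> residue_polys n P"
proof -
  define q where "q = ideal_norm P"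
  have q: "real q > 0" using norm_ge2 by (simp add: q_def)
  have "card (F.sqfree_monic n) + q ^ (n - 1) = q ^ n"
    using F.card_sqfree_monic[OF assms] by (simp add: q_def ideal_norm_def)
  then have "real (card (F.sqfree_monic n)) = real q ^ n - real q ^ (n - 1)"
    by (metis add_diff_cancel_right' of_nat_add of_nat_power)
  moreover have "real q ^ n = real q ^ (n - 1) * real q" using assms power_minus_mult[of n "real q"] by simp
  ultimately show "real (card (F.sqfree_monic n)) / real (ideal_norm P) ^ n = 1 - 1 / real (ideal_norm P)"
    using q by (simp add: field_simps flip: q_def)
  show "F.sqfree_monic n \<subseteq> residue_polys n P" using F.sqfree_monic_monic[of n] by (simp add: residue_polys_def)
qed

lemma red_residue_polys:
  assumes "integral_basis d \<omega>" "f \<in> poly_box n d \<omega> B"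
  shows "red f \<in> residue_polys n P"
proof -
  have "intpoly f" using poly_box_form(3)[OF assms] by (simp add: intpoly_def)
  then show ?thesis
    using red_monic reduce_poly_eq_red(3) poly_box_form[OF assms] by (simp add: residue_polys_def)
qed

lemma missing_type_density:
  assumes "is_partition n \<mu>"
  shows "real (card (residue_polys n P - F.type_monic \<mu>)) / real (ideal_norm P) ^ n =
    1 - type_density n \<mu> (real (ideal_norm P))"
proof -
  have "card (residue_polys n P - F.type_monic \<mu>) = card (residue_polys n P) - card (F.type_monic \<mu>)"
    using card_residue_polys(1) type_monic_density(2)[OF assms] by (meson card_Diff_subset finite_subset)
  moreover have "card (F.type_monic \<mu>) \<le> card (residue_polys n P)"
    using card_residue_polys(1) type_monic_density(2)[OF assms] by (rule card_mono)
  ultimately have "real (card (residue_polys n P - F.type_monic \<mu>)) =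
      real (ideal_norm P) ^ n - real (card (F.type_monic \<mu>))"
    by (simp add: card_residue_polys(2) of_nat_diff)
  then show ?thesis
    using norm_ge2 by (simp add: diff_divide_distrib type_monic_density(1)[OF assms])
qed

end

section \<open>Almost all polynomials have full symmetric Galois group\<close>

text \<open>Infinitely many rational primes exceed \<open>q0\<close>. Distinct ones have distinct
  primes above them, and a prime over \<open>p\<close> has norm at least \<open>p\<close>.\<close>

lemma ex_prime_ideals:
  fixes \<omega> :: "nat \<Rightarrow> 'k :: field_char_0" and q0 :: real
  assumes \<omega>: "integral_basis d \<omega>"
  shows "\<exists>J :: 'k set set. finite J \<and> card J = N \<and> (\<forall>Q\<in>J. nf_prime Q \<and> q0 \<le> real (ideal_norm Q))"
proof -
  have "{p :: nat. Factorial_Ring.prime p} \<subseteq> {p. Factorial_Ring.prime p \<and> q0 \<le> real p} \<union> {..nat \<lceil>q0\<rceil>}"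
    by (auto simp: not_le) linarith
  then have "infinite {p :: nat. Factorial_Ring.prime p \<and> q0 \<le> real p}"
    using primes_infinite finite_subset[of "{p :: nat. Factorial_Ring.prime p}"] by (meson finite_UnI finite_atMost)
  then obtain S where S: "finite S" "card S = N" "S \<subseteq> {p :: nat. Factorial_Ring.prime p \<and> q0 \<le> real p}"
    using infinite_arbitrarily_large by blast
  have "\<forall>p\<in>S. \<exists>Q :: 'k set. primeideal Q ring_of_integers \<and> of_nat p \<in> Q"
    using S(3) ex_prime_ideal_over by blast
  from bchoice[OF this] obtain Q :: "nat \<Rightarrow> 'k set"
    where Q: "\<forall>p\<in>S. primeideal (Q p) ring_of_integers \<and> of_nat p \<in> Q p" by (rule exE)
  have nf: "nf_prime (Q p)" if "p \<in> S" for p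
  proof -
    have "of_nat p \<noteq> (0 :: 'k)" using S(3) that by (auto simp: prime_gt_0_nat)
    then have "Q p \<noteq> {0}" using Q that by blast
    then show ?thesis using nf_primeI[OF \<omega>] Q that by blast
  qed
  have inj: "inj_on Q S"
  proof (rule inj_onI, rule ccontr)
    fix p p' assume p: "p \<in> S" "p' \<in> S" "Q p = Q p'" "p \<noteq> p'"
    interpret N: nf_prime "Q p" by (rule nf[OF p(1)])
    have "coprime (int p) (int p')" using S(3) p primes_coprime[of p p'] by auto
    moreover have "of_nat p \<in> Q p" "of_nat p' \<in> Q p" using Q p by auto
    ultimately show False using N.of_int_coprime[of "int p" "int p'"] by simp
  qed
  have "q0 \<le> real (ideal_norm (Q p))" if "p \<in> S" for p
  proof -
    have "Factorial_Ring.prime p" "q0 \<le> real p" "of_nat p \<in> Q p" using Q S(3) that by auto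
    then show ?thesis using nf_prime.norm_ge[OF nf[OF that], of p] by simp
  qed
  then show ?thesis
    using S nf inj by (intro exI[of _ "Q ` S"]) (auto simp: card_image)
qed

text \<open>If the Galois group of \<open>f\<close> is not the full symmetric group, then one of the
  three types is missed by \<open>f\<close> at all primes of \<open>J\<close> simultaneously. By
  independence of the reductions this has density at most \<open>(1 - c) ^ N\<close> for each type,
  and \<open>N\<close> is chosen to make that smaller than \<open>e / 3\<close>.\<close>

theorem not_sym_density_zero:
  fixes \<omega> :: "nat \<Rightarrow> 'k :: field_char_0"
  assumes \<omega>: "integral_basis d \<omega>" and n: "n \<ge> 2"
  shows "(\<lambda>B. real (card {f \<in> poly_box n d \<omega> B. \<not> galois_group f \<cong> sym_group n}) / real (card (poly_box n d \<omega> B)))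
    \<longlonglongrightarrow> 0"
proof (rule tendstoI)
  fix e :: real assume e: "e > 0"
  define t where "t = (\<lambda>a :: nat. if a = 0 then {#n#} else if a = 1 then {#n - 1, 1#}
    else add_mset 2 (replicate_mset (n - 2) 1))"
  have part: "is_partition n (t a)" for a
    using n by (auto simp: t_def is_partition_def)
  obtain c0 r0 where c0: "c0 > 0" "\<forall>q\<ge>r0. c0 \<le> type_density n (t 0) q"
    using type_density_lower_bound[OF part[of 0]] by blast
  obtain c1 r1 where c1: "c1 > 0" "\<forall>q\<ge>r1. c1 \<le> type_density n (t 1) q"
    using type_density_lower_bound[OF part[of 1]] by blast
  obtain c2 r2 where c2: "c2 > 0" "\<forall>q\<ge>r2. c2 \<le> type_density n (t 2) q"
    using type_density_lower_bound[OF part[of 2]] by blast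
  define c where "c = min (1 / 2) (min c0 (min c1 c2))"
  define q0 where "q0 = max r0 (max r1 r2)"
  have c: "0 < c" "c < 1" using c0 c1 c2 by (auto simp: c_def)
  have ct: "c \<le> type_density n (t a) q" if a: "a \<in> {0, 1, 2}" and q: "q \<ge> q0" for a q
  proof -
    have "q \<ge> r0" "q \<ge> r1" "q \<ge> r2" using q by (auto simp: q0_def)
    then have "c0 \<le> type_density n (t 0) q" "c1 \<le> type_density n (t 1) q" "c2 \<le> type_density n (t 2) q"
      using c0 c1 c2 by blast+
    then show ?thesis using a by (auto simp: c_def)
  qed
  obtain N where N: "(1 - c) ^ N < e / 3" using real_arch_pow_inv[of "e / 3" "1 - c"] c e by auto
  obtain J :: "'k set set" where J: "finite J" "card J = N" "\<forall>Q\<in>J. nf_prime Q \<and> q0 \<le> real (ideal_norm Q)"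
    using ex_prime_ideals[OF \<omega>, of N q0] by blast
  define U where "U a Q = residue_polys n Q - finite_field.type_monic (residue_ring_at Q) (t a)" for a and Q :: "'k set"
  define E where "E a B = {f \<in> poly_box n d \<omega> B. \<forall>Q\<in>J. nf_prime.red Q f \<in> U a Q}" for a B
  have ev: "eventually (\<lambda>B. real (card (E a B)) / real (card (poly_box n d \<omega> B)) < e / 3) sequentially"
    if a: "a \<in> {0, 1, 2}" for a
  proof -
    have lim: "(\<lambda>B. real (card (E a B)) / real (card (poly_box n d \<omega> B)))
        \<longlonglongrightarrow> (\<Prod>Q\<in>J. real (card (U a Q)) / real (ideal_norm Q) ^ n)"
      unfolding E_def using J by (intro density_of_reductions[OF \<omega>]) (auto simp: U_def)
    have "real (card (U a Q)) / real (ideal_norm Q) ^ n \<le> 1 - c" if Q: "Q \<in> J" for Q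
    proof -
      interpret N: nf_prime Q using J Q by blast
      show ?thesis
        using N.missing_type_density[OF part[of a]] ct[OF a, of "real (ideal_norm Q)"] J Q by (simp add: U_def)
    qed
    then have "(\<Prod>Q\<in>J. real (card (U a Q)) / real (ideal_norm Q) ^ n) \<le> (\<Prod>Q\<in>J. 1 - c)"
      by (intro prod_mono) auto
    also have "\<dots> < e / 3" using N J(2) by simp
    finally show ?thesis by (rule order_tendstoD(2)[OF lim])
  qed
  have sub: "{f \<in> poly_box n d \<omega> B. \<not> galois_group f \<cong> sym_group n} \<subseteq> E 0 B \<union> (E 1 B \<union> E 2 B)" for B
  proof (rule subsetI, rule ccontr)
    fix f assume "f \<in> {f \<in> poly_box n d \<omega> B. \<not> galois_group f \<cong> sym_group n}"
      and nE: "f \<notin> E 0 B \<union> (E 1 B \<union> E 2 B)"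
    then have f: "f \<in> poly_box n d \<omega> B" "\<not> galois_group f \<cong> sym_group n" by auto
    note form = poly_box_form[OF \<omega> f(1)]
    have h: "\<exists>Q. nf_prime Q \<and> has_splitting_type Q f (t a)" if "f \<notin> E a B" for a
    proof -
      obtain Q where Q: "Q \<in> J" "nf_prime.red Q f \<notin> U a Q" using \<open>f \<notin> E a B\<close> f(1) by (auto simp: E_def)
      interpret N: nf_prime Q using J Q by blast
      have "N.red f \<in> N.F.type_monic (t a)" using Q(2) N.red_residue_polys[OF \<omega> f(1)] by (simp add: U_def)
      then show ?thesis using N.has_splitting_type_iff[OF form(1)] N.nf_prime_axioms by blast
    qed
    obtain Q0 where Q0: "nf_prime Q0" "has_splitting_type Q0 f {#n#}" using h[of 0] nE by (auto simp: t_def)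
    obtain Q1 where Q1: "nf_prime Q1" "has_splitting_type Q1 f {#n - 1, 1#}" using h[of 1] nE by (auto simp: t_def)
    obtain Q2 where Q2: "nf_prime Q2" "has_splitting_type Q2 f (add_mset 2 (replicate_mset (n - 2) 1))"
      using h[of 2] nE by (auto simp: t_def)
    show False using galois_group_sym_if_types[OF form(3,1,2) Q0 Q1 Q2] f(2) by contradiction
  qed
  have fin: "finite (E a B)" for a B using finite_poly_box[OF \<omega>] by (auto simp: E_def)
  have le: "real (card {f \<in> poly_box n d \<omega> B. \<not> galois_group f \<cong> sym_group n}) \<le>
      real (card (E 0 B)) + (real (card (E 1 B)) + real (card (E 2 B)))" for B
  proof -
    have "card {f \<in> poly_box n d \<omega> B. \<not> galois_group f \<cong> sym_group n} \<le> card (E 0 B \<union> (E 1 B \<union> E 2 B))"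
      by (rule card_mono[OF _ sub]) (simp add: fin)
    also have "\<dots> \<le> card (E 0 B) + (card (E 1 B) + card (E 2 B))"
      by (meson add_left_mono card_Un_le order_trans)
    finally show ?thesis by linarith
  qed
  show "eventually (\<lambda>B. dist (real (card {f \<in> poly_box n d \<omega> B. \<not> galois_group f \<cong> sym_group n}) /
      real (card (poly_box n d \<omega> B))) 0 < e) sequentially"
    using ev[OF insertI1] ev[OF insertI2[OF insertI1]] ev[OF insertI2[OF insertI2[OF singletonI]]]
  proof eventually_elim
    case (elim B)
    have "real (card {f \<in> poly_box n d \<omega> B. \<not> galois_group f \<cong> sym_group n}) / real (card (poly_box n d \<omega> B)) \<le>
        (real (card (E 0 B)) + (real (card (E 1 B)) + real (card (E 2 B)))) / real (card (poly_box n d \<omega> B))"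
      by (rule divide_right_mono[OF le]) simp
    also have "\<dots> < e" unfolding add_divide_distrib using elim by linarith
    finally show ?case by simp
  qed
qed

theorem theorem6p1:
  fixes n d r :: nat
    and \<omega> :: "nat \<Rightarrow> 'k :: field_char_0"
    and P :: "nat \<Rightarrow> 'k set"
    and \<mu> :: "nat \<Rightarrow> nat multiset"
  assumes "number_field TYPE('k)"
    and "number_field_degree TYPE('k) = d"
    and "integral_basis d \<omega>"
    and "n \<ge> 2"
    and "\<And>i. i \<in> {1..r} \<Longrightarrow> primeideal (P i) ring_of_integers \<and> P i \<noteq> {0}"
    and "inj_on P {1..r}"
    and "\<And>i. i \<in> {1..r} \<Longrightarrow> is_partition n (\<mu> i)"
  shows "((\<lambda>B. real (card (poly_box_S n d \<omega> r P B)) / real (card (poly_box n d \<omega> B)))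
           \<longlonglongrightarrow> (\<Prod>i=1..r. 1 - 1 / real (ideal_norm (P i)))) \<and>
         ((\<lambda>B. real (card (poly_box_SU n d \<omega> r P \<mu> B)) / real (card (poly_box_S n d \<omega> r P B)))
           \<longlonglongrightarrow> (\<Prod>i=1..r. nu_star n (ideal_norm (P i)) (\<mu> i)))"
proof -
  note \<omega> = assms(3) and n = assms(4) and inj = assms(6) and part = assms(7)
  define J where "J = P ` {1..r}"
  \<comment> \<open>The density theorem runs over a set of primes; injectivity of \<open>P\<close>
    lets the partition attached to an index be recovered from the ideal.\<close>
  define ix where "ix = inv_into {1..r} P"
  define sq where "sq Q = finite_field.sqfree_monic (residue_ring_at Q) n" for Q :: "'k set"
  define ty where "ty Q = finite_field.type_monic (residue_ring_at Q) (\<mu> (ix Q))" for Q :: "'k set"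
  define box where "box = poly_box n d \<omega>"
  define T where "T B = {f \<in> box B. \<forall>Q\<in>J. nf_prime.red Q f \<in> ty Q}" for B
  define NS where "NS B = {f \<in> box B. \<not> galois_group f \<cong> sym_group n}" for B
  define S where "S = poly_box_S n d \<omega> r P"
  define SU where "SU = poly_box_SU n d \<omega> r P \<mu>"
  have ix: "ix (P i) = i" if "i \<in> {1..r}" for i using inj that by (simp add: ix_def)
  have nf: "nf_prime (P i)" if "i \<in> {1..r}" for i using nf_primeI[OF \<omega>] assms(5)[OF that] by blast
  have J: "finite J" "\<And>Q. Q \<in> J \<Longrightarrow> nf_prime Q" using nf by (auto simp: J_def)
  have finbox: "finite (box B)" for B unfolding box_def by (rule finite_poly_box[OF \<omega>])
  have dint: "algebraic_int (discriminant f)" if f: "f \<in> box B" for f B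
  proof -
    \<comment> \<open>Integrality of the discriminant was obtained in the presence of a prime. An
      auxiliary one is taken, which covers \<open>r = 0\<close> too.\<close>
    obtain Q :: "'k set" where "nf_prime Q" using ex_prime_ideals[OF \<omega>, of 1 0] by (auto simp: card_1_singleton_iff)
    then interpret nf_prime Q .
    show ?thesis
      using discriminant_sqfree(2)[of f] poly_box_form[OF \<omega>] f by (simp add: intpoly_def box_def)
  qed
  have S_eq: "S B = {f \<in> box B. \<forall>Q\<in>J. nf_prime.red Q f \<in> sq Q}" for B
    unfolding S_def poly_box_S_def box_def[symmetric]
  proof (rule Collect_cong, rule conj_cong[OF refl])
    fix f assume f: "f \<in> box B"
    have "coprime_ideals (PIdl\<^bsub>ring_of_integers\<^esub> (discriminant f)) (finprod (ideals_set ring_of_integers) P {1..r}) \<longleftrightarrow>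
        (\<forall>i\<in>{1..r}. discriminant f \<notin> P i)"
      by (rule coprime_discriminant_iff[OF _ nf dint[OF f]]) auto
    also have "\<dots> \<longleftrightarrow> (\<forall>i\<in>{1..r}. nf_prime.red (P i) f \<in> sq (P i))"
    proof (rule ball_cong[OF refl])
      fix i assume i: "i \<in> {1..r}"
      interpret N: nf_prime "P i" by (rule nf[OF i])
      show "(discriminant f \<notin> P i) = (N.red f \<in> sq (P i))"
        using N.discriminant_sqfree(1)[of f] poly_box_form[OF \<omega>] f by (simp add: N.intpoly_def box_def sq_def)
    qed
    also have "\<dots> \<longleftrightarrow> (\<forall>Q\<in>J. nf_prime.red Q f \<in> sq Q)" by (simp add: J_def)
    finally show "coprime_ideals (PIdl\<^bsub>ring_of_integers\<^esub> (discriminant f)) (finprod (ideals_set ring_of_integers) P {1..r}) \<longleftrightarrow>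
        (\<forall>Q\<in>J. nf_prime.red Q f \<in> sq Q)" .
  qed
  have ty: "ty Q \<subseteq> sq Q \<and> ty Q \<subseteq> residue_polys n Q \<and>
      real (card (ty Q)) / real (ideal_norm Q) ^ n = type_density n (\<mu> (ix Q)) (real (ideal_norm Q))" if Q: "Q \<in> J" for Q
  proof -
    interpret N: nf_prime Q using J Q by blast
    have p: "is_partition n (\<mu> (ix Q))" using Q ix part by (auto simp: J_def)
    show ?thesis using N.F.type_monic_sqfree(1)[OF p] N.type_monic_density[OF p] by (simp add: ty_def sq_def)
  qed
  have sq: "sq Q \<subseteq> residue_polys n Q \<and> real (card (sq Q)) / real (ideal_norm Q) ^ n = 1 - 1 / real (ideal_norm Q)"
    if Q: "Q \<in> J" for Q
  proof -
    interpret N: nf_prime Q using J Q by blast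
    show ?thesis using N.sqfree_monic_density[OF n] by (simp add: sq_def)
  qed
  have TS: "T B \<subseteq> S B" for B using ty by (auto simp: T_def S_eq)
  have split: "has_splitting_type (P i) f (\<mu> i) \<longleftrightarrow> nf_prime.red (P i) f \<in> ty (P i)"
    if i: "i \<in> {1..r}" and f: "f \<in> box B" for i f B
  proof -
    interpret N: nf_prime "P i" by (rule nf[OF i])
    show ?thesis
      using N.has_splitting_type_iff[OF poly_box_form(1)[OF \<omega>]] f by (simp add: ty_def ix[OF i] box_def)
  qed
  have SU_eq: "SU B = T B - NS B" for B
  proof -
    have "SU B = {f \<in> S B. f \<in> T B \<and> f \<notin> NS B}"
      unfolding SU_def poly_box_SU_def S_def[symmetric]
    proof (rule Collect_cong, rule conj_cong[OF refl])
      fix f assume "f \<in> S B"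
      then have f: "f \<in> box B" by (simp add: S_eq)
      have "(\<forall>i\<in>{1..r}. has_splitting_type (P i) f (\<mu> i)) \<longleftrightarrow> f \<in> T B"
        using split[OF _ f] f by (simp add: T_def J_def)
      then show "((\<forall>i\<in>{1..r}. has_splitting_type (P i) f (\<mu> i)) \<and> galois_group f \<cong> sym_group n) \<longleftrightarrow> f \<in> T B \<and> f \<notin> NS B"
        using f by (simp add: NS_def)
    qed
    then show ?thesis using TS by auto
  qed
  have "(\<lambda>B. real (card (S B)) / real (card (box B))) \<longlonglongrightarrow> (\<Prod>Q\<in>J. real (card (sq Q)) / real (ideal_norm Q) ^ n)"
    unfolding S_eq unfolding box_def by (rule density_of_reductions[OF \<omega> J]) (use sq in auto)
  also have "(\<Prod>Q\<in>J. real (card (sq Q)) / real (ideal_norm Q) ^ n) = (\<Prod>Q\<in>J. 1 - 1 / real (ideal_norm Q))"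
    using sq by (intro prod.cong) auto
  also have "\<dots> = (\<Prod>i=1..r. 1 - 1 / real (ideal_norm (P i)))" unfolding J_def prod.reindex[OF inj] by simp
  finally have lim_S: "(\<lambda>B. real (card (S B)) / real (card (box B))) \<longlonglongrightarrow> (\<Prod>i=1..r. 1 - 1 / real (ideal_norm (P i)))" .
  have "(\<lambda>B. real (card (T B)) / real (card (box B))) \<longlonglongrightarrow> (\<Prod>Q\<in>J. real (card (ty Q)) / real (ideal_norm Q) ^ n)"
    unfolding T_def unfolding box_def by (rule density_of_reductions[OF \<omega> J]) (use ty in auto)
  also have "(\<Prod>Q\<in>J. real (card (ty Q)) / real (ideal_norm Q) ^ n) = (\<Prod>Q\<in>J. type_density n (\<mu> (ix Q)) (real (ideal_norm Q)))"
    using ty by (intro prod.cong) auto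
  also have "\<dots> = (\<Prod>i=1..r. type_density n (\<mu> i) (real (ideal_norm (P i))))"
    unfolding J_def prod.reindex[OF inj] using ix by simp
  finally have lim_T: "(\<lambda>B. real (card (T B)) / real (card (box B))) \<longlonglongrightarrow>
      (\<Prod>i=1..r. type_density n (\<mu> i) (real (ideal_norm (P i))))" (is "_ \<longlonglongrightarrow> ?D") .
  have lim_X: "(\<lambda>B. real (card (NS B)) / real (card (box B))) \<longlonglongrightarrow> 0"
    using not_sym_density_zero[OF \<omega> n] by (simp add: NS_def box_def)
  \<comment> \<open>\<open>SU\<close> is squeezed between \<open>T\<close> and \<open>T\<close> with
    the exceptional set \<open>NS\<close> of density 0 removed.\<close>
  have lim_SU: "(\<lambda>B. real (card (SU B)) / real (card (box B))) \<longlonglongrightarrow> ?D"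
  proof (rule tendsto_sandwich)
    show "(\<lambda>B. real (card (T B)) / real (card (box B)) - real (card (NS B)) / real (card (box B))) \<longlonglongrightarrow> ?D"
      using tendsto_diff[OF lim_T lim_X] by simp
    have finX: "finite (NS B)" "finite (T B)" for B using finbox by (auto simp: NS_def T_def)
    have "card (T B) - card (NS B) \<le> card (SU B)" for B unfolding SU_eq by (rule diff_card_le_card_Diff[OF finX(1)])
    then have "real (card (T B)) - real (card (NS B)) \<le> real (card (SU B))" for B
      using le_diff_conv by (metis diff_le_eq of_nat_add of_nat_le_iff)
    then show "eventually (\<lambda>B. real (card (T B)) / real (card (box B)) - real (card (NS B)) / real (card (box B)) \<le>
        real (card (SU B)) / real (card (box B))) sequentially"
      by (auto simp: diff_divide_distrib[symmetric] intro!: always_eventually divide_right_mono)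
    have "card (SU B) \<le> card (T B)" for B unfolding SU_eq by (rule card_mono) (use finX in auto)
    then show "eventually (\<lambda>B. real (card (SU B)) / real (card (box B)) \<le> real (card (T B)) / real (card (box B))) sequentially"
      by (auto intro!: always_eventually divide_right_mono)
  qed (rule lim_T)
  have norm: "real (ideal_norm (P i)) > 1" if "i \<in> {1..r}" for i
    using nf_prime.norm_ge2[OF nf[OF that]] by simp
  \<comment> \<open>All norms exceed 1, so the limit in the denominator is nonzero and the quotient
    of the limits may be formed.\<close>
  have nz: "(\<Prod>i=1..r. 1 - 1 / real (ideal_norm (P i))) \<noteq> 0"
    using norm by (fastforce simp: prod_zero_iff)
  have "?D / (\<Prod>i=1..r. 1 - 1 / real (ideal_norm (P i))) =
      (\<Prod>i=1..r. type_density n (\<mu> i) (real (ideal_norm (P i))) / (1 - 1 / real (ideal_norm (P i))))"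
    by (simp add: prod_dividef)
  also have "\<dots> = (\<Prod>i=1..r. nu_star n (ideal_norm (P i)) (\<mu> i))"
  proof (rule prod.cong[OF refl])
    fix i assume i: "i \<in> {1..r}"
    have "real (ideal_norm (P i)) ^ n = real (ideal_norm (P i)) ^ (n - 1) * real (ideal_norm (P i))"
      using n power_minus_mult[of n "real (ideal_norm (P i))"] by simp
    \<comment> \<open>Dividing by \<open>1 - 1 / q\<close> turns \<open>1 / q ^ n\<close> into
      \<open>1 / (q ^ (n - 1) * (q - 1))\<close>: \<open>nu_star\<close> is the share of the type
      among the squarefree polynomials.\<close>
    then show "type_density n (\<mu> i) (real (ideal_norm (P i))) / (1 - 1 / real (ideal_norm (P i))) =
        nu_star n (ideal_norm (P i)) (\<mu> i)"
      using norm[OF i] by (simp add: type_density_def nu_star_def field_simps)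
  qed
  finally have lim: "(\<lambda>B. (real (card (SU B)) / real (card (box B))) / (real (card (S B)) / real (card (box B)))) \<longlonglongrightarrow>
      (\<Prod>i=1..r. nu_star n (ideal_norm (P i)) (\<mu> i))"
    using tendsto_divide[OF lim_SU lim_S nz] by simp
  \<comment> \<open>For positive \<open>B\<close> the box is nonempty, so its size cancels from the
    quotient.\<close>
  have "eventually (\<lambda>B. (real (card (SU B)) / real (card (box B))) / (real (card (S B)) / real (card (box B))) =
      real (card (SU B)) / real (card (S B))) sequentially"
    using eventually_gt_at_top[of 0]
  proof eventually_elim
    case (elim B)
    then have "card (box B) \<noteq> 0" by (simp add: box_def card_poly_box[OF \<omega>])
    then show ?case by simp
  qed
  then have "(\<lambda>B. real (card (SU B)) / real (card (S B))) \<longlonglongrightarrow> (\<Prod>i=1..r. nu_star n (ideal_norm (P i)) (\<mu> i))"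
    by (rule Lim_transform_eventually[OF lim])
  then show ?thesis using lim_S by (simp add: S_def SU_def box_def)
qed

end
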